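(* Let $\mathfrak D=(Z,X,Y;U,V,W;\Gamma)$ be a $\Pi_+$-admissible BTOA interpolation data set whose BTOA-Pick matrix $\mathbf\Gamma_{\mathfrak D}$ is invertible. Then the following are equivalent: (1) $\mathbf\Gamma_{\mathfrak D}$ is positive definite. (2) $\mathcal M_{\mathfrak D}^{[\perp\mathcal K]}$ is a strictly positive subspace of $\mathcal K$, i.e. $\mathcal M_{\mathfrak D}^{[\perp\mathcal K]}$ is a Hilbert space in the $J$-inner product. (3) The reproducing kernel Pontryagin space $\mathcal H(K_{\Theta,J})$ is a Hilbert space.
   Context: $\Pi_\pm=\{z\in\mathbb C:\pm\operatorname{Re}z>0\}$. A $\Pi_+$-admissible BTOA interpolation data set is a septet of matrices $\mathfrak D=(Z,X,Y;U,V,W;\Gamma)$ with $Z\in\mathbb C^{n_Z\times n_Z}$, $X\in\mathbb C^{n_Z\times p}$, $Y\in\mathbb C^{n_Z\times m}$, $W\in\mathbb C^{n_W\times n_W}$, $U\in\mathbb C^{m\times n_W}$, $V\in\mathbb C^{p\times n_W}$, $\Gamma\in\mathbb C^{n_Z\times n_W}$ such that: (1) $\sigma(Z)\cup\sigma(W)\subset\Pi_+$; (2) $(Z,X)$ is controllable and $(U,W)$ is observable; (3) $\Gamma W-Z\Gamma=XV-YU$. The BTOA-Pick matrix is $\mathbf\Gamma_{\mathfrak D}=\begin{bmatrix}\Gamma_L&\Gamma\\ \Gamma^*&\Gamma_R\end{bmatrix}$, where $\Gamma_L,\Gamma_R$ are the unique solutions of $\Gamma_LZ^*+Z\Gamma_L=XX^*-YY^*$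 and $\Gamma_RW+W^*\Gamma_R=U^*U-V^*V$. $L^2_N(i\mathbb R)$ is the space of $\mathbb C^N$-valued square-integrable functions on the imaginary line; $H^2_N(\Pi_+)$ is the Hardy space, identified via boundary values with a subspace of $L^2_N(i\mathbb R)$. Define $$\mathcal M_{\mathfrak D}=\Big\{\begin{bmatrix}V\\ U\end{bmatrix}(\lambda I-W)^{-1}x+\begin{bmatrix}f\\ g\end{bmatrix}: x\in\mathbb C^{n_W},\ \begin{bmatrix}f\\ g\end{bmatrix}\in H^2_{p+m}(\Pi_+),\ \sum_{z_0\in\Pi_+}\operatorname{Res}_{\lambda=z_0}(\lambda I-Z)^{-1}\begin{bmatrix}X&-Y\end{bmatrix}\begin{bmatrix}f(\lambda)\\ g(\lambda)\end{bmatrix}=\Gamma x\Big\},$$ $$\mathcal M_{\mathfrak D,-}=\{U(\lambda I-W)^{-1}x:x\in\mathbb C^{n_W}\}\oplus H^2_m(\Pi_+),\qquad \mathcal K=\begin{bmatrix}L^2_p(i\mathbb R)\\ \mathcal M_{\mathfrak D,-}\end{bmatrix}.$$ $\mathcal K$ carries the $J$-inner product $[f,g]_J=\langle Jf,g\rangle_{L^2}$ with $J=\begin{bmatrix}I_p&0\\ 0&-I_m\end{bmatrix}$, and $\mathcal M_{\mathfrak D}^{[\perp\mathcal K]}=\{f\in\mathcal K:[f,g]_J=0\ \forall g\in\mathcal M_{\mathfrak D}\}$. With $\mathbf A=\begin{bmatrix}-Z^*&0\\ 0&W\end{bmatrix}$, $\mathbf C=\begin{bmatrix}-X^*&V\\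 -Y^*&U\end{bmatrix}$, put $\Theta(\lambda)=I_{p+m}-\mathbf C(\lambda I-\mathbf A)^{-1}\mathbf\Gamma_{\mathfrak D}^{-1}\mathbf C^*J$ and $K_{\Theta,J}(z,\zeta)=\dfrac{J-\Theta(z)J\Theta(\zeta)^*}{z+\overline\zeta}$ on $\Pi_+\setminus\sigma(W)$. This Hermitian kernel has finitely many negative squares; $\mathcal H(K_{\Theta,J})$ is its reproducing kernel Pontryagin space, i.e. the Pontryagin space of $\mathbb C^{p+m}$-valued functions containing all $K_{\Theta,J}(\cdot,\omega)y$ with $[f,K_{\Theta,J}(\cdot,\omega)y]=\langle f(\omega),y\rangle$. It is a Hilbert space when its inner product is positive definite. *)

theory Defs
  imports
    "HOL-Complex_Analysis.Complex_Analysis"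
    "Jordan_Normal_Form.Spectral_Radius"
    "Jordan_Normal_Form.Schur_Decomposition"
    "Jordan_Normal_Form.Gauss_Jordan_Elimination"
begin

unbundle no vec_syntax

(* All matrices and vectors are those of Jordan_Normal_Form, with sizes that are natural
   numbers; every size may be 0, so that the one-sided problems are covered. *)

section \<open>Matrices\<close>

abbreviation minv :: "complex mat \<Rightarrow> complex mat"
  where "minv A \<equiv> the (mat_inverse A)"

definition resolvent :: "complex mat \<Rightarrow> complex \<Rightarrow> complex mat"
  where "resolvent A z = minv (z \<cdot>\<^sub>m 1\<^sub>m (dim_row A) - A)"

definition append_cols :: "complex mat \<Rightarrow> complex mat \<Rightarrow> complex mat" (infixr \<open>@\<^sub>c\<close> 65)
  where "A @\<^sub>c B = four_block_mat A B (0\<^sub>m 0 (dim_col A)) (0\<^sub>m 0 (dim_col B))"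

definition positive_definite_mat :: "complex mat \<Rightarrow> bool"
  where "positive_definite_mat A \<longleftrightarrow>
    square_mat A \<and> mat_adjoint A = A \<and>
    (\<forall>x \<in> carrier_vec (dim_row A). x \<noteq> 0\<^sub>v (dim_row A) \<longrightarrow> 0 < Re ((A *\<^sub>v x) \<bullet>c x))"

(* The columns of all Z^k X together span the state space. *)
definition controllable :: "complex mat \<Rightarrow> complex mat \<Rightarrow> bool"
  where "controllable Z X \<longleftrightarrow>
    LinearCombinations.module.span class_ring (module_vec TYPE(complex) (dim_row Z))
      (\<Union>k. set (cols ((Z ^\<^sub>m k) * X))) = carrier_vec (dim_row Z)"

definition observable :: "complex mat \<Rightarrow> complex mat \<Rightarrow> bool"
  where "observable U W \<longleftrightarrow>
    {x \<in> carrier_vec (dim_row W). \<forall>k. (U * (W ^\<^sub>m k)) *\<^sub>v x = 0\<^sub>v (dim_row U)}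
      = {0\<^sub>v (dim_row W)}"

section \<open>Indefinite inner product spaces of vector functions\<close>

definition fun_space :: "nat \<Rightarrow> (complex, 'a \<Rightarrow> complex vec) module"
  where "fun_space d = \<lparr>
    carrier = {f. \<forall>t. f t \<in> carrier_vec d},
    mult = undefined,
    one = undefined,
    zero = (\<lambda>t. 0\<^sub>v d),
    add = (\<lambda>f g t. f t + g t),
    smult = (\<lambda>c f t. c \<cdot>\<^sub>v f t)\<rparr>"

type_synonym 'a form = "('a \<Rightarrow> complex vec) \<Rightarrow> ('a \<Rightarrow> complex vec) \<Rightarrow> complex"

definition hermitian_form_on :: "('a \<Rightarrow> complex vec) set \<Rightarrow> 'a form \<Rightarrow> bool"
  where "hermitian_form_on S ip \<longleftrightarrow>
    (\<forall>f \<in> S. \<forall>g \<in> S. \<forall>h \<in> S. ip (\<lambda>t. f t + g t) h = ip f h + ip g h) \<and>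
    (\<forall>c. \<forall>f \<in> S. \<forall>h \<in> S. ip (\<lambda>t. c \<cdot>\<^sub>v f t) h = c * ip f h) \<and>
    (\<forall>f \<in> S. \<forall>g \<in> S. ip g f = cnj (ip f g))"

(* The functions in null are the ones that represent the zero vector: almost everywhere
   vanishing functions for spaces of L2 functions, just the zero function otherwise. *)
definition hilbert_space ::
    "nat \<Rightarrow> ('a \<Rightarrow> complex vec) set \<Rightarrow> ('a \<Rightarrow> complex vec) set \<Rightarrow> 'a form \<Rightarrow> bool"
  where "hilbert_space d null S ip \<longleftrightarrow>
    VectorSpace.subspace class_ring S (fun_space d) \<and> hermitian_form_on S ip \<and>
    (\<forall>f \<in> S. f \<notin> null \<longrightarrow> 0 < Re (ip f f)) \<and>
    (\<forall>s. (\<forall>n. s n \<in> S) \<and>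
         (\<forall>e>0. \<exists>M. \<forall>j\<ge>M. \<forall>k\<ge>M. Re (ip (\<lambda>t. s j t - s k t) (\<lambda>t. s j t - s k t)) < e) \<longrightarrow>
         (\<exists>f \<in> S. (\<lambda>n. Re (ip (\<lambda>t. s n t - f t) (\<lambda>t. s n t - f t))) \<longlonglongrightarrow> 0))"

definition pontryagin_space :: "nat \<Rightarrow> ('a \<Rightarrow> complex vec) set \<Rightarrow> 'a form \<Rightarrow> bool"
  where "pontryagin_space d S ip \<longleftrightarrow>
    VectorSpace.subspace class_ring S (fun_space d) \<and> hermitian_form_on S ip \<and>
    (\<exists>P Q. hilbert_space d {\<lambda>t. 0\<^sub>v d} P ip \<and>
       VectorSpace.subspace class_ring Q (fun_space d) \<and>
       VectorSpace.vectorspace.fin_dim class_ring ((fun_space d)\<lparr>carrier := Q\<rparr>) \<and>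
       (\<forall>g \<in> Q. g \<noteq> (\<lambda>t. 0\<^sub>v d) \<longrightarrow> Re (ip g g) < 0) \<and>
       (\<forall>f \<in> P. \<forall>g \<in> Q. ip f g = 0) \<and>
       S = {\<lambda>t. f t + g t | f g. f \<in> P \<and> g \<in> Q})"

(* Functions on \<Omega> are total functions vanishing off \<Omega>, and the inner product is 0 off the
   space; these conventions make the space and its inner product unique as HOL objects. *)
definition is_rk_pontryagin_space ::
    "nat \<Rightarrow> complex set \<Rightarrow> (complex \<Rightarrow> complex \<Rightarrow> complex mat) \<Rightarrow>
     (complex \<Rightarrow> complex vec) set \<times> complex form \<Rightarrow> bool"
  where "is_rk_pontryagin_space d \<Omega> K = (\<lambda>(S, ip).
    pontryagin_space d S ip \<and>
    (\<forall>f \<in> S. \<forall>z. z \<notin> \<Omega> \<longrightarrow> f z = 0\<^sub>v d) \<and>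
    (\<forall>f g. f \<notin> S \<or> g \<notin> S \<longrightarrow> ip f g = 0) \<and>
    (\<forall>w \<in> \<Omega>. \<forall>y \<in> carrier_vec d.
       let k = (\<lambda>z. if z \<in> \<Omega> then K z w *\<^sub>v y else 0\<^sub>v d)
       in k \<in> S \<and> (\<forall>f \<in> S. ip f k = f w \<bullet>c y)))"

definition rk_pontryagin_space ::
    "nat \<Rightarrow> complex set \<Rightarrow> (complex \<Rightarrow> complex \<Rightarrow> complex mat) \<Rightarrow>
     (complex \<Rightarrow> complex vec) set \<times> complex form"
  where "rk_pontryagin_space d \<Omega> K = (THE H. is_rk_pontryagin_space d \<Omega> K H)"

section \<open>L2 of the imaginary line and the Hardy space\<close>

definition right_half_plane :: "complex set" (\<open>\<Pi>\<^sub>+\<close>)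
  where "\<Pi>\<^sub>+ = {z. Re z > 0}"

definition vnorm2 :: "complex vec \<Rightarrow> real"
  where "vnorm2 v = (\<Sum>i<dim_vec v. (cmod (v $ i))\<^sup>2)"

(* A function F on the imaginary line is represented by y \<mapsto> F(\<i>y). Elements are
   representatives, not almost-everywhere classes. *)
definition L2_imag :: "nat \<Rightarrow> (real \<Rightarrow> complex vec) set"
  where "L2_imag d = {F. (\<forall>y. F y \<in> carrier_vec d) \<and>
    (\<forall>i<d. (\<lambda>y. F y $ i) \<in> borel_measurable lborel) \<and>
    integrable lborel (\<lambda>y. vnorm2 (F y))}"

definition hardy2 :: "nat \<Rightarrow> (complex \<Rightarrow> complex vec) set"
  where "hardy2 d = {f. (\<forall>z \<in> \<Pi>\<^sub>+. f z \<in> carrier_vec d) \<and>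
    (\<forall>i<d. (\<lambda>z. f z $ i) holomorphic_on \<Pi>\<^sub>+) \<and>
    (\<exists>B::real. \<forall>x>0. (\<integral>\<^sup>+ y. ennreal (vnorm2 (f (Complex x y))) \<partial>lborel) \<le> ennreal B)}"

(* Boundary values are taken in the L2 sense; they determine and are determined by f
   up to null sets. *)
definition boundary_value :: "nat \<Rightarrow> (complex \<Rightarrow> complex vec) \<Rightarrow> (real \<Rightarrow> complex vec) \<Rightarrow> bool"
  where "boundary_value d f F \<longleftrightarrow> F \<in> L2_imag d \<and>
    ((\<lambda>x. \<integral>y. vnorm2 (f (Complex x y) - F y) \<partial>lborel) \<longlongrightarrow> 0) (at_right 0)"

section \<open>BTOA interpolation data\<close>

record btoa_data =
  dZ :: "complex mat"
  dX :: "complex mat"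
  dY :: "complex mat"
  dU :: "complex mat"
  dV :: "complex mat"
  dW :: "complex mat"
  dG :: "complex mat"

abbreviation nZ :: "btoa_data \<Rightarrow> nat" where "nZ D \<equiv> dim_row (dZ D)"
abbreviation nW :: "btoa_data \<Rightarrow> nat" where "nW D \<equiv> dim_row (dW D)"
abbreviation dp :: "btoa_data \<Rightarrow> nat" where "dp D \<equiv> dim_col (dX D)"
abbreviation dm :: "btoa_data \<Rightarrow> nat" where "dm D \<equiv> dim_col (dY D)"

definition btoa_admissible :: "btoa_data \<Rightarrow> bool"
  where "btoa_admissible D \<longleftrightarrow>
    dZ D \<in> carrier_mat (nZ D) (nZ D) \<and> dX D \<in> carrier_mat (nZ D) (dp D) \<and>
    dY D \<in> carrier_mat (nZ D) (dm D) \<and> dU D \<in> carrier_mat (dm D) (nW D) \<and>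
    dV D \<in> carrier_mat (dp D) (nW D) \<and> dW D \<in> carrier_mat (nW D) (nW D) \<and>
    dG D \<in> carrier_mat (nZ D) (nW D) \<and>
    spectrum (dZ D) \<union> spectrum (dW D) \<subseteq> \<Pi>\<^sub>+ \<and>
    controllable (dZ D) (dX D) \<and> observable (dU D) (dW D) \<and>
    dG D * dW D - dZ D * dG D = dX D * dV D - dY D * dU D"

definition Gamma_L :: "btoa_data \<Rightarrow> complex mat"
  where "Gamma_L D = (THE G. G \<in> carrier_mat (nZ D) (nZ D) \<and>
    G * mat_adjoint (dZ D) + dZ D * G =
      dX D * mat_adjoint (dX D) - dY D * mat_adjoint (dY D))"

definition Gamma_R :: "btoa_data \<Rightarrow> complex mat"
  where "Gamma_R D = (THE G. G \<in> carrier_mat (nW D) (nW D) \<and>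
    G * dW D + mat_adjoint (dW D) * G =
      mat_adjoint (dU D) * dU D - mat_adjoint (dV D) * dV D)"

definition btoa_pick :: "btoa_data \<Rightarrow> complex mat"
  where "btoa_pick D =
    four_block_mat (Gamma_L D) (dG D) (mat_adjoint (dG D)) (Gamma_R D)"

definition Jmat :: "btoa_data \<Rightarrow> complex mat"
  where "Jmat D = four_block_mat (1\<^sub>m (dp D)) (0\<^sub>m (dp D) (dm D))
    (0\<^sub>m (dm D) (dp D)) (- 1\<^sub>m (dm D))"

(* The residues vanish off the spectrum of Z, so the infinite sum is a finite one. *)
definition M_space :: "btoa_data \<Rightarrow> (real \<Rightarrow> complex vec) set"
  where "M_space D =
    {\<lambda>y. ((dV D @\<^sub>r dU D) * resolvent (dW D) (\<i> * of_real y)) *\<^sub>v x + H y | x h H.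
       x \<in> carrier_vec (nW D) \<and> h \<in> hardy2 (dp D + dm D) \<and>
       boundary_value (dp D + dm D) h H \<and>
       (\<forall>i<nZ D.
         (\<Sum>\<^sub>\<infinity>z0\<in>\<Pi>\<^sub>+. residue
            (\<lambda>z. ((resolvent (dZ D) z * (dX D @\<^sub>c (- dY D))) *\<^sub>v h z) $ i) z0)
         = (dG D *\<^sub>v x) $ i)}"

definition M_minus :: "btoa_data \<Rightarrow> (real \<Rightarrow> complex vec) set"
  where "M_minus D =
    {\<lambda>y. (dU D * resolvent (dW D) (\<i> * of_real y)) *\<^sub>v x + G y | x g G.
       x \<in> carrier_vec (nW D) \<and> g \<in> hardy2 (dm D) \<and> boundary_value (dm D) g G}"

definition K_space :: "btoa_data \<Rightarrow> (real \<Rightarrow> complex vec) set"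
  where "K_space D = {\<lambda>y. F y @\<^sub>v G y | F G. F \<in> L2_imag (dp D) \<and> G \<in> M_minus D}"

definition J_inner :: "btoa_data \<Rightarrow> real form"
  where "J_inner D F G = (\<integral>y. (Jmat D *\<^sub>v F y) \<bullet>c G y \<partial>lborel)"

definition M_perp :: "btoa_data \<Rightarrow> (real \<Rightarrow> complex vec) set"
  where "M_perp D = {F \<in> K_space D. \<forall>G \<in> M_space D. J_inner D F G = 0}"

definition Amat :: "btoa_data \<Rightarrow> complex mat"
  where "Amat D = four_block_mat (- mat_adjoint (dZ D)) (0\<^sub>m (nZ D) (nW D))
    (0\<^sub>m (nW D) (nZ D)) (dW D)"

definition Cmat :: "btoa_data \<Rightarrow> complex mat"
  where "Cmat D = four_block_mat (- mat_adjoint (dX D)) (dV D) (- mat_adjoint (dY D)) (dU D)"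

definition Theta :: "btoa_data \<Rightarrow> complex \<Rightarrow> complex mat"
  where "Theta D z = 1\<^sub>m (dp D + dm D) -
    Cmat D * resolvent (Amat D) z * minv (btoa_pick D) * mat_adjoint (Cmat D) * Jmat D"

definition K_Theta :: "btoa_data \<Rightarrow> complex \<Rightarrow> complex \<Rightarrow> complex mat"
  where "K_Theta D z w = (1 / (z + cnj w)) \<cdot>\<^sub>m
    (Jmat D - Theta D z * Jmat D * mat_adjoint (Theta D w))"

definition H_Theta :: "btoa_data \<Rightarrow> (complex \<Rightarrow> complex vec) set \<times> complex form"
  where "H_Theta D =
    rk_pontryagin_space (dp D + dm D) (\<Pi>\<^sub>+ - spectrum (dW D)) (K_Theta D)"

end

theory Submission
 imports Defs "HOL-Probability.Sinc_Integral"
begin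

text \<open>Pair everything with the functions \<open>X\<^sup>* (\<lambda> + Z\<^sup>*)\<^sup>-\<^sup>1 a\<close> and \<open>V (\<lambda> - W)\<^sup>-\<^sup>1 b\<close> (and their analogues for
\<open>Y\<close> and \<open>U\<close>). By the residue theorem their Gram matrices on the imaginary axis solve the Lyapunov equations
that define the Pick matrix, and the interpolation condition is orthogonality to the first family. Hence an element
of the orthogonal complement is described by vectors \<open>(a, b)\<close> and a remainder \<open>r\<close>, and its \<open>J\<close>-form is
\<open>2 \<pi>\<close> times the Pick form at \<open>(a, - b)\<close> plus \<open>\<parallel>r\<parallel>\<^sup>2\<close>. The kernel factors as
\<open>C (z - A)\<^sup>-\<^sup>1 \<Gamma>\<^sup>-\<^sup>1 (C (w - A)\<^sup>-\<^sup>1)\<^sup>*\<close>, so its reproducing kernel space is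
\<open>\<complex>\<^sup>n\<close> with the Pick form, embedded by \<open>v \<mapsto> C (z - A)\<^sup>-\<^sup>1 v\<close>.\<close>

text \<open>The poles decide the geometry: those of \<open>hX a\<close> lie in the left half-plane,
  so it belongs to the Hardy space, while V (\<lambda> - W)^-1 b has its poles on the right and is
  orthogonal to that space. The main obstacle is that a Hardy function need not extend to the axis
  or decay pointwise; only its integrals over vertical lines are controlled. Contours are therefore
  closed along selected heights, and the axis is reached in the L2 mean. A second obstacle lies in
  the Lyapunov computation, where terms linear in the resolvent decay only like 1/|y|: their
  integrals exist as symmetric limits, each worth -\<pi> times the identity. Controllability of (Z,
  X) and observability of (U, W) act as positivity of two Gram matrices, which makes the linear
  systems for a and b solvable. A basis orthonormal for the Pick form up to signs is produced by
  maximality, and the three conditions are compared through these signs. The remainder r ranges over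
  an infinite-dimensional space, so condition (2) includes a genuine completeness statement; it
  holds because r is tied to (a, b) by relations that pass to limits.\<close>

section \<open>Moving the integral of a meromorphic function between vertical lines\<close>

lemma integrable_inverse_1_plus_square': "integrable lborel (%y::real. 1 / (1 + y\<^sup>2))"
 using integrable_inverse_1_plus_square
 by (simp add: set_integrable_def inverse_eq_divide)

lemma Complex_linepath:
 "linepath (Complex a R) (Complex b R) u = Complex (a + u * (b - a)) R"
 by (simp add: linepath_def complex_eq_iff algebra_simps)

lemma continuous_on_Complex_line:
 "continuous_on S (%y. Complex x y)" "continuous_on S (%x. Complex x y)"
 by (simp_all add: Complex_eq continuous_intros)

text \<open>By Tonelli the slice integrals, seen as a function of \<open>R\<close>, have a finite
  integral, whereas a lower bound \<open>e\<close> on a whole half-line would make it infinite. This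
  is how good heights for contours are found when the integrand has no pointwise decay.\<close>

lemma nn_integral_small_slice:
 fixes \<Phi> :: "real => real => ennreal"
 assumes meas: "(%(u, R). \<Phi> u R) \<in> borel_measurable (lborel \<Otimes>\<^sub>M lborel)"
  and M: "!!u. (\<integral>\<^sup>+ R. \<Phi> u R \<partial>lborel) \<le> ennreal M * indicator {0..1} u"
  and e: "e > 0"
 shows "\<exists>R\<ge>N. (\<integral>\<^sup>+ u. \<Phi> u R \<partial>lborel) \<le> ennreal e"
proof (rule ccontr)
 assume "\<not> ?thesis"
 then have big: "ennreal e \<le> (\<integral>\<^sup>+ u. \<Phi> u R \<partial>lborel)" if "R \<ge> N" for R
  using that by (meson linorder_linear)
 have "(\<integral>\<^sup>+ R. (\<integral>\<^sup>+ u. \<Phi> u R \<partial>lborel) \<partial>lborel) = (\<integral>\<^sup>+ u. (\<integral>\<^sup>+ R. \<Phi> u R \<partial>lborel) \<partial>lborel)"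
  using lborel_pair.Fubini'[OF meas] by simp
 also have "\<dots> \<le> (\<integral>\<^sup>+ (u::real). ennreal M * indicator {0..1} u \<partial>lborel)"
  by (rule nn_integral_mono) (rule M)
 also have "\<dots> = ennreal M"
  by (subst nn_integral_cmult_indicator) auto
 finally have fin: "(\<integral>\<^sup>+ R. (\<integral>\<^sup>+ u. \<Phi> u R \<partial>lborel) \<partial>lborel) \<le> ennreal M" .
 have "(\<integral>\<^sup>+ R. ennreal e * indicator {N..} R \<partial>lborel) \<le> (\<integral>\<^sup>+ R. (\<integral>\<^sup>+ u. \<Phi> u R \<partial>lborel) \<partial>lborel)"
  using big by (intro nn_integral_mono) (auto simp: indicator_def)
 moreover have "(\<integral>\<^sup>+ R. ennreal e * indicator {N..} R \<partial>lborel) = \<infinity>"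
 proof -
  have "emeasure lborel {N..} = \<infinity>"
  proof (rule ccontr)
   assume "emeasure lborel {N..} \<noteq> \<infinity>"
   then obtain r where r: "emeasure lborel {N..} = ennreal r" "r \<ge> 0"
    by (cases "emeasure lborel {N..}") auto
   \<comment> \<open>An interval of length \<open>r + 1\<close> inside the half-line exceeds the
     supposed finite measure \<open>r\<close>.\<close>
   have "emeasure lborel {N..N + (r + 1)} \<le> emeasure lborel {N..}"
    by (intro emeasure_mono) auto
   then have "ennreal (r + 1) \<le> ennreal r"
    using r by simp
   then show False using r by (simp add: ennreal_le_iff)
  qed
  then show ?thesis
   using e by (subst nn_integral_cmult_indicator) (auto simp: ennreal_mult_top)
 qed
 ultimately show False using fin by (simp add: top_unique)
qed

text \<open>Contour integrals are gauge integrals over [0,1], whereas Tonelli delivers bounds for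
  nonnegative Lebesgue integrals; this converts one into the other. The length \<open>b - a\<close>
  enters because the side is parametrized over the unit interval.\<close>

lemma norm_contour_integral_horizontal_le:
 assumes cont: "continuous_on {z. a \<le> Re z \<and> Re z \<le> b \<and> Im z = R} g" and ab: "a \<le> b"
  and small: "(\<integral>\<^sup>+ u. indicator {0..1} u * ennreal (cmod (g (Complex (a + u * (b - a)) R))) \<partial>lborel) \<le> ennreal e"
  and e: "e \<ge> 0"
 shows "cmod (contour_integral (linepath (Complex a R) (Complex b R)) g) \<le> e * (b - a)"
proof -
 let ?f = "%u. g (Complex (a + u * (b - a)) R)"
 have sub: "a + u * (b - a) \<le> b" if "0 \<le> u" "u \<le> 1" for u
  using that ab mult_right_mono[of u 1 "b - a"] by simp
 have c: "continuous_on {0..1} ?f"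
  by (rule continuous_on_compose2[OF cont])
   (use ab sub in \<open>auto intro!: continuous_intros simp: Complex_eq\<close>)
 have ci: "g contour_integrable_on linepath (Complex a R) (Complex b R)"
  unfolding contour_integrable_on has_contour_integral_def
  using c by (auto intro!: integrable_continuous_real continuous_intros simp: Complex_linepath contour_integrable_on)
 have d: "Complex b R - Complex a R = of_real (b - a)" by (simp add: complex_eq_iff)
 have eq: "contour_integral (linepath (Complex a R) (Complex b R)) g
   = integral {0..1} (%u. ?f u * of_real (b - a))"
  using has_contour_integral_integral[OF ci]
  unfolding has_contour_integral_linepath d Complex_linepath by (rule integral_unique[symmetric])
 have si: "set_integrable lborel {0..1} (%u. cmod (?f u))"
  by (intro borel_integrable_atLeastAtMost' continuous_intros c)
 have "ennreal (integral {0..1} (%u. cmod (?f u))) = ennreal (LINT u:{0..1}|lborel. cmod (?f u))"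
  using set_borel_integral_eq_integral(2)[OF si] by simp
 also have "\<dots> = (\<integral>\<^sup>+ u. indicator {0..1} u * ennreal (cmod (?f u)) \<partial>lborel)"
  unfolding set_lebesgue_integral_def using si unfolding set_integrable_def
  by (subst nn_integral_eq_integral[symmetric]) (auto simp: ennreal_mult' split: split_indicator intro!: nn_integral_cong)
 also have "\<dots> \<le> ennreal e" by (rule small)
 finally have le: "integral {0..1} (%u. cmod (?f u)) \<le> e"
  using e by (simp add: ennreal_le_iff)
 have "cmod (integral {0..1} (%u. ?f u * of_real (b - a))) \<le> integral {0..1} (%u. cmod (?f u) * (b - a))"
  by (rule integral_norm_bound_integral)
   (use ab in \<open>auto intro!: integrable_continuous_real continuous_intros c simp: norm_mult simp flip: of_real_diff\<close>)
 also have "\<dots> \<le> e * (b - a)"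
  using le ab by (simp add: mult_right_mono)
 finally show ?thesis unfolding eq .
qed

text \<open>Uniform bounds on the vertical lines between \<open>a\<close> and \<open>b\<close> bound
  an area integral, so beyond any height there are horizontal slices that are small. No claim is
  made about all large \<open>R\<close>.\<close>

lemma horizontal_sides_small:
 assumes cont: "continuous_on {z. a \<le> Re z \<and> Re z \<le> b \<and> T \<le> \<bar>Im z\<bar>} g" and ab: "a \<le> b"
  and M: "!!t. a \<le> t ==> t \<le> b ==>
   (\<integral>\<^sup>+ y. indicator {y. T \<le> \<bar>y\<bar>} y * ennreal (cmod (g (Complex t y))) \<partial>lborel) \<le> ennreal M"
  and e: "e > 0"
 shows "\<exists>R\<ge>N. cmod (contour_integral (linepath (Complex a R) (Complex b R)) g) \<le> e
  \<and> cmod (contour_integral (linepath (Complex a (-R)) (Complex b (-R))) g) \<le> e"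
proof -
 \<comment> \<open>Taking \<open>L\<close> nonnegative gives |s * R| = R for both signs
   \<open>s\<close>, so that heights beyond \<open>L\<close> stay in the region where
   \<open>g\<close> is controlled.\<close>
 define L where "L = Max {T, N, 0}"
 have L: "L \<ge> T" "L \<ge> N" "L \<ge> 0" unfolding L_def by auto
 \<comment> \<open>The sides have length \<open>b - a\<close>; the added 1 keeps the quotient
   meaningful when \<open>a = b\<close>.\<close>
 define e' where "e' = e / (b - a + 1)"
 have e': "e' > 0" "e' * (b - a) \<le> e" unfolding e'_def using e ab by (auto simp: field_simps)
 \<comment> \<open>The sign \<open>s\<close> selects the upper or the lower side; the cutoff to a
   closed set makes the function measurable on the whole plane.\<close>
 define p where "p = (%s u R. indicator ({0..1} \<times> {L..}) (u, R) * ennreal (cmod (g (Complex (a + u * (b - a)) (s * R)))))"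
 have sub: "a + u * (b - a) \<le> b" if "0 \<le> u" "u \<le> 1" for u
  using that ab mult_right_mono[of u 1 "b - a"] by simp
 have cp: "continuous_on ({0..1} \<times> {L..}) (%(u, R). g (Complex (a + u * (b - a)) (s * R)))"
  if "s = 1 \<or> s = -1" for s :: real
  unfolding case_prod_beta
  by (rule continuous_on_compose2[OF cont])
   (use that ab sub L in \<open>auto intro!: continuous_intros simp: Complex_eq\<close>)
 have mp: "(%(u, R). p s u R) \<in> borel_measurable (lborel \<Otimes>\<^sub>M lborel)" if "s = 1 \<or> s = -1" for s
 proof -
  have "closed ({0..1::real} \<times> {L..})" by (intro closed_Times) auto
  then have "(%x. indicator ({0..1} \<times> {L..}) x *\<^sub>R (case x of (u, R) => g (Complex (a + u * (b - a)) (s * R)))) \<in> borel_measurable borel"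
   by (intro borel_measurable_continuous_on_indicator cp that) (rule borel_closed)
  then have "(%x. ennreal (cmod (indicator ({0..1} \<times> {L..}) x *\<^sub>R (case x of (u, R) => g (Complex (a + u * (b - a)) (s * R)))))) \<in> borel_measurable borel"
   by measurable
  also have "(%x. ennreal (cmod (indicator ({0..1} \<times> {L..}) x *\<^sub>R (case x of (u, R) => g (Complex (a + u * (b - a)) (s * R)))))) = (%(u, R). p s u R)"
   by (auto simp: fun_eq_iff p_def split: split_indicator)
  finally show ?thesis by (simp add: lborel_prod)
 qed
 have int1: "(\<integral>\<^sup>+ R. p s u R \<partial>lborel) \<le> ennreal M * indicator {0..1} u" if "s = 1 \<or> s = -1" for s u
 proof (cases "u \<in> {0..1}")
  case True
  have "(\<integral>\<^sup>+ R. p s u R \<partial>lborel) \<le> (\<integral>\<^sup>+ R. indicator {y. T \<le> \<bar>y\<bar>} (s * R) * ennreal (cmod (g (Complex (a + u * (b - a)) (s * R)))) \<partial>lborel)"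
   unfolding p_def using L that by (intro nn_integral_mono) (auto split: split_indicator)
  also have "\<dots> = (\<integral>\<^sup>+ R. indicator {y. T \<le> \<bar>y\<bar>} R * ennreal (cmod (g (Complex (a + u * (b - a)) R))) \<partial>lborel)"
  proof -
   have mm: "(%R. indicator {y. T \<le> \<bar>y\<bar>} R * ennreal (cmod (g (Complex (a + u * (b - a)) R)))) \<in> borel_measurable borel"
   proof -
    have "closed {y::real. T \<le> \<bar>y\<bar>}" by (intro closed_Collect_le continuous_intros)
    moreover have "continuous_on {y::real. T \<le> \<bar>y\<bar>} (%R. g (Complex (a + u * (b - a)) R))"
     by (rule continuous_on_compose2[OF cont])
      (use True ab sub in \<open>auto intro!: continuous_intros simp: Complex_eq\<close>)
    ultimately have "(%R. indicator {y. T \<le> \<bar>y\<bar>} R *\<^sub>R g (Complex (a + u * (b - a)) R)) \<in> borel_measurable borel"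
     by (intro borel_measurable_continuous_on_indicator) auto
    then have "(%R. ennreal (cmod (indicator {y. T \<le> \<bar>y\<bar>} R *\<^sub>R g (Complex (a + u * (b - a)) R)))) \<in> borel_measurable borel"
     by measurable
    also have "(%R. ennreal (cmod (indicator {y. T \<le> \<bar>y\<bar>} R *\<^sub>R g (Complex (a + u * (b - a)) R)))) =
     (%R. indicator {y. T \<le> \<bar>y\<bar>} R * ennreal (cmod (g (Complex (a + u * (b - a)) R))))"
     by (auto simp: fun_eq_iff split: split_indicator)
    finally show ?thesis .
   qed
   show ?thesis using that nn_integral_real_affine[OF mm, of s 0] by auto
  qed
  also have "\<dots> \<le> ennreal M"
   using True ab sub by (intro M) auto
  finally show ?thesis using True by simp
 next
  case False
  then show ?thesis by (auto simp: p_def)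
 qed
 \<comment> \<open>The slice argument is applied to the sum over both signs, so that a single height
   serves the upper and the lower side; hence twice the bound.\<close>
 have "\<exists>R\<ge>L. (\<integral>\<^sup>+ u. p 1 u R + p (-1) u R \<partial>lborel) \<le> ennreal e'"
 proof (rule nn_integral_small_slice[where M = "2 * max M 0"])
  show "(%(u, R). p 1 u R + p (- 1) u R) \<in> borel_measurable (lborel \<Otimes>\<^sub>M lborel)"
   using borel_measurable_add[OF mp[of 1] mp[of "-1"]] by (simp add: case_prod_unfold)
  fix u
  have "(%R. p s u R) \<in> borel_measurable lborel" if "s = 1 \<or> s = -1" for s
   using measurable_Pair2[OF mp[OF that], of u] by simp
  then have "(\<integral>\<^sup>+ R. p 1 u R + p (- 1) u R \<partial>lborel) = (\<integral>\<^sup>+ R. p 1 u R \<partial>lborel) + (\<integral>\<^sup>+ R. p (- 1) u R \<partial>lborel)"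
   by (intro nn_integral_add) auto
  also have "\<dots> \<le> ennreal M * indicator {0..1} u + ennreal M * indicator {0..1} u"
   by (intro add_mono int1) auto
  also have "\<dots> \<le> ennreal (2 * max M 0) * indicator {0..1} u"
   by (auto split: split_indicator simp: ennreal_plus[symmetric] max_def simp del: ennreal_plus intro!: ennreal_leI) 
    (use ennreal_neg in auto)
  finally show "(\<integral>\<^sup>+ R. p 1 u R + p (- 1) u R \<partial>lborel) \<le> ennreal (2 * max M 0) * indicator {0..1} u" .
 qed (use e' in auto)
 then obtain R where R: "R \<ge> L" "(\<integral>\<^sup>+ u. p 1 u R + p (-1) u R \<partial>lborel) \<le> ennreal e'" by blast
 have side: "cmod (contour_integral (linepath (Complex a (s * R)) (Complex b (s * R))) g) \<le> e" if s: "s = 1 \<or> s = -1" for s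
 proof -
  have "cmod (contour_integral (linepath (Complex a (s * R)) (Complex b (s * R))) g) \<le> e' * (b - a)"
  proof (rule norm_contour_integral_horizontal_le)
   show "continuous_on {z. a \<le> Re z \<and> Re z \<le> b \<and> Im z = s * R} g"
    by (rule continuous_on_subset[OF cont]) (use s R L in auto)
   have "(\<integral>\<^sup>+ u. indicator {0..1} u * ennreal (cmod (g (Complex (a + u * (b - a)) (s * R)))) \<partial>lborel)
    \<le> (\<integral>\<^sup>+ u. p 1 u R + p (-1) u R \<partial>lborel)"
    using s R by (intro nn_integral_mono) (auto simp: p_def split: split_indicator)
   then show "(\<integral>\<^sup>+ u. indicator {0..1} u * ennreal (cmod (g (Complex (a + u * (b - a)) (s * R)))) \<partial>lborel) \<le> ennreal e'"
    using R(2) by order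
  qed (use ab e' in auto)
  then show ?thesis using e' by linarith
 qed
 show ?thesis using side[of 1] side[of "-1"] R L by (intro exI[of _ R]) auto
qed

text \<open>Links the Lebesgue integral over the line, in which inner products are defined, with the
  gauge integrals over segments that contour integrals and antiderivatives produce.\<close>

lemma tendsto_integral_symmetric:
 fixes f :: "real => complex"
 assumes "integrable lborel f"
 shows "((%R. integral {-R..R} f) \<longlongrightarrow> (\<integral>y. f y \<partial>lborel)) at_top"
proof -
 have "((%R. \<integral>y. indicator {-R..R} y *\<^sub>R f y \<partial>lborel) \<longlongrightarrow> (\<integral>y. f y \<partial>lborel)) at_top"
 proof (rule integral_dominated_convergence_at_top[where w = "%y. cmod (f y)"])
  show "AE x in lborel. ((%R. indicator {- R..R} x *\<^sub>R f x) \<longlongrightarrow> f x) at_top"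
  proof (rule AE_I2)
   fix x :: real
   have "eventually (%R. indicator {- R..R} x *\<^sub>R f x = f x) at_top"
    using eventually_ge_at_top[of "\<bar>x\<bar>"] by eventually_elim (auto simp: abs_le_iff indicator_def)
   then show "((%R. indicator {- R..R} x *\<^sub>R f x) \<longlongrightarrow> f x) at_top"
    by (rule tendsto_eventually)
  qed
 qed (use assms in \<open>auto split: split_indicator intro!: always_eventually\<close>)
 moreover have "(\<integral>y. indicator {-R..R} y *\<^sub>R f y \<partial>lborel) = integral {-R..R} f" for R
  using set_borel_integral_eq_integral(2)[of "{-R..R}" f] integrable_mult_indicator[OF _ assms, of "{-R..R}"]
  by (simp add: set_lebesgue_integral_def set_integrable_def)
 ultimately show ?thesis by simp
qed

text \<open>Residue theorem on rectangles whose heights run through a sequence \<open>R n\<close>,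
  the heights at which the horizontal sides are known to be small. On vertical sides dz = i dy,
  which absorbs the factor i of the residue theorem.\<close>

lemma vertical_line_shift:
 assumes g: "g holomorphic_on \<Pi>\<^sub>+ - S" and fin: "finite S" and ab: "0 < a" "a < b"
  and S: "!!s. s \<in> S ==> a < Re s \<and> Re s < b \<and> \<bar>Im s\<bar> < T"
  and M: "!!t. a \<le> t ==> t \<le> b ==>
   (\<integral>\<^sup>+ y. indicator {y. T \<le> \<bar>y\<bar>} y * ennreal (cmod (g (Complex t y))) \<partial>lborel) \<le> ennreal M"
  and inta: "integrable lborel (%y. g (Complex a y))"
  and intb: "integrable lborel (%y. g (Complex b y))"
 shows "(\<integral>y. g (Complex b y) \<partial>lborel) - (\<integral>y. g (Complex a y) \<partial>lborel)
  = 2 * pi * (\<Sum>s\<in>S. residue g s)"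
proof -
 let ?h = "%R. contour_integral (linepath (Complex a R) (Complex b R)) g"
 let ?v = "%x R. integral {-R..R} (%y. g (Complex x y))"
 have cont: "continuous_on (\<Pi>\<^sub>+ - S) g" using g by (rule holomorphic_on_imp_continuous_on)
 \<comment> \<open>The entry \<open>real n\<close> sends the heights to infinity, \<open>T\<close>
   clears all poles, and 1 makes the heights positive, so that no rectangle degenerates.\<close>
 have "\<exists>R \<ge> Max {real n, T, 1}. cmod (?h R) \<le> 1 / (real n + 1) \<and> cmod (?h (-R)) \<le> 1 / (real n + 1)" for n
 proof (rule horizontal_sides_small)
  show "continuous_on {z. a \<le> Re z \<and> Re z \<le> b \<and> T \<le> \<bar>Im z\<bar>} g"
   by (rule continuous_on_subset[OF cont]) (use ab S in \<open>force simp: right_half_plane_def\<close>)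
 qed (use ab M in auto)
 then obtain R where R: "!!n. R n \<ge> Max {real n, T, 1}" "!!n. cmod (?h (R n)) \<le> 1 / (real n + 1)"
  "!!n. cmod (?h (-R n)) \<le> 1 / (real n + 1)" by metis
 have R': "R n \<ge> n" "R n \<ge> T" "R n \<ge> 1" for n using R(1)[of n] by auto
 have Rlim: "filterlim R at_top sequentially"
  by (rule filterlim_at_top_mono[OF filterlim_real_sequentially]) (use R' in auto)
 have eq: "?v b (R n) - ?v a (R n) = 2 * pi * (\<Sum>s\<in>S. residue g s) + \<i> * (?h (- R n) - ?h (R n))" for n
 proof -
  define r where "r = R n"
  have r: "r > 0" "r \<ge> T" using R'[of n] by (auto simp: r_def)
  let ?a1 = "Complex a (-r)" and ?a2 = "Complex b (-r)" and ?a3 = "Complex b r" and ?a4 = "Complex a r"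
  have pi: "path_image (rectpath ?a1 ?a3) \<subseteq> \<Pi>\<^sub>+ - S"
  proof
   fix z assume "z \<in> path_image (rectpath ?a1 ?a3)"
   then have "a \<le> Re z \<and> Re z \<le> b \<and> (Re z = a \<or> Re z = b \<or> \<bar>Im z\<bar> = r)"
    using ab r by (subst (asm) path_image_rectpath) auto
   then show "z \<in> \<Pi>\<^sub>+ - S" using ab S[of z] r by (auto simp: right_half_plane_def)
  qed
  have segs: "closed_segment ?a1 ?a2 \<union> closed_segment ?a2 ?a3 \<union> closed_segment ?a3 ?a4 \<union> closed_segment ?a4 ?a1 \<subseteq> \<Pi>\<^sub>+ - S"
   using pi unfolding rectpath_def Let_def by (simp add: path_image_join)
  have cs: "continuous_on (closed_segment ?a1 ?a2) g" "continuous_on (closed_segment ?a2 ?a3) g"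
   "continuous_on (closed_segment ?a3 ?a4) g" "continuous_on (closed_segment ?a4 ?a1) g"
   using segs by (auto intro: continuous_on_subset[OF cont])
  have ci: "g contour_integrable_on linepath ?a1 ?a2" "g contour_integrable_on linepath ?a2 ?a3"
   "g contour_integrable_on linepath ?a3 ?a4" "g contour_integrable_on linepath ?a4 ?a1"
   using cs by (auto intro: contour_integrable_continuous_linepath)
  have "contour_integral (rectpath ?a1 ?a3) g = 2 * pi * \<i> * (\<Sum>p\<in>S. winding_number (rectpath ?a1 ?a3) p * residue g p)"
  proof (rule Residue_theorem[where S = "\<Pi>\<^sub>+"])
   show "open \<Pi>\<^sub>+" unfolding right_half_plane_def by (simp add: open_halfspace_Re_gt)
   show "connected \<Pi>\<^sub>+" unfolding right_half_plane_def
    by (intro convex_connected convex_halfspace_Re_gt)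
   show "\<forall>z. z \<notin> \<Pi>\<^sub>+ \<longrightarrow> winding_number (rectpath ?a1 ?a3) z = 0"
    using ab r by (auto intro!: winding_number_rectpath_outside simp: in_cbox_complex_iff right_half_plane_def)
  qed (use g fin pi in auto)
  also have "(\<Sum>p\<in>S. winding_number (rectpath ?a1 ?a3) p * residue g p) = (\<Sum>p\<in>S. residue g p)"
  proof (rule sum.cong)
   fix p assume p: "p \<in> S"
   have "winding_number (rectpath ?a1 ?a3) p = 1"
    by (rule winding_number_rectpath) (use S[OF p] r in \<open>auto simp: in_box_complex_iff\<close>)
   then show "winding_number (rectpath ?a1 ?a3) p * residue g p = residue g p" by simp
  qed simp
  also have "contour_integral (rectpath ?a1 ?a3) g = contour_integral (linepath ?a1 ?a2) g
   + (contour_integral (linepath ?a2 ?a3) g + (contour_integral (linepath ?a3 ?a4) g + contour_integral (linepath ?a4 ?a1) g))"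
   unfolding rectpath_def Let_def using ci by (simp add: contour_integrable_join)
  also have "contour_integral (linepath ?a3 ?a4) g = - ?h r"
   using cs(3) by (rule contour_integral_reverse_linepath)
  also have "contour_integral (linepath ?a4 ?a1) g = - contour_integral (linepath ?a1 ?a4) g"
   using cs(4) by (rule contour_integral_reverse_linepath)
  also have "contour_integral (linepath ?a1 ?a4) g = \<i> * ?v a r"
   using r by (subst contour_integral_linepath_same_Re[where c = a]) auto
  also have "contour_integral (linepath ?a2 ?a3) g = \<i> * ?v b r"
   using r by (subst contour_integral_linepath_same_Re[where c = b]) auto
  finally have "\<i> * (?v b r - ?v a r) = \<i> * (2 * pi * (\<Sum>s\<in>S. residue g s) + \<i> * (?h (- r) - ?h r))"
   by (simp add: algebra_simps)
  then show ?thesis unfolding r_def by simp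
 qed
 have l1: "(%n. ?v b (R n) - ?v a (R n)) \<longlonglongrightarrow> (\<integral>y. g (Complex b y) \<partial>lborel) - (\<integral>y. g (Complex a y) \<partial>lborel)"
  using tendsto_integral_symmetric[OF inta] tendsto_integral_symmetric[OF intb] Rlim
  by (intro tendsto_diff) (auto intro: filterlim_compose)
 have z: "(%n. 1 / (real n + 1)) \<longlonglongrightarrow> 0" by real_asymp
 have "(%n. ?h (R n)) \<longlonglongrightarrow> 0" "(%n. ?h (- R n)) \<longlonglongrightarrow> 0"
  by (rule Lim_null_comparison[OF _ z], use R in simp)+
 then have "(%n. 2 * pi * (\<Sum>s\<in>S. residue g s) + \<i> * (?h (- R n) - ?h (R n))) \<longlonglongrightarrow> 2 * pi * (\<Sum>s\<in>S. residue g s) + \<i> * (0 - 0)"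
  by (intro tendsto_intros)
 then have "(%n. ?v b (R n) - ?v a (R n)) \<longlonglongrightarrow> 2 * pi * (\<Sum>s\<in>S. residue g s)"
  unfolding eq by simp
 then show ?thesis using l1 LIMSEQ_unique by blast
qed

section \<open>Square-integrable functions on the line\<close>

definition sq_int :: "(real => complex) => bool"
 where "sq_int f \<longleftrightarrow> f \<in> borel_measurable lborel \<and> integrable lborel (%y. (cmod (f y))\<^sup>2)"

definition inner2 :: "(real => complex) => (real => complex) => complex"
 where "inner2 f g = (\<integral>y. f y * cnj (g y) \<partial>lborel)"

lemma sq_int_measurable: "sq_int f ==> f \<in> borel_measurable borel"
 by (simp add: sq_int_def)

lemma sq_int_mult_integrable:
 assumes "sq_int f" "sq_int g"
 shows "integrable lborel (%y. f y * g y)" "integrable lborel (%y. cmod (f y) * cmod (g y))"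
proof -
 note [measurable] = sq_int_measurable[OF assms(1)] sq_int_measurable[OF assms(2)]
 have i: "integrable lborel (%y. (cmod (f y))\<^sup>2 + (cmod (g y))\<^sup>2)"
  using assms by (auto simp: sq_int_def)
 have b: "cmod (f y) * cmod (g y) \<le> (cmod (f y))\<^sup>2 + (cmod (g y))\<^sup>2" for y
 proof -
  have "0 \<le> cmod (f y) * cmod (g y)" by simp
  then show ?thesis using sum_squares_bound[of "cmod (f y)" "cmod (g y)"] by linarith
 qed
 show "integrable lborel (%y. f y * g y)"
  by (rule Bochner_Integration.integrable_bound[OF i]) (use b in \<open>auto simp: norm_mult\<close>)
 show "integrable lborel (%y. cmod (f y) * cmod (g y))"
  by (rule Bochner_Integration.integrable_bound[OF i]) (use b in \<open>auto simp: norm_mult\<close>)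
qed

lemma sq_int_cnj: "sq_int f ==> sq_int (%y. cnj (f y))"
 unfolding sq_int_def by (auto intro: measurable_compose[OF _ borel_measurable_continuous_onI] continuous_intros)

lemma sq_int_cmult: "sq_int f ==> sq_int (%y. c * f y)"
 unfolding sq_int_def by (auto simp: norm_mult power_mult_distrib)

lemma sq_int_add:
 assumes "sq_int f" "sq_int g" shows "sq_int (%y. f y + g y)"
proof -
 note [measurable] = sq_int_measurable[OF assms(1)] sq_int_measurable[OF assms(2)]
 have i: "integrable lborel (%y. 2 * (cmod (f y))\<^sup>2 + 2 * (cmod (g y))\<^sup>2)"
  using assms by (auto simp: sq_int_def)
 have b: "(cmod (f y + g y))\<^sup>2 \<le> 2 * (cmod (f y))\<^sup>2 + 2 * (cmod (g y))\<^sup>2" for y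
 proof -
  have "(cmod (f y + g y))\<^sup>2 \<le> (cmod (f y) + cmod (g y))\<^sup>2"
   by (intro power_mono norm_triangle_ineq) auto
  also have "\<dots> \<le> 2 * (cmod (f y))\<^sup>2 + 2 * (cmod (g y))\<^sup>2"
   using sum_squares_bound[of "cmod (f y)" "cmod (g y)"] by (simp add: power2_sum)
  finally show ?thesis .
 qed
 show ?thesis unfolding sq_int_def
  by (intro conjI Bochner_Integration.integrable_bound[OF i]) (use b in \<open>auto\<close>)
qed

lemma sq_int_diff:
 assumes "sq_int f" "sq_int g" shows "sq_int (%y. f y - g y)"
 using sq_int_add[OF assms(1) sq_int_cmult[OF assms(2), of "-1"]] by simp

lemma quadratic_nonneg_discriminant:
 fixes A X B :: real
 assumes "!!t. 0 \<le> t\<^sup>2 * A + 2 * t * X + B" and "A \<ge> 0"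
 shows "X\<^sup>2 \<le> A * B"
proof (cases "A = 0")
 case True
 have "X = 0"
 proof (rule ccontr)
  assume "X \<noteq> 0"
  \<comment> \<open>At this \<open>t\<close> the affine function 2tX + B takes the value -1.\<close>
  then show False using assms(1)[of "-(B + 1) / (2 * X)"] True by (simp add: field_simps)
 qed
 then show ?thesis using True by simp
next
 case False
 then have "A > 0" using assms by simp
 \<comment> \<open>The quadratic is evaluated at its minimum -X/A; the factor \<open>A\<close>
   clears the denominator.\<close>
 then have "0 \<le> A * ((-X/A)\<^sup>2 * A + 2 * (-X/A) * X + B)"
  using assms(1)[of "-X/A"] by (intro mult_nonneg_nonneg) auto
 also have "\<dots> = A * B - X\<^sup>2" using \<open>A > 0\<close> by (simp add: field_simps power2_eq_square)
 finally show ?thesis by simp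
qed

lemma integral_Cauchy_Schwarz:
 assumes "sq_int f" "sq_int g"
 shows "(cmod (\<integral>y. f y * g y \<partial>lborel))\<^sup>2 \<le> (\<integral>y. (cmod (f y))\<^sup>2 \<partial>lborel) * (\<integral>y. (cmod (g y))\<^sup>2 \<partial>lborel)"
proof -
 let ?X = "\<integral>y. cmod (f y) * cmod (g y) \<partial>lborel"
 let ?A = "\<integral>y. (cmod (f y))\<^sup>2 \<partial>lborel" and ?B = "\<integral>y. (cmod (g y))\<^sup>2 \<partial>lborel"
 have i: "integrable lborel (%y. (cmod (f y))\<^sup>2)" "integrable lborel (%y. (cmod (g y))\<^sup>2)"
  "integrable lborel (%y. cmod (f y) * cmod (g y))"
  using assms sq_int_mult_integrable[OF assms] by (auto simp: sq_int_def)
 have "cmod (\<integral>y. f y * g y \<partial>lborel) \<le> ?X"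
  using integral_norm_bound[of lborel "%y. f y * g y"] by (simp add: norm_mult)
 then have "(cmod (\<integral>y. f y * g y \<partial>lborel))\<^sup>2 \<le> ?X\<^sup>2"
  by (intro power_mono) auto
 also have "\<dots> \<le> ?A * ?B"
 proof (rule quadratic_nonneg_discriminant)
  fix t :: real
  have "0 \<le> (\<integral>y. (t * cmod (f y) + cmod (g y))\<^sup>2 \<partial>lborel)"
   by (intro integral_nonneg_AE) auto
  also have "\<dots> = (\<integral>y. t\<^sup>2 * (cmod (f y))\<^sup>2 + 2 * t * (cmod (f y) * cmod (g y)) + (cmod (g y))\<^sup>2 \<partial>lborel)"
   by (intro Bochner_Integration.integral_cong) (auto simp: power2_eq_square algebra_simps)
  also have "\<dots> = t\<^sup>2 * ?A + 2 * t * ?X + ?B"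
   using i by simp
  finally show "0 \<le> t\<^sup>2 * ?A + 2 * t * ?X + ?B" .
 qed (intro integral_nonneg_AE, auto)
 finally show ?thesis .
qed

text \<open>Inside a ball compactness bounds \<open>\<rho>\<close>, outside the decay does.
  Expressing the bound by Im z alone makes it the same on all vertical lines in \<open>A\<close>,
  hence an integrable dominating function when the line moves to the axis.\<close>

lemma decay_bound:
 assumes cl: "closed A" and cont: "continuous_on A \<rho>"
  and K: "!!z. z \<in> A ==> T \<le> cmod z ==> cmod (\<rho> z) \<le> K / cmod z"
 shows "\<exists>K'\<ge>0. \<forall>z\<in>A. (cmod (\<rho> z))\<^sup>2 \<le> K' / (1 + (Im z)\<^sup>2)"
proof -
 \<comment> \<open>For |z| \<ge> 1 the weight 1 + (Im z)^2 is at most 2|z|^2; this is the origin of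
   the factor 2 in \<open>K'\<close>.\<close>
 define T' where "T' = max T 1"
 have "compact (A \<inter> cball 0 T')" using cl by (simp add: closed_Int_compact)
 then have "bounded (\<rho> ` (A \<inter> cball 0 T'))"
  by (intro compact_imp_bounded compact_continuous_image continuous_on_subset[OF cont]) auto
 then obtain M where M: "!!z. z \<in> A ==> cmod z \<le> T' ==> cmod (\<rho> z) \<le> M" "M > 0"
  unfolding bounded_pos by (metis IntI dist_0_norm imageI mem_cball)
 define K' where "K' = M\<^sup>2 * (1 + T'\<^sup>2) + 2 * K\<^sup>2"
 have "(cmod (\<rho> z))\<^sup>2 \<le> K' / (1 + (Im z)\<^sup>2)" if z: "z \<in> A" for z
 proof -
  have p: "1 + (Im z)\<^sup>2 > 0" by (simp add: add_pos_nonneg)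
  have im: "(Im z)\<^sup>2 \<le> (cmod z)\<^sup>2" using abs_Im_le_cmod[of z] by (simp add: abs_le_square_iff[symmetric])
  have "(cmod (\<rho> z))\<^sup>2 * (1 + (Im z)\<^sup>2) \<le> K'"
  proof (cases "cmod z \<le> T'")
   case True
   have "(cmod z)\<^sup>2 \<le> T'\<^sup>2" using True by (intro power_mono) auto
   then have "(cmod (\<rho> z))\<^sup>2 * (1 + (Im z)\<^sup>2) \<le> M\<^sup>2 * (1 + T'\<^sup>2)"
    using im M(1)[OF z True] by (intro mult_mono power_mono) auto
   then show ?thesis unfolding K'_def by (smt (verit) zero_le_power2)
  next
   case False
   then have c: "cmod z \<ge> T" "cmod z \<ge> 1" unfolding T'_def by auto
   have "(cmod (\<rho> z))\<^sup>2 \<le> (K / cmod z)\<^sup>2"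
    using K[OF z c(1)] by (intro power_mono) auto
   moreover have "1 \<le> (cmod z)\<^sup>2" using c(2) by simp
   then have "1 + (Im z)\<^sup>2 \<le> 2 * (cmod z)\<^sup>2" using im by linarith
   ultimately have "(cmod (\<rho> z))\<^sup>2 * (1 + (Im z)\<^sup>2) \<le> (K / cmod z)\<^sup>2 * (2 * (cmod z)\<^sup>2)"
    using p by (intro mult_mono) auto
   also have "\<dots> = 2 * K\<^sup>2"
    using c(2) by (simp add: power_divide) (metis norm_zero not_one_le_zero)
   finally show ?thesis unfolding K'_def by (smt (verit) zero_le_power2 mult_nonneg_nonneg)
  qed
  then show ?thesis using p by (simp add: pos_le_divide_eq)
 qed
 moreover have "K' \<ge> 0" unfolding K'_def by (auto intro!: add_nonneg_nonneg mult_nonneg_nonneg)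
 ultimately show ?thesis by blast
qed

lemma sq_int_decay:
 assumes "f \<in> borel_measurable borel" and "!!y. (cmod (f y))\<^sup>2 \<le> K / (1 + y\<^sup>2)"
 shows "sq_int f"
proof -
 note [measurable] = assms(1)
 have i: "integrable lborel (%y::real. K * (1 / (1 + y\<^sup>2)))"
  by (intro integrable_mult_right integrable_inverse_1_plus_square')
 show ?thesis unfolding sq_int_def
  by (intro conjI Bochner_Integration.integrable_bound[OF i])
   (use assms(2) in \<open>auto simp: abs_mult intro!: AE_I2 order_trans[OF _ divide_right_mono[OF abs_ge_self]] intro: add_nonneg_nonneg\<close>)
qed

lemma continuous_line_measurable:
 assumes "continuous_on A f" "!!y. Complex x y \<in> A"
 shows "(%y. f (Complex x y)) \<in> borel_measurable borel"
 by (intro borel_measurable_continuous_onI continuous_on_compose2[OF assms(1)] continuous_on_Complex_line)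
  (use assms(2) in auto)

section \<open>Scalar Hardy functions, their boundary values and residues\<close>

text \<open>One component of \<open>hardy2\<close> together with its \<open>boundary_value\<close>.
  The boundary function is carried along as data, just as in \<open>M_space\<close>.\<close>

definition hardy_pair :: "(complex => complex) => (real => complex) => bool"
 where "hardy_pair h H \<longleftrightarrow> h holomorphic_on \<Pi>\<^sub>+ \<and>
  (\<exists>B::real. \<forall>x>0. (\<integral>\<^sup>+ y. ennreal ((cmod (h (Complex x y)))\<^sup>2) \<partial>lborel) \<le> ennreal B) \<and>
  sq_int H \<and> ((%x. \<integral>y. (cmod (h (Complex x y) - H y))\<^sup>2 \<partial>lborel) \<longlongrightarrow> 0) (at_right 0)"

lemma sq_int_line:
 assumes h: "h holomorphic_on \<Pi>\<^sub>+" and x: "x > 0"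
  and B: "(\<integral>\<^sup>+ y. ennreal ((cmod (h (Complex x y)))\<^sup>2) \<partial>lborel) \<le> ennreal B"
 shows "sq_int (%y. h (Complex x y))"
proof -
 have [measurable]: "(%y. h (Complex x y)) \<in> borel_measurable borel"
  by (rule continuous_line_measurable[OF holomorphic_on_imp_continuous_on[OF h]])
   (use x in \<open>simp add: right_half_plane_def\<close>)
 have "integrable lborel (%y. (cmod (h (Complex x y)))\<^sup>2)"
 proof (rule integrableI_nonneg)
  show "(\<integral>\<^sup>+ y. ennreal ((cmod (h (Complex x y)))\<^sup>2) \<partial>lborel) < \<infinity>"
   using B by (rule order.strict_trans1) simp
 qed auto
 then show ?thesis unfolding sq_int_def by auto
qed

lemma hardy_pair_line:
 assumes "hardy_pair h H"
 obtains B where "B \<ge> 0" "!!x. x > 0 ==> (\<integral>\<^sup>+ y. ennreal ((cmod (h (Complex x y)))\<^sup>2) \<partial>lborel) \<le> ennreal B"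
  "!!x. x > 0 ==> sq_int (%y. h (Complex x y))"
  "!!x. x > 0 ==> (\<integral>y. (cmod (h (Complex x y)))\<^sup>2 \<partial>lborel) \<le> B"
proof -
 obtain B where B: "!!x. x > 0 ==> (\<integral>\<^sup>+ y. ennreal ((cmod (h (Complex x y)))\<^sup>2) \<partial>lborel) \<le> ennreal B"
  using assms unfolding hardy_pair_def by blast
 have s: "sq_int (%y. h (Complex x y))" if x: "x > 0" for x
  using assms B[OF x] x by (intro sq_int_line) (auto simp: hardy_pair_def)
 have B': "(\<integral>\<^sup>+ y. ennreal ((cmod (h (Complex x y)))\<^sup>2) \<partial>lborel) \<le> ennreal (max B 0)" if "x > 0" for x
  using B[OF that] by (auto simp: max_def ennreal_neg)
 show ?thesis
 proof (rule that[of "max B 0"])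
  fix x :: real assume x: "x > 0"
  have "ennreal (\<integral>y. (cmod (h (Complex x y)))\<^sup>2 \<partial>lborel) = (\<integral>\<^sup>+ y. ennreal ((cmod (h (Complex x y)))\<^sup>2) \<partial>lborel)"
   using s[OF x] by (intro nn_integral_eq_integral[symmetric]) (auto simp: sq_int_def)
  then show "(\<integral>y. (cmod (h (Complex x y)))\<^sup>2 \<partial>lborel) \<le> max B 0"
   using B'[OF x] by (metis ennreal_le_iff max.cobounded2)
 qed (use B' s in auto)
qed

text \<open>For b \<ge> 1 the integrand is dominated by its value at b = 1. This makes the right
  side of the contour disappear.\<close>

lemma tendsto_inverse_square_integral:
 "((%b. \<integral>(y::real). 1 / (b\<^sup>2 + y\<^sup>2) \<partial>lborel) \<longlongrightarrow> 0) at_top"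
proof -
 have "((%b. \<integral>(y::real). 1 / (b\<^sup>2 + y\<^sup>2) \<partial>lborel) \<longlongrightarrow> (\<integral>(y::real). 0 \<partial>lborel)) at_top"
 proof (rule integral_dominated_convergence_at_top[where w = "%y. 1 / (1 + y\<^sup>2)"])
  show "\<forall>\<^sub>F b in at_top. AE x in lborel. norm (1 / (b\<^sup>2 + x\<^sup>2)) \<le> 1 / (1 + x\<^sup>2 :: real)"
   using eventually_ge_at_top[of 1]
  proof eventually_elim
   case (elim b)
   then have "1 \<le> b\<^sup>2" by simp
   then have "0 < b\<^sup>2 + x\<^sup>2" for x by (intro add_pos_nonneg) auto
   then show ?case using \<open>1 \<le> b\<^sup>2\<close>
    by (intro AE_I2) (auto intro!: divide_left_mono mult_pos_pos add_pos_nonneg)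
  qed
  show "AE x in lborel. ((%b::real. 1 / (b\<^sup>2 + x\<^sup>2)) \<longlongrightarrow> 0) at_top"
   by (intro AE_I2) real_asymp
 qed (auto intro: integrable_inverse_1_plus_square')
 then show ?thesis by simp
qed

text \<open>The product is at most |\<rho>|^2 + |h|^2. The first summand has an integrable bound
  independent of t because |y| \<ge> 1, the second is bounded by the Hardy norm; together they give
  the uniform bound that the contour shift asks for.\<close>

lemma hardy_pair_horizontal_bound:
 assumes hp: "hardy_pair h H"
  and K: "!!z. T \<le> cmod z ==> cmod (\<rho> z) \<le> K / cmod z" and "T \<ge> 1"
 shows "\<exists>M. \<forall>t>0. (\<integral>\<^sup>+ y. indicator {y. T \<le> \<bar>y\<bar>} y * ennreal (cmod (\<rho> (Complex t y) * h (Complex t y))) \<partial>lborel) \<le> ennreal M"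
proof -
 obtain B where B: "B \<ge> 0" "!!x. x > 0 ==> (\<integral>\<^sup>+ y. ennreal ((cmod (h (Complex x y)))\<^sup>2) \<partial>lborel) \<le> ennreal B"
  "!!x. x > 0 ==> sq_int (%y. h (Complex x y))"
  using hardy_pair_line[OF hp] by metis
 define P where "P = (\<integral>(y::real). 2 * K\<^sup>2 * (1 / (1 + y\<^sup>2)) \<partial>lborel)"
 have iP: "integrable lborel (%y::real. 2 * K\<^sup>2 * (1 / (1 + y\<^sup>2)))"
  by (intro integrable_mult_right integrable_inverse_1_plus_square')
 have P: "(\<integral>\<^sup>+ (y::real). ennreal (2 * K\<^sup>2 * (1 / (1 + y\<^sup>2))) \<partial>lborel) = ennreal P"
  unfolding P_def by (rule nn_integral_eq_integral[OF iP]) (auto simp: add_nonneg_nonneg)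
 have P0: "P \<ge> 0" unfolding P_def by (rule integral_nonneg_AE) (auto simp: add_nonneg_nonneg)
 have "(\<integral>\<^sup>+ y. indicator {y. T \<le> \<bar>y\<bar>} y * ennreal (cmod (\<rho> (Complex t y) * h (Complex t y))) \<partial>lborel) \<le> ennreal (P + B)"
  if t: "t > 0" for t
 proof -
  note [measurable] = sq_int_measurable[OF B(3)[OF t]]
  have "(\<integral>\<^sup>+ y. indicator {y. T \<le> \<bar>y\<bar>} y * ennreal (cmod (\<rho> (Complex t y) * h (Complex t y))) \<partial>lborel)
   \<le> (\<integral>\<^sup>+ y. ennreal (2 * K\<^sup>2 * (1 / (1 + y\<^sup>2))) + ennreal ((cmod (h (Complex t y)))\<^sup>2) \<partial>lborel)"
  proof (rule nn_integral_mono)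
   fix y :: real
   show "indicator {y. T \<le> \<bar>y\<bar>} y * ennreal (cmod (\<rho> (Complex t y) * h (Complex t y)))
    \<le> ennreal (2 * K\<^sup>2 * (1 / (1 + y\<^sup>2))) + ennreal ((cmod (h (Complex t y)))\<^sup>2)"
   proof (cases "T \<le> \<bar>y\<bar>")
    case True
    let ?r = "cmod (\<rho> (Complex t y))" and ?h = "cmod (h (Complex t y))"
    have yc: "\<bar>y\<bar> \<le> cmod (Complex t y)" using abs_Im_le_cmod[of "Complex t y"] by simp
    have "?r \<le> K / cmod (Complex t y)" using K True yc by simp
    then have "?r\<^sup>2 \<le> (K / cmod (Complex t y))\<^sup>2" by (intro power_mono) auto
    also have "\<dots> = K\<^sup>2 / (t\<^sup>2 + y\<^sup>2)" by (simp add: power_divide cmod_power2)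
    also have "\<dots> \<le> K\<^sup>2 / ((1 + y\<^sup>2) / 2)"
    proof -
     have "1 \<le> y\<^sup>2" using True \<open>T \<ge> 1\<close> by (metis abs_square_le_1 abs_ge_self linorder_not_less order_trans power2_abs one_le_power)
     then have "(1 + y\<^sup>2) / 2 \<le> t\<^sup>2 + y\<^sup>2" using add_increasing[of "2 * t\<^sup>2" 1 "y\<^sup>2"] by (simp add: field_simps)
     then show ?thesis using t
      by (intro divide_left_mono mult_pos_pos divide_pos_pos add_pos_nonneg) auto
    qed
    also have "\<dots> = 2 * K\<^sup>2 * (1 / (1 + y\<^sup>2))" by (simp add: mult.commute)
    finally have r: "?r\<^sup>2 \<le> 2 * K\<^sup>2 * (1 / (1 + y\<^sup>2))" .
    have "0 \<le> ?r * ?h" by simp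
    then have "?r * ?h \<le> ?r\<^sup>2 + ?h\<^sup>2"
     using sum_squares_bound[of ?r ?h] by linarith
    then have "?r * ?h \<le> 2 * K\<^sup>2 * (1 / (1 + y\<^sup>2)) + ?h\<^sup>2" using r by linarith
    moreover have "ennreal (2 * K\<^sup>2 * (1 / (1 + y\<^sup>2)) + ?h\<^sup>2) = ennreal (2 * K\<^sup>2 * (1 / (1 + y\<^sup>2))) + ennreal (?h\<^sup>2)"
     by (rule ennreal_plus) (auto simp: add_nonneg_nonneg)
    ultimately show ?thesis using True
     by (metis (lifting) ennreal_leI indicator_simps(1) mem_Collect_eq mult_1 norm_mult)
   qed auto
  qed
  also have "\<dots> = (\<integral>\<^sup>+ y. ennreal (2 * K\<^sup>2 * (1 / (1 + y\<^sup>2))) \<partial>lborel) + (\<integral>\<^sup>+ y. ennreal ((cmod (h (Complex t y)))\<^sup>2) \<partial>lborel)"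
   by (intro nn_integral_add) auto
  also have "\<dots> \<le> ennreal P + ennreal B"
   using B(2)[OF t] P by (intro add_mono) auto
  finally show ?thesis using P0 B(1) by simp
 qed
 then show ?thesis by blast
qed

text \<open>Closing the contour to the right: the horizontal sides of a rectangle vanish along a
 sequence since the integrals over the lines are uniformly bounded, the right side vanishes
 by the decay of \<open>\<rho>\<close>, and the left side tends to the imaginary line in the mean.\<close>

theorem hardy_pair_residue:
 assumes hp: "hardy_pair h H"
  and hol: "\<rho> holomorphic_on UNIV - S" and fin: "finite S" and S0: "!!s. s \<in> S ==> Re s \<noteq> 0"
  and K0: "!!z. T0 \<le> cmod z ==> cmod (\<rho> z) \<le> K / cmod z"
 shows "sq_int (%y. \<rho> (Complex 0 y))"
  and "(\<integral>y. \<rho> (Complex 0 y) * H y \<partial>lborel) = - 2 * pi * (\<Sum>s | s \<in> S \<and> Re s > 0. residue (%z. \<rho> z * h z) s)"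
proof -
 define S' where "S' = {s \<in> S. Re s > 0}"
 define g where "g = (%z. \<rho> z * h z)"
 have finS': "finite S'" using fin by (simp add: S'_def)
 have cont\<rho>: "continuous_on (UNIV - S) \<rho>" using hol by (rule holomorphic_on_imp_continuous_on)
 obtain B where B: "B \<ge> 0" "!!x. x > 0 ==> (\<integral>\<^sup>+ y. ennreal ((cmod (h (Complex x y)))\<^sup>2) \<partial>lborel) \<le> ennreal B"
  "!!x. x > 0 ==> sq_int (%y. h (Complex x y))" "!!x. x > 0 ==> (\<integral>y. (cmod (h (Complex x y)))\<^sup>2 \<partial>lborel) \<le> B"
  using hardy_pair_line[OF hp] by metis
 \<comment> \<open>\<open>T\<close> dominates 1, the threshold of the decay, and strictly the
   modulus of every pole, so all poles lie in |Im z| < T and to the left of the line Re z =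
   T.\<close>
 define T where "T = Max (insert 1 (insert T0 ((%s. cmod s + 1) ` S)))"
 have T: "T \<ge> 1" "T \<ge> T0" "!!s. s \<in> S ==> cmod s < T"
 proof -
  have "finite (insert 1 (insert T0 ((%s. cmod s + 1) ` S)))" using fin by simp
  then have le: "x \<le> T" if "x \<in> insert 1 (insert T0 ((%s. cmod s + 1) ` S))" for x
   using that unfolding T_def by (rule Max_ge)
  then show "T \<ge> 1" "T \<ge> T0" by simp_all
  show "cmod s < T" if "s \<in> S" for s
   using le[of "cmod s + 1"] that by simp
 qed
 have K: "cmod (\<rho> z) \<le> K / cmod z" if "T \<le> cmod z" for z using K0 T that by simp
 \<comment> \<open>At most half the real part of every pole on the right; the inserted 1 covers the
   case without poles.\<close>
 define a where "a = Min (insert 1 ((%s. Re s / 2) ` S'))"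
 have a: "a > 0" "!!s. s \<in> S' ==> a < Re s"
 proof -
  have fa: "finite (insert 1 ((%s. Re s / 2) ` S'))" using finS' by simp
  then show "a > 0" unfolding a_def by (subst Min_gr_iff) (auto simp: S'_def)
  have le: "a \<le> x" if "x \<in> insert 1 ((%s. Re s / 2) ` S')" for x
   using that fa unfolding a_def by (simp add: Min_le)
  show "a < Re s" if "s \<in> S'" for s
  proof -
   have "a \<le> Re s / 2" using that by (intro le) simp
   then show ?thesis using that by (simp add: S'_def)
  qed
 qed
 \<comment> \<open>The closed strip between the axis and the line Re z = a contains no pole, since
   \<open>S\<close> avoids the axis itself; on it \<open>decay_bound\<close> applies.\<close>
 define A where "A = {z. 0 \<le> Re z} \<inter> {z. Re z \<le> a}"
 have clA: "closed A" unfolding A_def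
  by (intro closed_Int closed_halfspace_Re_ge closed_halfspace_Re_le)
 have AS: "A \<subseteq> UNIV - S" 
 proof
  fix z assume "z \<in> A"
  then have z: "0 \<le> Re z" "Re z \<le> a" by (auto simp: A_def)
  have "z \<notin> S"
  proof
   assume "z \<in> S"
   then have "z \<in> S'" using S0[of z] z by (simp add: S'_def)
   then show False using a(2)[of z] z by simp
  qed
  then show "z \<in> UNIV - S" by simp
 qed
 obtain K1 where K1: "K1 \<ge> 0" "!!z. z \<in> A ==> (cmod (\<rho> z))\<^sup>2 \<le> K1 / (1 + (Im z)\<^sup>2)"
  using decay_bound[OF clA continuous_on_subset[OF cont\<rho> AS] K] by blast
 have sqA: "sq_int (%y. \<rho> (Complex x y))" if "0 \<le> x" "x \<le> a" for x
 proof (rule sq_int_decay)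
  show "(%y. \<rho> (Complex x y)) \<in> borel_measurable borel"
   by (rule continuous_line_measurable[OF continuous_on_subset[OF cont\<rho> AS]]) (use that in \<open>simp add: A_def\<close>)
  show "(cmod (\<rho> (Complex x y)))\<^sup>2 \<le> K1 / (1 + y\<^sup>2)" for y
   using K1(2)[of "Complex x y"] that by (simp add: A_def)
 qed
 show sq0: "sq_int (%y. \<rho> (Complex 0 y))" using sqA[of 0] a by simp
 define I where "I = (%x. \<integral>y. g (Complex x y) \<partial>lborel)"
 have far: "(cmod (\<rho> (Complex b y)))\<^sup>2 \<le> K\<^sup>2 * (1 / (b\<^sup>2 + y\<^sup>2))" if "b \<ge> T" for b y
 proof -
  have "b \<le> cmod (Complex b y)" using complex_Re_le_cmod[of "Complex b y"] by simp
  then have "(cmod (\<rho> (Complex b y)))\<^sup>2 \<le> (K / cmod (Complex b y))\<^sup>2"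
   using that by (intro power_mono K) auto
  then show ?thesis by (simp add: power_divide cmod_power2)
 qed
 have i_far: "integrable lborel (%y::real. K\<^sup>2 * (1 / (b\<^sup>2 + y\<^sup>2)))" if "b \<ge> T" for b
 proof (rule Bochner_Integration.integrable_bound[OF integrable_mult_right[OF integrable_inverse_1_plus_square', of "K\<^sup>2"]])
  have "1 \<le> b\<^sup>2" using that T(1) by simp
  then show "AE x in lborel. norm (K\<^sup>2 * (1 / (b\<^sup>2 + x\<^sup>2))) \<le> norm (K\<^sup>2 * (1 / (1 + x\<^sup>2)))"
   by (intro AE_I2) (auto simp: abs_mult intro!: divide_left_mono mult_pos_pos add_pos_nonneg)
 qed auto
 have sqfar: "sq_int (%y. \<rho> (Complex b y))" if b: "b \<ge> T" for b
 proof (rule sq_int_decay[where K = "K\<^sup>2"])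
  have "Complex b y \<in> UNIV - S" for y
   using T(3)[of "Complex b y"] complex_Re_le_cmod[of "Complex b y"] b by auto
  then show "(%y. \<rho> (Complex b y)) \<in> borel_measurable borel"
   by (rule continuous_line_measurable[OF cont\<rho>])
  have "1 \<le> b\<^sup>2" using that T(1) by simp
  then have "K\<^sup>2 * (1 / (b\<^sup>2 + y\<^sup>2)) \<le> K\<^sup>2 / (1 + y\<^sup>2)" for y
   using b T(1) by (simp, intro divide_left_mono mult_pos_pos add_pos_nonneg) auto
  then show "(cmod (\<rho> (Complex b y)))\<^sup>2 \<le> K\<^sup>2 / (1 + y\<^sup>2)" for y
   using far[OF b, of y] order_trans by blast
 qed
 obtain M where M: "!!t. t > 0 ==> (\<integral>\<^sup>+ y. indicator {y. T \<le> \<bar>y\<bar>} y * ennreal (cmod (g (Complex t y))) \<partial>lborel) \<le> ennreal M"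
  using hardy_pair_horizontal_bound[OF hp K T(1)] unfolding g_def by blast
 have shift: "I b - I x = 2 * pi * (\<Sum>s\<in>S'. residue g s)" if x: "0 < x" "x \<le> a" and b: "b \<ge> T" "b > a" for x b
  unfolding I_def
 proof (rule vertical_line_shift[where M = M])
  have "h holomorphic_on \<Pi>\<^sub>+" using hp by (simp add: hardy_pair_def)
  then show "g holomorphic_on \<Pi>\<^sub>+ - S'" unfolding g_def
   by (intro holomorphic_on_mult holomorphic_on_subset[OF hol])
    (auto simp: S'_def right_half_plane_def intro: holomorphic_on_subset)
  show "integrable lborel (%y. g (Complex x y))" unfolding g_def
   using sq_int_mult_integrable[OF sqA B(3)] x by simp
  show "integrable lborel (%y. g (Complex b y))" unfolding g_def
   using sq_int_mult_integrable[OF sqfar B(3)] x b by simp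
  show "x < Re s \<and> Re s < b \<and> \<bar>Im s\<bar> < T" if "s \<in> S'" for s
   using that a(2)[OF that] x b T(3)[of s] complex_Re_le_cmod[of s] abs_Im_le_cmod[of s]
   by (auto simp: S'_def)
 qed (use x b M finS' in auto)
 \<comment> \<open>Cauchy-Schwarz: on the line Re z = b the L2 norm of \<open>\<rho>\<close> tends
   to 0, while that of \<open>h\<close> stays bounded.\<close>
 have "((%b. I b) \<longlongrightarrow> 0) at_top"
 proof -
  have "((%b. sqrt (K\<^sup>2 * (\<integral>(y::real). 1 / (b\<^sup>2 + y\<^sup>2) \<partial>lborel) * B)) \<longlongrightarrow> sqrt (K\<^sup>2 * 0 * B)) at_top"
   by (intro tendsto_intros tendsto_inverse_square_integral)
  then have l: "((%b. sqrt (K\<^sup>2 * (\<integral>(y::real). 1 / (b\<^sup>2 + y\<^sup>2) \<partial>lborel) * B)) \<longlongrightarrow> 0) at_top" by simp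
  show ?thesis
  proof (rule Lim_null_comparison[OF _ l])
   show "\<forall>\<^sub>F b in at_top. cmod (I b) \<le> sqrt (K\<^sup>2 * (\<integral>(y::real). 1 / (b\<^sup>2 + y\<^sup>2) \<partial>lborel) * B)"
    using eventually_ge_at_top[of T]
   proof eventually_elim
    case (elim b)
    then have b0: "b > 0" using T(1) by simp
    have "(cmod (I b))\<^sup>2 \<le> (\<integral>y. (cmod (\<rho> (Complex b y)))\<^sup>2 \<partial>lborel) * (\<integral>y. (cmod (h (Complex b y)))\<^sup>2 \<partial>lborel)"
     unfolding I_def g_def by (rule integral_Cauchy_Schwarz[OF sqfar[OF elim] B(3)[OF b0]])
    also have "\<dots> \<le> (K\<^sup>2 * (\<integral>(y::real). 1 / (b\<^sup>2 + y\<^sup>2) \<partial>lborel)) * B"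
    proof (intro mult_mono)
     have "(\<integral>y. (cmod (\<rho> (Complex b y)))\<^sup>2 \<partial>lborel) \<le> (\<integral>y. K\<^sup>2 * (1 / (b\<^sup>2 + y\<^sup>2)) \<partial>lborel)"
      using sqfar[OF elim] i_far[OF elim] far[OF elim] by (intro integral_mono) (auto simp: sq_int_def)
     then show "(\<integral>y. (cmod (\<rho> (Complex b y)))\<^sup>2 \<partial>lborel) \<le> K\<^sup>2 * (\<integral>(y::real). 1 / (b\<^sup>2 + y\<^sup>2) \<partial>lborel)"
      by (simp only: integral_mult_right_zero)
    qed (use B b0 in \<open>auto intro!: mult_nonneg_nonneg integral_nonneg_AE\<close>)
    finally show ?case by (intro real_le_rsqrt) simp
   qed
  qed
 qed
 moreover have "\<forall>\<^sub>F b in at_top. I b = I x + 2 * pi * (\<Sum>s\<in>S'. residue g s)" if "0 < x" "x \<le> a" for x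
  using eventually_ge_at_top[of "max T (a + 1)"]
 proof eventually_elim
  case (elim b)
  then have "I b - I x = 2 * pi * (\<Sum>s\<in>S'. residue g s)" by (intro shift that) auto
  then show ?case by (simp add: diff_eq_eq add.commute)
 qed
 \<comment> \<open>Letting b tend to infinity in the shift formula shows that \<open>I\<close> is
   constant on (0, a]; the minus sign is that of a contour closed clockwise.\<close>
 ultimately have I: "I x = - 2 * pi * (\<Sum>s\<in>S'. residue g s)" if "0 < x" "x \<le> a" for x
 proof -
  assume a1: "(I \<longlongrightarrow> 0) at_top" and a2: "!!x. 0 < x ==> x \<le> a ==> \<forall>\<^sub>F b in at_top. I b = I x + 2 * pi * (\<Sum>s\<in>S'. residue g s)"
  have "((%_. I x + 2 * pi * (\<Sum>s\<in>S'. residue g s)) \<longlongrightarrow> 0) (at_top :: real filter)"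
   using a1 a2[OF that] by (rule Lim_transform_eventually)
  then have "I x + 2 * pi * (\<Sum>s\<in>S'. residue g s) = 0" by (simp add: tendsto_const_iff)
  then show ?thesis by (simp add: eq_neg_iff_add_eq_0)
 qed
 have sqH: "sq_int H" using hp by (simp add: hardy_pair_def)
 \<comment> \<open>The limit at the axis is split: \<open>\<rho>\<close> moves to the axis by
   dominated convergence against the fixed \<open>H\<close>, and the error of replacing
   \<open>h\<close> by \<open>H\<close> vanishes by Cauchy-Schwarz, the L2 norms of
   \<open>\<rho>\<close> being uniformly bounded.\<close>
 have "(I \<longlongrightarrow> (\<integral>y. \<rho> (Complex 0 y) * H y \<partial>lborel)) (at_right 0)"
 proof -
  have near: "\<forall>\<^sub>F x in at_right 0. x \<in> {0<..<a}"
   using a(1) by (rule eventually_at_right_real)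
  have l1: "((%x. \<integral>y. \<rho> (Complex x y) * H y \<partial>lborel) \<longlongrightarrow> (\<integral>y. \<rho> (Complex 0 y) * H y \<partial>lborel)) (at_right 0)"
  proof (rule tendsto_at_right_sequentially[where b = a])
   fix X :: "nat => real" assume X: "!!n. 0 < X n" "!!n. X n < a" "X \<longlonglongrightarrow> 0"
   define w where "w = (%y::real. complex_of_real (sqrt (K1 / (1 + y\<^sup>2))))"
   have "sq_int w"
   proof (rule sq_int_decay)
    show "w \<in> borel_measurable borel" unfolding w_def by measurable
    show "(cmod (w y))\<^sup>2 \<le> K1 / (1 + y\<^sup>2)" for y
     using K1(1) by (simp add: w_def add_nonneg_nonneg)
   qed
   then have iw: "integrable lborel (%y. cmod (w y) * cmod (H y))"
    using sqH by (rule sq_int_mult_integrable)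
   show "(%n. \<integral>y. \<rho> (Complex (X n) y) * H y \<partial>lborel) \<longlonglongrightarrow> (\<integral>y. \<rho> (Complex 0 y) * H y \<partial>lborel)"
   proof (rule integral_dominated_convergence[OF _ _ iw])
    show "(%y. \<rho> (Complex 0 y) * H y) \<in> borel_measurable lborel"
     "!!n. (%y. \<rho> (Complex (X n) y) * H y) \<in> borel_measurable lborel"
     using sq_int_measurable[OF sqH] sq_int_measurable[OF sqA] X a by (auto simp: less_imp_le)
    show "AE y in lborel. (%n. \<rho> (Complex (X n) y) * H y) \<longlonglongrightarrow> \<rho> (Complex 0 y) * H y"
    proof (intro AE_I2 tendsto_intros)
     fix y
     have "(%n. Complex (X n) y) \<longlonglongrightarrow> Complex 0 y" by (intro tendsto_intros X(3))
     then show "(%n. \<rho> (Complex (X n) y)) \<longlonglongrightarrow> \<rho> (Complex 0 y)"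
      by (rule continuous_on_tendsto_compose[OF continuous_on_subset[OF cont\<rho> AS]])
       (use X a in \<open>auto simp: A_def less_imp_le intro!: always_eventually\<close>)
    qed
    show "AE y in lborel. cmod (\<rho> (Complex (X n) y) * H y) \<le> cmod (w y) * cmod (H y)" for n
    proof (rule AE_I2)
     fix y
     have "(cmod (\<rho> (Complex (X n) y)))\<^sup>2 \<le> K1 / (1 + y\<^sup>2)"
      using K1(2)[of "Complex (X n) y"] X by (simp add: A_def less_imp_le)
     then have "cmod (\<rho> (Complex (X n) y)) \<le> sqrt (K1 / (1 + y\<^sup>2))" by (rule real_le_rsqrt)
     then show "cmod (\<rho> (Complex (X n) y) * H y) \<le> cmod (w y) * cmod (H y)"
      using K1(1) unfolding norm_mult w_def norm_of_real
      by (intro mult_right_mono) (auto intro: order_trans)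
    qed
   qed
  qed (use a in auto)
  define Q where "Q = (\<integral>(y::real). K1 * (1 / (1 + y\<^sup>2)) \<partial>lborel)"
  have iQ: "integrable lborel (%y::real. K1 * (1 / (1 + y\<^sup>2)))"
   by (intro integrable_mult_right integrable_inverse_1_plus_square')
  have Q: "Q \<ge> 0" unfolding Q_def by (intro integral_nonneg_AE AE_I2) (use K1(1) in \<open>auto simp: add_nonneg_nonneg\<close>)
  have l2: "((%x. I x - (\<integral>y. \<rho> (Complex x y) * H y \<partial>lborel)) \<longlongrightarrow> 0) (at_right 0)"
  proof (rule Lim_null_comparison)
   have "((%x. sqrt (Q * (\<integral>y. (cmod (h (Complex x y) - H y))\<^sup>2 \<partial>lborel))) \<longlongrightarrow> sqrt (Q * 0)) (at_right 0)"
    using hp by (intro tendsto_intros) (simp add: hardy_pair_def)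
   then show "((%x. sqrt (Q * (\<integral>y. (cmod (h (Complex x y) - H y))\<^sup>2 \<partial>lborel))) \<longlongrightarrow> 0) (at_right 0)" by simp
   show "\<forall>\<^sub>F x in at_right 0. cmod (I x - (\<integral>y. \<rho> (Complex x y) * H y \<partial>lborel)) \<le> sqrt (Q * (\<integral>y. (cmod (h (Complex x y) - H y))\<^sup>2 \<partial>lborel))"
    using near
   proof eventually_elim
    case (elim x)
    then have x: "0 < x" "x < a" by auto
    have sx: "sq_int (%y. \<rho> (Complex x y))" and hx: "sq_int (%y. h (Complex x y))"
     using sqA B(3) x by auto
    have "I x - (\<integral>y. \<rho> (Complex x y) * H y \<partial>lborel) = (\<integral>y. \<rho> (Complex x y) * (h (Complex x y) - H y) \<partial>lborel)"
     unfolding I_def g_def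
     using sq_int_mult_integrable(1)[OF sx hx] sq_int_mult_integrable(1)[OF sx sqH]
     by (simp add: algebra_simps)
    also have "(cmod \<dots>)\<^sup>2 \<le> (\<integral>y. (cmod (\<rho> (Complex x y)))\<^sup>2 \<partial>lborel) * (\<integral>y. (cmod (h (Complex x y) - H y))\<^sup>2 \<partial>lborel)"
     by (rule integral_Cauchy_Schwarz[OF sx sq_int_diff[OF hx sqH]])
    also have "\<dots> \<le> Q * (\<integral>y. (cmod (h (Complex x y) - H y))\<^sup>2 \<partial>lborel)"
    proof (rule mult_right_mono)
     show "(\<integral>y. (cmod (\<rho> (Complex x y)))\<^sup>2 \<partial>lborel) \<le> Q" unfolding Q_def
      using sx iQ K1(2)[of "Complex x _"] x by (intro integral_mono) (auto simp: sq_int_def A_def)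
    qed (auto intro!: integral_nonneg_AE)
    finally show ?case by (rule real_le_rsqrt)
   qed
  qed
  show ?thesis using tendsto_add[OF l2 l1] by simp
 qed
 moreover have "\<forall>\<^sub>F x in at_right 0. I x = - 2 * pi * (\<Sum>s\<in>S'. residue g s)"
  using eventually_at_right_real[OF a(1)] by (rule eventually_mono) (rule I, auto)
 ultimately have "((%x::real. - 2 * pi * (\<Sum>s\<in>S'. residue g s)) \<longlongrightarrow> (\<integral>y. \<rho> (Complex 0 y) * H y \<partial>lborel)) (at_right 0)"
  by (rule Lim_transform_eventually)
 then have "(\<integral>y. \<rho> (Complex 0 y) * H y \<partial>lborel) = - 2 * pi * (\<Sum>s\<in>S'. residue g s)"
  by (simp add: tendsto_const_iff trivial_limit_at_right_real)
 then show "(\<integral>y. \<rho> (Complex 0 y) * H y \<partial>lborel) = - 2 * pi * (\<Sum>s | s \<in> S \<and> Re s > 0. residue (%z. \<rho> z * h z) s)"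
  by (simp add: g_def S'_def)
qed

section \<open>Inner product, adjoint, inverse and spectrum of complex matrices\<close>

unbundle no vec_syntax
unbundle no fps_syntax

lemma mult_mat_index_sum:
 assumes "A \<in> carrier_mat n k" "B \<in> carrier_mat k m" "i < n" "j < m"
 shows "(A * B) $$ (i, j) = (\<Sum>l<k. A $$ (i, l) * B $$ (l, j))"
 using assms by (simp add: scalar_prod_def atLeast0LessThan)

lemma mult_mat_vec_index_sum:
 assumes "A \<in> carrier_mat n k" "x \<in> carrier_vec k" "i < n"
 shows "(A *\<^sub>v x) $ i = (\<Sum>l<k. A $$ (i, l) * x $ l)"
 using assms by (simp add: scalar_prod_def atLeast0LessThan)

lemma cscalar_prod_sum:
 assumes "y \<in> carrier_vec n"
 shows "x \<bullet>c (y :: complex vec) = (\<Sum>i<n. x $ i * cnj (y $ i))"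
 using assms by (simp add: scalar_prod_def atLeast0LessThan)

lemma cscalar_prod_commute:
 assumes "x \<in> carrier_vec n" "y \<in> carrier_vec n"
 shows "y \<bullet>c x = cnj (x \<bullet>c (y :: complex vec))"
 using assms by (simp add: cscalar_prod_sum mult.commute)

lemma cscalar_prod_add_left:
 assumes "x \<in> carrier_vec n" "y \<in> carrier_vec n" "z \<in> carrier_vec n"
 shows "(x + y) \<bullet>c (z :: complex vec) = x \<bullet>c z + y \<bullet>c z"
 using assms by (simp add: add_scalar_prod_distrib[of _ n])

lemma cscalar_prod_add_right:
 assumes "x \<in> carrier_vec n" "y \<in> carrier_vec n" "z \<in> carrier_vec n"
 shows "x \<bullet>c (y + z :: complex vec) = x \<bullet>c y + x \<bullet>c z"
 using assms by (simp add: cscalar_prod_sum[of _ n] algebra_simps sum.distrib)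

lemma cscalar_prod_minus_left:
 assumes "x \<in> carrier_vec n" "y \<in> carrier_vec n" "z \<in> carrier_vec n"
 shows "(x - y) \<bullet>c (z :: complex vec) = x \<bullet>c z - y \<bullet>c z"
 using assms by (simp add: minus_scalar_prod_distrib[of _ n])

lemma cscalar_prod_minus_right:
 assumes "x \<in> carrier_vec n" "y \<in> carrier_vec n" "z \<in> carrier_vec n"
 shows "x \<bullet>c (y - z :: complex vec) = x \<bullet>c y - x \<bullet>c z"
 using assms by (simp add: cscalar_prod_sum[of _ n] algebra_simps sum_subtractf)

lemma cscalar_prod_smult_left:
 assumes "x \<in> carrier_vec n" "y \<in> carrier_vec n"
 shows "(c \<cdot>\<^sub>v x) \<bullet>c (y :: complex vec) = c * (x \<bullet>c y)"
 using assms by simp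

lemma cscalar_prod_smult_right:
 assumes "x \<in> carrier_vec n" "y \<in> carrier_vec n"
 shows "x \<bullet>c (c \<cdot>\<^sub>v y :: complex vec) = cnj c * (x \<bullet>c y)"
 using assms by (simp add: cscalar_prod_sum[of _ n] sum_distrib_left mult.left_commute)

lemma cscalar_prod_self:
 "(x :: complex vec) \<bullet>c x = complex_of_real (vnorm2 x)"
proof -
 have "x \<bullet>c x = (\<Sum>i<dim_vec x. complex_of_real ((cmod (x $ i))\<^sup>2))"
  unfolding cscalar_prod_sum[OF carrier_vec_dim_vec] complex_norm_square ..
 then show ?thesis by (simp only: vnorm2_def of_real_sum)
qed

lemma vnorm2_nonneg: "0 \<le> vnorm2 x"
 by (simp add: vnorm2_def sum_nonneg)

lemma vnorm2_eq_0_iff: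
 assumes "x \<in> carrier_vec n" shows "vnorm2 x = 0 \<longleftrightarrow> x = 0\<^sub>v n"
 using assms by (auto simp: vnorm2_def sum_nonneg_eq_0_iff intro!: eq_vecI)

lemma vec_eqI_cscalar:
 assumes x: "x \<in> carrier_vec n" and y: "y \<in> carrier_vec n"
  and eq: "!!z. z \<in> carrier_vec n ==> x \<bullet>c z = y \<bullet>c (z :: complex vec)"
 shows "x = y"
proof -
 have "(x - y) \<bullet>c (x - y) = 0"
  using eq[of "x - y"] x y by (simp add: cscalar_prod_minus_left[of _ n])
 then have "x - y = 0\<^sub>v n" using x y by (simp add: conjugate_square_eq_0_vec[of _ n])
 have "x $ i = y $ i" if "i < n" for i
  using arg_cong[OF \<open>x - y = 0\<^sub>v n\<close>, of "%u. vec_index u i"] that x y by simp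
 then show ?thesis using x y by (intro eq_vecI) auto
qed

lemma mat_adjoint_dim [simp]:
 "dim_row (mat_adjoint A) = dim_col A" "dim_col (mat_adjoint A) = dim_row A"
 by (auto simp: mat_adjoint_def)

lemma mat_adjoint_carrier [simp]:
 "A \<in> carrier_mat n m ==> mat_adjoint A \<in> carrier_mat m n"
 by (rule carrier_matI) auto

lemma mat_adjoint_index [simp]:
 "i < dim_col A ==> j < dim_row A ==> mat_adjoint (A :: complex mat) $$ (i, j) = cnj (A $$ (j, i))"
 by (simp add: mat_adjoint_def mat_of_rows_index)

lemma mat_adjoint_adjoint [simp]: "mat_adjoint (mat_adjoint (A :: complex mat)) = A"
 by (rule eq_matI) auto

lemma mat_adjoint_mult:
 assumes "A \<in> carrier_mat n k" "B \<in> carrier_mat k m"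
 shows "mat_adjoint (A * B) = mat_adjoint B * mat_adjoint (A :: complex mat)"
 by (rule eq_matI)
  (use assms in \<open>auto simp: scalar_prod_def mult.commute intro!: sum.cong\<close>)

lemma mat_adjoint_uminus: "mat_adjoint (- A) = - mat_adjoint (A :: complex mat)"
 by (rule eq_matI) auto

lemma mat_adjoint_add:
 assumes "A \<in> carrier_mat n k" "B \<in> carrier_mat n k"
 shows "mat_adjoint (A + B) = mat_adjoint A + mat_adjoint (B :: complex mat)"
 by (rule eq_matI) (use assms in auto)

lemma mat_adjoint_minus:
 assumes "A \<in> carrier_mat n k" "B \<in> carrier_mat n k"
 shows "mat_adjoint (A - B) = mat_adjoint A - mat_adjoint (B :: complex mat)"
 by (rule eq_matI) (use assms in auto)

lemma mat_adjoint_smult: "mat_adjoint (c \<cdot>\<^sub>m A) = cnj c \<cdot>\<^sub>m mat_adjoint (A :: complex mat)"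
 by (rule eq_matI) auto

lemma mat_adjoint_one [simp]: "mat_adjoint (1\<^sub>m n :: complex mat) = 1\<^sub>m n"
 by (rule eq_matI) auto

lemma mat_adjoint_zero [simp]: "mat_adjoint (0\<^sub>m n m :: complex mat) = 0\<^sub>m m n"
 by (rule eq_matI) auto

lemma mat_adjoint_cscalar:
 assumes A: "A \<in> carrier_mat n m" and x: "x \<in> carrier_vec m" and y: "y \<in> carrier_vec n"
 shows "(A *\<^sub>v x) \<bullet>c y = x \<bullet>c (mat_adjoint A *\<^sub>v (y :: complex vec))"
proof -
 have "(A *\<^sub>v x) \<bullet>c y = (\<Sum>i<n. \<Sum>l<m. A $$ (i, l) * x $ l * cnj (y $ i))"
  using assms by (simp add: cscalar_prod_sum[of _ n] mult_mat_vec_index_sum[of _ n m] sum_distrib_right del: index_mult_mat_vec)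
 also have "\<dots> = (\<Sum>l<m. \<Sum>i<n. A $$ (i, l) * x $ l * cnj (y $ i))" by (rule sum.swap)
 also have "\<dots> = x \<bullet>c (mat_adjoint A *\<^sub>v y)"
 proof -
  have "mat_adjoint A *\<^sub>v y \<in> carrier_vec m"
   using mult_mat_vec_carrier[OF mat_adjoint_carrier[OF A] y] .
  then show ?thesis using A y
   by (subst cscalar_prod_sum) (auto simp: mult_mat_vec_index_sum[of _ m n] sum_distrib_left algebra_simps simp del: index_mult_mat_vec intro!: sum.cong)
 qed
 finally show ?thesis .
qed

lemma minv_props:
 assumes A: "A \<in> carrier_mat n n" and d: "det A \<noteq> 0"
 shows "minv A \<in> carrier_mat n n" "A * minv A = 1\<^sub>m n" "minv A * A = 1\<^sub>m n"
proof -
 have "mat_inverse A \<noteq> None"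
  using mat_inverse(1)[OF A, of "()"] det_non_zero_imp_unit[OF A d, of "()"] by blast
 then obtain B where "mat_inverse A = Some B" by blast
 then show "minv A \<in> carrier_mat n n" "A * minv A = 1\<^sub>m n" "minv A * A = 1\<^sub>m n"
  using mat_inverse(2)[OF A] by auto
qed

lemma det_nonzero_of_right_inverse:
 assumes "A \<in> carrier_mat n n" "B \<in> carrier_mat n n" "A * B = 1\<^sub>m n"
 shows "det A \<noteq> (0 :: complex)"
 using det_mult[OF assms(1,2)] assms(3) by auto

lemma minv_unique:
 assumes A: "A \<in> carrier_mat n n" and B: "B \<in> carrier_mat n n" and AB: "A * B = 1\<^sub>m n"
 shows "minv A = B"
proof -
 note i = minv_props[OF A det_nonzero_of_right_inverse[OF A B AB]]
 have "minv A = minv A * (A * B)" using i AB by simp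
 also have "\<dots> = minv A * A * B" using A B i(1) by simp
 also have "\<dots> = B" unfolding i(3) using B by simp
 finally show ?thesis .
qed

lemma invertible_mat_det:
 assumes "invertible_mat (A :: complex mat)" "A \<in> carrier_mat n n"
 shows "det A \<noteq> 0"
proof -
 obtain B where B: "A * B = 1\<^sub>m n" "B * A = 1\<^sub>m (dim_row B)"
  using assms unfolding invertible_mat_def inverts_mat_def by auto
 have "dim_col B = n" using arg_cong[OF B(1), of dim_col] by simp
 moreover have "dim_row B = n" using arg_cong[OF B(2), of dim_col] assms by simp
 ultimately show ?thesis using det_nonzero_of_right_inverse[OF assms(2) _ B(1)] by auto
qed

lemma spectrum_iff_det:
 assumes A: "A \<in> carrier_mat n n"
 shows "z \<in> spectrum A \<longleftrightarrow> det (z \<cdot>\<^sub>m 1\<^sub>m n - A) = (0 :: complex)"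
proof -
 have "(z \<cdot>\<^sub>m 1\<^sub>m n - A) *\<^sub>v v = 0\<^sub>v n \<longleftrightarrow> A *\<^sub>v v = z \<cdot>\<^sub>v v" if v: "v \<in> carrier_vec n" for v
 proof -
  have "(z \<cdot>\<^sub>m 1\<^sub>m n - A) *\<^sub>v v = z \<cdot>\<^sub>v v - A *\<^sub>v v"
   using A v by (subst minus_mult_distrib_mat_vec[of _ n n]) (auto intro!: eq_vecI)
  also have "\<dots> = 0\<^sub>v n \<longleftrightarrow> A *\<^sub>v v = z \<cdot>\<^sub>v v"
  proof
   assume *: "z \<cdot>\<^sub>v v - A *\<^sub>v v = 0\<^sub>v n"
   show "A *\<^sub>v v = z \<cdot>\<^sub>v v"
   proof (rule eq_vecI)
    fix i assume "i < dim_vec (z \<cdot>\<^sub>v v)"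
    then show "(A *\<^sub>v v) $ i = (z \<cdot>\<^sub>v v) $ i"
     using arg_cong[OF *, of "%u. vec_index u i"] A v by simp
   qed (use A v in auto)
  qed (use A v in auto)
  finally show ?thesis .
 qed
 moreover have "z \<cdot>\<^sub>m 1\<^sub>m n - A \<in> carrier_mat n n" using A by auto
 ultimately have "det (z \<cdot>\<^sub>m 1\<^sub>m n - A) = 0 \<longleftrightarrow> (\<exists>v. v \<in> carrier_vec n \<and> v \<noteq> 0\<^sub>v n \<and> A *\<^sub>v v = z \<cdot>\<^sub>v v)"
  using det_0_iff_vec_prod_zero_field[of "z \<cdot>\<^sub>m 1\<^sub>m n - A" n] by blast
 then show ?thesis
  using A by (simp add: spectrum_def eigenvalue_def eigenvector_def)
qed

lemma resolvent_props:
 assumes A: "A \<in> carrier_mat n n" and z: "z \<notin> spectrum A"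
 shows "resolvent A z \<in> carrier_mat n n" "(z \<cdot>\<^sub>m 1\<^sub>m n - A) * resolvent A z = 1\<^sub>m n"
  "resolvent A z * (z \<cdot>\<^sub>m 1\<^sub>m n - A) = 1\<^sub>m n"
proof -
 have "z \<cdot>\<^sub>m 1\<^sub>m n - A \<in> carrier_mat n n" using A by auto
 moreover have "det (z \<cdot>\<^sub>m 1\<^sub>m n - A) \<noteq> 0" using z spectrum_iff_det[OF A] by simp
 moreover have "resolvent A z = minv (z \<cdot>\<^sub>m 1\<^sub>m n - A)" using A by (simp add: resolvent_def)
 ultimately show "resolvent A z \<in> carrier_mat n n" "(z \<cdot>\<^sub>m 1\<^sub>m n - A) * resolvent A z = 1\<^sub>m n"
  "resolvent A z * (z \<cdot>\<^sub>m 1\<^sub>m n - A) = 1\<^sub>m n"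
  using minv_props by metis+
qed

lemma resolvent_mult:
 assumes A: "A \<in> carrier_mat n n" and z: "z \<notin> spectrum A"
 shows "A * resolvent A z = z \<cdot>\<^sub>m resolvent A z - 1\<^sub>m n" "resolvent A z * A = z \<cdot>\<^sub>m resolvent A z - 1\<^sub>m n"
proof -
 note R = resolvent_props[OF A z]
 have "z \<cdot>\<^sub>m resolvent A z - A * resolvent A z = 1\<^sub>m n"
  using R(2) minus_mult_distrib_mat[of "z \<cdot>\<^sub>m 1\<^sub>m n" n n A "resolvent A z" n] A R(1)
  by (simp add: mult_smult_assoc_mat[of _ n n _ n])
 then show "A * resolvent A z = z \<cdot>\<^sub>m resolvent A z - 1\<^sub>m n"
  using A R(1) by (auto intro!: eq_matI simp flip: \<open>z \<cdot>\<^sub>m resolvent A z - A * resolvent A z = 1\<^sub>m n\<close>)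
 have "z \<cdot>\<^sub>m resolvent A z - resolvent A z * A = 1\<^sub>m n"
  using R(3) mult_minus_distrib_mat[of "resolvent A z" n n "z \<cdot>\<^sub>m 1\<^sub>m n" n A] A R(1)
  by (simp add: mult_smult_distrib[of _ n n _ n])
 then show "resolvent A z * A = z \<cdot>\<^sub>m resolvent A z - 1\<^sub>m n"
  using A R(1) by (auto intro!: eq_matI simp flip: \<open>z \<cdot>\<^sub>m resolvent A z - resolvent A z * A = 1\<^sub>m n\<close>)
qed

lemma resolvent_unique:
 assumes A: "A \<in> carrier_mat n n" and B: "B \<in> carrier_mat n n"
  and eq: "(z \<cdot>\<^sub>m 1\<^sub>m n - A) * B = 1\<^sub>m n"
 shows "resolvent A z = B" "z \<notin> spectrum A"
proof -
 have c: "z \<cdot>\<^sub>m 1\<^sub>m n - A \<in> carrier_mat n n" using A by auto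
 show "resolvent A z = B" using minv_unique[OF c B eq] A by (simp add: resolvent_def)
 show "z \<notin> spectrum A" using det_nonzero_of_right_inverse[OF c B eq] spectrum_iff_det[OF A] by simp
qed

lemma resolvent_uminus:
 assumes A: "A \<in> carrier_mat n n" and z: "- z \<notin> spectrum A"
 shows "resolvent (- A) z = - resolvent A (- z)" "z \<notin> spectrum (- A)"
proof -
 note R = resolvent_props[OF A z]
 have "(z \<cdot>\<^sub>m 1\<^sub>m n - (- A)) = - ((- z) \<cdot>\<^sub>m 1\<^sub>m n - A)"
  by (rule eq_matI) (use A in auto)
 then have "(z \<cdot>\<^sub>m 1\<^sub>m n - (- A)) * (- resolvent A (- z)) = 1\<^sub>m n"
  using R A by simp
 then show "resolvent (- A) z = - resolvent A (- z)" "z \<notin> spectrum (- A)"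
  using resolvent_unique[of "- A" n "- resolvent A (- z)" z] A R(1) by auto
qed

lemma resolvent_adjoint:
 assumes A: "A \<in> carrier_mat n n" and z: "cnj z \<notin> spectrum A"
 shows "resolvent (mat_adjoint A) z = mat_adjoint (resolvent A (cnj z))" "z \<notin> spectrum (mat_adjoint A)"
proof -
 note R = resolvent_props[OF A z]
 have "mat_adjoint (resolvent A (cnj z) * (cnj z \<cdot>\<^sub>m 1\<^sub>m n - A)) = 1\<^sub>m n" unfolding R(3) by simp
 moreover have "mat_adjoint (resolvent A (cnj z) * (cnj z \<cdot>\<^sub>m 1\<^sub>m n - A)) =
  mat_adjoint (cnj z \<cdot>\<^sub>m 1\<^sub>m n - A) * mat_adjoint (resolvent A (cnj z))"
  using A R(1) by (intro mat_adjoint_mult) auto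
 moreover have "mat_adjoint (cnj z \<cdot>\<^sub>m 1\<^sub>m n - A) = z \<cdot>\<^sub>m 1\<^sub>m n - mat_adjoint A"
  using A by (subst mat_adjoint_minus[of _ n n]) (auto simp: mat_adjoint_smult)
 ultimately have "(z \<cdot>\<^sub>m 1\<^sub>m n - mat_adjoint A) * mat_adjoint (resolvent A (cnj z)) = 1\<^sub>m n" by simp
 then show "resolvent (mat_adjoint A) z = mat_adjoint (resolvent A (cnj z))" "z \<notin> spectrum (mat_adjoint A)"
  using resolvent_unique[of "mat_adjoint A" n "mat_adjoint (resolvent A (cnj z))" z] A R(1) by auto
qed

lemma spectrum_uminus_iff:
 assumes A: "A \<in> carrier_mat n n" shows "z \<in> spectrum (- A) \<longleftrightarrow> - z \<in> spectrum (A :: complex mat)"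
 using resolvent_uminus(2)[OF A, of z] resolvent_uminus(2)[of "- A" n "- z"] A by auto

lemma spectrum_adjoint_iff:
 assumes A: "A \<in> carrier_mat n n" shows "z \<in> spectrum (mat_adjoint A) \<longleftrightarrow> cnj z \<in> spectrum (A :: complex mat)"
 using resolvent_adjoint(2)[OF A, of z] resolvent_adjoint(2)[of "mat_adjoint A" n "cnj z"] A by auto

lemma finite_spectrum: "A \<in> carrier_mat n n ==> finite (spectrum (A :: complex mat))"
 by (rule card_finite_spectrum(1))

lemma smult_smult_mat': "a \<cdot>\<^sub>m (b \<cdot>\<^sub>m A) = (a * b) \<cdot>\<^sub>m (A :: complex mat)"
 by (rule eq_matI) (auto simp: mult.assoc)

lemma one_smult_mat: "1 \<cdot>\<^sub>m A = (A :: complex mat)"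
 by (rule eq_matI) auto

section \<open>Resolvent entries: holomorphy and decay\<close>

lemma holomorphic_det:
 assumes M: "!!z. M z \<in> carrier_mat n n"
  and h: "!!i j. i < n ==> j < n ==> (%z. M z $$ (i, j)) holomorphic_on S"
 shows "(%z. det (M z)) holomorphic_on S"
proof -
 have "(%z. \<Sum>p | p permutes {0..<n}. signof p * (\<Prod>i = 0..<n. M z $$ (i, p i))) holomorphic_on S"
  by (intro holomorphic_on_sum holomorphic_on_mult holomorphic_on_prod holomorphic_on_const h)
   (auto dest: permutes_in_image)
 then show ?thesis unfolding det_def'[OF M] .
qed

text \<open>Cramer's rule: every entry is a cofactor of zI - A divided by the determinant, a
  quotient of entire functions whose denominator vanishes exactly on the spectrum.\<close>

lemma holomorphic_resolvent:
 assumes A: "A \<in> carrier_mat n n" and i: "i < n" and j: "j < n"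
 shows "(%z. resolvent A z $$ (i, j)) holomorphic_on - spectrum A"
proof -
 define M where "M = (%z. z \<cdot>\<^sub>m 1\<^sub>m n - A)"
 have M: "M z \<in> carrier_mat n n" for z using A by (auto simp: M_def)
 have hM: "(%z. M z $$ (i, j)) holomorphic_on S" if "i < n" "j < n" for i j S
 proof -
  have "(%z. z * (if i = j then 1 else 0) - A $$ (i, j)) holomorphic_on S"
   by (intro holomorphic_intros)
  moreover have "(%z. M z $$ (i, j)) = (%z. z * (if i = j then 1 else 0) - A $$ (i, j))"
   using that A by (auto simp: M_def fun_eq_iff)
  ultimately show ?thesis by (simp only:)
 qed
 have hd: "(%z. det (mat_delete (M z) j i)) holomorphic_on S" for S
 proof (rule holomorphic_det[where n = "n - 1"])
  show "mat_delete (M z) j i \<in> carrier_mat (n - 1) (n - 1)" for z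
   using M by (rule mat_delete_carrier)
  show "(%z. mat_delete (M z) j i $$ (a, b)) holomorphic_on S" if "a < n - 1" "b < n - 1" for a b
  proof -
   have "mat_delete (M z) j i $$ (a, b) = M z $$ (if a < j then a else Suc a, if b < i then b else Suc b)" for z
    using carrier_matD[OF M[of z]] that by (simp add: mat_delete_def)
   then have "(%z. mat_delete (M z) j i $$ (a, b)) = (%z. M z $$ (if a < j then a else Suc a, if b < i then b else Suc b))"
    by (rule ext)
   then show ?thesis by (simp only:) (rule hM, use that in auto)
  qed
 qed
 have "resolvent A z $$ (i, j) = cofactor (M z) j i / det (M z)" if z: "z \<in> - spectrum A" for z
 proof -
  have d: "det (M z) \<noteq> 0" using z spectrum_iff_det[OF A] by (simp add: M_def)
  note aj = adj_mat[OF M[of z]]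
  have "M z * ((1 / det (M z)) \<cdot>\<^sub>m adj_mat (M z)) = 1\<^sub>m n"
   using aj M[of z] d by (simp add: mult_smult_distrib[of _ n n _ n] smult_smult_mat' one_smult_mat)
  then have "resolvent A z = (1 / det (M z)) \<cdot>\<^sub>m adj_mat (M z)"
   using resolvent_unique(1)[OF A, of "(1 / det (M z)) \<cdot>\<^sub>m adj_mat (M z)" z] aj(1) by (simp add: M_def)
  then show ?thesis using i j carrier_matD[OF M[of z]] by (simp add: adj_mat_def)
 qed
 moreover have "(%z. cofactor (M z) j i / det (M z)) holomorphic_on - spectrum A"
  unfolding cofactor_def using spectrum_iff_det[OF A]
  by (intro holomorphic_intros hd holomorphic_det[OF M hM]) (auto simp: M_def)
 ultimately show ?thesis by (subst holomorphic_cong[OF refl]) auto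
qed

definition decays :: "(complex => complex) => bool"
 where "decays \<rho> \<longleftrightarrow> (\<exists>K T. \<forall>z. T \<le> cmod z \<longrightarrow> cmod (\<rho> z) \<le> K / cmod z)"

lemma decays_add:
 assumes "decays f" "decays g" shows "decays (%z. f z + g z)"
proof -
 obtain K T where 1: "!!z. T \<le> cmod z ==> cmod (f z) \<le> K / cmod z" using assms(1) unfolding decays_def by blast
 obtain K' T' where 2: "!!z. T' \<le> cmod z ==> cmod (g z) \<le> K' / cmod z" using assms(2) unfolding decays_def by blast
 have "cmod (f z + g z) \<le> (K + K') / cmod z" if "max T T' \<le> cmod z" for z
  using 1[of z] 2[of z] that norm_triangle_ineq[of "f z" "g z"] by (simp add: add_divide_distrib)
 then show ?thesis unfolding decays_def by blast
qed

lemma decays_cmult: assumes "decays f" shows "decays (%z. c * f z)"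
proof -
 obtain K T where 1: "!!z. T \<le> cmod z ==> cmod (f z) \<le> K / cmod z" using assms(1) unfolding decays_def by blast
 have "cmod (c * f z) \<le> (cmod c * K) / cmod z" if "T \<le> cmod z" for z
  using mult_left_mono[OF 1[OF that], of "cmod c"] by (simp add: norm_mult)
 then show ?thesis unfolding decays_def by blast
qed

lemma decays_zero: "decays (%z. 0)"
 unfolding decays_def by (rule exI[of _ 0]) auto

lemma decays_sum: "(!!i. i \<in> I ==> decays (f i)) ==> decays (%z. \<Sum>i\<in>I. f i z)"
 by (induction I rule: infinite_finite_induct) (auto intro: decays_add decays_zero)

lemma decays_reflect: "decays f ==> decays (%z. f (- z))"
 unfolding decays_def by (metis norm_minus_cancel)

text \<open>Let N be the sum of the moduli of all entries of the resolvent R. From zR = I + AR one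
  gets |z| N \<le> n + a N, and for |z| \<ge> 2a the last term is absorbed on the left, leaving N
  \<le> 2n / |z|.\<close>

lemma decays_resolvent:
 assumes A: "A \<in> carrier_mat n n" and i: "i < n" and j: "j < n"
 shows "decays (%z. resolvent A z $$ (i, j))"
proof -
 define a where "a = (\<Sum>i<n. \<Sum>k<n. cmod (A $$ (i, k)))"
 have a0: "a \<ge> 0" unfolding a_def by (intro sum_nonneg) auto
 obtain b where b: "b > 0" "!!s. s \<in> spectrum A ==> cmod s \<le> b"
  using finite_imp_bounded[OF finite_spectrum[OF A]] unfolding bounded_pos by blast
 \<comment> \<open>The summand 2a serves the absorption, while b + 1 puts z outside the
   spectrum.\<close>
 have "cmod (resolvent A z $$ (i, j)) \<le> (2 * real n) / cmod z" if z: "2 * a + b + 1 \<le> cmod z" for z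
 proof -
  have zs: "z \<notin> spectrum A" using b(2)[of z] z a0 by auto
  define R where "R = resolvent A z"
  have R: "R \<in> carrier_mat n n" and zR: "A * R = z \<cdot>\<^sub>m R - 1\<^sub>m n"
   using resolvent_props(1)[OF A zs] resolvent_mult(1)[OF A zs] by (auto simp: R_def)
  define N where "N = (\<Sum>i<n. \<Sum>j<n. cmod (R $$ (i, j)))"
  have N0: "N \<ge> 0" unfolding N_def by (intro sum_nonneg) auto
  have rowN: "(\<Sum>j<n. cmod (R $$ (k, j))) \<le> N" if "k < n" for k
   unfolding N_def using that by (intro member_le_sum) (auto intro: sum_nonneg)
  have e: "z * R $$ (i, j) = (if i = j then 1 else 0) + (\<Sum>k<n. A $$ (i, k) * R $$ (k, j))" if "i < n" "j < n" for i j
   using arg_cong[OF zR, of "%M. M $$ (i, j)"] that A R mult_mat_index_sum[OF A R that] by simp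
  have "cmod z * N = (\<Sum>i<n. \<Sum>j<n. cmod (z * R $$ (i, j)))"
   unfolding N_def by (simp add: sum_distrib_left norm_mult)
  also have "\<dots> \<le> (\<Sum>i<n. \<Sum>j<n. (if i = j then 1 else 0) + (\<Sum>k<n. cmod (A $$ (i, k)) * cmod (R $$ (k, j))))"
  proof (intro sum_mono)
   fix i j assume "i \<in> {..<n}" "j \<in> {..<n}"
   then have "cmod (z * R $$ (i, j)) \<le> cmod (if i = j then 1 else 0) + cmod (\<Sum>k<n. A $$ (i, k) * R $$ (k, j))"
    using e[of i j] by (simp only: lessThan_iff norm_triangle_ineq)
   also have "cmod (\<Sum>k<n. A $$ (i, k) * R $$ (k, j)) \<le> (\<Sum>k<n. cmod (A $$ (i, k)) * cmod (R $$ (k, j)))"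
    by (rule order_trans[OF norm_sum]) (simp add: norm_mult)
   finally show "cmod (z * R $$ (i, j)) \<le> (if i = j then 1 else 0) + (\<Sum>k<n. cmod (A $$ (i, k)) * cmod (R $$ (k, j)))"
    by (auto split: if_splits)
  qed
  also have "\<dots> = real n + (\<Sum>i<n. \<Sum>k<n. cmod (A $$ (i, k)) * (\<Sum>j<n. cmod (R $$ (k, j))))"
  proof -
   have "(\<Sum>j<n. \<Sum>k<n. cmod (A $$ (i, k)) * cmod (R $$ (k, j))) = (\<Sum>k<n. cmod (A $$ (i, k)) * (\<Sum>j<n. cmod (R $$ (k, j))))" for i
    by (subst sum.swap) (simp add: sum_distrib_left)
   moreover have "(\<Sum>i<n. \<Sum>j<n. if i = j then 1 else 0 :: real) = real n" by simp
   ultimately show ?thesis unfolding sum.distrib by (simp only:)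
  qed
  also have "\<dots> \<le> real n + (\<Sum>i<n. \<Sum>k<n. cmod (A $$ (i, k)) * N)"
   by (intro add_left_mono sum_mono mult_left_mono rowN) auto
  also have "\<dots> = real n + a * N" by (simp add: a_def sum_distrib_right)
  finally have "cmod z * N \<le> real n + a * N" .
  moreover have "2 * a * N \<le> cmod z * N" using z b(1) N0 by (intro mult_right_mono) auto
  ultimately have "cmod z * N \<le> 2 * real n" by linarith
  moreover have "cmod (R $$ (i, j)) \<le> N"
   using rowN[OF i] member_le_sum[of j "{..<n}" "%j. cmod (R $$ (i, j))"] j by auto
  moreover have "cmod z > 0" using z a0 b(1) by linarith
  ultimately have "cmod (R $$ (i, j)) * cmod z \<le> 2 * real n"
   using mult_right_mono[of "cmod (R $$ (i, j))" N "cmod z"] by (metis mult.commute norm_ge_zero order_trans)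
  then show ?thesis using \<open>cmod z > 0\<close> by (simp add: R_def pos_le_divide_eq)
 qed
 then show ?thesis unfolding decays_def by blast
qed

section \<open>Vector-valued L2 and Hardy functions\<close>

lemma vnorm2_sum: "v \<in> carrier_vec d ==> vnorm2 v = (\<Sum>i<d. (cmod (v $ i))\<^sup>2)"
 by (simp add: vnorm2_def)

lemma L2_imag_iff:
 "F \<in> L2_imag d \<longleftrightarrow> (\<forall>y. F y \<in> carrier_vec d) \<and> (\<forall>i<d. sq_int (%y. F y $ i))"
proof (cases "\<forall>y. F y \<in> carrier_vec d")
 case True
 have v: "vnorm2 (F y) = (\<Sum>i<d. (cmod (F y $ i))\<^sup>2)" for y using True by (simp add: vnorm2_sum)
 show ?thesis
 proof
  assume *: "F \<in> L2_imag d"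
  have "sq_int (%y. F y $ i)" if i: "i < d" for i
  proof -
   have m [measurable]: "(%y. F y $ i) \<in> borel_measurable borel" using * i by (simp add: L2_imag_def)
   have int: "integrable lborel (%y. vnorm2 (F y))" using * by (simp add: L2_imag_def)
   have "integrable lborel (%y. (cmod (F y $ i))\<^sup>2)"
    by (rule Bochner_Integration.integrable_bound[OF int])
     (use i in \<open>auto simp: v sum_nonneg intro!: AE_I2 member_le_sum\<close>)
   then show ?thesis unfolding sq_int_def by simp
  qed
  then show "(\<forall>y. F y \<in> carrier_vec d) \<and> (\<forall>i<d. sq_int (%y. F y $ i))" using True by simp
 next
  assume *: "(\<forall>y. F y \<in> carrier_vec d) \<and> (\<forall>i<d. sq_int (%y. F y $ i))"
  then have "integrable lborel (%y. \<Sum>i<d. (cmod (F y $ i))\<^sup>2)"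
   by (intro Bochner_Integration.integrable_sum) (auto simp: sq_int_def)
  then show "F \<in> L2_imag d" using * by (simp add: L2_imag_def v sq_int_def)
 qed
qed (auto simp: L2_imag_def)

lemma hardy_pair_add:
 assumes "hardy_pair f F" "hardy_pair g G"
 shows "hardy_pair (%z. f z + g z) (%y. F y + G y)"
proof -
 obtain B where B: "B \<ge> 0" "!!x. x > 0 ==> (\<integral>\<^sup>+ y. ennreal ((cmod (f (Complex x y)))\<^sup>2) \<partial>lborel) \<le> ennreal B"
  "!!x. x > 0 ==> sq_int (%y. f (Complex x y))" using hardy_pair_line[OF assms(1)] by metis
 obtain C where C: "C \<ge> 0" "!!x. x > 0 ==> (\<integral>\<^sup>+ y. ennreal ((cmod (g (Complex x y)))\<^sup>2) \<partial>lborel) \<le> ennreal C"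
  "!!x. x > 0 ==> sq_int (%y. g (Complex x y))" using hardy_pair_line[OF assms(2)] by metis
 have sq: "sq_int F" "sq_int G" using assms by (auto simp: hardy_pair_def)
 have le: "(cmod (a + b))\<^sup>2 \<le> 2 * (cmod a)\<^sup>2 + 2 * (cmod b)\<^sup>2" for a b :: complex
 proof -
  have "(cmod (a + b))\<^sup>2 \<le> (cmod a + cmod b)\<^sup>2" by (intro power_mono norm_triangle_ineq) auto
  then show ?thesis using sum_squares_bound[of "cmod a" "cmod b"] by (simp add: power2_sum)
 qed
 have "(\<integral>\<^sup>+ y. ennreal ((cmod (f (Complex x y) + g (Complex x y)))\<^sup>2) \<partial>lborel) \<le> ennreal (2 * B + 2 * C)" if x: "x > 0" for x
 proof -
  note [measurable] = sq_int_measurable[OF B(3)[OF x]] sq_int_measurable[OF C(3)[OF x]]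
  have "(\<integral>\<^sup>+ y. ennreal ((cmod (f (Complex x y) + g (Complex x y)))\<^sup>2) \<partial>lborel)
   \<le> (\<integral>\<^sup>+ y. ennreal 2 * ennreal ((cmod (f (Complex x y)))\<^sup>2) + ennreal 2 * ennreal ((cmod (g (Complex x y)))\<^sup>2) \<partial>lborel)"
  proof (rule nn_integral_mono)
   fix y
   have "ennreal ((cmod (f (Complex x y) + g (Complex x y)))\<^sup>2) \<le> ennreal (2 * (cmod (f (Complex x y)))\<^sup>2 + 2 * (cmod (g (Complex x y)))\<^sup>2)"
    by (rule ennreal_leI[OF le])
   also have "\<dots> = ennreal 2 * ennreal ((cmod (f (Complex x y)))\<^sup>2) + ennreal 2 * ennreal ((cmod (g (Complex x y)))\<^sup>2)"
    by (subst ennreal_plus) (auto simp: ennreal_mult')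
   finally show "ennreal ((cmod (f (Complex x y) + g (Complex x y)))\<^sup>2) \<le> \<dots>" .
  qed
  also have "\<dots> = ennreal 2 * (\<integral>\<^sup>+ y. ennreal ((cmod (f (Complex x y)))\<^sup>2) \<partial>lborel) + ennreal 2 * (\<integral>\<^sup>+ y. ennreal ((cmod (g (Complex x y)))\<^sup>2) \<partial>lborel)"
   by (subst nn_integral_add) (auto simp: nn_integral_cmult)
  also have "\<dots> \<le> ennreal 2 * ennreal B + ennreal 2 * ennreal C"
   using B(2)[OF x] C(2)[OF x] by (intro add_mono mult_left_mono) auto
  also have "\<dots> = ennreal (2 * B + 2 * C)" using B(1) C(1) by (simp add: ennreal_mult' ennreal_plus)
  finally show ?thesis .
 qed
 moreover have "((%x. \<integral>y. (cmod (f (Complex x y) + g (Complex x y) - (F y + G y)))\<^sup>2 \<partial>lborel) \<longlongrightarrow> 0) (at_right 0)"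
 proof (rule Lim_null_comparison)
  have "((%x. 2 * (\<integral>y. (cmod (f (Complex x y) - F y))\<^sup>2 \<partial>lborel) + 2 * (\<integral>y. (cmod (g (Complex x y) - G y))\<^sup>2 \<partial>lborel)) \<longlongrightarrow> 2 * 0 + 2 * 0) (at_right 0)"
   using assms unfolding hardy_pair_def by (intro tendsto_intros) auto
  then show "((%x. 2 * (\<integral>y. (cmod (f (Complex x y) - F y))\<^sup>2 \<partial>lborel) + 2 * (\<integral>y. (cmod (g (Complex x y) - G y))\<^sup>2 \<partial>lborel)) \<longlongrightarrow> 0) (at_right 0)" by simp
  have "norm (\<integral>y. (cmod (f (Complex x y) + g (Complex x y) - (F y + G y)))\<^sup>2 \<partial>lborel)
   \<le> 2 * (\<integral>y. (cmod (f (Complex x y) - F y))\<^sup>2 \<partial>lborel) + 2 * (\<integral>y. (cmod (g (Complex x y) - G y))\<^sup>2 \<partial>lborel)" if x: "x > 0" for x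
  proof -
   have i: "integrable lborel (%y. (cmod (f (Complex x y) - F y))\<^sup>2)" "integrable lborel (%y. (cmod (g (Complex x y) - G y))\<^sup>2)"
    "integrable lborel (%y. (cmod (f (Complex x y) + g (Complex x y) - (F y + G y)))\<^sup>2)"
    using sq_int_diff[OF B(3)[OF x] sq(1)] sq_int_diff[OF C(3)[OF x] sq(2)]
     sq_int_diff[OF sq_int_add[OF B(3)[OF x] C(3)[OF x]] sq_int_add[OF sq]]
    by (simp_all add: sq_int_def)
   have "(\<integral>y. (cmod (f (Complex x y) + g (Complex x y) - (F y + G y)))\<^sup>2 \<partial>lborel)
    \<le> (\<integral>y. 2 * (cmod (f (Complex x y) - F y))\<^sup>2 + 2 * (cmod (g (Complex x y) - G y))\<^sup>2 \<partial>lborel)"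
   proof (rule integral_mono)
    fix y
    show "(cmod (f (Complex x y) + g (Complex x y) - (F y + G y)))\<^sup>2 \<le> 2 * (cmod (f (Complex x y) - F y))\<^sup>2 + 2 * (cmod (g (Complex x y) - G y))\<^sup>2"
     using le[of "f (Complex x y) - F y" "g (Complex x y) - G y"] by (simp add: algebra_simps)
   qed (use i in auto)
   also have "\<dots> = 2 * (\<integral>y. (cmod (f (Complex x y) - F y))\<^sup>2 \<partial>lborel) + 2 * (\<integral>y. (cmod (g (Complex x y) - G y))\<^sup>2 \<partial>lborel)"
    using i by simp
   finally show ?thesis by (simp add: integral_nonneg_AE)
  qed
  then show "\<forall>\<^sub>F x in at_right 0. norm (\<integral>y. (cmod (f (Complex x y) + g (Complex x y) - (F y + G y)))\<^sup>2 \<partial>lborel)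
   \<le> 2 * (\<integral>y. (cmod (f (Complex x y) - F y))\<^sup>2 \<partial>lborel) + 2 * (\<integral>y. (cmod (g (Complex x y) - G y))\<^sup>2 \<partial>lborel)"
   using eventually_at_right_less[of 0] by (rule eventually_mono[rotated]) 
 qed
 ultimately show ?thesis
  using assms sq_int_add[OF sq] unfolding hardy_pair_def by (auto intro!: holomorphic_on_add)
qed

lemma hardy_pair_cmult:
 assumes "hardy_pair f F"
 shows "hardy_pair (%z. c * f z) (%y. c * F y)"
proof -
 obtain B where B: "B \<ge> 0" "!!x. x > 0 ==> (\<integral>\<^sup>+ y. ennreal ((cmod (f (Complex x y)))\<^sup>2) \<partial>lborel) \<le> ennreal B"
  "!!x. x > 0 ==> sq_int (%y. f (Complex x y))" using hardy_pair_line[OF assms(1)] by metis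
 have "(\<integral>\<^sup>+ y. ennreal ((cmod (c * f (Complex x y)))\<^sup>2) \<partial>lborel) \<le> ennreal ((cmod c)\<^sup>2 * B)" if x: "x > 0" for x
 proof -
  note [measurable] = sq_int_measurable[OF B(3)[OF x]]
  have "(\<integral>\<^sup>+ y. ennreal ((cmod (c * f (Complex x y)))\<^sup>2) \<partial>lborel) = ennreal ((cmod c)\<^sup>2) * (\<integral>\<^sup>+ y. ennreal ((cmod (f (Complex x y)))\<^sup>2) \<partial>lborel)"
   by (subst nn_integral_cmult[symmetric]) (auto simp: norm_mult power_mult_distrib ennreal_mult')
  also have "\<dots> \<le> ennreal ((cmod c)\<^sup>2) * ennreal B" using B(2)[OF x] by (intro mult_left_mono) auto
  finally show ?thesis by (simp add: ennreal_mult')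
 qed
 moreover have "((%x. \<integral>y. (cmod (c * f (Complex x y) - c * F y))\<^sup>2 \<partial>lborel) \<longlongrightarrow> 0) (at_right 0)"
 proof -
  have "((%x. (cmod c)\<^sup>2 * (\<integral>y. (cmod (f (Complex x y) - F y))\<^sup>2 \<partial>lborel)) \<longlongrightarrow> (cmod c)\<^sup>2 * 0) (at_right 0)"
   using assms unfolding hardy_pair_def by (intro tendsto_intros) auto
  then show ?thesis by (simp add: norm_mult power_mult_distrib flip: right_diff_distrib integral_mult_right_zero)
 qed
 ultimately show ?thesis
  using assms sq_int_cmult unfolding hardy_pair_def by (auto intro!: holomorphic_on_mult holomorphic_on_const)
qed

lemma hardy_pair_zero: "hardy_pair (%z. 0) (%y. 0)"
 unfolding hardy_pair_def sq_int_def by auto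

text \<open>Without poles in the closed right half-plane a single function K1/(1 + y^2) dominates
  |\<sigma>|^2 on all lines Re z = x \<ge> 0. It yields the Hardy bound and, by dominated
  convergence, the axis values as boundary function.\<close>

lemma hardy_pair_rational:
 assumes hol: "\<sigma> holomorphic_on UNIV - S" and fin: "finite S" and S: "!!s. s \<in> S ==> Re s < 0" and dec: "decays \<sigma>"
 shows "hardy_pair \<sigma> (%y. \<sigma> (Complex 0 y))"
proof -
 define A where "A = {z::complex. 0 \<le> Re z}"
 have clA: "closed A" unfolding A_def by (rule closed_halfspace_Re_ge)
 have AS: "A \<subseteq> UNIV - S" using S unfolding A_def by force
 have cont: "continuous_on A \<sigma>" using holomorphic_on_imp_continuous_on[OF hol] AS by (rule continuous_on_subset)
 obtain K T where KT: "!!z. T \<le> cmod z ==> cmod (\<sigma> z) \<le> K / cmod z" using dec unfolding decays_def by blast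
 obtain K1 where K1: "K1 \<ge> 0" "!!z. z \<in> A ==> (cmod (\<sigma> z))\<^sup>2 \<le> K1 / (1 + (Im z)\<^sup>2)"
  using decay_bound[OF clA cont KT] by blast
 have K1': "(cmod (\<sigma> (Complex x y)))\<^sup>2 \<le> K1 / (1 + y\<^sup>2)" if "x \<ge> 0" for x y
  using K1(2)[of "Complex x y"] that by (simp add: A_def)
 have meas: "(%y. \<sigma> (Complex x y)) \<in> borel_measurable borel" if "x \<ge> 0" for x
  by (rule continuous_line_measurable[OF cont]) (use that in \<open>simp add: A_def\<close>)
 have sq: "sq_int (%y. \<sigma> (Complex x y))" if "x \<ge> 0" for x
  using meas[OF that] K1'[OF that] by (rule sq_int_decay)
 define Q where "Q = (\<integral>(y::real). K1 * (1 / (1 + y\<^sup>2)) \<partial>lborel)"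
 have iQ: "integrable lborel (%y::real. K1 * (1 / (1 + y\<^sup>2)))"
  by (intro integrable_mult_right integrable_inverse_1_plus_square')
 have "(\<integral>\<^sup>+ y. ennreal ((cmod (\<sigma> (Complex x y)))\<^sup>2) \<partial>lborel) \<le> ennreal Q" if x: "x > 0" for x
 proof -
  have "(\<integral>\<^sup>+ y. ennreal ((cmod (\<sigma> (Complex x y)))\<^sup>2) \<partial>lborel) = ennreal (\<integral>y. (cmod (\<sigma> (Complex x y)))\<^sup>2 \<partial>lborel)"
   using sq[of x] x by (intro nn_integral_eq_integral) (auto simp: sq_int_def)
  also have "(\<integral>y. (cmod (\<sigma> (Complex x y)))\<^sup>2 \<partial>lborel) \<le> Q" unfolding Q_def
   using sq[of x] x iQ K1'[of x] by (intro integral_mono) (auto simp: sq_int_def)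
  finally show ?thesis by (simp add: ennreal_leI)
 qed
 moreover have "((%x. \<integral>y. (cmod (\<sigma> (Complex x y) - \<sigma> (Complex 0 y)))\<^sup>2 \<partial>lborel) \<longlongrightarrow> 0) (at_right 0)"
 proof (rule tendsto_at_right_sequentially[where b = 1])
  fix X :: "nat => real" assume X: "!!n. 0 < X n" "!!n. X n < 1" "X \<longlonglongrightarrow> 0"
  have "(%n. \<integral>y. (cmod (\<sigma> (Complex (X n) y) - \<sigma> (Complex 0 y)))\<^sup>2 \<partial>lborel) \<longlonglongrightarrow> (\<integral>(y::real). 0 \<partial>lborel)"
  \<comment> \<open>The 4 comes from |u - v|^2 \<le> 2|u|^2 + 2|v|^2, applied to two values with the
    same bound.\<close>
  proof (rule integral_dominated_convergence[where w = "%y. 4 * (K1 * (1 / (1 + y\<^sup>2)))"])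
   note [measurable] = meas
   have m0: "(%y. \<sigma> (Complex 0 y)) \<in> borel_measurable borel" by (rule meas) simp
   show "(%y. (cmod (\<sigma> (Complex (X n) y) - \<sigma> (Complex 0 y)))\<^sup>2) \<in> borel_measurable lborel" for n
    using meas[of "X n"] X(1)[of n] m0 by (auto simp: less_imp_le)
   show "AE y in lborel. (%n. (cmod (\<sigma> (Complex (X n) y) - \<sigma> (Complex 0 y)))\<^sup>2) \<longlonglongrightarrow> 0"
   proof (rule AE_I2)
    fix y
    have "(%n. Complex (X n) y) \<longlonglongrightarrow> Complex 0 y" by (intro tendsto_intros X(3))
    then have "(%n. \<sigma> (Complex (X n) y)) \<longlonglongrightarrow> \<sigma> (Complex 0 y)"
     by (rule continuous_on_tendsto_compose[OF cont])
      (use X in \<open>auto simp: A_def less_imp_le intro!: always_eventually\<close>)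
    then have "(%n. (cmod (\<sigma> (Complex (X n) y) - \<sigma> (Complex 0 y)))\<^sup>2) \<longlonglongrightarrow> (cmod (\<sigma> (Complex 0 y) - \<sigma> (Complex 0 y)))\<^sup>2"
     by (intro tendsto_intros)
    then show "(%n. (cmod (\<sigma> (Complex (X n) y) - \<sigma> (Complex 0 y)))\<^sup>2) \<longlonglongrightarrow> 0" by simp
   qed
   show "AE y in lborel. norm ((cmod (\<sigma> (Complex (X n) y) - \<sigma> (Complex 0 y)))\<^sup>2) \<le> 4 * (K1 * (1 / (1 + y\<^sup>2)))" for n
   proof (rule AE_I2)
    fix y
    let ?a = "cmod (\<sigma> (Complex (X n) y))" and ?b = "cmod (\<sigma> (Complex 0 y))"
    have "(cmod (\<sigma> (Complex (X n) y) - \<sigma> (Complex 0 y)))\<^sup>2 \<le> (?a + ?b)\<^sup>2"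
     by (intro power_mono norm_triangle_ineq4) auto
    also have "\<dots> \<le> 2 * ?a\<^sup>2 + 2 * ?b\<^sup>2" using sum_squares_bound[of ?a ?b] by (simp add: power2_sum)
    also have "\<dots> \<le> 2 * (K1 * (1 / (1 + y\<^sup>2))) + 2 * (K1 * (1 / (1 + y\<^sup>2)))"
     using K1'[of "X n" y] K1'[of 0 y] X(1)[of n] by (intro add_mono mult_left_mono) (auto simp: less_imp_le)
    finally show "norm ((cmod (\<sigma> (Complex (X n) y) - \<sigma> (Complex 0 y)))\<^sup>2) \<le> 4 * (K1 * (1 / (1 + y\<^sup>2)))" by simp
   qed
   show "integrable lborel (%y. 4 * (K1 * (1 / (1 + y\<^sup>2))))" using iQ by (rule integrable_mult_right)
  qed auto
  then show "(%n. \<integral>y. (cmod (\<sigma> (Complex (X n) y) - \<sigma> (Complex 0 y)))\<^sup>2 \<partial>lborel) \<longlonglongrightarrow> 0" by simp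
 qed auto
 moreover have "\<sigma> holomorphic_on \<Pi>\<^sub>+"
  by (rule holomorphic_on_subset[OF hol]) (use S in \<open>force simp: right_half_plane_def\<close>)
 ultimately show ?thesis unfolding hardy_pair_def using sq[of 0] by auto
qed

definition hardy_vec :: "nat => (complex => complex vec) => (real => complex vec) => bool"
 where "hardy_vec d h H \<longleftrightarrow> h \<in> hardy2 d \<and> boundary_value d h H"

text \<open>The analysis is done for scalar functions; finite sums over the components pass through
  the Hardy bound and the boundary limit in both directions.\<close>

lemma hardy_vec_iff:
 "hardy_vec d h H \<longleftrightarrow> (\<forall>z\<in>\<Pi>\<^sub>+. h z \<in> carrier_vec d) \<and> (\<forall>y. H y \<in> carrier_vec d) \<and>
  (\<forall>i<d. hardy_pair (%z. h z $ i) (%y. H y $ i))" (is "_ \<longleftrightarrow> ?R")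
proof
 assume *: "hardy_vec d h H"
 then have hc: "!!z. z \<in> \<Pi>\<^sub>+ ==> h z \<in> carrier_vec d" and Hc: "!!y. H y \<in> carrier_vec d"
  and hh: "!!i. i < d ==> (%z. h z $ i) holomorphic_on \<Pi>\<^sub>+"
  and HL: "H \<in> L2_imag d" and lim: "((%x. \<integral>y. vnorm2 (h (Complex x y) - H y) \<partial>lborel) \<longlongrightarrow> 0) (at_right 0)"
  by (auto simp: hardy_vec_def hardy2_def boundary_value_def L2_imag_iff)
 obtain B where B: "!!x. x > 0 ==> (\<integral>\<^sup>+ y. ennreal (vnorm2 (h (Complex x y))) \<partial>lborel) \<le> ennreal B"
  using * unfolding hardy_vec_def hardy2_def by blast
 have P: "Complex x y \<in> \<Pi>\<^sub>+" if "x > 0" for x y using that by (simp add: right_half_plane_def)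
 have Bi: "(\<integral>\<^sup>+ y. ennreal ((cmod (h (Complex x y) $ i))\<^sup>2) \<partial>lborel) \<le> ennreal B" if "x > 0" "i < d" for x i
 proof (rule order_trans[OF nn_integral_mono B[OF that(1)]])
  fix y
  show "ennreal ((cmod (h (Complex x y) $ i))\<^sup>2) \<le> ennreal (vnorm2 (h (Complex x y)))"
   unfolding vnorm2_sum[OF hc[OF P[OF that(1)]]]
   using that(2) by (intro ennreal_leI member_le_sum) auto
 qed
 have sqh: "sq_int (%y. h (Complex x y) $ i)" if "x > 0" "i < d" for x i
  using sq_int_line[OF hh[OF that(2)] that(1) Bi[OF that]] .
 have sqH: "sq_int (%y. H y $ i)" if "i < d" for i using HL that by (simp add: L2_imag_iff)
 have "hardy_pair (%z. h z $ i) (%y. H y $ i)" if i: "i < d" for i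
 proof -
  have "((%x. \<integral>y. (cmod (h (Complex x y) $ i - H y $ i))\<^sup>2 \<partial>lborel) \<longlongrightarrow> 0) (at_right 0)"
  proof (rule Lim_null_comparison[OF _ lim])
   have "norm (\<integral>y. (cmod (h (Complex x y) $ i - H y $ i))\<^sup>2 \<partial>lborel) \<le> (\<integral>y. vnorm2 (h (Complex x y) - H y) \<partial>lborel)" if x: "x > 0" for x
   proof -
    have v: "vnorm2 (h (Complex x y) - H y) = (\<Sum>i<d. (cmod (h (Complex x y) $ i - H y $ i))\<^sup>2)" for y
     using hc[OF P[OF x]] Hc[of y] by (subst vnorm2_sum[of _ d]) (auto intro!: sum.cong)
    have ii: "integrable lborel (%y. (cmod (h (Complex x y) $ i - H y $ i))\<^sup>2)" if "i < d" for i
     using sq_int_diff[OF sqh[OF x that] sqH[OF that]] by (simp add: sq_int_def)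
    have "(\<integral>y. (cmod (h (Complex x y) $ i - H y $ i))\<^sup>2 \<partial>lborel) \<le> (\<integral>y. vnorm2 (h (Complex x y) - H y) \<partial>lborel)"
     unfolding v
     by (intro integral_mono ii i Bochner_Integration.integrable_sum) (use i in \<open>auto intro!: member_le_sum\<close>)
    then show ?thesis by (simp add: integral_nonneg_AE)
   qed
   then show "\<forall>\<^sub>F x in at_right 0. norm (\<integral>y. (cmod (h (Complex x y) $ i - H y $ i))\<^sup>2 \<partial>lborel) \<le> (\<integral>y. vnorm2 (h (Complex x y) - H y) \<partial>lborel)"
    using eventually_at_right_less[of 0] by (rule eventually_mono[rotated])
  qed
  then show ?thesis unfolding hardy_pair_def using hh[OF i] sqH[OF i] Bi[OF _ i] by blast
 qed
 then show ?R using hc Hc by blast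
next
 assume R: ?R
 then have hc: "!!z. z \<in> \<Pi>\<^sub>+ ==> h z \<in> carrier_vec d" and Hc: "!!y. H y \<in> carrier_vec d"
  and hp: "!!i. i < d ==> hardy_pair (%z. h z $ i) (%y. H y $ i)" by auto
 have P: "Complex x y \<in> \<Pi>\<^sub>+" if "x > 0" for x y using that by (simp add: right_half_plane_def)
 have "\<exists>B\<ge>0. \<forall>x>0. sq_int (%y. h (Complex x y) $ i) \<and> (\<integral>y. (cmod (h (Complex x y) $ i))\<^sup>2 \<partial>lborel) \<le> B" if "i < d" for i
  using hardy_pair_line[OF hp[OF that]] by metis
 then obtain B where B: "!!i x. i < d ==> x > 0 ==> sq_int (%y. h (Complex x y) $ i)"
  "!!i x. i < d ==> x > 0 ==> (\<integral>y. (cmod (h (Complex x y) $ i))\<^sup>2 \<partial>lborel) \<le> B i" by metis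
 have sqH: "sq_int (%y. H y $ i)" if "i < d" for i using hp[OF that] by (simp add: hardy_pair_def)
 have "(\<integral>\<^sup>+ y. ennreal (vnorm2 (h (Complex x y))) \<partial>lborel) \<le> ennreal (\<Sum>i<d. B i)" if x: "x > 0" for x
 proof -
  have v: "vnorm2 (h (Complex x y)) = (\<Sum>i<d. (cmod (h (Complex x y) $ i))\<^sup>2)" for y
   using hc[OF P[OF x]] by (rule vnorm2_sum)
  have i: "integrable lborel (%y. (cmod (h (Complex x y) $ i))\<^sup>2)" if "i < d" for i
   using B(1)[OF that x] by (simp add: sq_int_def)
  have "(\<integral>\<^sup>+ y. ennreal (vnorm2 (h (Complex x y))) \<partial>lborel) = ennreal (\<integral>y. vnorm2 (h (Complex x y)) \<partial>lborel)"
   unfolding v using i by (intro nn_integral_eq_integral Bochner_Integration.integrable_sum) (auto simp: sum_nonneg)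
  also have "(\<integral>y. vnorm2 (h (Complex x y)) \<partial>lborel) = (\<Sum>i<d. \<integral>y. (cmod (h (Complex x y) $ i))\<^sup>2 \<partial>lborel)"
   unfolding v using i by (intro Bochner_Integration.integral_sum) auto
  also have "\<dots> \<le> (\<Sum>i<d. B i)" using B(2) x by (intro sum_mono) auto
  finally show ?thesis by (simp add: ennreal_leI)
 qed
 then have "h \<in> hardy2 d" using hc hp by (auto simp: hardy2_def hardy_pair_def)
 moreover have "((%x. \<integral>y. vnorm2 (h (Complex x y) - H y) \<partial>lborel) \<longlongrightarrow> 0) (at_right 0)"
 proof (rule Lim_transform_eventually)
  have "((%x. \<Sum>i<d. \<integral>y. (cmod (h (Complex x y) $ i - H y $ i))\<^sup>2 \<partial>lborel) \<longlongrightarrow> (\<Sum>i<d. 0)) (at_right 0)"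
   using hp unfolding hardy_pair_def by (intro tendsto_sum) auto
  then show "((%x. \<Sum>i<d. \<integral>y. (cmod (h (Complex x y) $ i - H y $ i))\<^sup>2 \<partial>lborel) \<longlongrightarrow> 0) (at_right 0)" by simp
  have "(\<Sum>i<d. \<integral>y. (cmod (h (Complex x y) $ i - H y $ i))\<^sup>2 \<partial>lborel) = (\<integral>y. vnorm2 (h (Complex x y) - H y) \<partial>lborel)" if x: "x > 0" for x
  proof -
   have v: "vnorm2 (h (Complex x y) - H y) = (\<Sum>i<d. (cmod (h (Complex x y) $ i - H y $ i))\<^sup>2)" for y
    using hc[OF P[OF x]] Hc[of y] by (subst vnorm2_sum[of _ d]) (auto intro!: sum.cong)
   have "integrable lborel (%y. (cmod (h (Complex x y) $ i - H y $ i))\<^sup>2)" if "i < d" for i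
    using sq_int_diff[OF B(1)[OF that x] sqH[OF that]] by (simp add: sq_int_def)
   then show ?thesis unfolding v by (intro Bochner_Integration.integral_sum[symmetric]) auto
  qed
  then show "\<forall>\<^sub>F x in at_right 0. (\<Sum>i<d. \<integral>y. (cmod (h (Complex x y) $ i - H y $ i))\<^sup>2 \<partial>lborel) = (\<integral>y. vnorm2 (h (Complex x y) - H y) \<partial>lborel)"
   using eventually_at_right_less[of 0] by (rule eventually_mono[rotated])
 qed
 moreover have "H \<in> L2_imag d" using Hc sqH by (simp add: L2_imag_iff)
 ultimately show "hardy_vec d h H" by (simp add: hardy_vec_def boundary_value_def)
qed

text \<open>Formulas for resolvent entries hold off the spectrum, where the inverse is specified.
  The exceptional set is finite, hence bounded, and decay at infinity does not see it.\<close>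

lemma decays_cong:
 assumes "decays f" "finite S" "!!z. z \<notin> S ==> f z = g z"
 shows "decays g"
proof -
 obtain K T where KT: "!!z. T \<le> cmod z ==> cmod (f z) \<le> K / cmod z" using assms(1) unfolding decays_def by blast
 obtain b where b: "b > 0" "!!s. s \<in> S ==> cmod s \<le> b"
  using finite_imp_bounded[OF assms(2)] unfolding bounded_pos by blast
 have "cmod (g z) \<le> K / cmod z" if "max T (b + 1) \<le> cmod z" for z
  using KT[of z] assms(3)[of z] b(2)[of z] that by force
 then show ?thesis unfolding decays_def by blast
qed

lemma mult_resolvent_right:
 assumes A: "A \<in> carrier_mat n n" and C: "C \<in> carrier_mat d n" and i: "i < d" and j: "j < n"
 shows "(%z. (C * resolvent A z) $$ (i, j)) holomorphic_on - spectrum A"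
  and "decays (%z. (C * resolvent A z) $$ (i, j))"
proof -
 have e: "(\<Sum>l<n. C $$ (i, l) * resolvent A z $$ (l, j)) = (C * resolvent A z) $$ (i, j)" if "z \<notin> spectrum A" for z
  using mult_mat_index_sum[OF C resolvent_props(1)[OF A that] i j] by simp
 have "(%z. \<Sum>l<n. C $$ (i, l) * resolvent A z $$ (l, j)) holomorphic_on - spectrum A"
  by (intro holomorphic_on_sum holomorphic_on_mult holomorphic_on_const holomorphic_resolvent[OF A]) (use j in auto)
 then show "(%z. (C * resolvent A z) $$ (i, j)) holomorphic_on - spectrum A"
  by (rule holomorphic_transform) (use e in auto)
 show "decays (%z. (C * resolvent A z) $$ (i, j))"
  by (rule decays_cong[OF _ finite_spectrum[OF A] e], intro decays_sum decays_cmult decays_resolvent[OF A]) (use j in auto)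
qed

lemma mult_resolvent_left:
 assumes A: "A \<in> carrier_mat n n" and B: "B \<in> carrier_mat n d" and i: "i < n" and j: "j < d"
 shows "(%z. (resolvent A z * B) $$ (i, j)) holomorphic_on - spectrum A"
  and "decays (%z. (resolvent A z * B) $$ (i, j))"
proof -
 have e: "(\<Sum>l<n. B $$ (l, j) * resolvent A z $$ (i, l)) = (resolvent A z * B) $$ (i, j)" if "z \<notin> spectrum A" for z
  using mult_mat_index_sum[OF resolvent_props(1)[OF A that] B i j] by (simp add: mult.commute)
 have "(%z. \<Sum>l<n. B $$ (l, j) * resolvent A z $$ (i, l)) holomorphic_on - spectrum A"
  by (intro holomorphic_on_sum holomorphic_on_mult holomorphic_on_const holomorphic_resolvent[OF A]) (use i in auto)
 then show "(%z. (resolvent A z * B) $$ (i, j)) holomorphic_on - spectrum A"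
  by (rule holomorphic_transform) (use e in auto)
 show "decays (%z. (resolvent A z * B) $$ (i, j))"
  by (rule decays_cong[OF _ finite_spectrum[OF A] e], intro decays_sum decays_cmult decays_resolvent[OF A]) (use i in auto)
qed

text \<open>The first conclusion of \<open>hardy_pair_residue\<close> concerns \<open>\<rho>\<close>
  alone, so it may be taken with the zero Hardy function.\<close>

lemma sq_int_axis:
 assumes "\<rho> holomorphic_on - S" "finite S" "!!s. s \<in> S ==> Re s \<noteq> 0" "decays \<rho>"
 shows "sq_int (%y. \<rho> (Complex 0 y))"
proof -
 obtain K T where "!!z. T \<le> cmod z ==> cmod (\<rho> z) \<le> K / cmod z" using assms(4) unfolding decays_def by blast
 then show ?thesis using assms by (intro hardy_pair_residue(1)[OF hardy_pair_zero, of \<rho> S T K]) (auto simp: Compl_eq_Diff_UNIV)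
qed

section \<open>Lyapunov equations solved by integrals over the axis\<close>

lemma integral_reflect_real: "(\<integral>y. f (- y) \<partial>lborel) = (\<integral>y. f y \<partial>lborel)" for f :: "real => complex"
 using lborel_integral_real_affine[of "-1" f 0] by simp

text \<open>On the axis 1/(iy - 1) = -1/(1 + y^2) - iy/(1 + y^2). The second part has the even
  antiderivative -i log(1 + y^2)/2 and cancels over symmetric segments.\<close>

lemma integral_inverse_shift:
 assumes "T > 0"
 shows "((%y. 1 / (Complex 0 y - 1)) has_integral complex_of_real (- 2 * arctan T)) {-T..T}"
proof -
 define F where "F = (%y::real. complex_of_real (- arctan y) - \<i> * complex_of_real (ln (1 + y\<^sup>2) / 2))"
 have "((%y. 1 / (Complex 0 y - 1)) has_integral F T - F (-T)) {-T..T}"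
 proof (rule fundamental_theorem_of_calculus)
  fix y :: real
  have p: "1 + y\<^sup>2 > 0" by (simp add: add_pos_nonneg)
  have "((%y. - arctan y) has_real_derivative - inverse (1 + y\<^sup>2)) (at y)"
   by (rule DERIV_minus[OF DERIV_arctan])
  then have d1: "((%y. - arctan y) has_real_derivative (- (1 / (1 + y\<^sup>2)))) (at y within {-T..T})"
   by (simp add: inverse_eq_divide has_field_derivative_at_within)
  have "((%y. 1 + y\<^sup>2) has_real_derivative 2 * y) (at y)" by (auto intro!: derivative_eq_intros)
  note d = DERIV_cdivide[OF DERIV_chain2[OF DERIV_ln[OF p] this], of 2]
  have "inverse (1 + y\<^sup>2) * (2 * y) / 2 = y / (1 + y\<^sup>2)"
   unfolding divide_inverse[of y] by simp
  with d have "((%y. ln (1 + y\<^sup>2) / 2) has_real_derivative (y / (1 + y\<^sup>2))) (at y)" by (simp only:)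
  then have d2: "((%y. ln (1 + y\<^sup>2) / 2) has_real_derivative (y / (1 + y\<^sup>2))) (at y within {-T..T})"
   by (rule has_field_derivative_at_within)
  have "(F has_vector_derivative (complex_of_real (- (1 / (1 + y\<^sup>2))) - \<i> * complex_of_real (y / (1 + y\<^sup>2)))) (at y within {-T..T})"
   unfolding F_def
   by (intro has_vector_derivative_diff has_vector_derivative_of_real d1 has_vector_derivative_mult_right d2)
  moreover have "complex_of_real (- (1 / (1 + y\<^sup>2))) - \<i> * complex_of_real (y / (1 + y\<^sup>2)) = 1 / (Complex 0 y - 1)"
   using p by (simp add: complex_eq_iff Re_divide Im_divide power2_eq_square)
  ultimately show "(F has_vector_derivative 1 / (Complex 0 y - 1)) (at y within {-T..T})" by simp
 qed (use assms in auto)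
 moreover have "F T - F (-T) = complex_of_real (- 2 * arctan T)" by (simp add: F_def arctan_minus)
 ultimately show ?thesis by simp
qed

lemma axis_notin_spectrum: "spectrum A \<subseteq> \<Pi>\<^sub>+ ==> Complex 0 y \<notin> spectrum A"
 by (auto simp: right_half_plane_def)

lemma hardy_pair_inverse_shift: "hardy_pair (%z. 1 / (z + 1)) (%y. 1 / (Complex 0 y + 1))"
proof (rule hardy_pair_rational[where S = "{-1}"])
 show "(%z::complex. 1 / (z + 1)) holomorphic_on UNIV - {-1}"
  by (intro holomorphic_intros) (auto simp: eq_neg_iff_add_eq_0)
 have "cmod (1 / (z + 1)) \<le> 2 / cmod z" if "2 \<le> cmod z" for z
 proof -
  have "cmod z \<le> cmod (z + 1) + 1" using norm_triangle_ineq[of "z + 1" "-1"] by simp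
  then have "cmod z / 2 \<le> cmod (z + 1)" using that by linarith
  then have "1 / cmod (z + 1) \<le> 1 / (cmod z / 2)" using that by (intro divide_left_mono mult_pos_pos) auto
  then show ?thesis by (simp add: norm_divide)
 qed
 then show "decays (%z. 1 / (z + 1))" unfolding decays_def by blast
qed auto

text \<open>Subtracting the scalar resolvent of \<open>1\<close> leaves an absolutely integrable function, whose
 integral vanishes because all its poles lie on one side of the imaginary line.\<close>

lemma principal_value_resolvent:
 assumes A: "A \<in> carrier_mat n n" and sp: "spectrum A \<subseteq> \<Pi>\<^sub>+" and i: "i < n" and j: "j < n"
 shows "((%T. integral {-T..T} (%y. resolvent A (Complex 0 y) $$ (i, j))) \<longlongrightarrow> (if i = j then - of_real pi else 0)) at_top"
proof -
 let ?R = "%y. resolvent A (Complex 0 y)"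
 have notin: "Complex 0 y \<notin> spectrum A" for y using axis_notin_spectrum[OF sp] .
 have R: "?R y \<in> carrier_mat n n" for y using resolvent_props(1)[OF A notin] .
 have z0: "integrable lborel (%y. ?R y $$ (k, l) * (1 / (Complex 0 y - 1))) \<and>
   (\<integral>y. ?R y $$ (k, l) * (1 / (Complex 0 y - 1)) \<partial>lborel) = 0" if kl: "k < n" "l < n" for k l
 proof -
  \<comment> \<open>Reflecting the argument moves all poles to the left, so against the Hardy
    function 1/(z + 1) no residue is left.\<close>
  define \<rho> where "\<rho> = (%z. resolvent A (- z) $$ (k, l))"
  let ?S = "uminus ` spectrum A"
  have hol: "\<rho> holomorphic_on UNIV - ?S"
  proof -
   have "((%z. resolvent A z $$ (k, l)) \<circ> uminus) holomorphic_on UNIV - ?S"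
    by (rule holomorphic_on_compose_gen[OF _ holomorphic_resolvent[OF A kl]])
     (auto intro!: holomorphic_intros simp: image_iff, metis minus_minus)
   then show ?thesis by (simp add: \<rho>_def o_def)
  qed
  obtain K T where KT: "!!z. T \<le> cmod z ==> cmod (\<rho> z) \<le> K / cmod z"
   using decays_reflect[OF decays_resolvent[OF A kl]] unfolding decays_def \<rho>_def by blast
  have S: "Re s < 0" if "s \<in> ?S" for s using that sp by (auto simp: right_half_plane_def)
  have S0: "Re s \<noteq> 0" if "s \<in> ?S" for s using S[OF that] by simp
  note r = hardy_pair_residue[OF hardy_pair_inverse_shift hol finite_imageI[OF finite_spectrum[OF A]] S0 KT]
  have "{s \<in> ?S. Re s > 0} = {}" using S by force
  then have e: "(\<integral>y. \<rho> (Complex 0 y) * (1 / (Complex 0 y + 1)) \<partial>lborel) = 0" using r(2) by (simp only: sum.empty mult_zero_right)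
  have sq: "sq_int (%y. 1 / (Complex 0 y + 1))" using hardy_pair_inverse_shift by (simp add: hardy_pair_def)
  have int: "integrable lborel (%y. \<rho> (Complex 0 y) * (1 / (Complex 0 y + 1)))"
   by (rule sq_int_mult_integrable(1)[OF r(1) sq])
  have m: "- Complex 0 y = Complex 0 (- y)" for y by (simp add: complex_eq_iff)
  have q: "\<rho> (Complex 0 (- y)) * (1 / (Complex 0 (- y) + 1)) = - (?R y $$ (k, l) * (1 / (Complex 0 y - 1)))" for y
  proof -
   have "Complex 0 (- y) + 1 = - (Complex 0 y - 1)" by (simp add: complex_eq_iff)
   then show ?thesis unfolding \<rho>_def m
    by (simp only: minus_minus minus_divide_right[symmetric] mult_minus_right)
  qed
  have "integrable lborel (%y. \<rho> (Complex 0 (0 + -1 * y)) * (1 / (Complex 0 (0 + -1 * y) + 1)))"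
   using int by (subst lborel_integrable_real_affine_iff) auto
  then have i1: "integrable lborel (%y. ?R y $$ (k, l) * (1 / (Complex 0 y - 1)))"
   using q by simp
  have "(\<integral>y. \<rho> (Complex 0 (- y)) * (1 / (Complex 0 (- y) + 1)) \<partial>lborel) = 0"
   using integral_reflect_real[of "%y. \<rho> (Complex 0 y) * (1 / (Complex 0 y + 1))"] e by simp
  then show ?thesis using i1 unfolding q by simp
 qed
 \<comment> \<open>Origin: the resolvent identity R_A - R_I = R_A (A - I) R_I at iy, entry by entry,
   with R_I equal to 1/(iy - 1) times the identity. The product of two decaying factors is
   integrable.\<close>
 define f where "f = (%y. (\<Sum>l<n. (?R y $$ (i, l) * (1 / (Complex 0 y - 1))) * A $$ (l, j)) - ?R y $$ (i, j) * (1 / (Complex 0 y - 1)))"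
 have fi: "integrable lborel f" unfolding f_def using z0 i j
  by (intro Bochner_Integration.integrable_diff Bochner_Integration.integrable_sum integrable_mult_left) auto
 have f0: "(\<integral>y. f y \<partial>lborel) = 0"
 proof -
  have "(\<integral>y. f y \<partial>lborel) = (\<integral>y. (\<Sum>l<n. (?R y $$ (i, l) * (1 / (Complex 0 y - 1))) * A $$ (l, j)) \<partial>lborel) - (\<integral>y. ?R y $$ (i, j) * (1 / (Complex 0 y - 1)) \<partial>lborel)"
   unfolding f_def using z0 i j
   by (intro Bochner_Integration.integral_diff Bochner_Integration.integrable_sum integrable_mult_left) auto
  also have "(\<integral>y. (\<Sum>l<n. (?R y $$ (i, l) * (1 / (Complex 0 y - 1))) * A $$ (l, j)) \<partial>lborel) = (\<Sum>l<n. \<integral>y. (?R y $$ (i, l) * (1 / (Complex 0 y - 1))) * A $$ (l, j) \<partial>lborel)"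
   using z0 i by (intro Bochner_Integration.integral_sum integrable_mult_left) auto
  also have "\<dots> = (\<Sum>l<n. (\<integral>y. ?R y $$ (i, l) * (1 / (Complex 0 y - 1)) \<partial>lborel) * A $$ (l, j))"
   using z0 i by (intro sum.cong refl Bochner_Integration.integral_mult_left) auto
  finally show ?thesis using z0 i j by simp
 qed
 have split: "?R y $$ (i, j) = (if i = j then 1 / (Complex 0 y - 1) else 0) + f y" for y
 proof -
  have "(?R y * A) $$ (i, j) = Complex 0 y * ?R y $$ (i, j) - (if i = j then 1 else 0)"
   using resolvent_mult(2)[OF A notin[of y]] R[of y] i j by simp
  then have s: "(\<Sum>l<n. ?R y $$ (i, l) * A $$ (l, j)) = Complex 0 y * ?R y $$ (i, j) - (if i = j then 1 else 0)"
   using mult_mat_index_sum[OF R[of y] A i j] by simp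
  have "f y = ((\<Sum>l<n. ?R y $$ (i, l) * A $$ (l, j)) - ?R y $$ (i, j)) / (Complex 0 y - 1)"
   unfolding f_def by (simp add: diff_divide_distrib sum_divide_distrib)
  also have "\<dots> = (?R y $$ (i, j) * (Complex 0 y - 1) - (if i = j then 1 else 0)) / (Complex 0 y - 1)"
   unfolding s by (simp add: algebra_simps)
  also have "\<dots> = ?R y $$ (i, j) - (if i = j then 1 else 0) / (Complex 0 y - 1)"
  proof -
   have "Complex 0 y - 1 \<noteq> 0" by (simp add: complex_eq_iff)
   then show ?thesis unfolding diff_divide_distrib using nonzero_mult_div_cancel_right[of "Complex 0 y - 1" "?R y $$ (i, j)"] by (simp only: not_False_eq_True simp_thms)
  qed
  finally show ?thesis by auto
 qed
 have l1: "((%T. integral {-T..T} f) \<longlongrightarrow> 0) at_top" using tendsto_integral_symmetric[OF fi] f0 by simp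
 have fint: "f integrable_on {-T..T}" for T
  using set_borel_integral_eq_integral(1)[of "{-T..T}" f] integrable_mult_indicator[OF _ fi, of "{-T..T}"]
  by (simp add: set_integrable_def)
 have e: "integral {-T..T} (%y. ?R y $$ (i, j)) = (if i = j then complex_of_real (- 2 * arctan T) else 0) + integral {-T..T} f" if "T > 0" for T
 proof -
  have h: "((%y. if i = j then 1 / (Complex 0 y - 1) else 0) has_integral (if i = j then complex_of_real (- 2 * arctan T) else 0)) {-T..T}"
   using integral_inverse_shift[OF that] by auto
  have "((%y. ?R y $$ (i, j)) has_integral (if i = j then complex_of_real (- 2 * arctan T) else 0) + integral {-T..T} f) {-T..T}"
   unfolding split by (rule has_integral_add[OF h integrable_integral[OF fint]])
  then show ?thesis by (rule integral_unique)
 qed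
 have "((%T. complex_of_real (- 2 * arctan T)) \<longlongrightarrow> complex_of_real (- 2 * (pi / 2))) at_top"
  by (intro tendsto_intros tendsto_arctan_at_top)
 then have l2: "((%T. (if i = j then complex_of_real (- 2 * arctan T) else 0) + integral {-T..T} f) \<longlongrightarrow> (if i = j then - of_real pi else 0) + 0) at_top"
  by (intro tendsto_add l1) auto
 show ?thesis
  by (rule Lim_transform_eventually[OF l2[simplified]])
   (use e in \<open>auto intro!: eventually_mono[OF eventually_gt_at_top[of 0]]\<close>)
qed

lemma assoc_mult_mat_mid:
 assumes "P \<in> carrier_mat a b" "G \<in> carrier_mat b c" "A \<in> carrier_mat c d" "R \<in> carrier_mat d e"
 shows "P * (G * A * R) = P * G * (A * R)" "P * (G * A) * R = P * G * (A * R)"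
proof -
 show "P * (G * A * R) = P * G * (A * R)"
  using assoc_mult_mat[OF assms(2-4)] assoc_mult_mat[OF assms(1,2) mult_carrier_mat[OF assms(3,4)]] by (simp only:)
 show "P * (G * A) * R = P * G * (A * R)"
  using assoc_mult_mat[OF assms(1-3)] assoc_mult_mat[OF mult_carrier_mat[OF assms(1,2)] assms(3,4)] by (simp only:)
qed

text \<open>By Plancherel this is the frequency-domain form of the integral of exp(-tA)^* M exp(-tA)
  over t \<ge> 0. Written over the axis and with M = C^* C it is directly a Gram matrix of the
  functions C (iy - A)^-1 v.\<close>

definition axis_gram :: "nat => complex mat => complex mat => complex mat"
 where "axis_gram n A M = mat n n (%(j, l).
  (1 / (2 * pi)) * (\<integral>y. (mat_adjoint (resolvent A (Complex 0 y)) * (M * resolvent A (Complex 0 y))) $$ (j, l) \<partial>lborel))"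

context
 fixes n :: nat and A :: "complex mat"
 assumes A: "A \<in> carrier_mat n n" and sp: "spectrum A \<subseteq> \<Pi>\<^sub>+"
begin

private abbreviation "R y \<equiv> resolvent A (Complex 0 y)"

private lemma R: "R y \<in> carrier_mat n n"
 using resolvent_props(1)[OF A axis_notin_spectrum[OF sp]] .

private lemma RA: "R y * A = Complex 0 y \<cdot>\<^sub>m R y - 1\<^sub>m n"
 using resolvent_mult(2)[OF A axis_notin_spectrum[OF sp]] .

lemma sq_int_resolvent:
 assumes "i < n" "j < n" shows "sq_int (%y. resolvent A (Complex 0 y) $$ (i, j))"
 by (rule sq_int_axis[OF holomorphic_resolvent[OF A assms] finite_spectrum[OF A] _ decays_resolvent[OF A assms]])
  (use sp in \<open>auto simp: right_half_plane_def\<close>)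

private lemma AR: "mat_adjoint A * mat_adjoint (R y) = - (Complex 0 y) \<cdot>\<^sub>m mat_adjoint (R y) - 1\<^sub>m n"
proof -
 have "mat_adjoint A * mat_adjoint (R y) = mat_adjoint (R y * A)"
  using mat_adjoint_mult[OF R A] by simp
 also have "\<dots> = - (Complex 0 y) \<cdot>\<^sub>m mat_adjoint (R y) - 1\<^sub>m n"
  unfolding RA using R[of y]
  by (subst mat_adjoint_minus[of _ n n]) (auto simp: mat_adjoint_smult complex_eq_iff intro!: eq_matI)
 finally show ?thesis .
qed

private lemma gram_entry:
 assumes M: "M \<in> carrier_mat n n" and jl: "j < n" "l < n"
 shows "(mat_adjoint (R y) * (M * R y)) $$ (j, l) = (\<Sum>k<n. \<Sum>m<n. M $$ (k, m) * (cnj (R y $$ (k, j)) * R y $$ (m, l)))"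
proof -
 have "M * R y \<in> carrier_mat n n" using M R[of y] by simp
 from mult_mat_index_sum[OF mat_adjoint_carrier[OF R] this jl]
 have "(mat_adjoint (R y) * (M * R y)) $$ (j, l) = (\<Sum>k<n. mat_adjoint (R y) $$ (j, k) * (M * R y) $$ (k, l))" .
 also have "\<dots> = (\<Sum>k<n. \<Sum>m<n. M $$ (k, m) * (cnj (R y $$ (k, j)) * R y $$ (m, l)))"
 proof (rule sum.cong[OF refl])
  fix k assume k: "k \<in> {..<n}"
  then have "mat_adjoint (R y) $$ (j, k) = cnj (R y $$ (k, j))" using R[of y] jl by (intro mat_adjoint_index) auto
  moreover have "(M * R y) $$ (k, l) = (\<Sum>m<n. M $$ (k, m) * R y $$ (m, l))"
   using mult_mat_index_sum[OF M R] k jl by simp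
  ultimately show "mat_adjoint (R y) $$ (j, k) * (M * R y) $$ (k, l) = (\<Sum>m<n. M $$ (k, m) * (cnj (R y $$ (k, j)) * R y $$ (m, l)))"
   by (simp add: sum_distrib_left algebra_simps)
 qed
 finally show ?thesis .
qed

lemma integrable_axis_gram:
 assumes M: "M \<in> carrier_mat n n" and jl: "j < n" "l < n"
 shows "integrable lborel (%y. (mat_adjoint (resolvent A (Complex 0 y)) * (M * resolvent A (Complex 0 y))) $$ (j, l))"
proof -
 have "integrable lborel (%y. \<Sum>k<n. \<Sum>m<n. M $$ (k, m) * (cnj (R y $$ (k, j)) * R y $$ (m, l)))"
  by (intro Bochner_Integration.integrable_sum integrable_mult_right sq_int_mult_integrable(1) sq_int_cnj sq_int_resolvent)
   (use jl in auto)
 then show ?thesis unfolding gram_entry[OF M jl] .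
qed

text \<open>Each of the two terms contributes \<pi>G by the principal value of the resolvent. They
  decay only like 1/|y|, which forces symmetric truncations instead of an integral over the
  line.\<close>

private lemma pv_linear:
 assumes G: "G \<in> carrier_mat n n" and jl: "j < n" "l < n"
 shows "((%T. integral {-T..T} (%y. - ((mat_adjoint (R y) * G) $$ (j, l) + (G * R y) $$ (j, l)))) \<longlongrightarrow> 2 * pi * G $$ (j, l)) at_top"
proof -
 have cont: "continuous_on {-T..T} (%y. R y $$ (a, b))" if "a < n" "b < n" for a b T
  by (rule continuous_on_compose2[OF holomorphic_on_imp_continuous_on[OF holomorphic_resolvent[OF A that]] continuous_on_Complex_line(1)])
   (use sp in \<open>auto simp: right_half_plane_def\<close>)
 have int: "(%y. R y $$ (a, b)) integrable_on {-T..T}" "(%y. cnj (R y $$ (a, b))) integrable_on {-T..T}" if "a < n" "b < n" for a b T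
  using cont[OF that] by (auto intro!: integrable_continuous_real continuous_on_cnj)
 have cn: "((%y. cnj (R y $$ (a, b))) has_integral cnj (integral {-T..T} (%y. R y $$ (a, b)))) {-T..T}" if "a < n" "b < n" for a b T
  using has_integral_cnj[THEN iffD2, OF integrable_integral[OF int(1)[OF that]]] by (simp add: o_def)
 have e: "- ((mat_adjoint (R y) * G) $$ (j, l) + (G * R y) $$ (j, l)) =
  - ((\<Sum>k<n. cnj (R y $$ (k, j)) * G $$ (k, l)) + (\<Sum>k<n. G $$ (j, k) * R y $$ (k, l)))" for y
 proof -
  have "(mat_adjoint (R y) * G) $$ (j, l) = (\<Sum>k<n. mat_adjoint (R y) $$ (j, k) * G $$ (k, l))"
   by (rule mult_mat_index_sum[OF mat_adjoint_carrier[OF R] G jl])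
  also have "\<dots> = (\<Sum>k<n. cnj (R y $$ (k, j)) * G $$ (k, l))"
   using R[of y] jl by (intro sum.cong refl) (subst mat_adjoint_index, auto)
  finally show ?thesis using mult_mat_index_sum[OF G R jl] by simp
 qed
 have "integral {-T..T} (%y. - ((\<Sum>k<n. cnj (R y $$ (k, j)) * G $$ (k, l)) + (\<Sum>k<n. G $$ (j, k) * R y $$ (k, l)))) =
  - ((\<Sum>k<n. cnj (integral {-T..T} (%y. R y $$ (k, j))) * G $$ (k, l)) + (\<Sum>k<n. G $$ (j, k) * integral {-T..T} (%y. R y $$ (k, l))))" for T
 proof -
  have "((%y. - ((\<Sum>k<n. cnj (R y $$ (k, j)) * G $$ (k, l)) + (\<Sum>k<n. G $$ (j, k) * R y $$ (k, l)))) has_integral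
   - ((\<Sum>k<n. cnj (integral {-T..T} (%y. R y $$ (k, j))) * G $$ (k, l)) + (\<Sum>k<n. G $$ (j, k) * integral {-T..T} (%y. R y $$ (k, l))))) {-T..T}"
   by (intro has_integral_neg has_integral_add has_integral_sum has_integral_mult_left has_integral_mult_right cn integrable_integral int)
    (use jl in auto)
  then show ?thesis by (rule integral_unique)
 qed
 moreover have "((%T. - ((\<Sum>k<n. cnj (integral {-T..T} (%y. R y $$ (k, j))) * G $$ (k, l)) + (\<Sum>k<n. G $$ (j, k) * integral {-T..T} (%y. R y $$ (k, l)))))
  \<longlongrightarrow> - ((\<Sum>k<n. cnj (if k = j then - of_real pi else 0) * G $$ (k, l)) + (\<Sum>k<n. G $$ (j, k) * (if k = l then - of_real pi else 0)))) at_top"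
  by (intro tendsto_intros principal_value_resolvent[OF A sp]) (use jl in auto)
 moreover have "- ((\<Sum>k<n. cnj (if k = j then - of_real pi else 0) * G $$ (k, l)) + (\<Sum>k<n. G $$ (j, k) * (if k = l then - of_real pi else 0))) = 2 * pi * G $$ (j, l)"
 proof -
  have "(\<Sum>k<n. cnj (if k = j then - of_real pi else 0) * G $$ (k, l)) = (\<Sum>k<n. if k = j then - of_real pi * G $$ (k, l) else 0)"
   by (intro sum.cong) auto
  moreover have "(\<Sum>k<n. G $$ (j, k) * (if k = l then - of_real pi else 0)) = (\<Sum>k<n. if k = l then - of_real pi * G $$ (j, k) else 0)"
   by (intro sum.cong) auto
  ultimately show ?thesis using jl by (simp add: sum.delta)
 qed
 ultimately show ?thesis unfolding e by simp
qed

text \<open>Sandwich the equation between R^* and R, the resolvent at iy. Since iy is purely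
  imaginary, the terms iy R^* G R cancel and -(R^* G + G R) remains, whose symmetric integral is
  2\<pi>G. Hence \<open>M\<close> determines \<open>G\<close>.\<close>

lemma lyapunov_unique:
 assumes G: "G \<in> carrier_mat n n" and M: "M \<in> carrier_mat n n" and eq: "G * A + mat_adjoint A * G = M"
 shows "G = axis_gram n A M"
proof (rule eq_matI)
 fix j l assume "j < dim_row (axis_gram n A M)" "l < dim_col (axis_gram n A M)"
 then have jl: "j < n" "l < n" by (auto simp: axis_gram_def)
 have e: "mat_adjoint (R y) * (M * R y) = - (mat_adjoint (R y) * G + G * R y)" for y
 proof -
  let ?z = "Complex 0 y" and ?R = "R y" and ?Q = "mat_adjoint (R y)"
  have c: "?R \<in> carrier_mat n n" "?Q \<in> carrier_mat n n" "mat_adjoint A \<in> carrier_mat n n" using R A by auto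
  have AR': "A * ?R = ?z \<cdot>\<^sub>m ?R - 1\<^sub>m n"
   using resolvent_mult(1)[OF A axis_notin_spectrum[OF sp]] .
  have QA: "?Q * mat_adjoint A = - ?z \<cdot>\<^sub>m ?Q - 1\<^sub>m n"
  proof -
   have "?Q * mat_adjoint A = mat_adjoint (A * ?R)" using mat_adjoint_mult[OF A R] by simp
   also have "\<dots> = - ?z \<cdot>\<^sub>m ?Q - 1\<^sub>m n" unfolding AR' using R[of y]
    by (subst mat_adjoint_minus[of _ n n]) (auto simp: mat_adjoint_smult complex_eq_iff intro!: eq_matI)
   finally show ?thesis .
  qed
  have "?Q * (M * ?R) = ?Q * (G * A * ?R + mat_adjoint A * G * ?R)"
   unfolding eq[symmetric] using c G A by (subst add_mult_distrib_mat[of _ n n]) auto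
  also have "\<dots> = ?Q * (G * A * ?R) + ?Q * (mat_adjoint A * G * ?R)"
   using c G A by (intro mult_add_distrib_mat[of _ n n]) auto
  also have "?Q * (G * A * ?R) = ?Q * G * (A * ?R)" by (rule assoc_mult_mat_mid(1)[OF c(2) G A c(1)])
  also have "?Q * (mat_adjoint A * G * ?R) = ?Q * mat_adjoint A * (G * ?R)" by (rule assoc_mult_mat_mid(1)[OF c(2,3) G c(1)])
  also have "?Q * G * (A * ?R) = ?z \<cdot>\<^sub>m (?Q * G * ?R) - ?Q * G" unfolding AR'
   using c G by (subst mult_minus_distrib_mat[of _ n n]) (auto simp: mult_smult_distrib[of _ n n _ n])
  also have "?Q * mat_adjoint A * (G * ?R) = - ?z \<cdot>\<^sub>m (?Q * G * ?R) - G * ?R" unfolding QA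
   using c G by (subst minus_mult_distrib_mat[of _ n n]) (auto simp: mult_smult_assoc_mat[of _ n n _ n] assoc_mult_mat[of _ n n _ n _ n])
  also have "?z \<cdot>\<^sub>m (?Q * G * ?R) - ?Q * G + (- ?z \<cdot>\<^sub>m (?Q * G * ?R) - G * ?R) = - (?Q * G + G * ?R)"
   using c G by (intro eq_matI) auto
  finally show ?thesis .
 qed
 have "((%T. integral {-T..T} (%y. - ((mat_adjoint (R y) * G) $$ (j, l) + (G * R y) $$ (j, l)))) \<longlongrightarrow> 2 * pi * G $$ (j, l)) at_top"
  by (rule pv_linear[OF G jl])
 moreover have "- ((mat_adjoint (R y) * G) $$ (j, l) + (G * R y) $$ (j, l)) = (mat_adjoint (R y) * (M * R y)) $$ (j, l)" for y
  unfolding e using R[of y] G jl by simp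
 ultimately have "((%T. integral {-T..T} (%y. (mat_adjoint (R y) * (M * R y)) $$ (j, l))) \<longlongrightarrow> 2 * pi * G $$ (j, l)) at_top" by simp
 from tendsto_unique[OF _ this tendsto_integral_symmetric[OF integrable_axis_gram[OF M jl]]]
 have "2 * pi * G $$ (j, l) = (\<integral>y. (mat_adjoint (R y) * (M * R y)) $$ (j, l) \<partial>lborel)" by simp
 then show "G $$ (j, l) = axis_gram n A M $$ (j, l)" using jl by (simp add: axis_gram_def field_simps)
qed (use G in \<open>auto simp: axis_gram_def\<close>)

text \<open>The same cancellation with A outside: the integrand S = R^* M R satisfies S A + A^* S =
  -(R^* M + M R), and the right side integrates symmetrically to 2\<pi>M.\<close>

lemma lyapunov_exists:
 assumes M: "M \<in> carrier_mat n n"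
 shows "axis_gram n A M * A + mat_adjoint A * axis_gram n A M = M"
proof (rule eq_matI)
 fix j l assume "j < dim_row M" "l < dim_col M"
 then have jl: "j < n" "l < n" using M by auto
 let ?G = "axis_gram n A M"
 let ?S = "%y. mat_adjoint (R y) * (M * R y)"
 have Gc: "?G \<in> carrier_mat n n" by (simp add: axis_gram_def)
 have Sc: "?S y \<in> carrier_mat n n" for y using mult_carrier_mat[OF mat_adjoint_carrier[OF R] mult_carrier_mat[OF M R]] .
 have Ac: "mat_adjoint A \<in> carrier_mat n n" using A by simp
 have e: "?S y * A + mat_adjoint A * ?S y = - (mat_adjoint (R y) * M + M * R y)" for y
 proof -
  let ?z = "Complex 0 y" and ?R = "R y" and ?Q = "mat_adjoint (R y)"
  have c: "?R \<in> carrier_mat n n" "?Q \<in> carrier_mat n n" using R by auto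
  have "?S y * A = ?Q * M * (?R * A)" by (rule assoc_mult_mat_mid(2)[OF c(2) M c(1) A])
  also have "\<dots> = ?z \<cdot>\<^sub>m (?Q * M * ?R) - ?Q * M" unfolding RA
   using c M by (subst mult_minus_distrib_mat[of _ n n]) (auto simp: mult_smult_distrib[of _ n n _ n])
  finally have 1: "?S y * A = ?z \<cdot>\<^sub>m (?Q * M * ?R) - ?Q * M" .
  have "mat_adjoint A * ?S y = mat_adjoint A * ?Q * (M * ?R)"
   by (rule assoc_mult_mat[OF Ac c(2) mult_carrier_mat[OF M c(1)], symmetric])
  also have "\<dots> = - ?z \<cdot>\<^sub>m (?Q * M * ?R) - M * ?R" unfolding AR
   using c M by (subst minus_mult_distrib_mat[of _ n n]) (auto simp: mult_smult_assoc_mat[of _ n n _ n] assoc_mult_mat[of _ n n _ n _ n])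
  finally have 2: "mat_adjoint A * ?S y = - ?z \<cdot>\<^sub>m (?Q * M * ?R) - M * ?R" .
  show ?thesis unfolding 1 2 using c M by (intro eq_matI) auto
 qed
 have i: "integrable lborel (%y. ?S y $$ (a, b))" if "a < n" "b < n" for a b
  by (rule integrable_axis_gram[OF M that])
 have ex: "- ((mat_adjoint (R y) * M) $$ (j, l) + (M * R y) $$ (j, l)) =
  (\<Sum>k<n. ?S y $$ (j, k) * A $$ (k, l)) + (\<Sum>k<n. mat_adjoint A $$ (j, k) * ?S y $$ (k, l))" for y
 proof -
  have "- ((mat_adjoint (R y) * M) $$ (j, l) + (M * R y) $$ (j, l)) = (?S y * A + mat_adjoint A * ?S y) $$ (j, l)"
   unfolding e using R[of y] M jl by simp
  also have "\<dots> = (?S y * A) $$ (j, l) + (mat_adjoint A * ?S y) $$ (j, l)"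
   using mult_carrier_mat[OF Ac Sc[of y]] jl by (intro index_add_mat) auto
  finally show ?thesis unfolding mult_mat_index_sum[OF Sc A jl] mult_mat_index_sum[OF Ac Sc jl] .
 qed
 let ?f = "%y. (\<Sum>k<n. ?S y $$ (j, k) * A $$ (k, l)) + (\<Sum>k<n. mat_adjoint A $$ (j, k) * ?S y $$ (k, l))"
 have fi: "integrable lborel ?f"
  using i jl by (intro Bochner_Integration.integrable_add Bochner_Integration.integrable_sum integrable_mult_left integrable_mult_right) auto
 have "((%T. integral {-T..T} ?f) \<longlongrightarrow> 2 * pi * M $$ (j, l)) at_top"
  using pv_linear[OF M jl] unfolding ex .
 from tendsto_unique[OF _ this tendsto_integral_symmetric[OF fi]]
 have "2 * pi * M $$ (j, l) = (\<integral>y. ?f y \<partial>lborel)" by simp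
 also have "\<dots> = (\<Sum>k<n. (\<integral>y. ?S y $$ (j, k) \<partial>lborel) * A $$ (k, l)) + (\<Sum>k<n. mat_adjoint A $$ (j, k) * (\<integral>y. ?S y $$ (k, l) \<partial>lborel))"
 proof -
  have 1: "integrable lborel (%y. \<Sum>k<n. ?S y $$ (j, k) * A $$ (k, l))"
   "integrable lborel (%y. \<Sum>k<n. mat_adjoint A $$ (j, k) * ?S y $$ (k, l))"
   using i jl by (intro Bochner_Integration.integrable_sum integrable_mult_left integrable_mult_right; simp)+
  have 2: "(\<integral>y. (\<Sum>k<n. ?S y $$ (j, k) * A $$ (k, l)) \<partial>lborel) = (\<Sum>k<n. \<integral>y. ?S y $$ (j, k) * A $$ (k, l) \<partial>lborel)"
   "(\<integral>y. (\<Sum>k<n. mat_adjoint A $$ (j, k) * ?S y $$ (k, l)) \<partial>lborel) = (\<Sum>k<n. \<integral>y. mat_adjoint A $$ (j, k) * ?S y $$ (k, l) \<partial>lborel)"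
   using i jl by (intro Bochner_Integration.integral_sum integrable_mult_left integrable_mult_right; simp)+
  show ?thesis unfolding Bochner_Integration.integral_add[OF 1] 2
   by (simp only: integral_mult_left_zero integral_mult_right_zero)
 qed
 also have "\<dots> = 2 * pi * ((\<Sum>k<n. ?G $$ (j, k) * A $$ (k, l)) + (\<Sum>k<n. mat_adjoint A $$ (j, k) * ?G $$ (k, l)))"
  using jl by (simp add: axis_gram_def sum_distrib_left distrib_left)
 also have "(\<Sum>k<n. ?G $$ (j, k) * A $$ (k, l)) + (\<Sum>k<n. mat_adjoint A $$ (j, k) * ?G $$ (k, l)) = (?G * A) $$ (j, l) + (mat_adjoint A * ?G) $$ (j, l)"
  unfolding mult_mat_index_sum[OF Gc A jl] mult_mat_index_sum[OF Ac Gc jl] ..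
 also have "\<dots> = (?G * A + mat_adjoint A * ?G) $$ (j, l)"
  using mult_carrier_mat[OF Ac Gc] jl by (intro index_add_mat(1)[symmetric]) auto
 finally show "(?G * A + mat_adjoint A * ?G) $$ (j, l) = M $$ (j, l)" by simp
qed (use A M in \<open>auto simp: axis_gram_def\<close>)

end

lemma axis_gram_carrier [simp]: "axis_gram n A M \<in> carrier_mat n n"
 by (simp add: axis_gram_def)

section \<open>Pairings of L2 and Hardy functions with C (z - A)^-1 v\<close>

definition rfun :: "complex mat => complex mat => complex vec => complex => complex vec"
 where "rfun C A v z = (C * resolvent A z) *\<^sub>v v"

definition vinner :: "nat => (real => complex vec) => (real => complex vec) => complex"
 where "vinner d F G = (\<Sum>i<d. inner2 (%y. F y $ i) (%y. G y $ i))"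

text \<open>The left side of the interpolation condition in \<open>M_space\<close>, one coordinate
  at a time.\<close>

definition residue_sum :: "complex mat => complex mat => (complex => complex vec) => nat => complex"
 where "residue_sum Z B h j = (\<Sum>\<^sub>\<infinity>z0\<in>\<Pi>\<^sub>+. residue (%z. ((resolvent Z z * B) *\<^sub>v h z) $ j) z0)"

lemma inner2_cnj: "inner2 g f = cnj (inner2 f g)"
 unfolding inner2_def by (subst Bochner_Integration.integral_cnj[symmetric]) (simp add: mult.commute)

lemma inner2_integrable: "sq_int f ==> sq_int g ==> integrable lborel (%y. f y * cnj (g y))"
 by (intro sq_int_mult_integrable(1) sq_int_cnj)

lemma inner2_add_left:
 "sq_int f ==> sq_int g ==> sq_int h ==> inner2 (%y. f y + g y) h = inner2 f h + inner2 g h"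
 unfolding inner2_def by (simp add: inner2_integrable distrib_right)

lemma inner2_cmult_left: "inner2 (%y. c * f y) h = c * inner2 f h"
 unfolding inner2_def by (simp add: mult.assoc)

lemma L2_imag_dim: "F \<in> L2_imag d ==> dim_vec (F y) = d"
 by (simp add: L2_imag_def)

lemma L2_imag_add:
 assumes "F \<in> L2_imag d" "G \<in> L2_imag d" shows "(%y. F y + G y) \<in> L2_imag d"
proof -
 have "(F y + G y) $ i = F y $ i + G y $ i" if "i < d" for i y
  using that L2_imag_dim[OF assms(2)] by simp
 then show ?thesis using assms by (simp add: L2_imag_iff sq_int_add)
qed

lemma L2_imag_smult:
 assumes "F \<in> L2_imag d" shows "(%y. c \<cdot>\<^sub>v F y) \<in> L2_imag d"
proof -
 have "(c \<cdot>\<^sub>v F y) $ i = c * F y $ i" if "i < d" for i y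
  using that L2_imag_dim[OF assms] by simp
 then show ?thesis using assms by (simp add: L2_imag_iff sq_int_cmult)
qed

lemma L2_imag_diff:
 assumes "F \<in> L2_imag d" "G \<in> L2_imag d" shows "(%y. F y - G y) \<in> L2_imag d"
proof -
 have "(F y - G y) $ i = F y $ i - G y $ i" if "i < d" for i y
  using that L2_imag_dim[OF assms(2)] by simp
 then show ?thesis using assms by (simp add: L2_imag_iff sq_int_diff)
qed

lemma L2_imag_zero: "(%y. 0\<^sub>v d) \<in> L2_imag d"
 by (auto simp: L2_imag_iff sq_int_def)

lemma L2_imag_carrier: "F \<in> L2_imag d ==> F y \<in> carrier_vec d"
 by (simp add: L2_imag_iff)

lemma vinner_cnj: "vinner d G F = cnj (vinner d F G)"
 unfolding vinner_def by (simp add: inner2_cnj[of "%y. F y $ _"])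

lemma vinner_add_left:
 assumes "F \<in> L2_imag d" "G \<in> L2_imag d" "H \<in> L2_imag d"
 shows "vinner d (%y. F y + G y) H = vinner d F H + vinner d G H"
proof -
 have "inner2 (%y. (F y + G y) $ i) (%y. H y $ i) = inner2 (%y. F y $ i) (%y. H y $ i) + inner2 (%y. G y $ i) (%y. H y $ i)"
  if "i < d" for i
 proof -
  have "(F y + G y) $ i = F y $ i + G y $ i" for y
   using that L2_imag_carrier[OF assms(2), of y] by simp
  then show ?thesis using assms that by (simp add: inner2_add_left L2_imag_iff)
 qed
 then show ?thesis unfolding vinner_def by (simp add: sum.distrib)
qed

lemma vinner_smult_left:
 assumes "F \<in> L2_imag d"
 shows "vinner d (%y. c \<cdot>\<^sub>v F y) H = c * vinner d F H"
proof -
 have "inner2 (%y. (c \<cdot>\<^sub>v F y) $ i) (%y. H y $ i) = c * inner2 (%y. F y $ i) (%y. H y $ i)" if "i < d" for i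
 proof -
  have "(c \<cdot>\<^sub>v F y) $ i = c * F y $ i" for y
   using that L2_imag_carrier[OF assms(1), of y] by simp
  then show ?thesis by (simp add: inner2_cmult_left)
 qed
 then show ?thesis unfolding vinner_def by (simp add: sum_distrib_left)
qed

lemma vinner_diff_left:
 assumes "F \<in> L2_imag d" "G \<in> L2_imag d" "H \<in> L2_imag d"
 shows "vinner d (%y. F y - G y) H = vinner d F H - vinner d G H"
proof -
 have "F y - G y = F y + (-1) \<cdot>\<^sub>v G y" for y
  using L2_imag_carrier[OF assms(1), of y] L2_imag_carrier[OF assms(2), of y] by (intro eq_vecI) auto
 then show ?thesis
  using vinner_add_left[OF assms(1) L2_imag_smult[OF assms(2)] assms(3), of "-1"] vinner_smult_left[OF assms(2), of "-1" H] by simp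
qed

lemma vinner_add_right:
 assumes "F \<in> L2_imag d" "G \<in> L2_imag d" "H \<in> L2_imag d"
 shows "vinner d H (%y. F y + G y) = vinner d H F + vinner d H G"
 using vinner_add_left[OF assms] by (simp add: vinner_cnj[of d H])

lemma vinner_diff_right:
 assumes "F \<in> L2_imag d" "G \<in> L2_imag d" "H \<in> L2_imag d"
 shows "vinner d H (%y. F y - G y) = vinner d H F - vinner d H G"
 using vinner_diff_left[OF assms] by (simp add: vinner_cnj[of d H])

lemma vinner_smult_right:
 assumes "F \<in> L2_imag d"
 shows "vinner d H (%y. c \<cdot>\<^sub>v F y) = cnj c * vinner d H F"
 using vinner_smult_left[OF assms, of c H] by (simp add: vinner_cnj[of d H])

lemma vinner_eq_integral:
 assumes "F \<in> L2_imag d" "G \<in> L2_imag d"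
 shows "vinner d F G = (\<integral>y. F y \<bullet>c G y \<partial>lborel)" "integrable lborel (%y. F y \<bullet>c G y)"
proof -
 have e: "F y \<bullet>c G y = (\<Sum>i<d. F y $ i * cnj (G y $ i))" for y
  by (rule cscalar_prod_sum[OF L2_imag_carrier[OF assms(2)]])
 have i: "integrable lborel (%y. F y $ i * cnj (G y $ i))" if "i < d" for i
  using assms that by (intro inner2_integrable) (auto simp: L2_imag_iff)
 show "vinner d F G = (\<integral>y. F y \<bullet>c G y \<partial>lborel)"
  unfolding e vinner_def inner2_def using i by (intro Bochner_Integration.integral_sum[symmetric]) auto
 show "integrable lborel (%y. F y \<bullet>c G y)"
  unfolding e using i by (intro Bochner_Integration.integrable_sum) auto
qed

lemma vinner_self:
 assumes "F \<in> L2_imag d"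
 shows "vinner d F F = complex_of_real (\<integral>y. vnorm2 (F y) \<partial>lborel)"
 unfolding vinner_eq_integral(1)[OF assms assms] cscalar_prod_self by simp

lemma vinner_self_nonneg: "F \<in> L2_imag d ==> 0 \<le> Re (vinner d F F)" "F \<in> L2_imag d ==> Im (vinner d F F) = 0"
 by (simp_all add: vinner_self integral_nonneg_AE vnorm2_nonneg)

lemma vinner_self_eq_0:
 assumes "F \<in> L2_imag d" "Re (vinner d F F) = 0"
 shows "AE y in lborel. F y = 0\<^sub>v d"
proof -
 have "(\<integral>y. vnorm2 (F y) \<partial>lborel) = 0" using assms by (simp add: vinner_self)
 moreover have "integrable lborel (%y. vnorm2 (F y))" using assms(1) by (simp add: L2_imag_def)
 ultimately have "AE y in lborel. vnorm2 (F y) = 0"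
  by (subst (asm) integral_nonneg_eq_0_iff_AE) (auto simp: vnorm2_nonneg)
 then show ?thesis using vnorm2_eq_0_iff[OF L2_imag_carrier[OF assms(1)]] by simp
qed

lemma vinner_cong_AE:
 assumes "AE y in lborel. F y = F' y" "F \<in> L2_imag d" "F' \<in> L2_imag d" "G \<in> L2_imag d"
 shows "vinner d F G = vinner d F' G"
 unfolding vinner_eq_integral(1)[OF assms(2,4)] vinner_eq_integral(1)[OF assms(3,4)]
proof (rule integral_cong_AE)
 show "AE y in lborel. F y \<bullet>c G y = F' y \<bullet>c G y" using assms(1) by eventually_elim simp
qed (rule borel_measurable_integrable[OF vinner_eq_integral(2)[OF assms(2,4)]],
  rule borel_measurable_integrable[OF vinner_eq_integral(2)[OF assms(3,4)]])

lemma hardy_pair_cong: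
 assumes hp: "hardy_pair f F" and FG: "!!y. G y = F y" and fg: "!!z. z \<in> \<Pi>\<^sub>+ ==> g z = f z"
 shows "hardy_pair g G"
proof -
 have G: "G = F" using FG by (rule ext)
 have e: "g (Complex x y) = f (Complex x y)" if "x > 0" for x y
  using that fg by (simp add: right_half_plane_def)
 have "g holomorphic_on \<Pi>\<^sub>+"
  by (rule holomorphic_transform[of f]) (use hp fg in \<open>auto simp: hardy_pair_def\<close>)
 moreover have "((%x. \<integral>y. (cmod (g (Complex x y) - F y))\<^sup>2 \<partial>lborel) \<longlongrightarrow> 0) (at_right 0)"
 proof (rule Lim_transform_eventually)
  show "((%x. \<integral>y. (cmod (f (Complex x y) - F y))\<^sup>2 \<partial>lborel) \<longlongrightarrow> 0) (at_right 0)"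
   using hp by (simp add: hardy_pair_def)
  show "\<forall>\<^sub>F x in at_right 0. (\<integral>y. (cmod (f (Complex x y) - F y))\<^sup>2 \<partial>lborel) = (\<integral>y. (cmod (g (Complex x y) - F y))\<^sup>2 \<partial>lborel)"
   using eventually_at_right_less[of 0] by (rule eventually_mono) (simp add: e)
 qed
 ultimately show ?thesis using hp e unfolding hardy_pair_def G by simp
qed

lemma hardy_vec_L2: "hardy_vec d h H ==> H \<in> L2_imag d"
 by (simp add: hardy_vec_def boundary_value_def)

lemma hardy_vec_dim:
 assumes "hardy_vec d h H"
 shows "dim_vec (H y) = d" "z \<in> \<Pi>\<^sub>+ ==> dim_vec (h z) = d"
 by (rule carrier_vecD, use assms in \<open>simp add: hardy_vec_iff\<close>)+

lemma hardy_vec_add: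
 assumes "hardy_vec d h H" "hardy_vec d g G"
 shows "hardy_vec d (%z. h z + g z) (%y. H y + G y)"
 unfolding hardy_vec_iff
proof (intro conjI ballI allI impI)
 fix i assume i: "i < d"
 have "hardy_pair (%z. h z $ i + g z $ i) (%y. H y $ i + G y $ i)"
  using assms i by (intro hardy_pair_add) (auto simp: hardy_vec_iff)
 moreover have "(H y + G y) $ i = H y $ i + G y $ i" for y
  using i hardy_vec_dim(1)[OF assms(2)] by simp
 moreover have "(h z + g z) $ i = h z $ i + g z $ i" if "z \<in> \<Pi>\<^sub>+" for z
  using i hardy_vec_dim(2)[OF assms(2) that] by simp
 ultimately show "hardy_pair (%z. (h z + g z) $ i) (%y. (H y + G y) $ i)"
  by (rule hardy_pair_cong)
qed (use assms in \<open>auto simp: hardy_vec_iff\<close>)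

lemma hardy_vec_smult:
 assumes "hardy_vec d h H"
 shows "hardy_vec d (%z. c \<cdot>\<^sub>v h z) (%y. c \<cdot>\<^sub>v H y)"
 unfolding hardy_vec_iff
proof (intro conjI ballI allI impI)
 fix i assume i: "i < d"
 have "hardy_pair (%z. c * h z $ i) (%y. c * H y $ i)"
  using assms i by (intro hardy_pair_cmult) (auto simp: hardy_vec_iff)
 moreover have "(c \<cdot>\<^sub>v H y) $ i = c * H y $ i" for y
  using i hardy_vec_dim(1)[OF assms] by simp
 moreover have "(c \<cdot>\<^sub>v h z) $ i = c * h z $ i" if "z \<in> \<Pi>\<^sub>+" for z
  using i hardy_vec_dim(2)[OF assms that] by simp
 ultimately show "hardy_pair (%z. (c \<cdot>\<^sub>v h z) $ i) (%y. (c \<cdot>\<^sub>v H y) $ i)"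
  by (rule hardy_pair_cong)
qed (use assms in \<open>auto simp: hardy_vec_iff\<close>)

lemma rfun_carrier: "C \<in> carrier_mat d n ==> rfun C A v z \<in> carrier_vec d"
 by (intro carrier_vecI) (simp add: rfun_def)

lemma rfun_index:
 assumes A: "A \<in> carrier_mat n n" and C: "C \<in> carrier_mat d n" and v: "v \<in> carrier_vec n"
  and z: "z \<notin> spectrum A" and i: "i < d"
 shows "rfun C A v z $ i = (\<Sum>j<n. v $ j * (C * resolvent A z) $$ (i, j))"
 unfolding rfun_def
 using mult_mat_vec_index_sum[OF mult_carrier_mat[OF C resolvent_props(1)[OF A z]] v i] by (simp add: mult.commute)

lemma rfun_holomorphic:
 assumes A: "A \<in> carrier_mat n n" and C: "C \<in> carrier_mat d n" and v: "v \<in> carrier_vec n" and i: "i < d"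
 shows "(%z. rfun C A v z $ i) holomorphic_on - spectrum A" "decays (%z. rfun C A v z $ i)"
proof -
 have e: "(\<Sum>j<n. v $ j * (C * resolvent A z) $$ (i, j)) = rfun C A v z $ i" if "z \<notin> spectrum A" for z
  using rfun_index[OF A C v that i] by simp
 have "(%z. \<Sum>j<n. v $ j * (C * resolvent A z) $$ (i, j)) holomorphic_on - spectrum A"
  by (intro holomorphic_on_sum holomorphic_on_mult holomorphic_on_const mult_resolvent_right[OF A C i]) auto
 then show "(%z. rfun C A v z $ i) holomorphic_on - spectrum A"
  by (rule holomorphic_transform) (use e in auto)
 show "decays (%z. rfun C A v z $ i)"
  by (rule decays_cong[OF _ finite_spectrum[OF A] e], intro decays_sum decays_cmult mult_resolvent_right[OF A C i]) auto
qed

lemma rfun_L2: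
 assumes A: "A \<in> carrier_mat n n" and C: "C \<in> carrier_mat d n" and v: "v \<in> carrier_vec n"
  and sp: "!!s. s \<in> spectrum A ==> Re s \<noteq> 0"
 shows "(%y. rfun C A v (Complex 0 y)) \<in> L2_imag d"
 unfolding L2_imag_iff
proof (intro conjI allI impI)
 show "rfun C A v (Complex 0 y) \<in> carrier_vec d" for y by (rule rfun_carrier[OF C])
 show "sq_int (%y. rfun C A v (Complex 0 y) $ i)" if "i < d" for i
  by (rule sq_int_axis[OF rfun_holomorphic(1)[OF A C v that] finite_spectrum[OF A] sp rfun_holomorphic(2)[OF A C v that]])
qed

lemma rfun_hardy:
 assumes A: "A \<in> carrier_mat n n" and C: "C \<in> carrier_mat d n" and v: "v \<in> carrier_vec n"
  and sp: "!!s. s \<in> spectrum A ==> Re s < 0"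
 shows "hardy_vec d (rfun C A v) (%y. rfun C A v (Complex 0 y))"
 unfolding hardy_vec_iff
proof (intro conjI allI impI ballI)
 show "rfun C A v z \<in> carrier_vec d" for z by (rule rfun_carrier[OF C])
 show "rfun C A v (Complex 0 y) \<in> carrier_vec d" for y by (rule rfun_carrier[OF C])
 show "hardy_pair (%z. rfun C A v z $ i) (%y. rfun C A v (Complex 0 y) $ i)" if "i < d" for i
  by (rule hardy_pair_rational[OF rfun_holomorphic(1)[OF A C v that, unfolded Compl_eq_Diff_UNIV] finite_spectrum[OF A] sp rfun_holomorphic(2)[OF A C v that]])
qed

lemma residue_finite_sum:
 assumes "finite I" "open S" "z \<in> S" "!!i. i \<in> I ==> f i holomorphic_on S - {z}"
 shows "residue (%w. \<Sum>i\<in>I. f i w) z = (\<Sum>i\<in>I. residue (f i) z)"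
 using assms(1,4)
proof (induction I)
 case (insert x F)
 have "residue (%w. f x w + (\<Sum>i\<in>F. f i w)) z = residue (f x) z + residue (%w. \<Sum>i\<in>F. f i w) z"
  by (rule residue_add[OF assms(2,3)]) (auto intro!: holomorphic_on_sum insert.prems)
 then show ?case using insert by simp
qed (simp add: residue_const)

text \<open>Off the spectrum of \<open>Z\<close> the integrand is holomorphic, so the infinite sum
  lives on finitely many points. Expanding the matrix product is legitimate only off the spectrum,
  which suffices because residues see only a punctured neighbourhood.\<close>

lemma residue_sum_eq:
 fixes h :: "complex => complex vec"
 assumes Z: "Z \<in> carrier_mat n n" and B: "B \<in> carrier_mat n d" and j: "j < n"
  and hc: "!!z. z \<in> \<Pi>\<^sub>+ ==> h z \<in> carrier_vec d"
  and hh: "!!i. i < d ==> (%z. h z $ i) holomorphic_on \<Pi>\<^sub>+"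
 shows "residue_sum Z B h j =
  (\<Sum>s | s \<in> spectrum Z \<and> Re s > 0. \<Sum>i<d. residue (%z. (resolvent Z z * B) $$ (j, i) * h z $ i) s)"
proof -
 let ?f = "%z. ((resolvent Z z * B) *\<^sub>v h z) $ j"
 let ?g = "%i z. (resolvent Z z * B) $$ (j, i) * h z $ i"
 let ?S = "{s. s \<in> spectrum Z \<and> Re s > 0}"
 have fin: "finite (spectrum Z)" by (rule finite_spectrum[OF Z])
 have opP: "open \<Pi>\<^sub>+" unfolding right_half_plane_def by (simp add: open_halfspace_Re_gt)
 have e: "?f z = (\<Sum>i<d. ?g i z)" if "z \<in> \<Pi>\<^sub>+ - spectrum Z" for z
  by (rule mult_mat_vec_index_sum[OF mult_carrier_mat[OF resolvent_props(1)[OF Z] B] hc j]) (use that in auto)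
 have hol: "?g i holomorphic_on \<Pi>\<^sub>+ - spectrum Z" if "i < d" for i
  by (intro holomorphic_on_mult holomorphic_on_subset[OF mult_resolvent_left(1)[OF Z B j that]] holomorphic_on_subset[OF hh[OF that]]) auto
 have res: "residue ?f s = (\<Sum>i<d. residue (?g i) s)" if s: "s \<in> \<Pi>\<^sub>+" for s
 proof -
  \<comment> \<open>Removing the other spectral points leaves an open set in which \<open>s\<close>
    is the only possible singularity.\<close>
  define T where "T = \<Pi>\<^sub>+ - (spectrum Z - {s})"
  have T: "open T" "s \<in> T" "T - {s} \<subseteq> \<Pi>\<^sub>+ - spectrum Z"
   using opP fin s unfolding T_def by (auto intro!: open_Diff finite_imp_closed)
  have "eventually (%z. z \<in> T - {s}) (at s)"
   using T(1,2) by (auto simp: eventually_at_topological)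
  then have "eventually (%z. ?f z = (\<Sum>i<d. ?g i z)) (at s)"
   by (rule eventually_mono) (use e T(3) in blast)
  then have "residue ?f s = residue (%z. \<Sum>i<d. ?g i z) s" by (rule residue_cong) simp
  also have "\<dots> = (\<Sum>i<d. residue (?g i) s)"
   using T by (intro residue_finite_sum[of _ T] holomorphic_on_subset[OF hol]) auto
  finally show ?thesis .
 qed
 have zero: "residue ?f s = 0" if "s \<in> \<Pi>\<^sub>+ - spectrum Z" for s
 proof -
  have "open (\<Pi>\<^sub>+ - spectrum Z)" using opP fin by (auto intro!: open_Diff finite_imp_closed)
  then have "residue (?g i) s = 0" if "i < d" for i
   using hol[OF that] \<open>s \<in> \<Pi>\<^sub>+ - spectrum Z\<close> by (intro residue_holo)
  then show ?thesis using res[of s] that by simp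
 qed
 have "residue_sum Z B h j = infsum (residue ?f) ?S"
  unfolding residue_sum_def
  by (rule infsum_cong_neutral) (use zero in \<open>auto simp: right_half_plane_def\<close>)
 also have "\<dots> = (\<Sum>s\<in>?S. residue ?f s)" using fin by (intro infsum_finite) simp
 also have "\<dots> = (\<Sum>s\<in>?S. \<Sum>i<d. residue (?g i) s)"
  by (intro sum.cong refl res) (auto simp: right_half_plane_def)
 finally show ?thesis .
qed

text \<open>Conjugation maps iy to -iy, so on the axis the adjoint of C R_A is -R_Z C^* with Z =
  -A^*. The pairing thus becomes an integral of the Hardy function against a resolvent, and the
  minus sign cancels the clockwise orientation in \<open>hardy_pair_residue\<close>.\<close>

theorem vinner_rfun:
 assumes A: "A \<in> carrier_mat n n" and C: "C \<in> carrier_mat d n" and v: "v \<in> carrier_vec n"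
  and sp: "!!s. s \<in> spectrum A ==> Re s \<noteq> 0" and hv: "hardy_vec d h H"
 shows "vinner d H (%y. rfun C A v (Complex 0 y)) =
  2 * pi * (\<Sum>j<n. cnj (v $ j) * residue_sum (- mat_adjoint A) (mat_adjoint C) h j)"
proof -
 define Z where "Z = - mat_adjoint A"
 define B where "B = mat_adjoint C"
 have Z: "Z \<in> carrier_mat n n" and B: "B \<in> carrier_mat n d" using A C by (auto simp: Z_def B_def)
 have spZ: "s \<in> spectrum Z \<longleftrightarrow> - cnj s \<in> spectrum A" for s
  unfolding Z_def using A by (simp add: spectrum_uminus_iff[of _ n] spectrum_adjoint_iff[of _ n])
 have spZ0: "Re s \<noteq> 0" if "s \<in> spectrum Z" for s using sp[of "- cnj s"] that spZ by simp
 have notin: "Complex 0 y \<notin> spectrum A" "Complex 0 y \<notin> spectrum Z" for y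
  using sp[of "Complex 0 y"] spZ0[of "Complex 0 y"] by auto
 have R: "resolvent A (Complex 0 y) \<in> carrier_mat n n" for y using resolvent_props(1)[OF A notin(1)] .
 have adj: "mat_adjoint (C * resolvent A (Complex 0 y)) = - (resolvent Z (Complex 0 y) * B)" for y
 proof -
  have i: "- Complex 0 y = cnj (Complex 0 y)" by (simp add: complex_eq_iff)
  have "resolvent Z (Complex 0 y) = - resolvent (mat_adjoint A) (- Complex 0 y)"
   unfolding Z_def using notin(1)[of y] A
   by (intro resolvent_uminus(1)) (auto simp: spectrum_adjoint_iff[of _ n] i)
  also have "resolvent (mat_adjoint A) (- Complex 0 y) = mat_adjoint (resolvent A (Complex 0 y))"
   using resolvent_adjoint(1)[OF A, of "- Complex 0 y"] notin(1)[of y] unfolding i by simp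
  finally have "resolvent Z (Complex 0 y) = - mat_adjoint (resolvent A (Complex 0 y))" .
  moreover have "dim_col (mat_adjoint (resolvent A (Complex 0 y))) = dim_row (mat_adjoint C)"
   using C R[of y] by simp
  ultimately show ?thesis unfolding B_def mat_adjoint_mult[OF C R]
   by (simp only: uminus_mult_left_mat uminus_uminus_mat)
 qed
 let ?\<rho> = "%j i z. (resolvent Z z * B) $$ (j, i)"
 have hp: "hardy_pair (%z. h z $ i) (%y. H y $ i)" if "i < d" for i using hv that by (simp add: hardy_vec_iff)
 have sqH: "sq_int (%y. H y $ i)" if "i < d" for i using hp[OF that] by (simp add: hardy_pair_def)
 have r: "sq_int (%y. ?\<rho> j i (Complex 0 y))"
  "(\<integral>y. ?\<rho> j i (Complex 0 y) * H y $ i \<partial>lborel) = - 2 * pi * (\<Sum>s | s \<in> spectrum Z \<and> Re s > 0. residue (%z. ?\<rho> j i z * h z $ i) s)"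
  if ij: "i < d" "j < n" for i j
 proof -
  obtain K T where KT: "!!z. T \<le> cmod z ==> cmod (?\<rho> j i z) \<le> K / cmod z"
   using mult_resolvent_left(2)[OF Z B ij(2,1)] unfolding decays_def by blast
  note q = hardy_pair_residue[OF hp[OF ij(1)] mult_resolvent_left(1)[OF Z B ij(2,1), unfolded Compl_eq_Diff_UNIV] finite_spectrum[OF Z] spZ0 KT]
  show "sq_int (%y. ?\<rho> j i (Complex 0 y))" by (rule q(1))
  show "(\<integral>y. ?\<rho> j i (Complex 0 y) * H y $ i \<partial>lborel) = - 2 * pi * (\<Sum>s | s \<in> spectrum Z \<and> Re s > 0. residue (%z. ?\<rho> j i z * h z $ i) s)"
   by (rule q(2))
 qed
 have "inner2 (%y. H y $ i) (%y. rfun C A v (Complex 0 y) $ i) =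
  2 * pi * (\<Sum>j<n. cnj (v $ j) * (\<Sum>s | s \<in> spectrum Z \<and> Re s > 0. residue (%z. ?\<rho> j i z * h z $ i) s))" if i: "i < d" for i
 proof -
  have "H y $ i * cnj (rfun C A v (Complex 0 y) $ i) = (\<Sum>j<n. - cnj (v $ j) * (?\<rho> j i (Complex 0 y) * H y $ i))" for y
  proof -
   have c: "cnj ((C * resolvent A (Complex 0 y)) $$ (i, j)) = - ?\<rho> j i (Complex 0 y)" if "j < n" for j
   proof -
    have "mat_adjoint (C * resolvent A (Complex 0 y)) $$ (j, i) = cnj ((C * resolvent A (Complex 0 y)) $$ (i, j))"
     using C R[of y] i that by (intro mat_adjoint_index) auto
    moreover have "(- (resolvent Z (Complex 0 y) * B)) $$ (j, i) = - ?\<rho> j i (Complex 0 y)"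
     using resolvent_props(1)[OF Z notin(2)[of y]] B i that by (intro index_uminus_mat(1)) auto
    ultimately show ?thesis unfolding adj by simp
   qed
   show ?thesis unfolding rfun_index[OF A C v notin(1) i] cnj_sum sum_distrib_left
    by (intro sum.cong refl) (simp add: c)
  qed
  then have "inner2 (%y. H y $ i) (%y. rfun C A v (Complex 0 y) $ i) =
   (\<integral>y. (\<Sum>j<n. - cnj (v $ j) * (?\<rho> j i (Complex 0 y) * H y $ i)) \<partial>lborel)" unfolding inner2_def by presburger
  also have "\<dots> = (\<Sum>j<n. \<integral>y. - cnj (v $ j) * (?\<rho> j i (Complex 0 y) * H y $ i) \<partial>lborel)"
   using r(1)[OF i] sqH[OF i] by (intro Bochner_Integration.integral_sum integrable_mult_right sq_int_mult_integrable(1)) auto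
  also have "\<dots> = (\<Sum>j<n. - cnj (v $ j) * (- 2 * pi * (\<Sum>s | s \<in> spectrum Z \<and> Re s > 0. residue (%z. ?\<rho> j i z * h z $ i) s)))"
   using r(2)[OF i] by (intro sum.cong refl) simp
  finally show ?thesis by (simp add: sum_distrib_left mult.left_commute)
 qed
 then have "vinner d H (%y. rfun C A v (Complex 0 y)) =
  (\<Sum>i<d. 2 * pi * (\<Sum>j<n. cnj (v $ j) * (\<Sum>s | s \<in> spectrum Z \<and> Re s > 0. residue (%z. ?\<rho> j i z * h z $ i) s)))"
  unfolding vinner_def by simp
 also have "\<dots> = 2 * pi * (\<Sum>j<n. cnj (v $ j) * (\<Sum>i<d. \<Sum>s | s \<in> spectrum Z \<and> Re s > 0. residue (%z. ?\<rho> j i z * h z $ i) s))"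
  unfolding sum_distrib_left[symmetric] by (subst sum.swap) (simp only: sum_distrib_left)
 also have "(%j. \<Sum>i<d. \<Sum>s | s \<in> spectrum Z \<and> Re s > 0. residue (%z. ?\<rho> j i z * h z $ i) s)
  = (%j. \<Sum>s | s \<in> spectrum Z \<and> Re s > 0. \<Sum>i<d. residue (%z. ?\<rho> j i z * h z $ i) s)"
  by (rule ext) (rule sum.swap)
 also have "(\<Sum>j<n. cnj (v $ j) * (\<Sum>s | s \<in> spectrum Z \<and> Re s > 0. \<Sum>i<d. residue (%z. ?\<rho> j i z * h z $ i) s))
  = (\<Sum>j<n. cnj (v $ j) * residue_sum Z B h j)"
  using hv hp by (intro sum.cong refl, subst residue_sum_eq[OF Z B]) (auto simp: hardy_vec_iff hardy_pair_def)
 finally show ?thesis unfolding Z_def B_def .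
qed

text \<open>The matrix -A^* has no spectrum in the right half-plane, so no residues occur: functions
  with poles on the right are orthogonal to the Hardy space.\<close>

lemma vinner_rfun_orthogonal:
 assumes A: "A \<in> carrier_mat n n" and C: "C \<in> carrier_mat d n" and v: "v \<in> carrier_vec n"
  and sp: "spectrum A \<subseteq> \<Pi>\<^sub>+" and hv: "hardy_vec d h H"
 shows "vinner d H (%y. rfun C A v (Complex 0 y)) = 0"
proof -
 have "{s. s \<in> spectrum (- mat_adjoint A) \<and> Re s > 0} = {}"
  using sp A by (auto simp: spectrum_uminus_iff[of _ n] spectrum_adjoint_iff[of _ n] right_half_plane_def)
 then have "residue_sum (- mat_adjoint A) (mat_adjoint C) h j = 0" if "j < n" for j
 proof -
  have "residue_sum (- mat_adjoint A) (mat_adjoint C) h j = (\<Sum>s | s \<in> spectrum (- mat_adjoint A) \<and> Re s > 0.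
   \<Sum>i<d. residue (%z. (resolvent (- mat_adjoint A) z * mat_adjoint C) $$ (j, i) * h z $ i) s)"
   using A C that hv by (intro residue_sum_eq[of _ n]) (auto simp: hardy_vec_iff hardy_pair_def)
  then show ?thesis unfolding \<open>{s. s \<in> spectrum (- mat_adjoint A) \<and> Re s > 0} = {}\<close> by simp
 qed
 moreover have "Re s \<noteq> 0" if "s \<in> spectrum A" for s using sp that by (auto simp: right_half_plane_def)
 ultimately show ?thesis using vinner_rfun[OF A C v _ hv] by simp
qed

theorem vinner_rfun_gram:
 assumes A: "A \<in> carrier_mat n n" and C: "C \<in> carrier_mat d n" and sp: "spectrum A \<subseteq> \<Pi>\<^sub>+"
  and v: "v \<in> carrier_vec n" and w: "w \<in> carrier_vec n"
 shows "vinner d (%y. rfun C A v (Complex 0 y)) (%y. rfun C A w (Complex 0 y)) =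
  2 * pi * ((axis_gram n A (mat_adjoint C * C) *\<^sub>v v) \<bullet>c w)"
proof -
 let ?R = "%y. resolvent A (Complex 0 y)"
 let ?M = "mat_adjoint C * C"
 let ?S = "%y. mat_adjoint (?R y) * (?M * ?R y)"
 have R: "?R y \<in> carrier_mat n n" for y using resolvent_props(1)[OF A axis_notin_spectrum[OF sp]] .
 have M: "?M \<in> carrier_mat n n" using C by auto
 have S: "?S y \<in> carrier_mat n n" for y using mult_carrier_mat[OF mat_adjoint_carrier[OF R] mult_carrier_mat[OF M R]] .
 have sp0: "Re s \<noteq> 0" if "s \<in> spectrum A" for s using sp that by (auto simp: right_half_plane_def)
 have L: "(%y. rfun C A v (Complex 0 y)) \<in> L2_imag d" "(%y. rfun C A w (Complex 0 y)) \<in> L2_imag d"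
  using rfun_L2[OF A C _ sp0] v w by auto
 have e: "rfun C A v (Complex 0 y) \<bullet>c rfun C A w (Complex 0 y) = (\<Sum>j<n. \<Sum>l<n. ?S y $$ (j, l) * (v $ l * cnj (w $ j)))" for y
 proof -
  have CR: "C * ?R y \<in> carrier_mat d n" using C R by (rule mult_carrier_mat)
  have CRv: "(C * ?R y) *\<^sub>v v \<in> carrier_vec d" "(C * ?R y) *\<^sub>v w \<in> carrier_vec d"
   using CR v w by (auto intro: mult_mat_vec_carrier)
  have "rfun C A v (Complex 0 y) \<bullet>c rfun C A w (Complex 0 y) = cnj ((C * ?R y *\<^sub>v w) \<bullet>c (C * ?R y *\<^sub>v v))"
   unfolding rfun_def using CRv by (rule cscalar_prod_commute[rotated])
  also have "\<dots> = cnj (w \<bullet>c (mat_adjoint (C * ?R y) *\<^sub>v (C * ?R y *\<^sub>v v)))"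
   unfolding mat_adjoint_cscalar[OF CR w CRv(1)] ..
  also have "mat_adjoint (C * ?R y) *\<^sub>v (C * ?R y *\<^sub>v v) = ?S y *\<^sub>v v"
  proof -
   have "mat_adjoint (C * ?R y) *\<^sub>v (C * ?R y *\<^sub>v v) = (mat_adjoint (C * ?R y) * (C * ?R y)) *\<^sub>v v"
    using mat_adjoint_carrier[OF CR] CR v by (rule assoc_mult_mat_vec[symmetric])
   also have "mat_adjoint (C * ?R y) * (C * ?R y) = ?S y"
    using assoc_mult_mat_mid(1)[OF mat_adjoint_carrier[OF R[of y]] mat_adjoint_carrier[OF C] C R[of y]]
    unfolding mat_adjoint_mult[OF C R[of y]] by (rule sym)
   finally show ?thesis .
  qed
  also have "cnj (w \<bullet>c (?S y *\<^sub>v v)) = (?S y *\<^sub>v v) \<bullet>c w"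
   by (rule cscalar_prod_commute[OF w mult_mat_vec_carrier[OF S v], symmetric])
  also have "\<dots> = (\<Sum>j<n. (?S y *\<^sub>v v) $ j * cnj (w $ j))" by (rule cscalar_prod_sum[OF w])
  also have "\<dots> = (\<Sum>j<n. \<Sum>l<n. ?S y $$ (j, l) * (v $ l * cnj (w $ j)))"
   using mult_mat_vec_index_sum[OF S v] by (intro sum.cong refl) (simp add: sum_distrib_right mult.assoc)
  finally show ?thesis .
 qed
 have i: "integrable lborel (%y. ?S y $$ (j, l))" if "j < n" "l < n" for j l
  by (rule integrable_axis_gram[OF A sp M that])
 have "vinner d (%y. rfun C A v (Complex 0 y)) (%y. rfun C A w (Complex 0 y)) =
  (\<integral>y. (\<Sum>j<n. \<Sum>l<n. ?S y $$ (j, l) * (v $ l * cnj (w $ j))) \<partial>lborel)"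
  unfolding vinner_eq_integral(1)[OF L] e ..
 also have "\<dots> = (\<Sum>j<n. \<Sum>l<n. (\<integral>y. ?S y $$ (j, l) \<partial>lborel) * (v $ l * cnj (w $ j)))"
 proof -
  have "(\<integral>y. (\<Sum>j<n. \<Sum>l<n. ?S y $$ (j, l) * (v $ l * cnj (w $ j))) \<partial>lborel) =
   (\<Sum>j<n. \<integral>y. (\<Sum>l<n. ?S y $$ (j, l) * (v $ l * cnj (w $ j))) \<partial>lborel)"
   using i by (intro Bochner_Integration.integral_sum Bochner_Integration.integrable_sum integrable_mult_left) auto
  also have "\<dots> = (\<Sum>j<n. \<Sum>l<n. \<integral>y. ?S y $$ (j, l) * (v $ l * cnj (w $ j)) \<partial>lborel)"
   using i by (intro sum.cong[OF refl] Bochner_Integration.integral_sum integrable_mult_left) auto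
  finally show ?thesis by (simp only: integral_mult_left_zero)
 qed
 also have "\<dots> = (\<Sum>j<n. \<Sum>l<n. 2 * pi * axis_gram n A ?M $$ (j, l) * (v $ l * cnj (w $ j)))"
  by (intro sum.cong refl) (simp add: axis_gram_def)
 also have "\<dots> = 2 * pi * (\<Sum>j<n. (axis_gram n A ?M *\<^sub>v v) $ j * cnj (w $ j))"
  unfolding sum_distrib_left
  using mult_mat_vec_index_sum[OF axis_gram_carrier v] by (intro sum.cong refl) (simp add: sum_distrib_left sum_distrib_right mult.assoc)
 also have "(\<Sum>j<n. (axis_gram n A ?M *\<^sub>v v) $ j * cnj (w $ j)) = (axis_gram n A ?M *\<^sub>v v) \<bullet>c w"
  by (rule cscalar_prod_sum[OF w, symmetric])
 finally show ?thesis .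
qed

lemma vinner_reflect: "vinner d (%y. F (- y)) (%y. G (- y)) = vinner d F G"
 unfolding vinner_def inner2_def
 using integral_reflect_real[of "%y. F y $ _ * cnj (G y $ _)"] by simp

lemma rfun_uminus:
 assumes A: "A \<in> carrier_mat n n" and C: "C \<in> carrier_mat d n" and sp: "spectrum A \<subseteq> \<Pi>\<^sub>+" and v: "v \<in> carrier_vec n"
 shows "rfun C (- A) v (Complex 0 y) = (- 1) \<cdot>\<^sub>v rfun C A v (Complex 0 (- y))"
proof -
 have m: "- Complex 0 y = Complex 0 (- y)" by (simp add: complex_eq_iff)
 have "resolvent (- A) (Complex 0 y) = - resolvent A (Complex 0 (- y))"
  using resolvent_uminus(1)[OF A, of "Complex 0 y"] axis_notin_spectrum[OF sp] unfolding m by simp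
 moreover have "C * resolvent A (Complex 0 (- y)) \<in> carrier_mat d n"
  using C resolvent_props(1)[OF A axis_notin_spectrum[OF sp]] by (rule mult_carrier_mat)
 moreover have "C * - resolvent A (Complex 0 (- y)) = - (C * resolvent A (Complex 0 (- y)))"
  using C resolvent_props(1)[OF A axis_notin_spectrum[OF sp, of "- y"]] by (intro uminus_mult_right_mat) simp
 ultimately show ?thesis unfolding rfun_def using v by (intro eq_vecI) auto
qed

text \<open>The change of variable from y to -y turns \<open>- A\<close> into \<open>A\<close> up to
  a sign of the function, and both operations preserve inner products. So functions with poles on
  the left have the Gram matrix of the reflected problem.\<close>

theorem vinner_rfun_gram_uminus:
 assumes A: "A \<in> carrier_mat n n" and C: "C \<in> carrier_mat d n" and sp: "spectrum A \<subseteq> \<Pi>\<^sub>+"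
  and v: "v \<in> carrier_vec n" and w: "w \<in> carrier_vec n"
 shows "vinner d (%y. rfun C (- A) v (Complex 0 y)) (%y. rfun C (- A) w (Complex 0 y)) =
  2 * pi * ((axis_gram n A (mat_adjoint C * C) *\<^sub>v v) \<bullet>c w)"
proof -
 have sp0: "Re s \<noteq> 0" if "s \<in> spectrum A" for s using sp that by (auto simp: right_half_plane_def)
 have L: "(%y. rfun C A v (Complex 0 y)) \<in> L2_imag d" "(%y. rfun C A w (Complex 0 y)) \<in> L2_imag d"
  using rfun_L2[OF A C _ sp0] v w by auto
 have "vinner d (%y. rfun C (- A) v (Complex 0 y)) (%y. rfun C (- A) w (Complex 0 y)) =
  vinner d (%y. (- 1) \<cdot>\<^sub>v rfun C A v (Complex 0 (- y))) (%y. (- 1) \<cdot>\<^sub>v rfun C A w (Complex 0 (- y)))"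
  unfolding rfun_uminus[OF A C sp v] rfun_uminus[OF A C sp w] ..
 also have "\<dots> = vinner d (%y. (- 1) \<cdot>\<^sub>v rfun C A v (Complex 0 y)) (%y. (- 1) \<cdot>\<^sub>v rfun C A w (Complex 0 y))"
  by (rule vinner_reflect[of d "%y. (- 1) \<cdot>\<^sub>v rfun C A v (Complex 0 y)"])
 also have "\<dots> = vinner d (%y. rfun C A v (Complex 0 y)) (%y. rfun C A w (Complex 0 y))"
  using L by (simp add: vinner_smult_left vinner_smult_right)
 finally show ?thesis using vinner_rfun_gram[OF assms] by simp
qed

section \<open>Completeness and duality in L2\<close>

text \<open>Riesz-Fischer. Along the indices \<open>r k\<close> the squared distances are below
  4^-k, so even with weights 2^k their sum is finite, and the subsequence converges almost
  everywhere. Fatou's lemma carries the Cauchy estimate of the full sequence over to the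
  limit.\<close>

lemma sq_int_complete:
 fixes s :: "nat => real => complex"
 assumes sq: "!!n. sq_int (s n)"
  and cauchy: "!!e. e > 0 ==> \<exists>M. \<forall>j\<ge>M. \<forall>k\<ge>M. (\<integral>y. (cmod (s j y - s k y))\<^sup>2 \<partial>lborel) < e"
 obtains f where "sq_int f" "(%n. \<integral>y. (cmod (s n y - f y))\<^sup>2 \<partial>lborel) \<longlonglongrightarrow> 0"
proof -
 let ?d = "%j k. \<integral>y. (cmod (s j y - s k y))\<^sup>2 \<partial>lborel"
 have "\<exists>M. \<forall>j\<ge>M. \<forall>k\<ge>M. ?d j k < (1/4)^i" for i :: nat by (rule cauchy) simp
 then obtain N where N: "!!i j k. N i \<le> j ==> N i \<le> k ==> ?d j k < (1/4)^i" by metis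
 \<comment> \<open>The maximum over all thresholds up to \<open>k\<close> puts both
   \<open>r k\<close> and \<open>r (Suc k)\<close> beyond \<open>N k\<close>, also when
   \<open>N\<close> is not monotone.\<close>
 define r where "r = (%k. Max (N ` {..k}))"
 have rN: "N i \<le> r k" if "i \<le> k" for i k unfolding r_def using that by (intro Max_ge) auto
 have meas [measurable]: "s n \<in> borel_measurable borel" for n using sq_int_measurable[OF sq] .
 have int: "integrable lborel (%y. (cmod (s j y - s k y))\<^sup>2)" for j k
  using sq_int_diff[OF sq sq] by (simp add: sq_int_def)
 have nn: "(\<integral>\<^sup>+ y. ennreal ((cmod (s j y - s k y))\<^sup>2) \<partial>lborel) = ennreal (?d j k)" for j k
  by (rule nn_integral_eq_integral[OF int]) auto
 define g where "g = (%k y. s (r (Suc k)) y - s (r k) y)"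
 have "(\<integral>\<^sup>+ y. (\<Sum>k. ennreal (2^k * (cmod (g k y))\<^sup>2)) \<partial>lborel) = (\<Sum>k. \<integral>\<^sup>+ y. ennreal (2^k * (cmod (g k y))\<^sup>2) \<partial>lborel)"
  unfolding g_def by (rule nn_integral_suminf) measurable
 also have "\<dots> \<le> (\<Sum>k. ennreal ((1/2)^k))"
 proof (intro suminf_le allI)
  fix k
  have "(\<integral>\<^sup>+ y. ennreal (2^k * (cmod (g k y))\<^sup>2) \<partial>lborel) = ennreal (2^k) * (\<integral>\<^sup>+ y. ennreal ((cmod (g k y))\<^sup>2) \<partial>lborel)"
   unfolding g_def by (subst nn_integral_cmult[symmetric]) (auto simp: ennreal_mult')
  also have "\<dots> = ennreal (2^k * ?d (r (Suc k)) (r k))" unfolding g_def nn by (simp add: ennreal_mult')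
  also have "\<dots> \<le> ennreal (2^k * (1/4)^k)"
   using N[of k "r (Suc k)" "r k"] rN by (intro ennreal_leI mult_left_mono) (auto intro: less_imp_le)
  also have "(2::real)^k * (1/4)^k = (1/2)^k" by (simp flip: power_mult_distrib)
  finally show "(\<integral>\<^sup>+ y. ennreal (2^k * (cmod (g k y))\<^sup>2) \<partial>lborel) \<le> ennreal ((1/2)^k)" .
 qed auto
 also have "\<dots> = ennreal 2"
 proof -
  have "(%k. (1/2)^k :: real) sums 2" using geometric_sums[of "1/2 :: real"] by simp
  then show ?thesis by (intro suminf_ennreal_eq) auto
 qed
 finally have "(\<integral>\<^sup>+ y. (\<Sum>k. ennreal (2^k * (cmod (g k y))\<^sup>2)) \<partial>lborel) \<le> ennreal 2" .
 then have "(\<integral>\<^sup>+ y. (\<Sum>k. ennreal (2^k * (cmod (g k y))\<^sup>2)) \<partial>lborel) < \<infinity>"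
  by (rule order.strict_trans1) simp
 then have fin: "(\<integral>\<^sup>+ y. (\<Sum>k. ennreal (2^k * (cmod (g k y))\<^sup>2)) \<partial>lborel) \<noteq> \<infinity>"
  by (rule less_imp_neq)
 have "AE y in lborel. (\<Sum>k. ennreal (2^k * (cmod (g k y))\<^sup>2)) \<noteq> \<infinity>"
  by (rule nn_integral_PInf_AE[OF _ fin]) (unfold g_def, measurable)
 then have conv: "AE y in lborel. convergent (%k. s (r k) y)"
 proof eventually_elim
  case (elim y)
  have sm: "summable (%k. 2^k * (cmod (g k y))\<^sup>2)"
   by (rule summable_suminf_not_top) (use elim in auto)
  have "summable (%k. cmod (g k y))"
  proof (rule summable_comparison_test')
   show "summable (%k. 2^k * (cmod (g k y))\<^sup>2 + (1/2)^k)"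
    by (intro summable_add sm) (simp add: summable_geometric)
   fix k :: nat
   define u :: real where "u = 2^k"
   have u: "u > 0" "(1/2)^k = 1 / u" by (simp_all add: u_def power_one_over)
   \<comment> \<open>The square yields |g| \<le> 2^k |g|^2 + 2^-k, which trades the weighted sum of
     squares for absolute summability.\<close>
   have "0 \<le> (u * cmod (g k y) - 1)\<^sup>2" by simp
   then have "2 * (u * cmod (g k y)) \<le> u * (u * (cmod (g k y))\<^sup>2 + 1 / u)"
    using u(1) by (simp add: power2_eq_square algebra_simps)
   then have "2 * cmod (g k y) \<le> u * (cmod (g k y))\<^sup>2 + 1 / u"
    using u(1) mult_le_cancel_left_pos[of u "2 * cmod (g k y)"] by (simp add: mult.left_commute)
   then have "cmod (g k y) \<le> u * (cmod (g k y))\<^sup>2 + 1 / u"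
    using norm_ge_zero[of "g k y"] by linarith
   then show "norm (cmod (g k y)) \<le> 2^k * (cmod (g k y))\<^sup>2 + (1/2)^k"
    unfolding u(2) u_def[symmetric] by (simp only: real_norm_def abs_norm_cancel)
  qed
  then have "summable (%k. g k y)" by (rule summable_norm_cancel)
  then have "(%k. \<Sum>i<k. g i y) \<longlonglongrightarrow> (\<Sum>i. g i y)" by (rule summable_LIMSEQ)
  then have "(%k. s (r 0) y + (\<Sum>i<k. g i y)) \<longlonglongrightarrow> s (r 0) y + (\<Sum>i. g i y)" by (intro tendsto_intros)
  moreover have "s (r 0) y + (\<Sum>i<k. g i y) = s (r k) y" for k
   unfolding g_def sum_lessThan_telescope[of "%i. s (r i) y"] by simp
  ultimately show ?case unfolding convergent_def by auto
 qed
 define f where "f = (%y. lim (%k. s (r k) y))"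
 have fm [measurable]: "f \<in> borel_measurable borel" unfolding f_def by (rule borel_measurable_lim_metric) measurable
 \<comment> \<open>Fatou along the subsequence: the distance of \<open>s n\<close> to
   \<open>f\<close> is at most the lower limit of its distances to the
   \<open>s (r k)\<close>.\<close>
 have bound: "(\<integral>\<^sup>+ y. ennreal ((cmod (s n y - f y))\<^sup>2) \<partial>lborel) \<le> ennreal ((1/4)^K)" if n: "n \<ge> N K" for n K
 proof -
  have "(\<integral>\<^sup>+ y. ennreal ((cmod (s n y - f y))\<^sup>2) \<partial>lborel) = (\<integral>\<^sup>+ y. liminf (%k. ennreal ((cmod (s n y - s (r k) y))\<^sup>2)) \<partial>lborel)"
  proof (rule nn_integral_cong_AE)
   show "AE y in lborel. ennreal ((cmod (s n y - f y))\<^sup>2) = liminf (%k. ennreal ((cmod (s n y - s (r k) y))\<^sup>2))"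
    using conv
   proof eventually_elim
    case (elim y)
    then have "(%k. s (r k) y) \<longlonglongrightarrow> f y" unfolding f_def by (simp add: convergent_LIMSEQ_iff)
    then have "(%k. ennreal ((cmod (s n y - s (r k) y))\<^sup>2)) \<longlonglongrightarrow> ennreal ((cmod (s n y - f y))\<^sup>2)"
     by (intro tendsto_intros tendsto_ennrealI)
    then show ?case by (intro lim_imp_Liminf[symmetric]) auto
   qed
  qed
  also have "\<dots> \<le> liminf (%k. \<integral>\<^sup>+ y. ennreal ((cmod (s n y - s (r k) y))\<^sup>2) \<partial>lborel)"
   by (rule nn_integral_liminf) measurable
  also have "\<dots> \<le> ennreal ((1/4)^K)"
  proof (rule Liminf_le)
   have "(\<integral>\<^sup>+ y. ennreal ((cmod (s n y - s (r k) y))\<^sup>2) \<partial>lborel) \<le> ennreal ((1/4)^K)" if "k \<ge> K" for k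
    unfolding nn using N[OF n rN[OF that]] by (intro ennreal_leI) simp
   then show "\<forall>\<^sub>F k in sequentially. (\<integral>\<^sup>+ y. ennreal ((cmod (s n y - s (r k) y))\<^sup>2) \<partial>lborel) \<le> ennreal ((1/4)^K)"
    by (auto simp: eventually_sequentially)
  qed simp
  finally show ?thesis .
 qed
 have sqd: "sq_int (%y. s n y - f y)" if "n \<ge> N K" for n K
 proof -
  have "integrable lborel (%y. (cmod (s n y - f y))\<^sup>2)"
   by (rule integrableI_nonneg) (use order.strict_trans1[OF bound[OF that]] in auto)
  then show ?thesis by (simp add: sq_int_def)
 qed
 have sqf: "sq_int f"
  using sq_int_diff[OF sq[of "N 0"] sqd[of 0 "N 0"]] by simp
 have "(%n. \<integral>y. (cmod (s n y - f y))\<^sup>2 \<partial>lborel) \<longlonglongrightarrow> 0"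
 proof (rule LIMSEQ_I)
  fix e :: real assume "e > 0"
  then obtain K where K: "(1/4)^K < e" using real_arch_pow_inv[of e "1/4"] by auto
  have "norm ((\<integral>y. (cmod (s n y - f y))\<^sup>2 \<partial>lborel) - 0) < e" if n: "n \<ge> N K" for n
  proof -
   have "ennreal (\<integral>y. (cmod (s n y - f y))\<^sup>2 \<partial>lborel) = (\<integral>\<^sup>+ y. ennreal ((cmod (s n y - f y))\<^sup>2) \<partial>lborel)"
    using sqd[OF n] by (intro nn_integral_eq_integral[symmetric]) (auto simp: sq_int_def)
   also have "\<dots> \<le> ennreal ((1/4)^K)" by (rule bound[OF n])
   finally have "(\<integral>y. (cmod (s n y - f y))\<^sup>2 \<partial>lborel) \<le> (1/4)^K" by (subst (asm) ennreal_le_iff) auto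
   then show ?thesis using K by (simp add: integral_nonneg_AE)
  qed
  then show "\<exists>no. \<forall>n\<ge>no. norm ((\<integral>y. (cmod (s n y - f y))\<^sup>2 \<partial>lborel) - 0) < e" by blast
 qed
 with sqf show ?thesis by (rule that)
qed

lemma L2_imag_complete:
 assumes L: "!!n. s n \<in> L2_imag d"
  and cauchy: "!!e. e > 0 ==> \<exists>M. \<forall>j\<ge>M. \<forall>k\<ge>M. Re (vinner d (%y. s j y - s k y) (%y. s j y - s k y)) < e"
 obtains f where "f \<in> L2_imag d" "(%n. Re (vinner d (%y. s n y - f y) (%y. s n y - f y))) \<longlonglongrightarrow> 0"
proof -
 have e: "Re (vinner d (%y. F y - G y) (%y. F y - G y)) = (\<Sum>i<d. \<integral>y. (cmod (F y $ i - G y $ i))\<^sup>2 \<partial>lborel)"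
  if "G \<in> L2_imag d" for F G
 proof -
  have "inner2 (%y. (F y - G y) $ i) (%y. (F y - G y) $ i) = complex_of_real (\<integral>y. (cmod (F y $ i - G y $ i))\<^sup>2 \<partial>lborel)" if i: "i < d" for i
  proof -
   have "(F y - G y) $ i = F y $ i - G y $ i" for y
    using i L2_imag_dim[OF \<open>G \<in> L2_imag d\<close>] by simp
   then have "inner2 (%y. (F y - G y) $ i) (%y. (F y - G y) $ i) = (\<integral>y. complex_of_real ((cmod (F y $ i - G y $ i))\<^sup>2) \<partial>lborel)"
    unfolding inner2_def complex_norm_square by simp
   then show ?thesis by (simp only: integral_complex_of_real)
  qed
  then show ?thesis unfolding vinner_def by simp
 qed
 have "\<exists>f. sq_int f \<and> (%n. \<integral>y. (cmod (s n y $ i - f y))\<^sup>2 \<partial>lborel) \<longlonglongrightarrow> 0" if i: "i < d" for i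
 proof -
  have sq: "sq_int (%y. s n y $ i)" for n using L i by (simp add: L2_imag_iff)
  have "\<exists>M. \<forall>j\<ge>M. \<forall>k\<ge>M. (\<integral>y. (cmod (s j y $ i - s k y $ i))\<^sup>2 \<partial>lborel) < \<epsilon>" if \<epsilon>: "\<epsilon> > 0" for \<epsilon>
  proof -
   obtain M where M: "!!j k. j \<ge> M ==> k \<ge> M ==> (\<Sum>i<d. \<integral>y. (cmod (s j y $ i - s k y $ i))\<^sup>2 \<partial>lborel) < \<epsilon>"
    using cauchy[OF \<epsilon>] unfolding e[OF L] by blast
   have "(\<integral>y. (cmod (s j y $ i - s k y $ i))\<^sup>2 \<partial>lborel) < \<epsilon>" if "j \<ge> M" "k \<ge> M" for j k
    by (rule le_less_trans[OF _ M[OF that]])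
     (use i in \<open>auto intro!: member_le_sum[of i "{..<d}" "%i. \<integral>y. (cmod (s j y $ i - s k y $ i))\<^sup>2 \<partial>lborel"] integral_nonneg_AE\<close>)
   then show ?thesis by blast
  qed
  from sq_int_complete[of "%n y. s n y $ i", OF sq this]
  obtain f where "sq_int f" "(%n. \<integral>y. (cmod (s n y $ i - f y))\<^sup>2 \<partial>lborel) \<longlonglongrightarrow> 0" .
  then show ?thesis by blast
 qed
 then have "\<forall>i. \<exists>f. i < d \<longrightarrow> sq_int f \<and> (%n. \<integral>y. (cmod (s n y $ i - f y))\<^sup>2 \<partial>lborel) \<longlonglongrightarrow> 0"
  by blast
 from choice[OF this] obtain f where f: "!!i. i < d ==> sq_int (f i)"
  "!!i. i < d ==> (%n. \<integral>y. (cmod (s n y $ i - f i y))\<^sup>2 \<partial>lborel) \<longlonglongrightarrow> 0"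
  by blast
 define g where "g = (%y. vec d (%i. f i y))"
 have g: "g \<in> L2_imag d" unfolding L2_imag_iff using f(1) by (auto simp: g_def)
 have "(%n. \<Sum>i<d. \<integral>y. (cmod (s n y $ i - f i y))\<^sup>2 \<partial>lborel) \<longlonglongrightarrow> (\<Sum>i<d. 0)"
  by (intro tendsto_sum f(2)) simp
 moreover have "(\<Sum>i<d. \<integral>y. (cmod (s n y $ i - f i y))\<^sup>2 \<partial>lborel) = Re (vinner d (%y. s n y - g y) (%y. s n y - g y))" for n
  unfolding e[OF g] by (intro sum.cong) (auto simp: g_def)
 ultimately have "(%n. Re (vinner d (%y. s n y - g y) (%y. s n y - g y))) \<longlonglongrightarrow> 0" by simp
 with g show ?thesis by (rule that)
qed

lemma vinner_Cauchy_Schwarz: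
 assumes "F \<in> L2_imag d" "G \<in> L2_imag d"
 shows "(cmod (vinner d F G))\<^sup>2 \<le> Re (vinner d F F) * Re (vinner d G G)"
proof -
 let ?A = "Re (vinner d F F)" and ?B = "Re (vinner d G G)" and ?X = "cmod (vinner d F G)"
 \<comment> \<open>A unimodular factor rotates the inner product onto the nonnegative reals, so that
   the real discriminant argument applies to the multiples \<open>t * u\<close>.\<close>
 obtain u where u: "cmod u = 1" "u * vinner d F G = of_real ?X"
 proof (cases "vinner d F G = 0")
  case True then show ?thesis by (intro that[of 1]) auto
 next
  case False
  then show ?thesis
   by (intro that[of "of_real ?X / vinner d F G"]) (auto simp: norm_divide)
 qed
 have "?X\<^sup>2 \<le> ?A * ?B"
 proof (rule quadratic_nonneg_discriminant)
  fix t :: real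
  let ?c = "of_real t * u"
  have L: "(%y. ?c \<cdot>\<^sub>v F y) \<in> L2_imag d" by (rule L2_imag_smult[OF assms(1)])
  have L2: "(%y. ?c \<cdot>\<^sub>v F y + G y) \<in> L2_imag d" by (rule L2_imag_add[OF L assms(2)])
  have "vinner d (%y. ?c \<cdot>\<^sub>v F y + G y) (%y. ?c \<cdot>\<^sub>v F y + G y) =
   ?c * cnj ?c * vinner d F F + ?c * vinner d F G + cnj (?c * vinner d F G) + vinner d G G"
   unfolding vinner_add_left[OF L assms(2) L2] vinner_add_right[OF L assms(2) L] vinner_add_right[OF L assms(2) assms(2)]
    vinner_smult_left[OF assms(1)] vinner_smult_right[OF assms(1)] vinner_cnj[of d G F]
   by (simp add: algebra_simps)
  also have "?c * cnj ?c = of_real (t\<^sup>2)"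
   using u(1) complex_norm_square[of u] by (simp add: power2_eq_square)
  also have "?c * vinner d F G = of_real (t * ?X)" using u(2) by (simp add: mult.assoc)
  finally have "Re (vinner d (%y. ?c \<cdot>\<^sub>v F y + G y) (%y. ?c \<cdot>\<^sub>v F y + G y)) = t\<^sup>2 * ?A + 2 * t * ?X + ?B" by simp
  then show "0 \<le> t\<^sup>2 * ?A + 2 * t * ?X + ?B" using vinner_self_nonneg(1)[OF L2] by simp
 qed (rule vinner_self_nonneg(1)[OF assms(1)])
 then show ?thesis .
qed

text \<open>The pairing depends on \<open>v\<close> only through the finitely many pairings of
  \<open>F\<close> with the columns of C (iy - A)^-1; these are the coordinates of \<open>q\<close>.
  Projecting onto such functions thereby becomes linear algebra.\<close>

lemma rfun_functional:
 assumes A: "A \<in> carrier_mat n n" and C: "C \<in> carrier_mat d n" and sp: "!!s. s \<in> spectrum A ==> Re s \<noteq> 0"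
  and F: "F \<in> L2_imag d"
 obtains q where "q \<in> carrier_vec n" "!!v. v \<in> carrier_vec n ==> vinner d F (%y. rfun C A v (Complex 0 y)) = q \<bullet>c v"
proof -
 let ?\<tau> = "%i j y. (C * resolvent A (Complex 0 y)) $$ (i, j)"
 have notin: "Complex 0 y \<notin> spectrum A" for y using sp[of "Complex 0 y"] by auto
 define q where "q = vec n (%j. \<Sum>i<d. inner2 (%y. F y $ i) (?\<tau> i j))"
 have sq: "sq_int (?\<tau> i j)" if "i < d" "j < n" for i j
  by (rule sq_int_axis[OF mult_resolvent_right(1)[OF A C that] finite_spectrum[OF A] sp mult_resolvent_right(2)[OF A C that]])
 have sF: "sq_int (%y. F y $ i)" if "i < d" for i using F that by (simp add: L2_imag_iff)
 have "vinner d F (%y. rfun C A v (Complex 0 y)) = q \<bullet>c v" if v: "v \<in> carrier_vec n" for v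
 proof -
  have "inner2 (%y. F y $ i) (%y. rfun C A v (Complex 0 y) $ i) = (\<Sum>j<n. cnj (v $ j) * inner2 (%y. F y $ i) (?\<tau> i j))" if i: "i < d" for i
  proof -
   have "F y $ i * cnj (rfun C A v (Complex 0 y) $ i) = (\<Sum>j<n. cnj (v $ j) * (F y $ i * cnj (?\<tau> i j y)))" for y
    unfolding rfun_index[OF A C v notin i] cnj_sum sum_distrib_left complex_cnj_mult
    by (intro sum.cong refl) (rule mult.left_commute)
   then have "inner2 (%y. F y $ i) (%y. rfun C A v (Complex 0 y) $ i) = (\<integral>y. (\<Sum>j<n. cnj (v $ j) * (F y $ i * cnj (?\<tau> i j y))) \<partial>lborel)"
    unfolding inner2_def by presburger
   also have "\<dots> = (\<Sum>j<n. \<integral>y. cnj (v $ j) * (F y $ i * cnj (?\<tau> i j y)) \<partial>lborel)"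
    using sq[OF i] sF[OF i] by (intro Bochner_Integration.integral_sum integrable_mult_right inner2_integrable) auto
   finally show ?thesis unfolding inner2_def by (simp only: integral_mult_right_zero)
  qed
  then have "vinner d F (%y. rfun C A v (Complex 0 y)) = (\<Sum>i<d. \<Sum>j<n. cnj (v $ j) * inner2 (%y. F y $ i) (?\<tau> i j))"
   unfolding vinner_def by simp
  also have "\<dots> = (\<Sum>j<n. \<Sum>i<d. cnj (v $ j) * inner2 (%y. F y $ i) (?\<tau> i j))" by (rule sum.swap)
  also have "\<dots> = (\<Sum>j<n. q $ j * cnj (v $ j))"
   by (intro sum.cong refl) (simp add: q_def sum_distrib_left[symmetric] mult.commute)
  finally show ?thesis using cscalar_prod_sum[OF v] by simp
 qed
 moreover have "q \<in> carrier_vec n" by (simp add: q_def)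
 ultimately show ?thesis using that by blast
qed

section \<open>Vectors and functions in two blocks\<close>

lemma sum_lessThan_add: "(\<Sum>i<p + m. f i) = (\<Sum>i<p. f i) + (\<Sum>i<m. f (p + i :: nat) :: complex)"
 by (induction m) (auto simp: add.assoc)

lemma append_vec_nth:
 assumes "x \<in> carrier_vec p" "y \<in> carrier_vec m"
 shows "i < p ==> (x @\<^sub>v y) $ i = x $ i" "i < m ==> (x @\<^sub>v y) $ (p + i) = y $ i"
 using carrier_vecD[OF assms(1)] carrier_vecD[OF assms(2)] by simp_all

lemma cscalar_prod_append:
 assumes "x \<in> carrier_vec p" "y \<in> carrier_vec m" "x' \<in> carrier_vec p" "y' \<in> carrier_vec m"
 shows "(x @\<^sub>v y) \<bullet>c (x' @\<^sub>v y' :: complex vec) = x \<bullet>c x' + y \<bullet>c y'"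
proof -
 have "x' @\<^sub>v y' \<in> carrier_vec (p + m)" using assms by simp
 then show ?thesis
  unfolding cscalar_prod_sum[OF assms(3)] cscalar_prod_sum[OF assms(4)]
  by (simp add: cscalar_prod_sum sum_lessThan_add append_vec_nth[OF assms(1,2)] append_vec_nth[OF assms(3,4)])
qed

lemma append_vec_split:
 assumes "v \<in> carrier_vec (p + m)"
 shows "v = vec_first v p @\<^sub>v vec_last v m"
 using vec_first_last_append[OF assms] by simp

lemma L2_imag_append:
 assumes "!!y. F y \<in> carrier_vec p" "!!y. G y \<in> carrier_vec m"
 shows "(%y. F y @\<^sub>v G y) \<in> L2_imag (p + m) \<longleftrightarrow> F \<in> L2_imag p \<and> G \<in> L2_imag m"
proof -
 have "(\<forall>i<p + m. sq_int (%y. (F y @\<^sub>v G y) $ i)) \<longleftrightarrow> (\<forall>i<p. sq_int (%y. F y $ i)) \<and> (\<forall>i<m. sq_int (%y. G y $ i))"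
 proof
  assume *: "\<forall>i<p + m. sq_int (%y. (F y @\<^sub>v G y) $ i)"
  have "sq_int (%y. F y $ i)" if "i < p" for i
   using *[rule_format, of i] that by (simp only: append_vec_nth(1)[OF assms that] trans_less_add1)
  moreover have "sq_int (%y. G y $ i)" if "i < m" for i
   using *[rule_format, of "p + i"] that by (simp only: append_vec_nth(2)[OF assms that] nat_add_left_cancel_less)
  ultimately show "(\<forall>i<p. sq_int (%y. F y $ i)) \<and> (\<forall>i<m. sq_int (%y. G y $ i))" by blast
 next
  assume *: "(\<forall>i<p. sq_int (%y. F y $ i)) \<and> (\<forall>i<m. sq_int (%y. G y $ i))"
  show "\<forall>i<p + m. sq_int (%y. (F y @\<^sub>v G y) $ i)"
  proof (intro allI impI)
   fix i assume i: "i < p + m"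
   show "sq_int (%y. (F y @\<^sub>v G y) $ i)"
   proof (cases "i < p")
    case True
    then show ?thesis using * by (simp only: append_vec_nth(1)[OF assms True])
   next
    case False
    then obtain k where k: "i = p + k" "k < m" using i by (metis add_less_cancel_left le_Suc_ex linorder_not_less)
    then show ?thesis using * unfolding k(1) by (simp only: append_vec_nth(2)[OF assms k(2)])
   qed
  qed
 qed
 then show ?thesis using assms by (simp add: L2_imag_iff)
qed

lemma vinner_append:
 assumes "!!y. F y \<in> carrier_vec p" "!!y. G y \<in> carrier_vec m" "!!y. F' y \<in> carrier_vec p" "!!y. G' y \<in> carrier_vec m"
 shows "vinner (p + m) (%y. F y @\<^sub>v G y) (%y. F' y @\<^sub>v G' y) = vinner p F F' + vinner m G G'"
 unfolding vinner_def sum_lessThan_add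
 by (simp add: append_vec_nth[OF assms(1,2)] append_vec_nth[OF assms(3,4)])

lemma hardy_vec_append:
 assumes "hardy_vec p f F" "hardy_vec m g G"
 shows "hardy_vec (p + m) (%z. f z @\<^sub>v g z) (%y. F y @\<^sub>v G y)"
 unfolding hardy_vec_iff
proof (intro conjI ballI allI impI)
 have c: "!!y. F y \<in> carrier_vec p" "!!y. G y \<in> carrier_vec m"
  "!!z. z \<in> \<Pi>\<^sub>+ ==> f z \<in> carrier_vec p" "!!z. z \<in> \<Pi>\<^sub>+ ==> g z \<in> carrier_vec m"
  using assms by (auto simp: hardy_vec_iff)
 show "F y @\<^sub>v G y \<in> carrier_vec (p + m)" for y using c by simp
 show "f z @\<^sub>v g z \<in> carrier_vec (p + m)" if "z \<in> \<Pi>\<^sub>+" for z using c that by simp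
 fix i assume i: "i < p + m"
 show "hardy_pair (%z. (f z @\<^sub>v g z) $ i) (%y. (F y @\<^sub>v G y) $ i)"
 proof (cases "i < p")
  case True
  then have "hardy_pair (%z. f z $ i) (%y. F y $ i)" using assms(1) by (simp add: hardy_vec_iff)
  then show ?thesis
   by (rule hardy_pair_cong) (use append_vec_nth(1)[OF c(1,2) True] append_vec_nth(1)[OF c(3,4) True] in auto)
 next
  case False
  then obtain k where k: "i = p + k" "k < m" using i by (metis add_less_cancel_left le_Suc_ex linorder_not_less)
  then have "hardy_pair (%z. g z $ k) (%y. G y $ k)" using assms(2) by (simp add: hardy_vec_iff)
  then show ?thesis unfolding k(1)
   by (rule hardy_pair_cong) (use append_vec_nth(2)[OF c(1,2) k(2)] append_vec_nth(2)[OF c(3,4) k(2)] in auto)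
 qed
qed

lemma hardy_vec_zero: "hardy_vec d (%z. 0\<^sub>v d) (%y. 0\<^sub>v d)"
 unfolding hardy_vec_iff using hardy_pair_zero by simp

lemma hardy_vec_diff:
 assumes "hardy_vec d h H" "hardy_vec d g G"
 shows "hardy_vec d (%z. h z + (- 1) \<cdot>\<^sub>v g z) (%y. H y + (- 1) \<cdot>\<^sub>v G y)"
 by (rule hardy_vec_add[OF assms(1) hardy_vec_smult[OF assms(2)]])

section \<open>Symmetry and positivity of the Gram matrices\<close>

text \<open>The adjoint solves the same Lyapunov equation, so uniqueness identifies the two.\<close>

lemma axis_gram_unique_adjoint:
 assumes A: "A \<in> carrier_mat n n" and sp: "spectrum A \<subseteq> \<Pi>\<^sub>+" and M: "M \<in> carrier_mat n n" and h: "mat_adjoint M = M"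
 shows "mat_adjoint (axis_gram n A M) = axis_gram n A M"
proof (rule lyapunov_unique[OF A sp _ M])
 let ?G = "axis_gram n A M"
 have G: "?G \<in> carrier_mat n n" by simp
 show "mat_adjoint ?G \<in> carrier_mat n n" using G by (rule mat_adjoint_carrier)
 have As: "mat_adjoint A \<in> carrier_mat n n" using A by (rule mat_adjoint_carrier)
 have "mat_adjoint (?G * A + mat_adjoint A * ?G) = mat_adjoint A * mat_adjoint ?G + mat_adjoint ?G * A"
  using mat_adjoint_add[OF mult_carrier_mat[OF G A] mult_carrier_mat[OF As G]]
  unfolding mat_adjoint_mult[OF G A] mat_adjoint_mult[OF As G] by simp
 also have "\<dots> = mat_adjoint ?G * A + mat_adjoint A * mat_adjoint ?G"
  by (rule comm_add_mat[OF mult_carrier_mat[OF As mat_adjoint_carrier[OF G]] mult_carrier_mat[OF mat_adjoint_carrier[OF G] A]])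
 finally show "mat_adjoint ?G * A + mat_adjoint A * mat_adjoint ?G = M"
  unfolding lyapunov_exists[OF A sp M] h by simp
qed

lemma minus_add_minus_mat:
 assumes "a \<in> carrier_mat n k" "b \<in> carrier_mat n k" "c \<in> carrier_mat n k" "e \<in> carrier_mat n k"
 shows "(a - b) + (c - e) = (a + c) - (b + e :: complex mat)"
 by (rule eq_matI) (use assms in auto)

lemma axis_gram_minus:
 assumes A: "A \<in> carrier_mat n n" and sp: "spectrum A \<subseteq> \<Pi>\<^sub>+" and M: "M \<in> carrier_mat n n" and N: "N \<in> carrier_mat n n"
 shows "axis_gram n A (M - N) = axis_gram n A M - axis_gram n A N"
proof (rule lyapunov_unique[OF A sp, symmetric])
 let ?G = "axis_gram n A M" and ?H = "axis_gram n A N"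
 have G: "?G \<in> carrier_mat n n" "?H \<in> carrier_mat n n" by simp_all
 have As: "mat_adjoint A \<in> carrier_mat n n" using A by (rule mat_adjoint_carrier)
 show "?G - ?H \<in> carrier_mat n n" using G(2) by (rule minus_carrier_mat)
 show "M - N \<in> carrier_mat n n" using N by (rule minus_carrier_mat)
 have c: "?G * A \<in> carrier_mat n n" "?H * A \<in> carrier_mat n n" "mat_adjoint A * ?G \<in> carrier_mat n n" "mat_adjoint A * ?H \<in> carrier_mat n n"
  using mult_carrier_mat[OF G(1) A] mult_carrier_mat[OF G(2) A] mult_carrier_mat[OF As G(1)] mult_carrier_mat[OF As G(2)] .
 have "(?G - ?H) * A + mat_adjoint A * (?G - ?H) = (?G * A - ?H * A) + (mat_adjoint A * ?G - mat_adjoint A * ?H)"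
  unfolding minus_mult_distrib_mat[OF G A] mult_minus_distrib_mat[OF As G] ..
 also have "\<dots> = (?G * A + mat_adjoint A * ?G) - (?H * A + mat_adjoint A * ?H)"
  by (rule minus_add_minus_mat[OF c])
 finally show "(?G - ?H) * A + mat_adjoint A * (?G - ?H) = M - N"
  unfolding lyapunov_exists[OF A sp M] lyapunov_exists[OF A sp N] .
qed

text \<open>The set where \<open>f\<close> is nonzero is open, and a nonempty open set is not
  negligible.\<close>

lemma continuous_AE_zero:
 fixes f :: "real => complex"
 assumes "continuous_on UNIV f" "AE y in lborel. f y = 0"
 shows "f y = 0"
proof (rule ccontr)
 assume "f y \<noteq> 0"
 have op: "open {y. f y \<noteq> 0}" using assms(1) by (intro open_Collect_neq continuous_on_const)
 have "{y. f y \<noteq> 0} \<in> null_sets lborel"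
  using AE_iff_null_sets[of "{y. f y \<noteq> 0}" lborel] borel_open[OF op] assms(2) by simp
 then have "negligible {y. f y \<noteq> 0}" by (simp add: negligible_iff_null_sets null_sets_completionI)
 then show False using open_not_negligible[OF op] \<open>f y \<noteq> 0\<close> by blast
qed

context
 fixes n d :: nat and A C :: "complex mat"
 assumes A: "A \<in> carrier_mat n n" and sp: "spectrum A \<subseteq> \<Pi>\<^sub>+" and C: "C \<in> carrier_mat d n"
begin

text \<open>Since R A = zR - I, the function C R A v equals iy C R v - C v on the axis, which under
  the hypothesis is the constant -Cv. It also decays at infinity, so Cv = 0. The second conclusion
  repeats the hypothesis for Av and drives the induction on powers.\<close>

lemma rfun_axis_zero_imp:
 assumes v: "v \<in> carrier_vec n" and 0: "!!y. rfun C A v (Complex 0 y) = 0\<^sub>v d"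
 shows "C *\<^sub>v v = 0\<^sub>v d" "!!y. rfun C A (A *\<^sub>v v) (Complex 0 y) = 0\<^sub>v d"
proof -
 have Av: "A *\<^sub>v v \<in> carrier_vec n" using A v by (rule mult_mat_vec_carrier)
 have e: "rfun C A (A *\<^sub>v v) (Complex 0 y) = - (C *\<^sub>v v)" for y
 proof -
  let ?z = "Complex 0 y" and ?R = "resolvent A (Complex 0 y)"
  have R: "?R \<in> carrier_mat n n" using resolvent_props(1)[OF A axis_notin_spectrum[OF sp]] .
  have "rfun C A (A *\<^sub>v v) ?z = C *\<^sub>v (?R *\<^sub>v (A *\<^sub>v v))"
   unfolding rfun_def by (rule assoc_mult_mat_vec[OF C R Av])
  also have "?R *\<^sub>v (A *\<^sub>v v) = (?R * A) *\<^sub>v v" by (rule assoc_mult_mat_vec[OF R A v, symmetric])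
  also have "?R * A = ?z \<cdot>\<^sub>m ?R - 1\<^sub>m n" using resolvent_mult(2)[OF A axis_notin_spectrum[OF sp]] .
  also have "(?z \<cdot>\<^sub>m ?R - 1\<^sub>m n) *\<^sub>v v = (?z \<cdot>\<^sub>m ?R) *\<^sub>v v - 1\<^sub>m n *\<^sub>v v"
   using R v by (intro minus_mult_distrib_mat_vec[of _ n n]) auto
  also have "C *\<^sub>v \<dots> = C *\<^sub>v ((?z \<cdot>\<^sub>m ?R) *\<^sub>v v) - C *\<^sub>v v"
   using C R v by (subst mult_minus_distrib_mat_vec[of _ d n]) (auto intro: mult_mat_vec_carrier[of _ n n])
  also have "(?z \<cdot>\<^sub>m ?R) *\<^sub>v v = ?z \<cdot>\<^sub>v (?R *\<^sub>v v)" using R v by (intro eq_vecI) auto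
  also have "C *\<^sub>v (?z \<cdot>\<^sub>v (?R *\<^sub>v v)) = ?z \<cdot>\<^sub>v (C *\<^sub>v (?R *\<^sub>v v))"
   by (rule mult_mat_vec[OF C mult_mat_vec_carrier[OF R v]])
  also have "C *\<^sub>v (?R *\<^sub>v v) = 0\<^sub>v d"
   using 0[of y] assoc_mult_mat_vec[OF C R v] by (simp add: rfun_def)
  finally show ?thesis using C by (auto intro!: eq_vecI)
 qed
 have "(C *\<^sub>v v) $ i = 0" if i: "i < d" for i
 proof (rule ccontr)
  assume ne: "(C *\<^sub>v v) $ i \<noteq> 0"
  obtain K T where KT: "!!z. T \<le> cmod z ==> cmod (rfun C A (A *\<^sub>v v) z $ i) \<le> K / cmod z"
   using rfun_holomorphic(2)[OF A C Av i] unfolding decays_def by blast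
  define c where "c = cmod ((C *\<^sub>v v) $ i)"
  have c: "c > 0" using ne by (simp add: c_def)
  \<comment> \<open>At this height c * y exceeds K, contradicting the decay estimate; the maximum
    also keeps it beyond \<open>T\<close> and positive.\<close>
  define y where "y = max (max T 1) (\<bar>K\<bar> / c + 1)"
  have y: "y \<ge> T" "y \<ge> 1" "y \<ge> \<bar>K\<bar> / c + 1" by (simp_all add: y_def)
  have cy: "cmod (Complex 0 y) = y" using y(2) by (simp add: cmod_def)
  have "c \<le> K / y"
   using KT[of "Complex 0 y"] y C i unfolding cy e c_def by simp
  then have "c * y \<le> K" using y(2) by (simp add: pos_le_divide_eq)
  moreover have "c * (\<bar>K\<bar> / c + 1) \<le> c * y" using c y(3) by (intro mult_left_mono) auto
  ultimately show False using c by (simp add: distrib_left)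
 qed
 then show C0: "C *\<^sub>v v = 0\<^sub>v d" using C by (intro eq_vecI) auto
 show "!!y. rfun C A (A *\<^sub>v v) (Complex 0 y) = 0\<^sub>v d" unfolding e C0 by auto
qed

lemma rfun_axis_zero_imp_powers:
 assumes "v \<in> carrier_vec n" "!!y. rfun C A v (Complex 0 y) = 0\<^sub>v d"
 shows "(C * (A ^\<^sub>m k)) *\<^sub>v v = 0\<^sub>v d"
 using assms
proof (induction k arbitrary: v)
 case 0
 then show ?case using rfun_axis_zero_imp(1)[OF 0] A C by simp
next
 case (Suc k)
 have Av: "A *\<^sub>v v \<in> carrier_vec n" using A Suc.prems(1) by (rule mult_mat_vec_carrier)
 have Ak: "A ^\<^sub>m k \<in> carrier_mat n n" using A by (rule pow_carrier_mat)
 have "(C * (A ^\<^sub>m Suc k)) *\<^sub>v v = (C * (A ^\<^sub>m k) * A) *\<^sub>v v"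
  using assoc_mult_mat[OF C Ak A] by simp
 also have "\<dots> = (C * (A ^\<^sub>m k)) *\<^sub>v (A *\<^sub>v v)"
  by (rule assoc_mult_mat_vec[OF mult_carrier_mat[OF C Ak] A Suc.prems(1)])
 also have "\<dots> = 0\<^sub>v d" by (rule Suc.IH[OF Av rfun_axis_zero_imp(2)[OF Suc.prems]])
 finally show ?case .
qed

lemma rfun_axis_continuous:
 assumes "v \<in> carrier_vec n" "i < d"
 shows "continuous_on UNIV (%y. rfun C A v (Complex 0 y) $ i)"
 by (rule continuous_on_compose2[OF holomorphic_on_imp_continuous_on[OF rfun_holomorphic(1)[OF A C assms]] continuous_on_Complex_line(1)])
  (use axis_notin_spectrum[OF sp] in auto)

lemma axis_gram_nonneg:
 assumes v: "v \<in> carrier_vec n"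
 shows "0 \<le> Re ((axis_gram n A (mat_adjoint C * C) *\<^sub>v v) \<bullet>c v)"
proof -
 have "Re s \<noteq> 0" if "s \<in> spectrum A" for s using sp that by (auto simp: right_half_plane_def)
 then have L: "(%y. rfun C A v (Complex 0 y)) \<in> L2_imag d" by (rule rfun_L2[OF A C v])
 have "0 \<le> Re (vinner d (%y. rfun C A v (Complex 0 y)) (%y. rfun C A v (Complex 0 y)))"
  by (rule vinner_self_nonneg(1)[OF L])
 then show ?thesis unfolding vinner_rfun_gram[OF A C sp v v] using pi_gt_zero by (auto simp: zero_le_mult_iff)
qed

text \<open>If the form vanishes at \<open>v\<close>, the function C (iy - A)^-1 v is zero almost
  everywhere, by continuity everywhere, and all C A^k v vanish. This is the positivity of the
  observability Gramian.\<close>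

lemma axis_gram_pos:
 assumes v: "v \<in> carrier_vec n" "v \<noteq> 0\<^sub>v n"
  and obs: "(!!k. (C * (A ^\<^sub>m k)) *\<^sub>v v = 0\<^sub>v d) ==> v = 0\<^sub>v n"
 shows "0 < Re ((axis_gram n A (mat_adjoint C * C) *\<^sub>v v) \<bullet>c v)"
proof (rule ccontr)
 assume "\<not> ?thesis"
 then have z: "Re ((axis_gram n A (mat_adjoint C * C) *\<^sub>v v) \<bullet>c v) = 0" using axis_gram_nonneg[OF v(1)] by simp
 have "Re s \<noteq> 0" if "s \<in> spectrum A" for s using sp that by (auto simp: right_half_plane_def)
 then have L: "(%y. rfun C A v (Complex 0 y)) \<in> L2_imag d" by (rule rfun_L2[OF A C v(1)])
 have "Re (vinner d (%y. rfun C A v (Complex 0 y)) (%y. rfun C A v (Complex 0 y))) = 0"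
  unfolding vinner_rfun_gram[OF A C sp v(1) v(1)] using z by simp
 then have ae: "AE y in lborel. rfun C A v (Complex 0 y) = 0\<^sub>v d" by (rule vinner_self_eq_0[OF L])
 have "rfun C A v (Complex 0 y) = 0\<^sub>v d" for y
 proof (rule eq_vecI)
  fix i assume "i < dim_vec (0\<^sub>v d :: complex vec)"
  then have i: "i < d" by simp
  have "AE y in lborel. rfun C A v (Complex 0 y) $ i = 0" using ae by eventually_elim (use i in simp)
  then have "rfun C A v (Complex 0 y) $ i = 0" by (rule continuous_AE_zero[OF rfun_axis_continuous[OF v(1) i]])
  then show "rfun C A v (Complex 0 y) $ i = 0\<^sub>v d $ i" using i by simp
 qed (use carrier_vecD[OF rfun_carrier[OF C]] in simp)
 then show False using obs rfun_axis_zero_imp_powers[OF v(1)] v(2) by blast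
qed

end

lemma pow_mat_commute:
 assumes "A \<in> carrier_mat n n" shows "A * A ^\<^sub>m k = A ^\<^sub>m k * A"
proof (induction k)
 case 0
 then show ?case using assms by simp
next
 case (Suc k)
 have "A * (A ^\<^sub>m k * A) = A * A ^\<^sub>m k * A"
  by (rule assoc_mult_mat[OF assms pow_carrier_mat[OF assms] assms, symmetric])
 then show ?case using Suc by simp
qed

text \<open>Duality: \<open>a\<close> is orthogonal to the columns of every Z^k X, and the vectors
  orthogonal to \<open>a\<close> form a subspace. It contains the span of these columns, which is
  the whole space and so contains \<open>a\<close> itself.\<close>

lemma controllable_imp_observable_adjoint:
 assumes Z: "Z \<in> carrier_mat n n" and X: "X \<in> carrier_mat n p" and ctrl: "controllable Z X"
  and a: "a \<in> carrier_vec n" and 0: "!!k. (mat_adjoint X * (mat_adjoint Z ^\<^sub>m k)) *\<^sub>v a = 0\<^sub>v p"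
 shows "a = 0\<^sub>v n"
proof -
 let ?S = "\<Union>k. set (cols ((Z ^\<^sub>m k) * X))"
 interpret vec_space "TYPE(complex)" n .
 have Zk: "Z ^\<^sub>m k \<in> carrier_mat n n" for k using Z by (rule pow_carrier_mat)
 have adjp: "mat_adjoint (Z ^\<^sub>m k) = mat_adjoint Z ^\<^sub>m k" for k
 proof (induction k)
  case 0 then show ?case using Z by simp
 next
  case (Suc k)
  have comm: "mat_adjoint Z * mat_adjoint Z ^\<^sub>m k = mat_adjoint Z ^\<^sub>m k * mat_adjoint Z"
   by (rule pow_mat_commute[OF mat_adjoint_carrier[OF Z]])
  show ?case using mat_adjoint_mult[OF Zk[of k] Z] Suc comm by simp
 qed
 have ker: "x \<bullet>c a = 0" if x: "x \<in> ?S" for x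
 proof -
  obtain k where k: "x \<in> set (cols ((Z ^\<^sub>m k) * X))" using x by blast
  let ?M = "(Z ^\<^sub>m k) * X"
  have M: "?M \<in> carrier_mat n p" using Zk X by (rule mult_carrier_mat)
  obtain j where j: "j < p" "x = col ?M j" using k carrier_matD(2)[OF M] unfolding cols_def by auto
  have "mat_adjoint ?M *\<^sub>v a = 0\<^sub>v p" using 0[of k] unfolding mat_adjoint_mult[OF Zk X] adjp .
  moreover have "(mat_adjoint ?M *\<^sub>v a) $ j = (\<Sum>l<n. cnj (?M $$ (l, j)) * a $ l)"
  proof -
   have "(mat_adjoint ?M *\<^sub>v a) $ j = (\<Sum>l<n. mat_adjoint ?M $$ (j, l) * a $ l)"
    by (rule mult_mat_vec_index_sum[OF mat_adjoint_carrier[OF M] a j(1)])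
   also have "\<dots> = (\<Sum>l<n. cnj (?M $$ (l, j)) * a $ l)"
    using carrier_matD[OF M] j(1) by (intro sum.cong refl) (subst mat_adjoint_index, auto)
   finally show ?thesis .
  qed
  ultimately have "cnj (\<Sum>l<n. cnj (?M $$ (l, j)) * a $ l) = 0" using j(1) by simp
  then have "(\<Sum>l<n. ?M $$ (l, j) * cnj (a $ l)) = 0" by simp
  moreover have "x \<bullet>c a = (\<Sum>l<n. ?M $$ (l, j) * cnj (a $ l))"
   unfolding cscalar_prod_sum[OF a] using carrier_matD[OF M] j by (intro sum.cong refl) simp
  ultimately show ?thesis by simp
 qed
 have Sc: "?S \<subseteq> carrier_vec n"
 proof
  fix x assume "x \<in> ?S"
  then obtain k where k: "x \<in> set (cols ((Z ^\<^sub>m k) * X))" by blast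
  then show "x \<in> carrier_vec n" using cols_dim[of "(Z ^\<^sub>m k) * X"] carrier_matD(1)[OF mult_carrier_mat[OF Zk[of k] X]] by auto
 qed
 have "submodule class_ring {x \<in> carrier_vec n. x \<bullet>c a = 0} (module_vec TYPE(complex) n)"
 proof (unfold_locales)
  show "{x \<in> carrier_vec n. x \<bullet>c a = 0} \<subseteq> carrier V" by auto
  show "v \<oplus>\<^bsub>V\<^esub> w \<in> {x \<in> carrier_vec n. x \<bullet>c a = 0}" if "v \<in> {x \<in> carrier_vec n. x \<bullet>c a = 0}" "w \<in> {x \<in> carrier_vec n. x \<bullet>c a = 0}" for v w
   using that a by (simp add: module_vec_def cscalar_prod_add_left[of _ n])
  show "\<zero>\<^bsub>V\<^esub> \<in> {x \<in> carrier_vec n. x \<bullet>c a = 0}" using a by (simp add: module_vec_def)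
  show "c \<odot>\<^bsub>V\<^esub> v \<in> {x \<in> carrier_vec n. x \<bullet>c a = 0}" if "v \<in> {x \<in> carrier_vec n. x \<bullet>c a = 0}" for c v
   using that a by (simp add: module_vec_def cscalar_prod_smult_left[of _ n])
 qed
 then have "span ?S \<subseteq> {x \<in> carrier_vec n. x \<bullet>c a = 0}"
  by (rule span_is_subset[rotated]) (use ker Sc in auto)
 moreover have "span ?S = carrier_vec n" using ctrl carrier_matD(1)[OF Z] unfolding controllable_def by simp
 ultimately have "a \<bullet>c a = 0" using a by blast
 then show ?thesis using a by (simp add: conjugate_square_eq_0_vec[of _ n])
qed

lemma fun_space_subspaceI:
 assumes c: "!!f t. f \<in> S ==> f t \<in> carrier_vec d" and z: "(%t. 0\<^sub>v d) \<in> S"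
  and a: "!!f g. f \<in> S ==> g \<in> S ==> (%t. f t + g t) \<in> S"
  and s: "!!k f. f \<in> S ==> (%t. k \<cdot>\<^sub>v f t) \<in> S"
 shows "VectorSpace.subspace class_ring S (fun_space d)"
proof -
 have ag: "abelian_group (fun_space d :: (complex, 'a => complex vec) module)"
 proof (rule abelian_groupI)
  fix x assume "x \<in> carrier (fun_space d :: (complex, 'a => complex vec) module)"
  then show "\<exists>y\<in>carrier (fun_space d). y \<oplus>\<^bsub>fun_space d\<^esub> x = \<zero>\<^bsub>fun_space d\<^esub>"
   by (intro bexI[of _ "%t. - x t"]) (auto simp: fun_space_def)
 qed (auto simp: fun_space_def fun_eq_iff intro: comm_add_vec[of _ d] assoc_add_vec[of _ d])
 have mod: "module class_ring (fun_space d :: (complex, 'a => complex vec) module)"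
  by (rule moduleI[OF domain.axioms(1)[OF field.axioms(1)[OF class_field]] ag])
   (auto simp: fun_space_def class_ring_simps smult_smult_assoc add_smult_distrib_vec fun_eq_iff intro!: smult_add_distrib_vec)
 then have vs: "vectorspace class_ring (fun_space d :: (complex, 'a => complex vec) module)"
  using class_field by (rule vectorspace.intro)
 have "submodule class_ring S (fun_space d)"
  by (rule submodule.intro[OF mod]) (use c z a s in \<open>auto simp: fun_space_def\<close>)
 with vs show ?thesis by (rule subspace.intro)
qed

lemma mat_adjoint_four_block:
 assumes "A \<in> carrier_mat a c" "B \<in> carrier_mat a e" "C \<in> carrier_mat b c" "D \<in> carrier_mat b e"
 shows "mat_adjoint (four_block_mat A B C D) =
  four_block_mat (mat_adjoint A) (mat_adjoint C) (mat_adjoint B) (mat_adjoint (D :: complex mat))"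
 by (rule eq_matI) (use assms in auto)

lemma zero_mult_vec:
 assumes "v \<in> carrier_vec b" shows "0\<^sub>m a b *\<^sub>v v = (0\<^sub>v a :: complex vec)"
 using carrier_vecD[OF assms] by (intro eq_vecI) (auto simp: scalar_prod_def)

lemma uminus_mult_vec:
 assumes "A \<in> carrier_mat a b" "v \<in> carrier_vec b"
 shows "(- A) *\<^sub>v v = (- 1) \<cdot>\<^sub>v ((A :: complex mat) *\<^sub>v v)"
 using carrier_matD[OF assms(1)] carrier_vecD[OF assms(2)] by (intro eq_vecI) auto

section \<open>Functions and Gram matrices attached to the interpolation data\<close>

locale btoa =
 fixes D :: btoa_data
 assumes adm: "btoa_admissible D"
begin

abbreviation "nz \<equiv> nZ D"
abbreviation "nw \<equiv> nW D"
abbreviation "p \<equiv> dp D"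
abbreviation "m \<equiv> dm D"
abbreviation "Z \<equiv> dZ D"
abbreviation "X \<equiv> dX D"
abbreviation "Y \<equiv> dY D"
abbreviation "U \<equiv> dU D"
abbreviation "V \<equiv> dV D"
abbreviation "W \<equiv> dW D"
abbreviation "Gam \<equiv> dG D"
abbreviation "Zs \<equiv> mat_adjoint (dZ D)"
abbreviation "Xs \<equiv> mat_adjoint (dX D)"
abbreviation "Ys \<equiv> mat_adjoint (dY D)"
abbreviation "B \<equiv> dX D @\<^sub>c (- dY D)"
abbreviation "Bs \<equiv> mat_adjoint (dX D) @\<^sub>r (- mat_adjoint (dY D))"

lemma dims: "Z \<in> carrier_mat nz nz" "X \<in> carrier_mat nz p" "Y \<in> carrier_mat nz m" "U \<in> carrier_mat m nw"
 "V \<in> carrier_mat p nw" "W \<in> carrier_mat nw nw" "Gam \<in> carrier_mat nz nw"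
 using adm unfolding btoa_admissible_def by (blast, blast, blast, blast, blast, blast, blast)

lemma adj_dims: "Zs \<in> carrier_mat nz nz" "Xs \<in> carrier_mat p nz" "Ys \<in> carrier_mat m nz"
 "mat_adjoint Gam \<in> carrier_mat nw nz"
 by (rule mat_adjoint_carrier, rule dims)+

lemma uminus_Zs: "- Zs \<in> carrier_mat nz nz" "- Ys \<in> carrier_mat m nz"
 by (rule uminus_carrier_mat, rule adj_dims)+

lemma spW: "spectrum W \<subseteq> \<Pi>\<^sub>+" and spZ: "spectrum Z \<subseteq> \<Pi>\<^sub>+"
 using adm unfolding btoa_admissible_def by blast+

lemma spZs: "spectrum Zs \<subseteq> \<Pi>\<^sub>+"
proof
 fix s assume "s \<in> spectrum Zs"
 then have "cnj s \<in> spectrum Z" using spectrum_adjoint_iff[OF dims(1)] by blast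
 then show "s \<in> \<Pi>\<^sub>+" using spZ by (force simp: right_half_plane_def)
qed

lemma spmZs: "s \<in> spectrum (- Zs) ==> Re s < 0"
proof -
 assume "s \<in> spectrum (- Zs)"
 then have "- s \<in> spectrum Zs" using spectrum_uminus_iff[OF adj_dims(1)] by blast
 then show "Re s < 0" using spZs by (force simp: right_half_plane_def)
qed

lemma nonaxis: "s \<in> spectrum W ==> Re s \<noteq> 0" "s \<in> spectrum (- Zs) ==> Re s \<noteq> 0"
 using spW spmZs[of s] by (auto simp: right_half_plane_def)

text \<open>Pairing with a function built from \<open>Bs\<close> produces residues against the
  adjoint of \<open>Bs\<close>. Stacking \<open>Xs\<close> over \<open>- Ys\<close> makes this
  adjoint the row [X, -Y] of the interpolation condition.\<close>

lemma B_adjoint: "mat_adjoint Bs = B" "Bs \<in> carrier_mat (p + m) nz"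
proof -
 show "Bs \<in> carrier_mat (p + m) nz" by (rule carrier_append_rows[OF adj_dims(2) uminus_Zs(2)])
 have "mat_adjoint Bs = four_block_mat X (- Y) (mat_adjoint (0\<^sub>m p 0)) (mat_adjoint (0\<^sub>m m 0))"
  unfolding append_rows_def mat_adjoint_dim
  using mat_adjoint_four_block[OF adj_dims(2) zero_carrier_mat[of p 0] uminus_Zs(2) zero_carrier_mat[of m 0]]
  by (simp add: mat_adjoint_uminus)
 then show "mat_adjoint Bs = B" unfolding append_cols_def by simp
qed

abbreviation "hX a \<equiv> rfun Xs (- Zs) a"
abbreviation "hY a \<equiv> rfun Ys (- Zs) a"
abbreviation "hB a \<equiv> rfun Bs (- Zs) a"
abbreviation "fX a \<equiv> %y. rfun Xs (- Zs) a (Complex 0 y)"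
abbreviation "fY a \<equiv> %y. rfun Ys (- Zs) a (Complex 0 y)"
abbreviation "fB a \<equiv> %y. rfun Bs (- Zs) a (Complex 0 y)"
abbreviation "gU b \<equiv> %y. rfun U W b (Complex 0 y)"
abbreviation "gV b \<equiv> %y. rfun V W b (Complex 0 y)"
abbreviation "GX \<equiv> axis_gram nz Zs (mat_adjoint Xs * Xs)"
abbreviation "GY \<equiv> axis_gram nz Zs (mat_adjoint Ys * Ys)"
abbreviation "GB \<equiv> axis_gram nz Zs (mat_adjoint Bs * Bs)"
abbreviation "GU \<equiv> axis_gram nw W (mat_adjoint U * U)"
abbreviation "GV \<equiv> axis_gram nw W (mat_adjoint V * V)"
abbreviation "Lvec h \<equiv> vec nz (residue_sum Z B h)"

lemma f_L2:
 "a \<in> carrier_vec nz ==> fX a \<in> L2_imag p" "a \<in> carrier_vec nz ==> fY a \<in> L2_imag m"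
 "a \<in> carrier_vec nz ==> fB a \<in> L2_imag (p + m)"
 "b \<in> carrier_vec nw ==> gU b \<in> L2_imag m" "b \<in> carrier_vec nw ==> gV b \<in> L2_imag p"
 using rfun_L2[OF uminus_Zs(1) adj_dims(2) _ nonaxis(2)] rfun_L2[OF uminus_Zs(1) adj_dims(3) _ nonaxis(2)]
  rfun_L2[OF uminus_Zs(1) B_adjoint(2) _ nonaxis(2)] rfun_L2[OF dims(6,4) _ nonaxis(1)] rfun_L2[OF dims(6,5) _ nonaxis(1)]
 by blast+

lemma f_hardy:
 "a \<in> carrier_vec nz ==> hardy_vec p (hX a) (fX a)" "a \<in> carrier_vec nz ==> hardy_vec m (hY a) (fY a)"
 "a \<in> carrier_vec nz ==> hardy_vec (p + m) (hB a) (fB a)"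
 using rfun_hardy[OF uminus_Zs(1) adj_dims(2) _ spmZs] rfun_hardy[OF uminus_Zs(1) adj_dims(3) _ spmZs]
  rfun_hardy[OF uminus_Zs(1) B_adjoint(2) _ spmZs]
 by blast+

lemma g_orth:
 "hardy_vec m h H ==> b \<in> carrier_vec nw ==> vinner m H (gU b) = 0"
 "hardy_vec p h' H' ==> b \<in> carrier_vec nw ==> vinner p H' (gV b) = 0"
 using vinner_rfun_orthogonal[OF dims(6,4) _ spW] vinner_rfun_orthogonal[OF dims(6,5) _ spW] by blast+

lemma grams:
 "a \<in> carrier_vec nz ==> a' \<in> carrier_vec nz ==> vinner p (fX a) (fX a') = 2 * pi * ((GX *\<^sub>v a) \<bullet>c a')"
 "a \<in> carrier_vec nz ==> a' \<in> carrier_vec nz ==> vinner m (fY a) (fY a') = 2 * pi * ((GY *\<^sub>v a) \<bullet>c a')"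
 "a \<in> carrier_vec nz ==> a' \<in> carrier_vec nz ==> vinner (p + m) (fB a) (fB a') = 2 * pi * ((GB *\<^sub>v a) \<bullet>c a')"
 "b \<in> carrier_vec nw ==> b' \<in> carrier_vec nw ==> vinner m (gU b) (gU b') = 2 * pi * ((GU *\<^sub>v b) \<bullet>c b')"
 "b \<in> carrier_vec nw ==> b' \<in> carrier_vec nw ==> vinner p (gV b) (gV b') = 2 * pi * ((GV *\<^sub>v b) \<bullet>c b')"
 by (rule vinner_rfun_gram_uminus[OF adj_dims(1,2) spZs], assumption+)
  (rule vinner_rfun_gram_uminus[OF adj_dims(1,3) spZs] vinner_rfun_gram_uminus[OF adj_dims(1) B_adjoint(2) spZs]
   vinner_rfun_gram[OF dims(6,4) spW] vinner_rfun_gram[OF dims(6,5) spW], assumption+)+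

text \<open>For the state matrix \<open>- Zs\<close> the matrix whose residues occur in
  \<open>vinner_rfun\<close> is \<open>Z\<close>. So the interpolation condition prescribes inner
  products with the functions \<open>fB a\<close>, and its homogeneous form is orthogonality to a
  finite-dimensional subspace of the Hardy space.\<close>

lemma residue_pairing:
 assumes h: "hardy_vec (p + m) h H" and a: "a \<in> carrier_vec nz"
 shows "vinner (p + m) H (fB a) = 2 * pi * (Lvec h \<bullet>c a)"
proof -
 have e: "- mat_adjoint (- Zs) = Z" by (simp add: mat_adjoint_uminus)
 have "Lvec h \<bullet>c a = (\<Sum>j<nz. cnj (a $ j) * residue_sum Z B h j)"
  unfolding cscalar_prod_sum[OF a] by (intro sum.cong refl) (simp add: mult.commute)
 then show ?thesis
  using vinner_rfun[OF uminus_Zs(1) B_adjoint(2) a nonaxis(2) h] unfolding e B_adjoint(1) by simp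
qed

lemma fB_append: "a \<in> carrier_vec nz ==> fB a = (%y. fX a y @\<^sub>v (- 1) \<cdot>\<^sub>v fY a y)"
proof
 fix y assume a: "a \<in> carrier_vec nz"
 have "Complex 0 y \<notin> spectrum (- Zs)" using nonaxis(2)[of "Complex 0 y"] by auto
 then have R: "resolvent (- Zs) (Complex 0 y) \<in> carrier_mat nz nz" by (rule resolvent_props(1)[OF uminus_Zs(1)])
 let ?v = "resolvent (- Zs) (Complex 0 y) *\<^sub>v a"
 have v: "?v \<in> carrier_vec nz" using R a by (rule mult_mat_vec_carrier)
 have "fB a y = Bs *\<^sub>v ?v" unfolding rfun_def by (rule assoc_mult_mat_vec[OF B_adjoint(2) R a])
 also have "\<dots> = (Xs *\<^sub>v ?v) @\<^sub>v ((- Ys) *\<^sub>v ?v)"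
  by (rule mat_mult_append[OF adj_dims(2) uminus_Zs(2) v])
 also have "Xs *\<^sub>v ?v = fX a y" unfolding rfun_def by (rule assoc_mult_mat_vec[OF adj_dims(2) R a, symmetric])
 also have "(- Ys) *\<^sub>v ?v = (- 1) \<cdot>\<^sub>v (Ys *\<^sub>v ?v)" by (rule uminus_mult_vec[OF adj_dims(3) v])
 also have "Ys *\<^sub>v ?v = fY a y" unfolding rfun_def by (rule assoc_mult_mat_vec[OF adj_dims(3) R a, symmetric])
 finally show "fB a y = fX a y @\<^sub>v (- 1) \<cdot>\<^sub>v fY a y" .
qed

lemma Pmats: "GX \<in> carrier_mat nz nz" "GY \<in> carrier_mat nz nz" "GB \<in> carrier_mat nz nz"
 "GU \<in> carrier_mat nw nw" "GV \<in> carrier_mat nw nw"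
 by simp_all

lemma gram_hermitian: "mat_adjoint GX = GX" "mat_adjoint GY = GY" "mat_adjoint GB = GB" "mat_adjoint GU = GU" "mat_adjoint GV = GV"
proof -
 have h: "mat_adjoint (mat_adjoint C * C) = mat_adjoint C * C" if "C \<in> carrier_mat d k" for C :: "complex mat" and d k
  using mat_adjoint_mult[OF mat_adjoint_carrier[OF that] that] by simp
 have c: "mat_adjoint C * C \<in> carrier_mat k k" if "C \<in> carrier_mat d k" for C :: "complex mat" and d k
  using mult_carrier_mat[OF mat_adjoint_carrier[OF that] that] .
 show "mat_adjoint GX = GX" by (rule axis_gram_unique_adjoint[OF adj_dims(1) spZs c[OF adj_dims(2)] h[OF adj_dims(2)]])
 show "mat_adjoint GY = GY" by (rule axis_gram_unique_adjoint[OF adj_dims(1) spZs c[OF adj_dims(3)] h[OF adj_dims(3)]])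
 show "mat_adjoint GB = GB" by (rule axis_gram_unique_adjoint[OF adj_dims(1) spZs c[OF B_adjoint(2)] h[OF B_adjoint(2)]])
 show "mat_adjoint GU = GU" by (rule axis_gram_unique_adjoint[OF dims(6) spW c[OF dims(4)] h[OF dims(4)]])
 show "mat_adjoint GV = GV" by (rule axis_gram_unique_adjoint[OF dims(6) spW c[OF dims(5)] h[OF dims(5)]])
qed

text \<open>Controllability of (Z, X) is observability of (Xs, Zs) by duality, and the latter is
  what positivity of a Gram matrix asks for.\<close>

lemma GX_pos:
 assumes "a \<in> carrier_vec nz" "a \<noteq> 0\<^sub>v nz" shows "0 < Re ((GX *\<^sub>v a) \<bullet>c a)"
proof (rule axis_gram_pos[OF adj_dims(1) spZs adj_dims(2) assms])
 assume "!!k. (Xs * Zs ^\<^sub>m k) *\<^sub>v a = 0\<^sub>v p"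
 moreover have "controllable Z X" using adm unfolding btoa_admissible_def by blast
 ultimately show "a = 0\<^sub>v nz" by (intro controllable_imp_observable_adjoint[OF dims(1,2) _ assms(1)])
qed

lemma GU_pos:
 assumes "b \<in> carrier_vec nw" "b \<noteq> 0\<^sub>v nw" shows "0 < Re ((GU *\<^sub>v b) \<bullet>c b)"
proof (rule axis_gram_pos[OF dims(6) spW dims(4) assms])
 assume "!!k. (U * W ^\<^sub>m k) *\<^sub>v b = 0\<^sub>v m"
 then have "b \<in> {x \<in> carrier_vec (dim_row W). \<forall>k. (U * (W ^\<^sub>m k)) *\<^sub>v x = 0\<^sub>v (dim_row U)}"
  using assms(1) unfolding carrier_matD(1)[OF dims(4)] by blast
 then show "b = 0\<^sub>v nw" using adm unfolding btoa_admissible_def observable_def by blast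
qed

text \<open>Stacking adds the forms, and squaring removes the sign of \<open>Ys\<close>: up to the
  factor 2\<pi>, the form of \<open>GB\<close> is that of \<open>GX\<close> plus the nonnegative
  square norm of \<open>fY a\<close>.\<close>

lemma GB_pos:
 assumes a: "a \<in> carrier_vec nz" "a \<noteq> 0\<^sub>v nz" shows "0 < Re ((GB *\<^sub>v a) \<bullet>c a)"
proof -
 have c: "fX a y \<in> carrier_vec p" "(- 1) \<cdot>\<^sub>v fY a y \<in> carrier_vec m" for y
  using rfun_carrier[OF adj_dims(2)] rfun_carrier[OF adj_dims(3)] by auto
 have "vinner (p + m) (fB a) (fB a) = vinner p (fX a) (fX a) + vinner m (%y. (- 1) \<cdot>\<^sub>v fY a y) (%y. (- 1) \<cdot>\<^sub>v fY a y)"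
  unfolding fB_append[OF a(1)] by (rule vinner_append[OF c c])
 also have "vinner m (%y. (- 1) \<cdot>\<^sub>v fY a y) (%y. (- 1) \<cdot>\<^sub>v fY a y) = vinner m (fY a) (fY a)"
  by (simp add: vinner_smult_left[OF f_L2(2)[OF a(1)]] vinner_smult_right[OF f_L2(2)[OF a(1)]])
 finally have "2 * pi * ((GB *\<^sub>v a) \<bullet>c a) = 2 * pi * ((GX *\<^sub>v a) \<bullet>c a) + vinner m (fY a) (fY a)"
  unfolding grams(1,3)[OF a(1) a(1)] .
 then have "2 * pi * Re ((GB *\<^sub>v a) \<bullet>c a) = 2 * pi * Re ((GX *\<^sub>v a) \<bullet>c a) + Re (vinner m (fY a) (fY a))"
  by (auto dest!: arg_cong[of _ _ Re])
 moreover have "0 < 2 * pi * Re ((GX *\<^sub>v a) \<bullet>c a)" using GX_pos[OF a] by simp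
 ultimately have "0 < 2 * pi * Re ((GB *\<^sub>v a) \<bullet>c a)" using vinner_self_nonneg(1)[OF f_L2(2)[OF a(1)]] by linarith
 then show ?thesis by (simp add: zero_less_mult_iff)
qed

end

lemma pos_imp_det_nonzero:
 assumes G: "G \<in> carrier_mat n n" and pos: "!!v. v \<in> carrier_vec n ==> v \<noteq> 0\<^sub>v n ==> 0 < Re ((G *\<^sub>v v) \<bullet>c v)"
 shows "det G \<noteq> 0"
proof
 assume "det G = 0"
 then obtain v where v: "v \<in> carrier_vec n" "v \<noteq> 0\<^sub>v n" "G *\<^sub>v v = 0\<^sub>v n"
  using det_0_iff_vec_prod_zero_field[OF G] by blast
 have "(G *\<^sub>v v) \<bullet>c v = 0" unfolding v(3) using v(1) by simp
 then show False using pos[OF v(1,2)] by simp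
qed

lemma pos_solve:
 assumes G: "G \<in> carrier_mat n n" and pos: "!!v. v \<in> carrier_vec n ==> v \<noteq> 0\<^sub>v n ==> 0 < Re ((G *\<^sub>v v) \<bullet>c v)"
  and c: "c \<in> carrier_vec n"
 obtains x where "x \<in> carrier_vec n" "G *\<^sub>v x = c"
proof -
 note i = minv_props[OF G pos_imp_det_nonzero[OF G pos]]
 show ?thesis
 proof (rule that[of "minv G *\<^sub>v c"])
  show "minv G *\<^sub>v c \<in> carrier_vec n" using i(1) c by (rule mult_mat_vec_carrier)
  have "G *\<^sub>v (minv G *\<^sub>v c) = (G * minv G) *\<^sub>v c" by (rule assoc_mult_mat_vec[OF G i(1) c, symmetric])
  then show "G *\<^sub>v (minv G *\<^sub>v c) = c" using i(2) c by simp
 qed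
qed

context btoa
begin

lemma Jmat_append:
 assumes "x \<in> carrier_vec p" "y \<in> carrier_vec m"
 shows "Jmat D *\<^sub>v (x @\<^sub>v y) = x @\<^sub>v (- 1) \<cdot>\<^sub>v y"
proof -
 have "Jmat D *\<^sub>v (x @\<^sub>v y) = (1\<^sub>m p *\<^sub>v x + 0\<^sub>m p m *\<^sub>v y) @\<^sub>v (0\<^sub>m m p *\<^sub>v x + (- 1\<^sub>m m) *\<^sub>v y)"
  unfolding Jmat_def by (rule four_block_mat_mult_vec[of _ p p _ m _ m]) (use assms in auto)
 also have "(- 1\<^sub>m m) *\<^sub>v y = (- 1) \<cdot>\<^sub>v y" using assms(2) by (intro eq_vecI) auto
 finally show ?thesis unfolding zero_mult_vec[OF assms(1)] zero_mult_vec[OF assms(2)] using assms by simp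
qed

lemma J_inner_append:
 assumes "F1 \<in> L2_imag p" "F2 \<in> L2_imag m" "G1 \<in> L2_imag p" "G2 \<in> L2_imag m"
 shows "J_inner D (%y. F1 y @\<^sub>v F2 y) (%y. G1 y @\<^sub>v G2 y) = vinner p F1 G1 - vinner m F2 G2"
  "vinner (p + m) (%y. F1 y @\<^sub>v (- 1) \<cdot>\<^sub>v F2 y) (%y. G1 y @\<^sub>v G2 y) = vinner p F1 G1 - vinner m F2 G2"
proof -
 note c = L2_imag_carrier[OF assms(1)] L2_imag_carrier[OF assms(2)] L2_imag_carrier[OF assms(3)] L2_imag_carrier[OF assms(4)]
 have c2: "(- 1) \<cdot>\<^sub>v F2 y \<in> carrier_vec m" for y using c(2) by simp
 show 1: "vinner (p + m) (%y. F1 y @\<^sub>v (- 1) \<cdot>\<^sub>v F2 y) (%y. G1 y @\<^sub>v G2 y) = vinner p F1 G1 - vinner m F2 G2"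
  unfolding vinner_append[OF c(1) c2 c(3,4)] vinner_smult_left[OF assms(2)] by simp
 have L: "(%y. F1 y @\<^sub>v (- 1) \<cdot>\<^sub>v F2 y) \<in> L2_imag (p + m)" "(%y. G1 y @\<^sub>v G2 y) \<in> L2_imag (p + m)"
  using L2_imag_append[of F1 p "%y. (- 1) \<cdot>\<^sub>v F2 y" m, OF c(1) c2] L2_imag_append[of G1 p G2 m, OF c(3,4)] assms L2_imag_smult by auto
 show "J_inner D (%y. F1 y @\<^sub>v F2 y) (%y. G1 y @\<^sub>v G2 y) = vinner p F1 G1 - vinner m F2 G2"
  unfolding J_inner_def Jmat_append[OF c(1,2)] vinner_eq_integral(1)[OF L, symmetric] by (rule 1)
qed

lemma rfun_VU:
 assumes x: "x \<in> carrier_vec nw"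
 shows "((V @\<^sub>r U) * resolvent W (\<i> * complex_of_real y)) *\<^sub>v x = gV x y @\<^sub>v gU x y"
  "(U * resolvent W (\<i> * complex_of_real y)) *\<^sub>v x = gU x y"
proof -
 have i: "\<i> * complex_of_real y = Complex 0 y" by (simp add: complex_eq_iff)
 have R: "resolvent W (Complex 0 y) \<in> carrier_mat nw nw" by (rule resolvent_props(1)[OF dims(6) axis_notin_spectrum[OF spW]])
 have v: "resolvent W (Complex 0 y) *\<^sub>v x \<in> carrier_vec nw" using R x by (rule mult_mat_vec_carrier)
 have "((V @\<^sub>r U) * resolvent W (Complex 0 y)) *\<^sub>v x = (V @\<^sub>r U) *\<^sub>v (resolvent W (Complex 0 y) *\<^sub>v x)"
  by (rule assoc_mult_mat_vec[OF carrier_append_rows[OF dims(5,4)] R x])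
 also have "\<dots> = (V *\<^sub>v (resolvent W (Complex 0 y) *\<^sub>v x)) @\<^sub>v (U *\<^sub>v (resolvent W (Complex 0 y) *\<^sub>v x))"
  by (rule mat_mult_append[OF dims(5,4) v])
 also have "\<dots> = gV x y @\<^sub>v gU x y" unfolding rfun_def
  by (simp only: assoc_mult_mat_vec[OF dims(5) R x] assoc_mult_mat_vec[OF dims(4) R x])
 finally show "((V @\<^sub>r U) * resolvent W (\<i> * complex_of_real y)) *\<^sub>v x = gV x y @\<^sub>v gU x y" unfolding i .
 show "(U * resolvent W (\<i> * complex_of_real y)) *\<^sub>v x = gU x y" unfolding i rfun_def ..
qed

lemma M_space_iff:
 "F \<in> M_space D \<longleftrightarrow> (\<exists>x h H. F = (%y. (gV x y @\<^sub>v gU x y) + H y) \<and> x \<in> carrier_vec nw \<and> hardy_vec (p + m) h H \<and> Lvec h = Gam *\<^sub>v x)"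
proof -
 have L: "(\<forall>i<nz. residue_sum Z B h i = (Gam *\<^sub>v x) $ i) \<longleftrightarrow> Lvec h = Gam *\<^sub>v x" for h x
 proof -
  have d: "dim_vec (Gam *\<^sub>v x) = nz" using carrier_matD(1)[OF dims(7)] by (simp only: dim_mult_mat_vec)
  show ?thesis
  proof
   assume *: "\<forall>i<nz. residue_sum Z B h i = (Gam *\<^sub>v x) $ i"
   show "Lvec h = Gam *\<^sub>v x" by (rule eq_vecI) (use * d in simp_all)
  next
   assume *: "Lvec h = Gam *\<^sub>v x"
   show "\<forall>i<nz. residue_sum Z B h i = (Gam *\<^sub>v x) $ i"
    unfolding *[symmetric] by simp
  qed
 qed
 have "F \<in> M_space D \<longleftrightarrow> (\<exists>x h H. F = (%y. ((V @\<^sub>r U) * resolvent W (\<i> * complex_of_real y)) *\<^sub>v x + H y) \<and> x \<in> carrier_vec nw \<and> hardy_vec (p + m) h H \<and>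
  (\<forall>i<nz. residue_sum Z B h i = (Gam *\<^sub>v x) $ i))"
  unfolding M_space_def hardy_vec_def residue_sum_def by blast
 also have "\<dots> \<longleftrightarrow> (\<exists>x h H. F = (%y. (gV x y @\<^sub>v gU x y) + H y) \<and> x \<in> carrier_vec nw \<and> hardy_vec (p + m) h H \<and> Lvec h = Gam *\<^sub>v x)"
  unfolding L by (intro ex_cong1 conj_cong[OF _ refl] iffI) (auto simp: rfun_VU(1))
 finally show ?thesis .
qed

lemma K_space_iff:
 "F \<in> K_space D \<longleftrightarrow> (\<exists>F1 b g G. F = (%y. F1 y @\<^sub>v (gU b y + G y)) \<and> F1 \<in> L2_imag p \<and> b \<in> carrier_vec nw \<and> hardy_vec m g G)"
proof
 assume "F \<in> K_space D"
 then obtain F1 x g G where "F = (%y. F1 y @\<^sub>v ((U * resolvent W (\<i> * complex_of_real y)) *\<^sub>v x + G y))" "F1 \<in> L2_imag p" "x \<in> carrier_vec nw" "hardy_vec m g G"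
  unfolding K_space_def M_minus_def hardy_vec_def by blast
 then show "\<exists>F1 b g G. F = (%y. F1 y @\<^sub>v (gU b y + G y)) \<and> F1 \<in> L2_imag p \<and> b \<in> carrier_vec nw \<and> hardy_vec m g G"
  using rfun_VU(2) by auto
next
 assume "\<exists>F1 b g G. F = (%y. F1 y @\<^sub>v (gU b y + G y)) \<and> F1 \<in> L2_imag p \<and> b \<in> carrier_vec nw \<and> hardy_vec m g G"
 then obtain F1 b g G where F: "F = (%y. F1 y @\<^sub>v (gU b y + G y))" "F1 \<in> L2_imag p" "b \<in> carrier_vec nw" "hardy_vec m g G" by blast
 have "(%y. gU b y + G y) \<in> M_minus D"
  using F(3,4) rfun_VU(2)[OF F(3)] unfolding M_minus_def hardy_vec_def
  by (intro CollectI exI[of _ b] exI[of _ g] exI[of _ G]) auto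
 then show "F \<in> K_space D" unfolding K_space_def F(1) using F(2)
  by (intro CollectI exI[of _ F1] exI[of _ "%y. gU b y + G y"] conjI refl)
qed

end

section \<open>Bases orthonormal up to signs for a Hermitian form\<close>

text \<open>If n < k, padding both factors with zeros to size k keeps the product equal to the
  identity. A one-sided inverse of a square matrix is two-sided, but the reversed product has a zero
  row.\<close>

lemma left_inverse_size_le:
 fixes A B :: "complex mat"
 assumes A: "A \<in> carrier_mat k n" and B: "B \<in> carrier_mat n k" and AB: "A * B = 1\<^sub>m k"
 shows "k \<le> n"
proof (rule ccontr)
 assume "\<not> k \<le> n"
 then have kn: "n < k" by simp
 define A' where "A' = mat k k (%(i, l). if l < n then A $$ (i, l) else (0 :: complex))"
 define B' where "B' = mat k k (%(l, j). if l < n then B $$ (l, j) else (0 :: complex))"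
 have c: "A' \<in> carrier_mat k k" "B' \<in> carrier_mat k k" by (simp_all add: A'_def B'_def)
 have "A' * B' = 1\<^sub>m k"
 proof (rule eq_matI)
  fix i j assume "i < dim_row (1\<^sub>m k :: complex mat)" "j < dim_col (1\<^sub>m k :: complex mat)"
  then have ij: "i < k" "j < k" by auto
  have "(A' * B') $$ (i, j) = (\<Sum>l<k. A' $$ (i, l) * B' $$ (l, j))" by (rule mult_mat_index_sum[OF c ij])
  also have "\<dots> = (\<Sum>l<n. A $$ (i, l) * B $$ (l, j))"
   using kn ij by (intro sum.mono_neutral_cong_right) (auto simp: A'_def B'_def)
  also have "\<dots> = (A * B) $$ (i, j)" by (rule mult_mat_index_sum[OF A B ij, symmetric])
  finally show "(A' * B') $$ (i, j) = 1\<^sub>m k $$ (i, j)" unfolding AB .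
 qed (simp_all add: A'_def B'_def)
 then have "B' * A' = 1\<^sub>m k" by (rule mat_mult_left_right_inverse[OF c])
 moreover have "(B' * A') $$ (n, n) = 0"
  unfolding mult_mat_index_sum[OF c(2,1) kn kn] using kn by (intro sum.neutral) (auto simp: B'_def)
 ultimately show False using kn by simp
qed

definition form_orthonormal :: "nat => complex mat => complex vec set => nat => (nat => complex vec) => (nat => real) => bool"
 where "form_orthonormal n G T k v e \<longleftrightarrow> (\<forall>i<k. v i \<in> T \<and> (e i = 1 \<or> e i = - 1)) \<and>
  (\<forall>i<k. \<forall>j<k. (G *\<^sub>v v i) \<bullet>c v j = (if i = j then complex_of_real (e i) else 0))"

lemma hermitian_form_commute:
 assumes "G \<in> carrier_mat n n" "mat_adjoint G = G" "x \<in> carrier_vec n" "y \<in> carrier_vec n"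
 shows "(G *\<^sub>v y) \<bullet>c x = cnj ((G *\<^sub>v x) \<bullet>c (y :: complex vec))"
proof -
 have "(G *\<^sub>v y) \<bullet>c x = y \<bullet>c (G *\<^sub>v x)" using mat_adjoint_cscalar[OF assms(1,4,3)] assms(2) by simp
 then show ?thesis using cscalar_prod_commute[OF mult_mat_vec_carrier[OF assms(1,3)] assms(4)] by simp
qed

text \<open>The rows formed from the conjugates of e i v i and the columns G v j multiply to the
  identity, because e i squares to 1; a factorization of this shape bounds the length by the
  dimension.\<close>

lemma form_orthonormal_le:
 assumes G: "G \<in> carrier_mat n n" and T: "T \<subseteq> carrier_vec n" and o: "form_orthonormal n G T k v e"
 shows "k \<le> n"
proof -
 have vT: "v i \<in> carrier_vec n" "e i * e i = 1" if "i < k" for i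
  using o T that unfolding form_orthonormal_def by auto
 define A where "A = mat k n (%(i, l). of_real (e i) * cnj (v i $ l))"
 define B where "B = mat n k (%(l, j). (G *\<^sub>v v j) $ l)"
 have c: "A \<in> carrier_mat k n" "B \<in> carrier_mat n k" by (simp_all add: A_def B_def)
 have "A * B = 1\<^sub>m k"
 proof (rule eq_matI)
  fix i j assume "i < dim_row (1\<^sub>m k :: complex mat)" "j < dim_col (1\<^sub>m k :: complex mat)"
  then have ij: "i < k" "j < k" by auto
  have "(A * B) $$ (i, j) = (\<Sum>l<n. A $$ (i, l) * B $$ (l, j))" by (rule mult_mat_index_sum[OF c ij])
  also have "\<dots> = of_real (e i) * (\<Sum>l<n. (G *\<^sub>v v j) $ l * cnj (v i $ l))"
   unfolding sum_distrib_left using ij by (intro sum.cong refl) (simp add: A_def B_def mult.assoc mult.commute[of "cnj _"])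
  also have "(\<Sum>l<n. (G *\<^sub>v v j) $ l * cnj (v i $ l)) = (G *\<^sub>v v j) \<bullet>c v i"
   by (rule cscalar_prod_sum[OF vT(1)[OF ij(1)], symmetric])
  also have "\<dots> = (if j = i then of_real (e j) else 0)" using o ij unfolding form_orthonormal_def by blast
  finally show "(A * B) $$ (i, j) = 1\<^sub>m k $$ (i, j)" using ij vT(2)[OF ij(1)] by (auto simp flip: of_real_mult)
 qed (simp_all add: A_def B_def)
 then show ?thesis by (rule left_inverse_size_le[OF c])
qed

text \<open>The length of such systems is bounded by n, so a longest one exists. A vector orthogonal
  to it on which the form does not vanish could be normalized and appended.\<close>

lemma maximal_form_orthonormal:
 assumes G: "G \<in> carrier_mat n n" and h: "mat_adjoint G = G" and T: "T \<subseteq> carrier_vec n"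
  and sm: "!!c x. x \<in> T ==> c \<cdot>\<^sub>v x \<in> T"
 obtains k v e where "form_orthonormal n G T k v e"
  "!!x. x \<in> T ==> (!!i. i < k ==> (G *\<^sub>v x) \<bullet>c v i = 0) ==> (G *\<^sub>v x) \<bullet>c x = 0"
proof -
 let ?P = "%k. \<exists>v e. form_orthonormal n G T k v e"
 have P0: "?P 0" by (simp add: form_orthonormal_def)
 have bd: "\<forall>k. ?P k \<longrightarrow> k \<le> n" using form_orthonormal_le[OF G T] by blast
 define k where "k = (GREATEST k. ?P k)"
 have Pk: "?P k" unfolding k_def by (rule GreatestI_nat[where P = ?P and k = 0 and b = n]) (use P0 bd in blast)+
 have max: "j \<le> k" if "?P j" for j unfolding k_def by (rule Greatest_le_nat[where P = ?P and b = n]) (use that bd in blast)+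
 obtain v e where o: "form_orthonormal n G T k v e" using Pk by blast
 have "(G *\<^sub>v x) \<bullet>c x = 0" if x: "x \<in> T" and orth: "!!i. i < k ==> (G *\<^sub>v x) \<bullet>c v i = 0" for x
 proof (rule ccontr)
  assume ne: "(G *\<^sub>v x) \<bullet>c x \<noteq> 0"
  have xc: "x \<in> carrier_vec n" using x T by auto
  have Gx: "G *\<^sub>v x \<in> carrier_vec n" using G xc by (rule mult_mat_vec_carrier)
  define r where "r = Re ((G *\<^sub>v x) \<bullet>c x)"
  have "Im ((G *\<^sub>v x) \<bullet>c x) = 0"
   using arg_cong[OF hermitian_form_commute[OF G h xc xc], of Im] by simp
  then have r: "(G *\<^sub>v x) \<bullet>c x = of_real r" by (simp add: r_def complex_eq_iff)
  have r0: "r \<noteq> 0" using ne r by auto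
  \<comment> \<open>Scaling by 1/sqrt |r| turns the value r of the form into its sign.\<close>
  define t where "t = 1 / sqrt \<bar>r\<bar>"
  have t: "t * t * r = sgn r" using r0 by (simp add: t_def sgn_if field_simps)
  define u where "u = complex_of_real t \<cdot>\<^sub>v x"
  have uT: "u \<in> T" unfolding u_def by (rule sm[OF x])
  have uc: "u \<in> carrier_vec n" using uT T by auto
  have Gu: "G *\<^sub>v u = complex_of_real t \<cdot>\<^sub>v (G *\<^sub>v x)" unfolding u_def by (rule mult_mat_vec[OF G xc])
  have uu: "(G *\<^sub>v u) \<bullet>c u = of_real (sgn r)"
   unfolding Gu cscalar_prod_smult_left[OF Gx uc] unfolding u_def cscalar_prod_smult_right[OF Gx xc] r
   using t by (simp flip: of_real_mult add: mult.assoc)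
  have vi: "v i \<in> carrier_vec n" if "i < k" for i using o T that unfolding form_orthonormal_def by auto
  have uv: "(G *\<^sub>v u) \<bullet>c v i = 0" if "i < k" for i
   unfolding Gu cscalar_prod_smult_left[OF Gx vi[OF that]] using orth[OF that] by simp
  have vu: "(G *\<^sub>v v i) \<bullet>c u = 0" if "i < k" for i
   unfolding hermitian_form_commute[OF G h uc vi[OF that]] uv[OF that] by simp
  have "form_orthonormal n G T (Suc k) (v(k := u)) (e(k := sgn r))"
   unfolding form_orthonormal_def
  proof (intro conjI allI impI)
   fix i assume "i < Suc k"
   then show "(v(k := u)) i \<in> T" "(e(k := sgn r)) i = 1 \<or> (e(k := sgn r)) i = - 1"
    using o uT r0 unfolding form_orthonormal_def by (auto simp: less_Suc_eq sgn_if)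
   fix j assume "j < Suc k"
   then show "(G *\<^sub>v (v(k := u)) i) \<bullet>c (v(k := u)) j = (if i = j then complex_of_real ((e(k := sgn r)) i) else 0)"
    using o uu uv vu \<open>i < Suc k\<close> unfolding form_orthonormal_def by (auto simp: less_Suc_eq)
  qed
  then have "Suc k \<le> k" using max by blast
  then show False by simp
 qed
 with o show ?thesis by (rule that)
qed

definition lin_comb :: "nat => nat => (nat => complex vec) => (nat => complex) => complex vec"
 where "lin_comb n k v c = vec n (%l. \<Sum>i<k. c i * v i $ l)"

lemma lin_comb_carrier [simp]: "lin_comb n k v c \<in> carrier_vec n"
 by (simp add: lin_comb_def)

lemma lin_comb_Suc:
 assumes "v k \<in> carrier_vec n"
 shows "lin_comb n (Suc k) v c = lin_comb n k v c + c k \<cdot>\<^sub>v v k"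
 using carrier_vecD[OF assms] by (intro eq_vecI) (auto simp: lin_comb_def)

lemma lin_comb_in:
 assumes "!!i. i < k ==> v i \<in> T" "T \<subseteq> carrier_vec n" "0\<^sub>v n \<in> T"
  and "!!x y. x \<in> T ==> y \<in> T ==> x + y \<in> T" "!!c x. x \<in> T ==> c \<cdot>\<^sub>v x \<in> T"
 shows "lin_comb n k v c \<in> T"
 using assms(1)
proof (induction k)
 case 0
 have "lin_comb n 0 v c = 0\<^sub>v n" by (intro eq_vecI) (auto simp: lin_comb_def)
 then show ?case using assms(3) by simp
next
 case (Suc k)
 have "v k \<in> T" using Suc.prems by simp
 moreover have "v k \<in> carrier_vec n" using \<open>v k \<in> T\<close> assms(2) by blast
 moreover have "lin_comb n k v c \<in> T" using Suc by simp
 ultimately show ?case using lin_comb_Suc[where v = v and k = k and n = n and c = c] assms(4,5) by simp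
qed

lemma lin_comb_form:
 assumes G: "G \<in> carrier_mat n n" and v: "!!i. i < k ==> v i \<in> carrier_vec n" and u: "u \<in> carrier_vec n"
 shows "(G *\<^sub>v lin_comb n k v c) \<bullet>c u = (\<Sum>i<k. c i * ((G *\<^sub>v v i) \<bullet>c u))"
 using v
proof (induction k)
 case 0
 have "lin_comb n 0 v c = 0\<^sub>v n" by (intro eq_vecI) (auto simp: lin_comb_def)
 moreover have "G *\<^sub>v 0\<^sub>v n = 0\<^sub>v n" using G by (intro eq_vecI) auto
 ultimately show ?case using u by simp
next
 case (Suc k)
 have vk: "v k \<in> carrier_vec n" using Suc.prems by simp
 have Gc: "G *\<^sub>v lin_comb n k v c \<in> carrier_vec n" "G *\<^sub>v v k \<in> carrier_vec n"
  using G vk by (auto intro: mult_mat_vec_carrier)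
 have "G *\<^sub>v lin_comb n (Suc k) v c = G *\<^sub>v lin_comb n k v c + c k \<cdot>\<^sub>v (G *\<^sub>v v k)"
  unfolding lin_comb_Suc[where v = v and k = k, OF vk] mult_mat_vec[OF G vk, symmetric]
  by (rule mult_add_distrib_mat_vec[OF G]) (use vk in auto)
 then have "(G *\<^sub>v lin_comb n (Suc k) v c) \<bullet>c u = (G *\<^sub>v lin_comb n k v c) \<bullet>c u + (c k \<cdot>\<^sub>v (G *\<^sub>v v k)) \<bullet>c u"
  using cscalar_prod_add_left[OF Gc(1) _ u] Gc(2) by simp
 also have "(c k \<cdot>\<^sub>v (G *\<^sub>v v k)) \<bullet>c u = c k * ((G *\<^sub>v v k) \<bullet>c u)" by (rule cscalar_prod_smult_left[OF Gc(2) u])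
 finally show ?case using Suc by simp
qed

text \<open>A maximal orthonormal system of a nondegenerate form is a basis: on its orthogonal
 complement the quadratic form vanishes, hence by polarization so does the whole form.\<close>

lemma form_orthonormal_basis:
 assumes G: "G \<in> carrier_mat n n" and h: "mat_adjoint G = G" and T: "T \<subseteq> carrier_vec n" "0\<^sub>v n \<in> T"
  and add: "!!x y. x \<in> T ==> y \<in> T ==> x + y \<in> T" and sm: "!!c x. x \<in> T ==> c \<cdot>\<^sub>v x \<in> T"
  and nondeg: "!!x. x \<in> T ==> (!!y. y \<in> T ==> (G *\<^sub>v x) \<bullet>c y = 0) ==> x = 0\<^sub>v n"
 obtains k v e where "form_orthonormal n G T k v e"
  "!!x. x \<in> T ==> x = lin_comb n k v (%i. of_real (e i) * ((G *\<^sub>v x) \<bullet>c v i))"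
proof -
 obtain k v e where o: "form_orthonormal n G T k v e"
  and max: "!!x. x \<in> T ==> (!!i. i < k ==> (G *\<^sub>v x) \<bullet>c v i = 0) ==> (G *\<^sub>v x) \<bullet>c x = 0"
  using maximal_form_orthonormal[OF G h T(1) sm] by blast
 have vT: "v i \<in> T" if "i < k" for i using o that unfolding form_orthonormal_def by auto
 have vc: "v i \<in> carrier_vec n" if "i < k" for i using vT[OF that] T by auto
 have ee: "complex_of_real (e i) * of_real (e i) = 1" if "i < k" for i
  using o that unfolding form_orthonormal_def by (auto simp flip: of_real_mult)
 \<comment> \<open>Projection onto the span of the system; the factors e i undo the signs in the
   coordinates.\<close>
 define q where "q = (%x. lin_comb n k v (%i. of_real (e i) * ((G *\<^sub>v x) \<bullet>c v i)))"
 have qT: "q x \<in> T" for x unfolding q_def by (rule lin_comb_in[OF vT T add sm])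
 have qv: "(G *\<^sub>v q x) \<bullet>c v j = (G *\<^sub>v x) \<bullet>c v j" if j: "j < k" for x j
 proof -
  have "(G *\<^sub>v q x) \<bullet>c v j = (\<Sum>i<k. of_real (e i) * ((G *\<^sub>v x) \<bullet>c v i) * ((G *\<^sub>v v i) \<bullet>c v j))"
   unfolding q_def by (rule lin_comb_form[OF G vc vc[OF j]])
  also have "\<dots> = (\<Sum>i<k. if i = j then of_real (e i) * ((G *\<^sub>v x) \<bullet>c v i) * of_real (e i) else 0)"
   using o j unfolding form_orthonormal_def by (intro sum.cong refl) auto
  also have "\<dots> = of_real (e j) * ((G *\<^sub>v x) \<bullet>c v j) * of_real (e j)" using j by (simp add: sum.delta)
  also have "\<dots> = (G *\<^sub>v x) \<bullet>c v j" using ee[OF j] by (simp add: mult.commute mult.left_commute)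
  finally show ?thesis .
 qed
 \<comment> \<open>The orthogonal complement of the system inside \<open>T\<close>. It contains
   every difference of x and q x, and these have to be shown to vanish.\<close>
 define S where "S = {x \<in> T. \<forall>i<k. (G *\<^sub>v x) \<bullet>c v i = 0}"
 have Sc: "x \<in> carrier_vec n" if "x \<in> S" for x using that T by (auto simp: S_def)
 have Sadd: "x + c \<cdot>\<^sub>v y \<in> S" if xy: "x \<in> S" "y \<in> S" for x y c
 proof -
  have c: "x \<in> carrier_vec n" "y \<in> carrier_vec n" using Sc xy by auto
  have e: "G *\<^sub>v (x + c \<cdot>\<^sub>v y) = G *\<^sub>v x + c \<cdot>\<^sub>v (G *\<^sub>v y)"
   unfolding mult_mat_vec[OF G c(2), symmetric] by (rule mult_add_distrib_mat_vec[OF G]) (use c in auto)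
  have "(G *\<^sub>v (x + c \<cdot>\<^sub>v y)) \<bullet>c v i = 0" if i: "i < k" for i
  proof -
   have "(G *\<^sub>v (x + c \<cdot>\<^sub>v y)) \<bullet>c v i = (G *\<^sub>v x) \<bullet>c v i + (c \<cdot>\<^sub>v (G *\<^sub>v y)) \<bullet>c v i"
    unfolding e by (rule cscalar_prod_add_left[OF mult_mat_vec_carrier[OF G c(1)] _ vc[OF i]])
     (use mult_mat_vec_carrier[OF G c(2)] in simp)
   also have "(c \<cdot>\<^sub>v (G *\<^sub>v y)) \<bullet>c v i = c * ((G *\<^sub>v y) \<bullet>c v i)"
    by (rule cscalar_prod_smult_left[OF mult_mat_vec_carrier[OF G c(2)] vc[OF i]])
   finally show ?thesis using xy i by (simp add: S_def)
  qed
  then show ?thesis using xy add sm by (simp add: S_def)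
 qed
 have S0: "(G *\<^sub>v x) \<bullet>c y = 0" if xy: "x \<in> S" "y \<in> S" for x y
 proof -
  have c: "x \<in> carrier_vec n" "y \<in> carrier_vec n" using Sc xy by auto
  have Gc: "G *\<^sub>v x \<in> carrier_vec n" "G *\<^sub>v y \<in> carrier_vec n" using c G by (auto intro: mult_mat_vec_carrier)
  have z: "(G *\<^sub>v u) \<bullet>c u = 0" if "u \<in> S" for u using max that by (auto simp: S_def)
  have polar: "(G *\<^sub>v (x + c \<cdot>\<^sub>v y)) \<bullet>c (x + c \<cdot>\<^sub>v y) = cnj c * ((G *\<^sub>v x) \<bullet>c y) + c * cnj ((G *\<^sub>v x) \<bullet>c y)" for c
  proof -
   have cy: "c \<cdot>\<^sub>v y \<in> carrier_vec n" "c \<cdot>\<^sub>v (G *\<^sub>v y) \<in> carrier_vec n" "x + c \<cdot>\<^sub>v y \<in> carrier_vec n" using \<open>y \<in> carrier_vec n\<close> \<open>x \<in> carrier_vec n\<close> Gc by auto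
   have e: "G *\<^sub>v (x + c \<cdot>\<^sub>v y) = G *\<^sub>v x + c \<cdot>\<^sub>v (G *\<^sub>v y)"
    unfolding mult_mat_vec[OF G \<open>y \<in> carrier_vec n\<close>, symmetric] by (rule mult_add_distrib_mat_vec[OF G]) (use cy \<open>x \<in> carrier_vec n\<close> in auto)
   show ?thesis unfolding e cscalar_prod_add_left[OF Gc(1) cy(2,3)] cscalar_prod_smult_left[OF Gc(2) cy(3)]
     cscalar_prod_add_right[OF Gc(1) \<open>x \<in> carrier_vec n\<close> cy(1)] cscalar_prod_add_right[OF Gc(2) \<open>x \<in> carrier_vec n\<close> cy(1)]
     cscalar_prod_smult_right[OF Gc(1) \<open>y \<in> carrier_vec n\<close>] cscalar_prod_smult_right[OF Gc(2) \<open>y \<in> carrier_vec n\<close>]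
     z[OF xy(1)] z[OF xy(2)] hermitian_form_commute[OF G h \<open>x \<in> carrier_vec n\<close> \<open>y \<in> carrier_vec n\<close>]
    by simp
  qed
  let ?s = "(G *\<^sub>v x) \<bullet>c y"
  \<comment> \<open>The scalar 1 kills the real part of the form and \<i> the imaginary
    part.\<close>
  have "?s + cnj ?s = 0" using polar[where c = 1] z[OF Sadd[where c = 1, OF xy]] by simp
  moreover have "- \<i> * ?s + \<i> * cnj ?s = 0" using polar[where c = \<i>] z[OF Sadd[where c = \<i>, OF xy]] by simp
  ultimately show "?s = 0" by (simp add: complex_eq_iff)
 qed
 have split: "x + (- 1) \<cdot>\<^sub>v q x \<in> S" if x: "x \<in> T" for x
 proof -
  have xc: "x \<in> carrier_vec n" "q x \<in> carrier_vec n" using x qT T by auto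
  have e: "G *\<^sub>v (x + (- 1) \<cdot>\<^sub>v q x) = G *\<^sub>v x + (- 1) \<cdot>\<^sub>v (G *\<^sub>v q x)"
   unfolding mult_mat_vec[OF G xc(2), symmetric] by (rule mult_add_distrib_mat_vec[OF G]) (use xc in auto)
  have Gc: "G *\<^sub>v x \<in> carrier_vec n" "G *\<^sub>v q x \<in> carrier_vec n" using xc G by (auto intro: mult_mat_vec_carrier)
  have "(G *\<^sub>v (x + (- 1) \<cdot>\<^sub>v q x)) \<bullet>c v i = 0" if i: "i < k" for i
   unfolding e using cscalar_prod_add_left[where y = "(- 1) \<cdot>\<^sub>v (G *\<^sub>v q x)", OF Gc(1) _ vc[OF i]] Gc
    cscalar_prod_smult_left[where c = "- 1", OF Gc(2) vc[OF i]] qv[OF i] by simp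
  then show ?thesis using add[OF x sm[OF qT]] by (simp add: S_def)
 qed
 have "x = q x" if x: "x \<in> T" for x
 proof -
  let ?r = "x + (- 1) \<cdot>\<^sub>v q x"
  have xc: "x \<in> carrier_vec n" "q x \<in> carrier_vec n" using x qT T by auto
  have rS: "?r \<in> S" by (rule split[OF x])
  have rc: "?r \<in> carrier_vec n" by (rule Sc[OF rS])
  have "?r = 0\<^sub>v n"
  proof (rule nondeg)
   show "?r \<in> T" using rS by (simp add: S_def)
   fix y assume y: "y \<in> T"
   have yc: "y \<in> carrier_vec n" "q y \<in> carrier_vec n" using y qT T by auto
   have Gr: "G *\<^sub>v ?r \<in> carrier_vec n" using G rc by (rule mult_mat_vec_carrier)
   \<comment> \<open>A test vector splits into its part in \<open>S\<close> and its projection; the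
     difference vector \<open>?r\<close> is orthogonal to both.\<close>
   have "y = (y + (- 1) \<cdot>\<^sub>v q y) + q y" using yc by (intro eq_vecI) auto
   then have "(G *\<^sub>v ?r) \<bullet>c y = (G *\<^sub>v ?r) \<bullet>c (y + (- 1) \<cdot>\<^sub>v q y) + (G *\<^sub>v ?r) \<bullet>c q y"
    using cscalar_prod_add_right[OF Gr Sc[OF split[OF y]] yc(2)] by simp
   also have "(G *\<^sub>v ?r) \<bullet>c (y + (- 1) \<cdot>\<^sub>v q y) = 0" by (rule S0[OF rS split[OF y]])
   also have "(G *\<^sub>v ?r) \<bullet>c q y = cnj ((G *\<^sub>v q y) \<bullet>c ?r)" by (rule hermitian_form_commute[OF G h yc(2) rc])
   also have "(G *\<^sub>v q y) \<bullet>c ?r = (\<Sum>i<k. of_real (e i) * ((G *\<^sub>v y) \<bullet>c v i) * ((G *\<^sub>v v i) \<bullet>c ?r))"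
   proof -
    have qy: "q y = lin_comb n k v (%i. of_real (e i) * ((G *\<^sub>v y) \<bullet>c v i))" by (simp only: q_def)
    show ?thesis unfolding qy by (rule lin_comb_form[OF G vc rc])
   qed
   also have "\<dots> = 0"
   proof (rule sum.neutral, rule ballI)
    fix i assume "i \<in> {..<k}"
    then have i: "i < k" by simp
    have "(G *\<^sub>v v i) \<bullet>c ?r = cnj ((G *\<^sub>v ?r) \<bullet>c v i)" by (rule hermitian_form_commute[OF G h rc vc[OF i]])
    also have "(G *\<^sub>v ?r) \<bullet>c v i = 0" using rS i by (simp add: S_def)
    finally show "of_real (e i) * ((G *\<^sub>v y) \<bullet>c v i) * ((G *\<^sub>v v i) \<bullet>c ?r) = 0" by simp
   qed
   finally show "(G *\<^sub>v ?r) \<bullet>c y = 0" by simp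
  qed
  have "x $ l = q x $ l" if "l < n" for l
  proof -
   have "x $ l + (- 1) * q x $ l = ?r $ l" using carrier_vecD[OF xc(2)] that by simp
   then show ?thesis unfolding \<open>?r = 0\<^sub>v n\<close> using that by simp
  qed
  then show ?thesis using carrier_vecD[OF xc(1)] carrier_vecD[OF xc(2)] by (intro eq_vecI) auto
 qed
 with o show ?thesis unfolding q_def by (intro that) auto
qed

text \<open>Parseval with signs. It diagonalizes the form, so that positivity and convergence can be
  read off from the signs and the coordinates.\<close>

lemma form_orthonormal_expand:
 assumes G: "G \<in> carrier_mat n n" and h: "mat_adjoint G = G" and T: "T \<subseteq> carrier_vec n"
  and o: "form_orthonormal n G T k v e"
  and rep: "!!x. x \<in> T ==> x = lin_comb n k v (%i. of_real (e i) * ((G *\<^sub>v x) \<bullet>c v i))"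
  and x: "x \<in> T" and y: "y \<in> carrier_vec n"
 shows "(G *\<^sub>v x) \<bullet>c y = (\<Sum>i<k. of_real (e i) * ((G *\<^sub>v x) \<bullet>c v i) * cnj ((G *\<^sub>v y) \<bullet>c v i))"
proof -
 have vc: "v i \<in> carrier_vec n" if "i < k" for i using o that T unfolding form_orthonormal_def by blast
 have "(G *\<^sub>v x) \<bullet>c y = (G *\<^sub>v lin_comb n k v (%i. of_real (e i) * ((G *\<^sub>v x) \<bullet>c v i))) \<bullet>c y"
  using arg_cong[OF rep[OF x], of "%u. (G *\<^sub>v u) \<bullet>c y"] .
 also have "\<dots> = (\<Sum>i<k. of_real (e i) * ((G *\<^sub>v x) \<bullet>c v i) * ((G *\<^sub>v v i) \<bullet>c y))"
  by (rule lin_comb_form[OF G vc y])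
 also have "\<dots> = (\<Sum>i<k. of_real (e i) * ((G *\<^sub>v x) \<bullet>c v i) * cnj ((G *\<^sub>v y) \<bullet>c v i))"
  by (intro sum.cong refl arg_cong2[where f = "(*)"] hermitian_form_commute[OF G h y vc]) auto
 finally show ?thesis .
qed

lemma form_orthonormal_coordinate:
 assumes G: "G \<in> carrier_mat n n" and T: "T \<subseteq> carrier_vec n"
  and o: "form_orthonormal n G T k v e" and j: "j < k"
 shows "(G *\<^sub>v lin_comb n k v c) \<bullet>c v j = c j * of_real (e j)"
proof -
 have vc: "v i \<in> carrier_vec n" if "i < k" for i using o that T unfolding form_orthonormal_def by blast
 have "(G *\<^sub>v lin_comb n k v c) \<bullet>c v j = (\<Sum>i<k. c i * ((G *\<^sub>v v i) \<bullet>c v j))"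
  by (rule lin_comb_form[OF G vc vc[OF j]])
 also have "\<dots> = (\<Sum>i<k. if i = j then c j * of_real (e j) else 0)"
  using o j unfolding form_orthonormal_def by (intro sum.cong refl) auto
 finally show ?thesis using j by (simp add: sum.delta)
qed

text \<open>The signs are values of the form at the basis vectors. Conversely, with all signs 1 the
  form is a sum of squared coordinates, and these vanish together only at zero.\<close>

lemma positive_definite_iff_signs:
 assumes G: "G \<in> carrier_mat n n" and h: "mat_adjoint G = G"
  and o: "form_orthonormal n G (carrier_vec n) k v e"
  and rep: "!!x. x \<in> carrier_vec n ==> x = lin_comb n k v (%i. of_real (e i) * ((G *\<^sub>v x) \<bullet>c v i))"
 shows "positive_definite_mat G \<longleftrightarrow> (\<forall>i<k. e i = 1)"
proof
 have d: "dim_row G = n" "square_mat G" using G by auto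
 show "\<forall>i<k. e i = 1" if pd: "positive_definite_mat G"
 proof (intro allI impI)
  fix i assume i: "i < k"
  have vi: "v i \<in> carrier_vec n" "e i = 1 \<or> e i = - 1" "(G *\<^sub>v v i) \<bullet>c v i = of_real (e i)"
   using o i unfolding form_orthonormal_def by auto
  have "v i \<noteq> 0\<^sub>v n"
  proof
   assume "v i = 0\<^sub>v n"
   then have "(G *\<^sub>v v i) \<bullet>c v i = 0"
    unfolding cscalar_prod_sum[OF vi(1)] by simp
   then show False using vi by auto
  qed
  then have "0 < Re ((G *\<^sub>v v i) \<bullet>c v i)" using pd vi(1) d unfolding positive_definite_mat_def by blast
  then show "e i = 1" using vi by auto
 qed
 assume e: "\<forall>i<k. e i = 1"
 have "0 < Re ((G *\<^sub>v x) \<bullet>c x)" if x: "x \<in> carrier_vec n" "x \<noteq> 0\<^sub>v n" for x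
 proof -
  have "(G *\<^sub>v x) \<bullet>c x = (\<Sum>i<k. of_real (e i) * ((G *\<^sub>v x) \<bullet>c v i) * cnj ((G *\<^sub>v x) \<bullet>c v i))"
   by (rule form_orthonormal_expand[OF G h subset_refl o rep x(1) x(1)])
  also have "\<dots> = (\<Sum>i<k. of_real ((cmod ((G *\<^sub>v x) \<bullet>c v i))\<^sup>2))"
   by (intro sum.cong refl) (use e in \<open>simp add: complex_norm_square del: of_real_power\<close>)
  finally have f0: "(G *\<^sub>v x) \<bullet>c x = (\<Sum>i<k. of_real ((cmod ((G *\<^sub>v x) \<bullet>c v i))\<^sup>2))" .
  have f: "Re ((G *\<^sub>v x) \<bullet>c x) = (\<Sum>i<k. (cmod ((G *\<^sub>v x) \<bullet>c v i))\<^sup>2)" unfolding f0 by simp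
  have "\<exists>i<k. (G *\<^sub>v x) \<bullet>c v i \<noteq> 0"
  proof (rule ccontr)
   assume *: "\<not> (\<exists>i<k. (G *\<^sub>v x) \<bullet>c v i \<noteq> 0)"
   have "lin_comb n k v (%i. of_real (e i) * ((G *\<^sub>v x) \<bullet>c v i)) = 0\<^sub>v n"
    using * by (intro eq_vecI) (auto simp: lin_comb_def intro!: sum.neutral)
   then show False using rep[OF x(1)] x(2) by simp
  qed
  then obtain i where i: "i < k" "(G *\<^sub>v x) \<bullet>c v i \<noteq> 0" by blast
  show ?thesis unfolding f by (rule sum_pos2[of _ i]) (use i in auto)
 qed
 then show "positive_definite_mat G" unfolding positive_definite_mat_def using d h by blast
qed

section \<open>The J-orthogonal complement of \<open>M_space\<close> and its form\<close>

context btoa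
begin

lemma Lvec_carrier: "Lvec h \<in> carrier_vec nz" by simp

lemma Lvec_fB:
 assumes c: "c \<in> carrier_vec nz" shows "Lvec (hB c) = GB *\<^sub>v c"
proof (rule vec_eqI_cscalar[OF Lvec_carrier mult_mat_vec_carrier[OF Pmats(3) c]])
 fix a :: "complex vec" assume a: "a \<in> carrier_vec nz"
 have "2 * pi * (Lvec (hB c) \<bullet>c a) = 2 * pi * ((GB *\<^sub>v c) \<bullet>c a)"
  using residue_pairing[OF f_hardy(3)[OF c] a] grams(3)[OF c a] by (simp only:)
 then show "Lvec (hB c) \<bullet>c a = (GB *\<^sub>v c) \<bullet>c a" by simp
qed

text \<open>The residue functional is onto already on the span of the boundary functions \<open>fB c\<close>, whose
 Gram matrix \<open>GB\<close> is positive definite by controllability.\<close>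

lemma Lvec_onto:
 assumes v: "v \<in> carrier_vec nz"
 obtains c where "c \<in> carrier_vec nz" "Lvec (hB c) = v"
 using pos_solve[OF Pmats(3) GB_pos v] Lvec_fB by metis

text \<open>Linearity of the residue functional is read off from its representation by inner
  products with the \<open>fB a\<close>.\<close>

lemma Lvec_diff:
 assumes h: "hardy_vec (p + m) h H" and g: "hardy_vec (p + m) g G" and e: "Lvec h = Lvec g"
 shows "Lvec (%z. h z + (- 1) \<cdot>\<^sub>v g z) = 0\<^sub>v nz"
proof (rule vec_eqI_cscalar[OF Lvec_carrier zero_carrier_vec])
 fix a :: "complex vec" assume a: "a \<in> carrier_vec nz"
 note L = hardy_vec_L2[OF h] L2_imag_smult[OF hardy_vec_L2[OF g], of "- 1"] f_L2(3)[OF a]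
 have "vinner (p + m) (%y. H y + (- 1) \<cdot>\<^sub>v G y) (fB a) = 0"
  unfolding vinner_add_left[OF L] vinner_smult_left[OF hardy_vec_L2[OF g]]
   residue_pairing[OF h a] residue_pairing[OF g a] e by simp
 then show "Lvec (%z. h z + (- 1) \<cdot>\<^sub>v g z) \<bullet>c a = 0\<^sub>v nz \<bullet>c a"
  using residue_pairing[OF hardy_vec_diff[OF h g] a] a by simp
qed

lemma rfun_zero_vec: "C \<in> carrier_mat d n ==> A \<in> carrier_mat n n ==> z \<notin> spectrum A ==> rfun C A (0\<^sub>v n) z = 0\<^sub>v d"
 using mult_carrier_mat[OF _ resolvent_props(1)[of A n z], of C d] unfolding rfun_def
 by (intro eq_vecI) (auto simp: scalar_prod_def)

lemma hardy_in_M_space: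
 assumes h: "hardy_vec (p + m) h H" and L: "Lvec h = 0\<^sub>v nz"
 shows "H \<in> M_space D"
 unfolding M_space_iff
proof (intro exI conjI)
 show "hardy_vec (p + m) h H" by (rule h)
 show "0\<^sub>v nw \<in> carrier_vec nw" by simp
 show "Lvec h = Gam *\<^sub>v 0\<^sub>v nw" unfolding L using carrier_matD[OF dims(7)] by (intro eq_vecI) (auto simp: scalar_prod_def)
 have z: "gV (0\<^sub>v nw) y = 0\<^sub>v p" "gU (0\<^sub>v nw) y = 0\<^sub>v m" for y
  using rfun_zero_vec[OF dims(5,6) axis_notin_spectrum[OF spW]] rfun_zero_vec[OF dims(4,6) axis_notin_spectrum[OF spW]] .
 have "0\<^sub>v p @\<^sub>v 0\<^sub>v m = (0\<^sub>v (p + m) :: complex vec)" by (intro eq_vecI) auto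
 then show "H = (%y. (gV (0\<^sub>v nw) y @\<^sub>v gU (0\<^sub>v nw) y) + H y)"
  unfolding z using L2_imag_carrier[OF hardy_vec_L2[OF h]] by simp
qed

lemma g_L2:
 assumes "x \<in> carrier_vec nw" shows "(%y. gV x y @\<^sub>v gU x y) \<in> L2_imag (p + m)"
 using L2_imag_append[of "gV x" p "gU x" m] rfun_carrier[OF dims(5)] rfun_carrier[OF dims(4)] f_L2(4,5)[OF assms] by blast

text \<open>On the Hardy space J F acts like \<open>fB a\<close> for a suitable \<open>a\<close>: it
  annihilates the Hardy functions without residues, so what is left is a functional of finitely many
  residues. Comparing components fixes the second one up to null sets and makes F1 - fX a orthogonal
  to the Hardy space. The elements of \<open>M_space\<close> with a rational part contribute the
  last equation.\<close>

lemma M_perp_structure: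
 assumes F: "F \<in> M_perp D"
 obtains F1 F2 a b where "F = (%y. F1 y @\<^sub>v F2 y)" "F1 \<in> L2_imag p" "F2 \<in> L2_imag m"
  "a \<in> carrier_vec nz" "b \<in> carrier_vec nw" "AE y in lborel. F2 y = gU b y + fY a y"
  "!!h H. hardy_vec p h H ==> vinner p (%y. F1 y - fX a y) H = 0"
  "!!x. x \<in> carrier_vec nw ==> vinner p (%y. F1 y - fX a y) (gV x) = 2 * pi * ((GU *\<^sub>v b - mat_adjoint Gam *\<^sub>v a) \<bullet>c x)"
proof -
 obtain F1 b g G where F': "F = (%y. F1 y @\<^sub>v (gU b y + G y))" and F1: "F1 \<in> L2_imag p" and b: "b \<in> carrier_vec nw" and g: "hardy_vec m g G"
  using F K_space_iff unfolding M_perp_def by blast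
 define F2 where "F2 = (%y. gU b y + G y)"
 have GL: "G \<in> L2_imag m" by (rule hardy_vec_L2[OF g])
 have F2: "F2 \<in> L2_imag m" unfolding F2_def by (rule L2_imag_add[OF f_L2(4)[OF b] GL])
 have FF: "F = (%y. F1 y @\<^sub>v F2 y)" unfolding F' F2_def ..
 \<comment> \<open>\<open>Q\<close> is J F, so J-orthogonality of \<open>F\<close> becomes
   L2-orthogonality of \<open>Q\<close>.\<close>
 define Q where "Q = (%y. F1 y @\<^sub>v (- 1) \<cdot>\<^sub>v F2 y)"
 have F2m: "(%y. (- 1) \<cdot>\<^sub>v F2 y) \<in> L2_imag m" by (rule L2_imag_smult[OF F2])
 have QL: "Q \<in> L2_imag (p + m)" unfolding Q_def
  using L2_imag_append[of F1 p "%y. (- 1) \<cdot>\<^sub>v F2 y" m] L2_imag_carrier[OF F1] L2_imag_carrier[OF F2m] F1 F2m by blast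
 have Qorth: "vinner (p + m) Q E = 0" if E: "E \<in> M_space D" and EL: "E \<in> L2_imag (p + m)" for E
 proof -
  define E1 where "E1 = (%y. vec_first (E y) p)"
  define E2 where "E2 = (%y. vec_last (E y) m)"
  have EE: "E = (%y. E1 y @\<^sub>v E2 y)" unfolding E1_def E2_def using append_vec_split[OF L2_imag_carrier[OF EL]] by blast
  have c: "E1 y \<in> carrier_vec p" "E2 y \<in> carrier_vec m" for y by (simp_all add: E1_def E2_def)
  have L: "E1 \<in> L2_imag p" "E2 \<in> L2_imag m" using L2_imag_append[of E1 p E2 m, OF c] EL unfolding EE[symmetric] by blast+
  have "J_inner D F E = 0" using F E unfolding M_perp_def by blast
  then show ?thesis unfolding FF EE J_inner_append(1)[OF F1 F2 L] Q_def J_inner_append(2)[OF F1 F2 L] .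
 qed
 obtain q where q: "q \<in> carrier_vec nz" and qv: "!!v. v \<in> carrier_vec nz ==> vinner (p + m) Q (fB v) = q \<bullet>c v"
  using rfun_functional[OF uminus_Zs(1) B_adjoint(2) nonaxis(2) QL] by blast
 obtain a0 where a0: "a0 \<in> carrier_vec nz" "GB *\<^sub>v a0 = q" using pos_solve[OF Pmats(3) GB_pos q] by blast
 \<comment> \<open>The factor cancels the 2\<pi> of the Gram formula, so that \<open>fB a\<close>
   and \<open>Q\<close> have equal pairings with all \<open>fB c\<close>.\<close>
 define a where "a = complex_of_real (1 / (2 * pi)) \<cdot>\<^sub>v a0"
 have a: "a \<in> carrier_vec nz" unfolding a_def using a0(1) by simp
 have Ga: "GB *\<^sub>v a = complex_of_real (1 / (2 * pi)) \<cdot>\<^sub>v q" unfolding a_def a0(2)[symmetric] by (rule mult_mat_vec[OF Pmats(3) a0(1)])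
 have Qf: "vinner (p + m) Q (fB c) = vinner (p + m) (fB a) (fB c)" if c: "c \<in> carrier_vec nz" for c
  unfolding qv[OF c] grams(3)[OF a c] Ga cscalar_prod_smult_left[OF q c] by simp
 have QH: "vinner (p + m) Q H = vinner (p + m) (fB a) H" if h: "hardy_vec (p + m) h H" for h H
 proof -
  \<comment> \<open>Subtracting \<open>fB c\<close> with the same residues leaves an element of
    \<open>M_space\<close>, which \<open>Q\<close> annihilates. The pairing with \<open>fB a\<close>
    depends on the residues only, so both sides reduce to pairings with \<open>fB c\<close>.\<close>
  obtain c where c: "c \<in> carrier_vec nz" "Lvec (hB c) = Lvec h" using Lvec_onto[OF Lvec_carrier] by blast
  let ?K = "%y. H y + (- 1) \<cdot>\<^sub>v fB c y"
  have hL: "H \<in> L2_imag (p + m)" "fB c \<in> L2_imag (p + m)" "(%y. (- 1) \<cdot>\<^sub>v fB c y) \<in> L2_imag (p + m)"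
   using hardy_vec_L2[OF h] f_L2(3)[OF c(1)] L2_imag_smult[OF f_L2(3)[OF c(1)]] by auto
  have hd: "hardy_vec (p + m) (%z. h z + (- 1) \<cdot>\<^sub>v hB c z) ?K" by (rule hardy_vec_diff[OF h f_hardy(3)[OF c(1)]])
  have "?K \<in> M_space D" by (rule hardy_in_M_space[OF hd Lvec_diff[OF h f_hardy(3)[OF c(1)] c(2)[symmetric]]])
  then have "vinner (p + m) Q ?K = 0" by (rule Qorth[OF _ hardy_vec_L2[OF hd]])
  then have 1: "vinner (p + m) Q H = vinner (p + m) Q (fB c)"
   unfolding vinner_add_right[OF hL(1,3) QL] vinner_smult_right[OF hL(2)] by simp
  have "vinner (p + m) H (fB a) = vinner (p + m) (fB c) (fB a)"
   unfolding residue_pairing[OF h a] residue_pairing[OF f_hardy(3)[OF c(1)] a] c(2) ..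
  then have "vinner (p + m) (fB a) H = vinner (p + m) (fB a) (fB c)"
   using vinner_cnj[of "p + m" "fB a" H] vinner_cnj[of "p + m" "fB a" "fB c"] by (simp only:)
  then show ?thesis using 1 Qf[OF c(1)] by (simp only:)
 qed
 note fXL = f_L2(1)[OF a] note fYL = f_L2(2)[OF a]
 have fYm: "(%y. (- 1) \<cdot>\<^sub>v fY a y) \<in> L2_imag m" by (rule L2_imag_smult[OF fYL])
 have zz: "hardy_vec p (%z. 0\<^sub>v p) (%y. 0\<^sub>v p)" "hardy_vec m (%z. 0\<^sub>v m) (%y. 0\<^sub>v m)" by (rule hardy_vec_zero)+
 have v0: "vinner d E (%y. 0\<^sub>v d) = 0" for d E unfolding vinner_def inner2_def by simp
 have split: "vinner p F1 H1 - vinner m F2 H2 = vinner p (fX a) H1 - vinner m (fY a) H2"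
  if "hardy_vec p h1 H1" "hardy_vec m h2 H2" for h1 H1 h2 H2
  using QH[OF hardy_vec_append[OF that]]
  unfolding fB_append[OF a] Q_def J_inner_append(2)[OF F1 F2 hardy_vec_L2[OF that(1)] hardy_vec_L2[OF that(2)]]
   J_inner_append(2)[OF fXL fYL hardy_vec_L2[OF that(1)] hardy_vec_L2[OF that(2)]] .
 have orth1: "vinner p (%y. F1 y - fX a y) H = 0" if h: "hardy_vec p h H" for h H
  using split[OF h zz(2)] unfolding v0 vinner_diff_left[OF F1 fXL hardy_vec_L2[OF h]] by simp
 have orth2: "vinner m F2 H = vinner m (fY a) H" if h: "hardy_vec m h H" for h H
  using split[OF zz(1) h] unfolding v0 by simp
 have ae: "AE y in lborel. F2 y = gU b y + fY a y"
 proof -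
  \<comment> \<open>The difference lies in the Hardy space, to which \<open>gU b\<close> is
    orthogonal; testing with the difference itself shows that its norm is zero.\<close>
  let ?d = "%y. G y + (- 1) \<cdot>\<^sub>v fY a y"
  have dh: "hardy_vec m (%z. g z + (- 1) \<cdot>\<^sub>v hY a z) ?d" by (rule hardy_vec_diff[OF g f_hardy(2)[OF a]])
  have dL: "?d \<in> L2_imag m" by (rule hardy_vec_L2[OF dh])
  have "vinner m (gU b) ?d = cnj (vinner m ?d (gU b))" by (rule vinner_cnj)
  then have gd: "vinner m (gU b) ?d = 0" unfolding g_orth(1)[OF dh b] by simp
  have "vinner m F2 ?d = vinner m (gU b) ?d + vinner m G ?d"
   unfolding F2_def by (rule vinner_add_left[OF f_L2(4)[OF b] GL dL])
  then have "vinner m G ?d = vinner m (fY a) ?d" using orth2[OF dh] gd by simp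
  then have "vinner m ?d ?d = 0"
   unfolding vinner_add_left[OF GL fYm dL] vinner_smult_left[OF fYL] by simp
  then have "AE y in lborel. ?d y = 0\<^sub>v m" by (intro vinner_self_eq_0[OF dL]) simp
  then show ?thesis
  proof eventually_elim
   case (elim y)
   have c: "G y \<in> carrier_vec m" "fY a y \<in> carrier_vec m" using L2_imag_carrier[OF GL] L2_imag_carrier[OF fYL] by auto
   have "G y = fY a y"
   proof (rule eq_vecI)
    fix i assume "i < dim_vec (fY a y)"
    then have i: "i < m" using carrier_vecD[OF c(2)] by simp
    have "G y $ i + (- 1) * fY a y $ i = (G y + (- 1) \<cdot>\<^sub>v fY a y) $ i" using i carrier_vecD[OF c(2)] by simp
    then show "G y $ i = fY a y $ i" unfolding elim using i by simp
   qed (use carrier_vecD[OF c(1)] carrier_vecD[OF c(2)] in simp)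
   then show ?case by (simp add: F2_def)
  qed
 qed
 have "vinner p (%y. F1 y - fX a y) (gV x) = 2 * pi * ((GU *\<^sub>v b - mat_adjoint Gam *\<^sub>v a) \<bullet>c x)"
  if x: "x \<in> carrier_vec nw" for x
 proof -
  have Gx: "Gam *\<^sub>v x \<in> carrier_vec nz" by (rule mult_mat_vec_carrier[OF dims(7) x])
  \<comment> \<open>Adding \<open>fB c\<close> with residues \<open>Gam *\<^sub>v x\<close>
    completes the rational part to an element of \<open>M_space\<close>.\<close>
  obtain c where c: "c \<in> carrier_vec nz" "Lvec (hB c) = Gam *\<^sub>v x" using Lvec_onto[OF Gx] by blast
  note gL = g_L2[OF x]
  let ?E = "%y. (gV x y @\<^sub>v gU x y) + fB c y"
  have EM: "?E \<in> M_space D" unfolding M_space_iff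
  proof (intro exI conjI)
   show "?E = (%y. (gV x y @\<^sub>v gU x y) + fB c y)" ..
  qed (rule x f_hardy(3)[OF c(1)] c(2))+
  have EL: "?E \<in> L2_imag (p + m)" by (rule L2_imag_add[OF gL f_L2(3)[OF c(1)]])
  have k1: "0 = vinner (p + m) Q (%y. gV x y @\<^sub>v gU x y) + vinner (p + m) Q (fB c)"
   using Qorth[OF EM EL] unfolding vinner_add_right[OF gL f_L2(3)[OF c(1)] QL] by simp
  have k2: "vinner (p + m) Q (%y. gV x y @\<^sub>v gU x y) = vinner p F1 (gV x) - vinner m F2 (gU x)"
   unfolding Q_def by (rule J_inner_append(2)[OF F1 F2 f_L2(5)[OF x] f_L2(4)[OF x]])
  have k3: "vinner (p + m) Q (fB c) = 2 * pi * ((mat_adjoint Gam *\<^sub>v a) \<bullet>c x)"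
  proof -
   have "vinner (p + m) Q (fB c) = cnj (vinner (p + m) (fB c) (fB a))"
    unfolding Qf[OF c(1)] by (rule vinner_cnj)
   also have "\<dots> = 2 * pi * cnj ((Gam *\<^sub>v x) \<bullet>c a)"
    unfolding residue_pairing[OF f_hardy(3)[OF c(1)] a] c(2) by simp
   also have "cnj ((Gam *\<^sub>v x) \<bullet>c a) = (mat_adjoint Gam *\<^sub>v a) \<bullet>c x"
    unfolding mat_adjoint_cscalar[OF dims(7) x a]
    by (rule cscalar_prod_commute[OF x mult_mat_vec_carrier[OF adj_dims(4) a], symmetric])
   finally show ?thesis .
  qed
  have k4: "vinner p (fX a) (gV x) = 0" by (rule g_orth(2)[OF f_hardy(1)[OF a] x])
  have k5: "vinner m F2 (gU x) = 2 * pi * ((GU *\<^sub>v b) \<bullet>c x)"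
   unfolding F2_def vinner_add_left[OF f_L2(4)[OF b] GL f_L2(4)[OF x]] grams(4)[OF b x] g_orth(1)[OF g x] by simp
  have k6: "(GU *\<^sub>v b - mat_adjoint Gam *\<^sub>v a) \<bullet>c x = (GU *\<^sub>v b) \<bullet>c x - (mat_adjoint Gam *\<^sub>v a) \<bullet>c x"
   by (rule cscalar_prod_minus_left[OF mult_mat_vec_carrier[OF Pmats(4) b] mult_mat_vec_carrier[OF adj_dims(4) a] x])
  have ar: "v - 0 = c * (s - t)" if "0 = v - c * s + c * t" for v c s t :: complex using that by (simp add: algebra_simps)
  show ?thesis
   unfolding vinner_diff_left[OF F1 fXL f_L2(5)[OF x]] k4 k6 by (rule ar[OF k1[unfolded k2 k3 k5]])
 qed
 with FF F1 F2 a b ae orth1 show ?thesis by (rule that)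
qed

text \<open>With \<open>mat_adjoint Zs = Z\<close> and \<open>mat_adjoint Xs = X\<close> the
  defining equation is the Lyapunov equation of \<open>Zs\<close>, whose solution is additive in the
  right side.\<close>

lemma Gamma_L_eq: "Gamma_L D = GX - GY"
proof -
 let ?M = "X * Xs - Y * Ys"
 have c: "X * Xs \<in> carrier_mat nz nz" "Y * Ys \<in> carrier_mat nz nz"
  using mult_carrier_mat[OF dims(2) adj_dims(2)] mult_carrier_mat[OF dims(3) adj_dims(3)] .
 have M: "?M \<in> carrier_mat nz nz" by (rule minus_carrier_mat[OF c(2)])
 have "Gamma_L D = axis_gram nz Zs ?M"
  unfolding Gamma_L_def
 proof (rule the_equality)
  show "axis_gram nz Zs ?M \<in> carrier_mat nz nz \<and> axis_gram nz Zs ?M * Zs + Z * axis_gram nz Zs ?M = ?M"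
   using lyapunov_exists[OF adj_dims(1) spZs M] by simp
  fix G assume "G \<in> carrier_mat nz nz \<and> G * Zs + Z * G = ?M"
  then show "G = axis_gram nz Zs ?M" by (intro lyapunov_unique[OF adj_dims(1) spZs _ M]) auto
 qed
 also have "\<dots> = axis_gram nz Zs (X * Xs) - axis_gram nz Zs (Y * Ys)"
  by (rule axis_gram_minus[OF adj_dims(1) spZs c])
 finally show ?thesis by simp
qed

lemma Gamma_R_eq: "Gamma_R D = GU - GV"
proof -
 let ?M = "mat_adjoint U * U - mat_adjoint V * V"
 have c: "mat_adjoint U * U \<in> carrier_mat nw nw" "mat_adjoint V * V \<in> carrier_mat nw nw"
  using mult_carrier_mat[OF mat_adjoint_carrier[OF dims(4)] dims(4)] mult_carrier_mat[OF mat_adjoint_carrier[OF dims(5)] dims(5)] .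
 have M: "?M \<in> carrier_mat nw nw" by (rule minus_carrier_mat[OF c(2)])
 have "Gamma_R D = axis_gram nw W ?M"
  unfolding Gamma_R_def
 proof (rule the_equality)
  show "axis_gram nw W ?M \<in> carrier_mat nw nw \<and> axis_gram nw W ?M * W + mat_adjoint W * axis_gram nw W ?M = ?M"
   using lyapunov_exists[OF dims(6) spW M] by simp
  fix G assume "G \<in> carrier_mat nw nw \<and> G * W + mat_adjoint W * G = ?M"
  then show "G = axis_gram nw W ?M" by (intro lyapunov_unique[OF dims(6) spW _ M]) auto
 qed
 also have "\<dots> = GU - GV" by (rule axis_gram_minus[OF dims(6) spW c])
 finally show ?thesis .
qed

abbreviation "Pick \<equiv> btoa_pick D"

lemma Gamma_dims: "Gamma_L D \<in> carrier_mat nz nz" "Gamma_R D \<in> carrier_mat nw nw"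
 unfolding Gamma_L_eq Gamma_R_eq by (rule minus_carrier_mat, rule Pmats)+

lemma Pick_carrier: "Pick \<in> carrier_mat (nz + nw) (nz + nw)"
 unfolding btoa_pick_def by (rule four_block_carrier_mat[OF Gamma_dims])

lemma Pick_hermitian: "mat_adjoint Pick = Pick"
proof -
 have "mat_adjoint (Gamma_L D) = Gamma_L D" "mat_adjoint (Gamma_R D) = Gamma_R D"
  unfolding Gamma_L_eq Gamma_R_eq mat_adjoint_minus[OF Pmats(1,2)] mat_adjoint_minus[OF Pmats(4,5)] gram_hermitian by (rule refl)+
 then show ?thesis
  unfolding btoa_pick_def mat_adjoint_four_block[OF Gamma_dims(1) dims(7) adj_dims(4) Gamma_dims(2)] by simp
qed

lemma Pick_mult:
 assumes a: "a \<in> carrier_vec nz" and b: "b \<in> carrier_vec nw"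
 shows "Pick *\<^sub>v (a @\<^sub>v b) = (Gamma_L D *\<^sub>v a + Gam *\<^sub>v b) @\<^sub>v (mat_adjoint Gam *\<^sub>v a + Gamma_R D *\<^sub>v b)"
 unfolding btoa_pick_def by (rule four_block_mat_mult_vec[OF Gamma_dims(1) dims(7) adj_dims(4) Gamma_dims(2) a b])

lemma Pick_form:
 assumes a: "a \<in> carrier_vec nz" and b: "b \<in> carrier_vec nw"
 shows "(Pick *\<^sub>v (a @\<^sub>v b)) \<bullet>c (a @\<^sub>v b) =
  (GX *\<^sub>v a) \<bullet>c a - (GY *\<^sub>v a) \<bullet>c a + (mat_adjoint Gam *\<^sub>v a) \<bullet>c b + cnj ((mat_adjoint Gam *\<^sub>v a) \<bullet>c b)
  + (GU *\<^sub>v b) \<bullet>c b - (GV *\<^sub>v b) \<bullet>c b"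
proof -
 have c: "Gamma_L D *\<^sub>v a \<in> carrier_vec nz" "Gam *\<^sub>v b \<in> carrier_vec nz" "mat_adjoint Gam *\<^sub>v a \<in> carrier_vec nw" "Gamma_R D *\<^sub>v b \<in> carrier_vec nw"
  using mult_mat_vec_carrier[OF Gamma_dims(1) a] mult_mat_vec_carrier[OF dims(7) b] mult_mat_vec_carrier[OF adj_dims(4) a] mult_mat_vec_carrier[OF Gamma_dims(2) b] .
 have g: "GX *\<^sub>v a \<in> carrier_vec nz" "GY *\<^sub>v a \<in> carrier_vec nz" "GU *\<^sub>v b \<in> carrier_vec nw" "GV *\<^sub>v b \<in> carrier_vec nw"
  using mult_mat_vec_carrier[OF Pmats(1) a] mult_mat_vec_carrier[OF Pmats(2) a] mult_mat_vec_carrier[OF Pmats(4) b] mult_mat_vec_carrier[OF Pmats(5) b] .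
 have 1: "(Gamma_L D *\<^sub>v a) \<bullet>c a = (GX *\<^sub>v a) \<bullet>c a - (GY *\<^sub>v a) \<bullet>c a"
  unfolding Gamma_L_eq minus_mult_distrib_mat_vec[OF Pmats(1,2) a] by (rule cscalar_prod_minus_left[OF g(1,2) a])
 have 2: "(Gamma_R D *\<^sub>v b) \<bullet>c b = (GU *\<^sub>v b) \<bullet>c b - (GV *\<^sub>v b) \<bullet>c b"
  unfolding Gamma_R_eq minus_mult_distrib_mat_vec[OF Pmats(4,5) b] by (rule cscalar_prod_minus_left[OF g(3,4) b])
 have 3: "(Gam *\<^sub>v b) \<bullet>c a = cnj ((mat_adjoint Gam *\<^sub>v a) \<bullet>c b)"
  unfolding mat_adjoint_cscalar[OF dims(7) b a] by (rule cscalar_prod_commute[OF c(3) b])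
 have s: "Gamma_L D *\<^sub>v a + Gam *\<^sub>v b \<in> carrier_vec nz" "mat_adjoint Gam *\<^sub>v a + Gamma_R D *\<^sub>v b \<in> carrier_vec nw"
  using add_carrier_vec[OF c(1,2)] add_carrier_vec[OF c(3,4)] .
 show ?thesis
  unfolding Pick_mult[OF a b] cscalar_prod_append[OF s a b] cscalar_prod_add_left[OF c(1,2) a] cscalar_prod_add_left[OF c(3,4) b] 1 2 3
  by simp
qed

lemma gram_real: "b \<in> carrier_vec nw ==> Im ((GU *\<^sub>v b) \<bullet>c b) = 0" "b \<in> carrier_vec nw ==> Im ((GV *\<^sub>v b) \<bullet>c b) = 0"
 using arg_cong[OF hermitian_form_commute[OF Pmats(4) gram_hermitian(4), of b b], of Im]
  arg_cong[OF hermitian_form_commute[OF Pmats(5) gram_hermitian(5), of b b], of Im] by simp_all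

text \<open>Completing the square in the indefinite form of an element of the orthogonal complement.\<close>

lemma M_perp_form:
 assumes F1: "F1 \<in> L2_imag p" and F2: "F2 \<in> L2_imag m" and a: "a \<in> carrier_vec nz" and b: "b \<in> carrier_vec nw"
  and ae: "AE y in lborel. F2 y = gU b y + fY a y"
  and o1: "!!h H. hardy_vec p h H ==> vinner p (%y. F1 y - fX a y) H = 0"
  and o2: "!!x. x \<in> carrier_vec nw ==> vinner p (%y. F1 y - fX a y) (gV x) = 2 * pi * ((GU *\<^sub>v b - mat_adjoint Gam *\<^sub>v a) \<bullet>c x)"
 shows "vinner p F1 F1 - vinner m F2 F2 =
  2 * pi * ((Pick *\<^sub>v (a @\<^sub>v (- 1) \<cdot>\<^sub>v b)) \<bullet>c (a @\<^sub>v (- 1) \<cdot>\<^sub>v b)) +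
  vinner p (%y. F1 y - fX a y - gV b y) (%y. F1 y - fX a y - gV b y)"
proof -
 note fXL = f_L2(1)[OF a] note fYL = f_L2(2)[OF a] note gUL = f_L2(4)[OF b] note gVL = f_L2(5)[OF b]
 define f where "f = (%y. F1 y - fX a y)"
 have fL: "f \<in> L2_imag p" unfolding f_def by (rule L2_imag_diff[OF F1 fXL])
 have F1e: "F1 = (%y. f y + fX a y)"
 proof
  fix y
  show "F1 y = f y + fX a y" unfolding f_def
   using L2_imag_carrier[OF F1, of y] L2_imag_carrier[OF fXL, of y] by (intro eq_vecI) auto
 qed
 \<comment> \<open>\<open>fX a\<close> is itself a Hardy function, hence orthogonal to
   \<open>f\<close>, and the square norm of \<open>F1\<close> splits.\<close>
 have ffX: "vinner p f (fX a) = 0" unfolding f_def by (rule o1[OF f_hardy(1)[OF a]])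
 have fXf: "vinner p (fX a) f = 0" using vinner_cnj[of p "fX a" f] ffX by simp
 have 1: "vinner p F1 F1 = vinner p f f + 2 * pi * ((GX *\<^sub>v a) \<bullet>c a)"
  unfolding F1e vinner_add_left[OF fL fXL L2_imag_add[OF fL fXL]] vinner_add_right[OF fL fXL fL] vinner_add_right[OF fL fXL fXL]
   ffX fXf grams(1)[OF a a] by simp
 define E where "E = (%y. gU b y + fY a y)"
 have EL: "E \<in> L2_imag m" unfolding E_def by (rule L2_imag_add[OF gUL fYL])
 have ae': "AE y in lborel. F2 y = E y" using ae by (simp add: E_def)
 have "vinner m F2 F2 = vinner m E F2" by (rule vinner_cong_AE[OF ae' F2 EL F2])
 also have "\<dots> = cnj (vinner m F2 E)" by (rule vinner_cnj)
 also have "vinner m F2 E = vinner m E E" by (rule vinner_cong_AE[OF ae' F2 EL EL])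
 also have "cnj (vinner m E E) = vinner m E E" by (rule vinner_cnj[symmetric])
 also have "vinner m E E = 2 * pi * ((GU *\<^sub>v b) \<bullet>c b) + 2 * pi * ((GY *\<^sub>v a) \<bullet>c a)"
 proof -
  have o: "vinner m (fY a) (gU b) = 0" by (rule g_orth(1)[OF f_hardy(2)[OF a] b])
  then have o': "vinner m (gU b) (fY a) = 0" using vinner_cnj[of m "gU b" "fY a"] by simp
  show ?thesis unfolding E_def vinner_add_left[OF gUL fYL L2_imag_add[OF gUL fYL]] vinner_add_right[OF gUL fYL gUL] vinner_add_right[OF gUL fYL fYL]
   o o' grams(4)[OF b b] grams(2)[OF a a] by simp
 qed
 finally have 2: "vinner m F2 F2 = 2 * pi * ((GU *\<^sub>v b) \<bullet>c b) + 2 * pi * ((GY *\<^sub>v a) \<bullet>c a)" .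
 let ?s = "(mat_adjoint Gam *\<^sub>v a) \<bullet>c b" and ?u = "(GU *\<^sub>v b) \<bullet>c b" and ?v = "(GV *\<^sub>v b) \<bullet>c b"
 have fg: "vinner p f (gV b) = 2 * pi * (?u - ?s)"
  unfolding f_def o2[OF b] using cscalar_prod_minus_left[OF mult_mat_vec_carrier[OF Pmats(4) b] mult_mat_vec_carrier[OF adj_dims(4) a] b] by simp
 have ur: "cnj ?u = ?u" using gram_real(1)[OF b] by (simp add: complex_eq_iff)
 have gf: "vinner p (gV b) f = 2 * pi * (?u - cnj ?s)" unfolding vinner_cnj[of p "gV b" f] fg by (simp add: ur)
 have 3: "vinner p (%y. f y - gV b y) (%y. f y - gV b y) = vinner p f f - 2 * pi * (?u - ?s) - 2 * pi * (?u - cnj ?s) + 2 * pi * ?v"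
  unfolding vinner_diff_left[OF fL gVL L2_imag_diff[OF fL gVL]] vinner_diff_right[OF fL gVL fL] vinner_diff_right[OF fL gVL gVL]
   fg gf grams(5)[OF b b] by simp
 have bm: "(- 1) \<cdot>\<^sub>v b \<in> carrier_vec nw" using b by simp
 \<comment> \<open>Negating b leaves the quadratic terms alone and flips the mixed term; this is why
   the Pick form appears at (a, -b).\<close>
 have neg: "(Q *\<^sub>v ((- 1) \<cdot>\<^sub>v b)) \<bullet>c ((- 1) \<cdot>\<^sub>v b) = (Q *\<^sub>v b) \<bullet>c b" if "Q \<in> carrier_mat nw nw" for Q
  unfolding mult_mat_vec[OF that b] cscalar_prod_smult_left[OF mult_mat_vec_carrier[OF that b] bm]
   cscalar_prod_smult_right[OF mult_mat_vec_carrier[OF that b] b] by simp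
 have P: "(Pick *\<^sub>v (a @\<^sub>v (- 1) \<cdot>\<^sub>v b)) \<bullet>c (a @\<^sub>v (- 1) \<cdot>\<^sub>v b) =
  (GX *\<^sub>v a) \<bullet>c a - (GY *\<^sub>v a) \<bullet>c a - ?s - cnj ?s + ?u - ?v"
  unfolding Pick_form[OF a bm] neg[OF Pmats(4)] neg[OF Pmats(5)]
   cscalar_prod_smult_right[OF mult_mat_vec_carrier[OF adj_dims(4) a] b] by simp
 show ?thesis unfolding 1 2 P 3[unfolded f_def] f_def by (simp add: algebra_simps)
qed

end

section \<open>Coordinates of the orthogonal complement\<close>

lemma L2_imag_splitE:
 assumes "F \<in> L2_imag (p + m)"
 obtains F1 F2 where "F = (%y. F1 y @\<^sub>v F2 y)" "F1 \<in> L2_imag p" "F2 \<in> L2_imag m"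
proof -
 have e: "F = (%y. vec_first (F y) p @\<^sub>v vec_last (F y) m)" using append_vec_split[OF L2_imag_carrier[OF assms]] by blast
 have "(%y. vec_first (F y) p) \<in> L2_imag p \<and> (%y. vec_last (F y) m) \<in> L2_imag m"
  using L2_imag_append[of "%y. vec_first (F y) p" p "%y. vec_last (F y) m" m] assms unfolding e[symmetric] by simp
 then show ?thesis using that[OF e] by blast
qed

lemma hardy_vec_splitE:
 assumes "hardy_vec (p + m) h H"
 obtains h1 H1 h2 H2 where "H = (%y. H1 y @\<^sub>v H2 y)" "hardy_vec p h1 H1" "hardy_vec m h2 H2"
proof -
 have c: "H y \<in> carrier_vec (p + m)" for y by (rule L2_imag_carrier[OF hardy_vec_L2[OF assms]])
 have h: "hardy_pair (%z. vec_index (h z) i) (%y. vec_index (H y) i)" if "i < p + m" for i using assms that unfolding hardy_vec_iff by blast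
 show ?thesis
 proof (rule that)
  show "H = (%y. vec p (%i. vec_index (H y) i) @\<^sub>v vec m (%i. vec_index (H y) (p + i)))"
  proof
   fix y show "H y = vec p (%i. vec_index (H y) i) @\<^sub>v vec m (%i. vec_index (H y) (p + i))"
    using carrier_vecD[OF c, of y] by (intro eq_vecI) auto
  qed
  show "hardy_vec p (%z. vec p (%i. vec_index (h z) i)) (%y. vec p (%i. vec_index (H y) i))"
   "hardy_vec m (%z. vec m (%i. vec_index (h z) (p + i))) (%y. vec m (%i. vec_index (H y) (p + i)))"
   unfolding hardy_vec_iff using h by simp_all
 qed
qed

lemma rfun_linear:
 assumes A: "A \<in> carrier_mat n n" and C: "C \<in> carrier_mat d n" and z: "z \<notin> spectrum A"
  and v: "v \<in> carrier_vec n" and w: "w \<in> carrier_vec n"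
 shows "rfun C A (v + w) z = rfun C A v z + rfun C A w z" "rfun C A (v - w) z = rfun C A v z - rfun C A w z"
  "rfun C A (c \<cdot>\<^sub>v v) z = c \<cdot>\<^sub>v rfun C A v z"
proof -
 have CR: "C * resolvent A z \<in> carrier_mat d n" using C resolvent_props(1)[OF A z] by (rule mult_carrier_mat)
 show "rfun C A (v + w) z = rfun C A v z + rfun C A w z" unfolding rfun_def by (rule mult_add_distrib_mat_vec[OF CR v w])
 show "rfun C A (v - w) z = rfun C A v z - rfun C A w z" unfolding rfun_def by (rule mult_minus_distrib_mat_vec[OF CR v w])
 show "rfun C A (c \<cdot>\<^sub>v v) z = c \<cdot>\<^sub>v rfun C A v z" unfolding rfun_def by (rule mult_mat_vec[OF CR v])
qed

lemma append_vec_minus: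
 assumes "x \<in> carrier_vec p" "y \<in> carrier_vec m" "x' \<in> carrier_vec p" "y' \<in> carrier_vec m"
 shows "(x @\<^sub>v y) - (x' @\<^sub>v y') = (x - x') @\<^sub>v (y - y' :: complex vec)"
 using carrier_vecD[OF assms(1)] carrier_vecD[OF assms(2)] carrier_vecD[OF assms(3)] carrier_vecD[OF assms(4)] by (intro eq_vecI) auto

lemma append_vec_smult: "c \<cdot>\<^sub>v (x @\<^sub>v y) = (c \<cdot>\<^sub>v x) @\<^sub>v (c \<cdot>\<^sub>v y :: complex vec)"
 by (intro eq_vecI) auto

context btoa
begin

lemma axis_notin: "Complex 0 y \<notin> spectrum W" "Complex 0 y \<notin> spectrum (- Zs)"
 using nonaxis(1)[of "Complex 0 y"] nonaxis(2)[of "Complex 0 y"] by auto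

lemma K_space_L2: "F \<in> K_space D ==> F \<in> L2_imag (p + m)"
 unfolding K_space_iff
proof (elim exE conjE)
 fix F1 b g G assume F: "F = (%y. F1 y @\<^sub>v (gU b y + G y))" "F1 \<in> L2_imag p" "b \<in> carrier_vec nw" "hardy_vec m g G"
 have 2: "(%y. gU b y + G y) \<in> L2_imag m" by (rule L2_imag_add[OF f_L2(4)[OF F(3)] hardy_vec_L2[OF F(4)]])
 show "F \<in> L2_imag (p + m)" unfolding F(1)
  using L2_imag_append[of F1 p "%y. gU b y + G y" m, OF L2_imag_carrier[OF F(2)] L2_imag_carrier[OF 2]] F(2) 2 by blast
qed

lemma M_space_L2: "F \<in> M_space D ==> F \<in> L2_imag (p + m)"
 unfolding M_space_iff using L2_imag_add[OF g_L2 hardy_vec_L2] by blast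

lemma M_perp_L2: "F \<in> M_perp D ==> F \<in> L2_imag (p + m)"
 unfolding M_perp_def using K_space_L2 by blast

lemma J_inner_linear:
 assumes F: "F \<in> L2_imag (p + m)" and G: "G \<in> L2_imag (p + m)" and H: "H \<in> L2_imag (p + m)"
 shows "J_inner D (%y. F y + G y) H = J_inner D F H + J_inner D G H"
  "J_inner D (%y. c \<cdot>\<^sub>v F y) H = c * J_inner D F H" "J_inner D G F = cnj (J_inner D F G)"
proof -
 obtain F1 F2 where F': "F = (%y. F1 y @\<^sub>v F2 y)" "F1 \<in> L2_imag p" "F2 \<in> L2_imag m" using L2_imag_splitE[OF F] .
 obtain G1 G2 where G': "G = (%y. G1 y @\<^sub>v G2 y)" "G1 \<in> L2_imag p" "G2 \<in> L2_imag m" using L2_imag_splitE[OF G] .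
 obtain H1 H2 where H': "H = (%y. H1 y @\<^sub>v H2 y)" "H1 \<in> L2_imag p" "H2 \<in> L2_imag m" using L2_imag_splitE[OF H] .
 have e: "(F1 y @\<^sub>v F2 y) + (G1 y @\<^sub>v G2 y) = (F1 y + G1 y) @\<^sub>v (F2 y + G2 y)" for y
  by (rule append_vec_add[OF L2_imag_carrier[OF F'(2)] L2_imag_carrier[OF G'(2)] L2_imag_carrier[OF F'(3)] L2_imag_carrier[OF G'(3)]])
 show "J_inner D (%y. F y + G y) H = J_inner D F H + J_inner D G H"
  unfolding F'(1) G'(1) H'(1) e J_inner_append(1)[OF F'(2,3) H'(2,3)] J_inner_append(1)[OF G'(2,3) H'(2,3)]
   J_inner_append(1)[OF L2_imag_add[OF F'(2) G'(2)] L2_imag_add[OF F'(3) G'(3)] H'(2,3)]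
   vinner_add_left[OF F'(2) G'(2) H'(2)] vinner_add_left[OF F'(3) G'(3) H'(3)] by simp
 show "J_inner D (%y. c \<cdot>\<^sub>v F y) H = c * J_inner D F H"
  unfolding F'(1) H'(1) append_vec_smult J_inner_append(1)[OF F'(2,3) H'(2,3)]
   J_inner_append(1)[OF L2_imag_smult[OF F'(2)] L2_imag_smult[OF F'(3)] H'(2,3)]
   vinner_smult_left[OF F'(2)] vinner_smult_left[OF F'(3)] by (simp add: algebra_simps)
 show "J_inner D G F = cnj (J_inner D F G)"
  unfolding F'(1) G'(1) J_inner_append(1)[OF F'(2,3) G'(2,3)] J_inner_append(1)[OF G'(2,3) F'(2,3)]
  using vinner_cnj[of p F1 G1] vinner_cnj[of m F2 G2] by simp
qed

lemma K_space_closed: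
 shows "F \<in> K_space D ==> G \<in> K_space D ==> (%y. F y + G y) \<in> K_space D"
  "F \<in> K_space D ==> (%y. c \<cdot>\<^sub>v F y) \<in> K_space D"
proof -
 assume "F \<in> K_space D"
 then obtain F1 b g F2 where F: "F = (%y. F1 y @\<^sub>v (gU b y + F2 y))" "F1 \<in> L2_imag p" "b \<in> carrier_vec nw" "hardy_vec m g F2"
  unfolding K_space_iff by blast
 note r = rfun_linear[OF dims(6,4) axis_notin(1)]
 have U: "gU b y \<in> carrier_vec m" for b y by (rule rfun_carrier[OF dims(4)])
 have F2c: "F2 y \<in> carrier_vec m" for y by (rule L2_imag_carrier[OF hardy_vec_L2[OF F(4)]])
 show "(%y. c \<cdot>\<^sub>v F y) \<in> K_space D"
  unfolding K_space_iff
 proof (intro exI conjI)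
  show "(%y. c \<cdot>\<^sub>v F y) = (%y. (c \<cdot>\<^sub>v F1 y) @\<^sub>v (gU (c \<cdot>\<^sub>v b) y + c \<cdot>\<^sub>v F2 y))"
   unfolding F(1) append_vec_smult r(3)[OF F(3) F(3)] smult_add_distrib_vec[OF U F2c] ..
 qed (rule L2_imag_smult[OF F(2)] hardy_vec_smult[OF F(4)] smult_carrier_vec[THEN iffD2, OF F(3)])+
 assume "G \<in> K_space D"
 then obtain G1 b' g' G2 where G: "G = (%y. G1 y @\<^sub>v (gU b' y + G2 y))" "G1 \<in> L2_imag p" "b' \<in> carrier_vec nw" "hardy_vec m g' G2"
  unfolding K_space_iff by blast
 have G2c: "G2 y \<in> carrier_vec m" for y by (rule L2_imag_carrier[OF hardy_vec_L2[OF G(4)]])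
 show "(%y. F y + G y) \<in> K_space D"
  unfolding K_space_iff
 proof (intro exI conjI)
  have 1: "(F1 y @\<^sub>v (gU b y + F2 y)) + (G1 y @\<^sub>v (gU b' y + G2 y)) = (F1 y + G1 y) @\<^sub>v ((gU b y + F2 y) + (gU b' y + G2 y))" for y
   by (rule append_vec_add[OF L2_imag_carrier[OF F(2)] L2_imag_carrier[OF G(2)] add_carrier_vec[OF U F2c] add_carrier_vec[OF U G2c]])
  have 2: "(gU b y + F2 y) + (gU b' y + G2 y) = (gU b y + gU b' y) + (F2 y + G2 y)" for y
   using carrier_vecD[OF U, of b y] carrier_vecD[OF U, of b' y] carrier_vecD[OF F2c, of y] carrier_vecD[OF G2c, of y]
   by (intro eq_vecI) auto
  show "(%y. F y + G y) = (%y. (F1 y + G1 y) @\<^sub>v (gU (b + b') y + (F2 y + G2 y)))"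
   unfolding F(1) G(1) 1 2 r(1)[OF F(3) G(3)] ..
 qed (rule L2_imag_add[OF F(2) G(2)] hardy_vec_add[OF F(4) G(4)] add_carrier_vec[OF F(3) G(3)])+
qed

lemma M_perp_closed:
 shows "F \<in> M_perp D ==> G \<in> M_perp D ==> (%y. F y + G y) \<in> M_perp D"
  "F \<in> M_perp D ==> (%y. c \<cdot>\<^sub>v F y) \<in> M_perp D"
proof -
 assume F: "F \<in> M_perp D"
 show "(%y. c \<cdot>\<^sub>v F y) \<in> M_perp D"
  using F K_space_closed(2)[of F c] J_inner_linear(2)[OF M_perp_L2[OF F] M_perp_L2[OF F] M_space_L2] unfolding M_perp_def by auto
 assume G: "G \<in> M_perp D"
 show "(%y. F y + G y) \<in> M_perp D"
  using F G K_space_closed(1)[of F G] J_inner_linear(1)[OF M_perp_L2[OF F] M_perp_L2[OF G] M_space_L2] unfolding M_perp_def by auto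
qed

text \<open>Elements of the orthogonal complement in the coordinates of the Pick matrix: the second
 component is determined by \<open>(a, b)\<close>, the first one up to a function orthogonal to
 the Hardy space.\<close>

definition perp_rep :: "(real => complex vec) => (real => complex vec) => complex vec => complex vec => bool"
 where "perp_rep F1 F2 a b \<longleftrightarrow> F1 \<in> L2_imag p \<and> F2 \<in> L2_imag m \<and> a \<in> carrier_vec nz \<and> b \<in> carrier_vec nw \<and>
  (AE y in lborel. F2 y = gU b y + fY a y) \<and>
  (\<forall>h H. hardy_vec p h H \<longrightarrow> vinner p (%y. F1 y - fX a y) H = 0) \<and>
  (\<forall>x \<in> carrier_vec nw. vinner p (%y. F1 y - fX a y) (gV x) = 2 * pi * ((GU *\<^sub>v b - mat_adjoint Gam *\<^sub>v a) \<bullet>c x))"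

lemma perp_repD:
 assumes "perp_rep F1 F2 a b"
 shows "F1 \<in> L2_imag p" "F2 \<in> L2_imag m" "a \<in> carrier_vec nz" "b \<in> carrier_vec nw"
  "AE y in lborel. F2 y = gU b y + fY a y"
  "!!h H. hardy_vec p h H ==> vinner p (%y. F1 y - fX a y) H = 0"
  "!!x. x \<in> carrier_vec nw ==> vinner p (%y. F1 y - fX a y) (gV x) = 2 * pi * ((GU *\<^sub>v b - mat_adjoint Gam *\<^sub>v a) \<bullet>c x)"
 using assms unfolding perp_rep_def by auto

lemma M_perp_rep:
 assumes "F \<in> M_perp D"
 obtains F1 F2 a b where "F = (%y. F1 y @\<^sub>v F2 y)" "perp_rep F1 F2 a b"
proof -
 obtain F1 F2 a b where s: "F = (%y. F1 y @\<^sub>v F2 y)" "F1 \<in> L2_imag p" "F2 \<in> L2_imag m"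
  "a \<in> carrier_vec nz" "b \<in> carrier_vec nw" "AE y in lborel. F2 y = gU b y + fY a y"
  "!!h H. hardy_vec p h H ==> vinner p (%y. F1 y - fX a y) H = 0"
  "!!x. x \<in> carrier_vec nw ==> vinner p (%y. F1 y - fX a y) (gV x) = 2 * pi * ((GU *\<^sub>v b - mat_adjoint Gam *\<^sub>v a) \<bullet>c x)"
  by (rule M_perp_structure[OF assms]) (rule that; assumption)
 have "perp_rep F1 F2 a b" unfolding perp_rep_def by (intro conjI allI impI ballI s) assumption+
 then show ?thesis by (rule that[OF s(1)])
qed

lemma perp_rep_form:
 assumes "perp_rep F1 F2 a b"
 shows "J_inner D (%y. F1 y @\<^sub>v F2 y) (%y. F1 y @\<^sub>v F2 y) =
  2 * pi * ((Pick *\<^sub>v (a @\<^sub>v (- 1) \<cdot>\<^sub>v b)) \<bullet>c (a @\<^sub>v (- 1) \<cdot>\<^sub>v b)) +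
  vinner p (%y. F1 y - fX a y - gV b y) (%y. F1 y - fX a y - gV b y)"
 unfolding J_inner_append(1)[OF perp_repD(1,2)[OF assms] perp_repD(1,2)[OF assms]]
 by (rule M_perp_form[OF perp_repD[OF assms]])

text \<open>All conditions are linear in the functions and the vectors, the almost-everywhere one
  included, so differences of elements are described by differences of coordinates.\<close>

lemma perp_rep_diff:
 assumes F: "perp_rep F1 F2 a b" and G: "perp_rep G1 G2 a' b'"
 shows "perp_rep (%y. F1 y - G1 y) (%y. F2 y - G2 y) (a - a') (b - b')"
 unfolding perp_rep_def
proof (intro conjI allI impI ballI)
 note f = perp_repD[OF F] note g = perp_repD[OF G]
 have U: "gU b y \<in> carrier_vec m" for b y by (rule rfun_carrier[OF dims(4)])
 have fYc: "fY b y \<in> carrier_vec m" for b y by (rule rfun_carrier[OF adj_dims(3)])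
 have fXc: "fX b y \<in> carrier_vec p" for b y by (rule rfun_carrier[OF adj_dims(2)])
 note c1 = L2_imag_carrier[OF f(1)] and c2 = L2_imag_carrier[OF g(1)]
 note rX = rfun_linear(2)[OF uminus_Zs(1) adj_dims(2) axis_notin(2) f(3) g(3)]
 note rY = rfun_linear(2)[OF uminus_Zs(1) adj_dims(3) axis_notin(2) f(3) g(3)]
 note rU = rfun_linear(2)[OF dims(6,4) axis_notin(1) f(4) g(4)]
 note fL = L2_imag_diff[OF f(1) f_L2(1)[OF f(3)]] and gL = L2_imag_diff[OF g(1) f_L2(1)[OF g(3)]]
 have e: "(F1 y - G1 y) - fX (a - a') y = (F1 y - fX a y) - (G1 y - fX a' y)" for y
  unfolding rX using carrier_vecD[OF c1, of y] carrier_vecD[OF c2, of y] carrier_vecD[OF fXc, of a y] carrier_vecD[OF fXc, of a' y]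
  by (intro eq_vecI) auto
 show "(%y. F1 y - G1 y) \<in> L2_imag p" by (rule L2_imag_diff[OF f(1) g(1)])
 show "(%y. F2 y - G2 y) \<in> L2_imag m" by (rule L2_imag_diff[OF f(2) g(2)])
 show "a - a' \<in> carrier_vec nz" by (rule minus_carrier_vec[OF f(3) g(3)])
 show "b - b' \<in> carrier_vec nw" by (rule minus_carrier_vec[OF f(4) g(4)])
 show "AE y in lborel. F2 y - G2 y = gU (b - b') y + fY (a - a') y"
  using f(5) g(5)
 proof eventually_elim
  case (elim y)
  show ?case unfolding elim rY rU
   using carrier_vecD[OF U, of b y] carrier_vecD[OF U, of b' y] carrier_vecD[OF fYc, of a y] carrier_vecD[OF fYc, of a' y]
   by (intro eq_vecI) auto
 qed
 show "vinner p (%y. F1 y - G1 y - fX (a - a') y) H = 0" if "hardy_vec p h H" for h H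
  unfolding e vinner_diff_left[OF fL gL hardy_vec_L2[OF that]] f(6)[OF that] g(6)[OF that] by simp
 fix x :: "complex vec" assume x: "x \<in> carrier_vec nw"
 have c: "GU *\<^sub>v b \<in> carrier_vec nw" "GU *\<^sub>v b' \<in> carrier_vec nw" "mat_adjoint Gam *\<^sub>v a \<in> carrier_vec nw" "mat_adjoint Gam *\<^sub>v a' \<in> carrier_vec nw"
  using mult_mat_vec_carrier[OF Pmats(4) f(4)] mult_mat_vec_carrier[OF Pmats(4) g(4)]
   mult_mat_vec_carrier[OF adj_dims(4) f(3)] mult_mat_vec_carrier[OF adj_dims(4) g(3)] .
 show "vinner p (%y. F1 y - G1 y - fX (a - a') y) (gV x) = 2 * pi * ((GU *\<^sub>v (b - b') - mat_adjoint Gam *\<^sub>v (a - a')) \<bullet>c x)"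
  unfolding e vinner_diff_left[OF fL gL f_L2(5)[OF x]] f(7)[OF x] g(7)[OF x]
   mult_minus_distrib_mat_vec[OF Pmats(4) f(4) g(4)] mult_minus_distrib_mat_vec[OF adj_dims(4) f(3) g(3)]
   cscalar_prod_minus_left[OF minus_carrier_vec[OF c(1,2)] minus_carrier_vec[OF c(3,4)] x]
   cscalar_prod_minus_left[OF c(1,2) x] cscalar_prod_minus_left[OF c(3,4) x] cscalar_prod_minus_left[OF c(1,3) x] cscalar_prod_minus_left[OF c(2,4) x]
  by (simp add: algebra_simps)
qed

text \<open>Converse of the structure lemma. The pairing with a general element of
  \<open>M_space\<close> splits into four products, which cancel by the conditions of
  \<open>perp_rep\<close> and the interpolation condition. The exact form of \<open>F2\<close> gives
  membership in \<open>K_space\<close> with Hardy part \<open>hY a\<close>.\<close>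

lemma M_perpI:
 assumes r: "perp_rep F1 F2 a b" and F2: "F2 = (%y. gU b y + fY a y)"
 shows "(%y. F1 y @\<^sub>v F2 y) \<in> M_perp D"
proof -
 note f = perp_repD[OF r]
 note L = f_L2(1)[OF f(3)] f_L2(2)[OF f(3)] f_L2(4)[OF f(4)]
 have "(%y. F1 y @\<^sub>v F2 y) \<in> K_space D" unfolding K_space_iff F2
  by (intro exI conjI) (rule refl, rule f(1), rule f(4), rule f_hardy(2)[OF f(3)])
 moreover have "J_inner D (%y. F1 y @\<^sub>v F2 y) E = 0" if E: "E \<in> M_space D" for E
 proof -
  obtain x h H where x: "E = (%y. (gV x y @\<^sub>v gU x y) + H y)" "x \<in> carrier_vec nw" "hardy_vec (p + m) h H" "Lvec h = Gam *\<^sub>v x"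
   using E unfolding M_space_iff by blast
  obtain h1 H1 h2 H2 where H: "H = (%y. H1 y @\<^sub>v H2 y)" "hardy_vec p h1 H1" "hardy_vec m h2 H2" using hardy_vec_splitE[OF x(3)] .
  note HL = hardy_vec_L2[OF H(2)] hardy_vec_L2[OF H(3)]
  note gL = f_L2(5)[OF x(2)] f_L2(4)[OF x(2)]
  have E': "E = (%y. (gV x y + H1 y) @\<^sub>v (gU x y + H2 y))"
   unfolding x(1) H(1)
   using append_vec_add[OF L2_imag_carrier[OF gL(1)] L2_imag_carrier[OF HL(1)] L2_imag_carrier[OF gL(2)] L2_imag_carrier[OF HL(2)]] by blast
  have "J_inner D (%y. F1 y @\<^sub>v F2 y) E = vinner p F1 (gV x) + vinner p F1 H1 - (vinner m F2 (gU x) + vinner m F2 H2)"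
   unfolding E' J_inner_append(1)[OF f(1,2) L2_imag_add[OF gL(1) HL(1)] L2_imag_add[OF gL(2) HL(2)]]
    vinner_add_right[OF gL(1) HL(1) f(1)] vinner_add_right[OF gL(2) HL(2) f(2)] ..
  moreover have "vinner p F1 (gV x) = 2 * pi * ((GU *\<^sub>v b - mat_adjoint Gam *\<^sub>v a) \<bullet>c x)"
   using f(7)[OF x(2)] unfolding vinner_diff_left[OF f(1) L(1) gL(1)] g_orth(2)[OF f_hardy(1)[OF f(3)] x(2)] by simp
  moreover have "vinner p F1 H1 = vinner p (fX a) H1"
   using f(6)[OF H(2)] unfolding vinner_diff_left[OF f(1) L(1) HL(1)] by simp
  moreover have "vinner m F2 (gU x) = 2 * pi * ((GU *\<^sub>v b) \<bullet>c x)"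
   unfolding F2 vinner_add_left[OF L(3,2) gL(2)] grams(4)[OF f(4) x(2)] g_orth(1)[OF f_hardy(2)[OF f(3)] x(2)] by simp
  moreover have "vinner m F2 H2 = vinner m (fY a) H2"
   using vinner_cnj[of m "gU b" H2] unfolding F2 vinner_add_left[OF L(3,2) HL(2)] g_orth(1)[OF H(3) f(4)] by simp
  \<comment> \<open>Here the interpolation condition enters, as the value of the pairing with
    \<open>fB a\<close>.\<close>
  moreover have "vinner p (fX a) H1 - vinner m (fY a) H2 = 2 * pi * ((mat_adjoint Gam *\<^sub>v a) \<bullet>c x)"
  proof -
   have "vinner p (fX a) H1 - vinner m (fY a) H2 = vinner (p + m) (fB a) H"
    unfolding fB_append[OF f(3)] H(1) by (rule J_inner_append(2)[OF L(1,2) HL, symmetric])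
   also have "\<dots> = cnj (vinner (p + m) H (fB a))" by (rule vinner_cnj)
   also have "\<dots> = 2 * pi * cnj ((Gam *\<^sub>v x) \<bullet>c a)" unfolding residue_pairing[OF x(3) f(3)] x(4) by simp
   also have "cnj ((Gam *\<^sub>v x) \<bullet>c a) = (mat_adjoint Gam *\<^sub>v a) \<bullet>c x"
    unfolding mat_adjoint_cscalar[OF dims(7) x(2) f(3)]
    by (rule cscalar_prod_commute[OF x(2) mult_mat_vec_carrier[OF adj_dims(4) f(3)], symmetric])
   finally show ?thesis .
  qed
  moreover have "(GU *\<^sub>v b - mat_adjoint Gam *\<^sub>v a) \<bullet>c x = (GU *\<^sub>v b) \<bullet>c x - (mat_adjoint Gam *\<^sub>v a) \<bullet>c x"
   by (rule cscalar_prod_minus_left[OF mult_mat_vec_carrier[OF Pmats(4) f(4)] mult_mat_vec_carrier[OF adj_dims(4) f(3)] x(2)])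
  ultimately show ?thesis by (simp add: algebra_simps)
 qed
 ultimately show ?thesis unfolding M_perp_def by blast
qed

lemma M_perp_null:
 assumes "AE y in lborel. F y = 0\<^sub>v (p + m)" shows "J_inner D F F = 0"
 unfolding J_inner_def
proof (rule integral_eq_zero_AE)
 show "AE y in lborel. (Jmat D *\<^sub>v F y) \<bullet>c F y = 0" using assms
 proof eventually_elim
  case (elim y)
  show ?case unfolding elim cscalar_prod_sum[OF zero_carrier_vec] by simp
 qed
qed

text \<open>Testing on \<open>(X\<^sup>* r a + V r y, U r b + Y\<^sup>* r a)\<close>, where \<open>b\<close> is chosen to make this element orthogonal
 to the model space, exhibits the Pick form at \<open>(a, - y)\<close> as a sum of two nonnegative terms.\<close>

lemma Pick_nonneg:
 assumes nn: "!!F. F \<in> M_perp D ==> 0 \<le> Re (J_inner D F F)"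
  and a: "a \<in> carrier_vec nz" and y: "y \<in> carrier_vec nw"
 shows "0 \<le> Re ((Pick *\<^sub>v (a @\<^sub>v (- 1) \<cdot>\<^sub>v y)) \<bullet>c (a @\<^sub>v (- 1) \<cdot>\<^sub>v y))"
proof -
 have Gc: "GV *\<^sub>v y \<in> carrier_vec nw" "mat_adjoint Gam *\<^sub>v a \<in> carrier_vec nw"
  using mult_mat_vec_carrier[OF Pmats(5) y] mult_mat_vec_carrier[OF adj_dims(4) a] .
 \<comment> \<open>Solvable because observability makes \<open>GU\<close> positive definite; the
   right side is what the third condition of \<open>perp_rep\<close> demands when F1 - fX a is
   \<open>gV y\<close>.\<close>
 obtain b where b: "b \<in> carrier_vec nw" "GU *\<^sub>v b = GV *\<^sub>v y + mat_adjoint Gam *\<^sub>v a"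
  using pos_solve[OF Pmats(4) GU_pos add_carrier_vec[OF Gc]] by blast
 define F1 where "F1 = (%t. gV y t + fX a t)"
 define F2 where "F2 = (%t. gU b t + fY a t)"
 note L = f_L2(1)[OF a] f_L2(2)[OF a] f_L2(4)[OF b(1)] f_L2(5)[OF y]
 have e: "(%t. F1 t - fX a t) = gV y"
 proof
  fix t show "F1 t - fX a t = gV y t"
   using carrier_vecD[OF L2_imag_carrier[OF L(1)], of t] carrier_vecD[OF L2_imag_carrier[OF L(4)], of t]
   unfolding F1_def by (intro eq_vecI) auto
 qed
 have "(GV *\<^sub>v y + mat_adjoint Gam *\<^sub>v a) - mat_adjoint Gam *\<^sub>v a = GV *\<^sub>v y"
  using carrier_vecD[OF Gc(1)] carrier_vecD[OF Gc(2)] by (intro eq_vecI) auto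
 then have b2: "GU *\<^sub>v b - mat_adjoint Gam *\<^sub>v a = GV *\<^sub>v y" unfolding b(2) .
 have FL: "F1 \<in> L2_imag p" "F2 \<in> L2_imag m" unfolding F1_def F2_def by (rule L2_imag_add[OF L(4,1)], rule L2_imag_add[OF L(3,2)])
 have r: "perp_rep F1 F2 a b"
  unfolding perp_rep_def e b2
 proof (intro conjI allI impI ballI FL a b(1) grams(5)[OF y])
  show "AE t in lborel. F2 t = gU b t + fY a t" by (simp add: F2_def)
  show "vinner p (gV y) H = 0" if "hardy_vec p h H" for h H
   using vinner_cnj[of p "gV y" H] g_orth(2)[OF that y] by simp
 qed
 have "0 \<le> Re (J_inner D (%t. F1 t @\<^sub>v F2 t) (%t. F1 t @\<^sub>v F2 t))" by (rule nn[OF M_perpI[OF r F2_def]])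
 also have "J_inner D (%t. F1 t @\<^sub>v F2 t) (%t. F1 t @\<^sub>v F2 t) = vinner p F1 F1 - vinner m F2 F2" by (rule J_inner_append(1)[OF FL FL])
 also have "vinner p F1 F1 = 2 * pi * ((GV *\<^sub>v y) \<bullet>c y) + 2 * pi * ((GX *\<^sub>v a) \<bullet>c a)"
 proof -
  have o: "vinner p (fX a) (gV y) = 0" by (rule g_orth(2)[OF f_hardy(1)[OF a] y])
  then have o': "vinner p (gV y) (fX a) = 0" using vinner_cnj[of p "gV y" "fX a"] by simp
  show ?thesis unfolding F1_def vinner_add_left[OF L(4,1) L2_imag_add[OF L(4,1)]] vinner_add_right[OF L(4,1) L(4)] vinner_add_right[OF L(4,1) L(1)]
   o o' grams(5)[OF y y] grams(1)[OF a a] by simp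
 qed
 also have "vinner m F2 F2 = 2 * pi * ((GU *\<^sub>v b) \<bullet>c b) + 2 * pi * ((GY *\<^sub>v a) \<bullet>c a)"
 proof -
  have o: "vinner m (fY a) (gU b) = 0" by (rule g_orth(1)[OF f_hardy(2)[OF a] b(1)])
  then have o': "vinner m (gU b) (fY a) = 0" using vinner_cnj[of m "gU b" "fY a"] by simp
  show ?thesis unfolding F2_def vinner_add_left[OF L(3,2) L2_imag_add[OF L(3,2)]] vinner_add_right[OF L(3,2) L(3)] vinner_add_right[OF L(3,2) L(2)]
   o o' grams(4)[OF b(1) b(1)] grams(2)[OF a a] by simp
 qed
 finally have "0 \<le> 2 * pi * (Re ((GV *\<^sub>v y) \<bullet>c y) + Re ((GX *\<^sub>v a) \<bullet>c a) - Re ((GU *\<^sub>v b) \<bullet>c b) - Re ((GY *\<^sub>v a) \<bullet>c a))"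
  by (simp add: algebra_simps)
 then have Q: "0 \<le> Re ((GV *\<^sub>v y) \<bullet>c y) + Re ((GX *\<^sub>v a) \<bullet>c a) - Re ((GU *\<^sub>v b) \<bullet>c b) - Re ((GY *\<^sub>v a) \<bullet>c a)"
  by (simp add: zero_le_mult_iff linorder_not_le[THEN iffD2, OF pi_gt_zero])
 have ym: "(- 1) \<cdot>\<^sub>v y \<in> carrier_vec nw" using y by simp
 have neg: "(Q *\<^sub>v ((- 1) \<cdot>\<^sub>v y)) \<bullet>c ((- 1) \<cdot>\<^sub>v y) = (Q *\<^sub>v y) \<bullet>c y" if "Q \<in> carrier_mat nw nw" for Q
  unfolding mult_mat_vec[OF that y] cscalar_prod_smult_left[OF mult_mat_vec_carrier[OF that y] ym]
   cscalar_prod_smult_right[OF mult_mat_vec_carrier[OF that y] y] by simp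
 have Gb: "GU *\<^sub>v b \<in> carrier_vec nw" "GU *\<^sub>v y \<in> carrier_vec nw"
  using mult_mat_vec_carrier[OF Pmats(4) b(1)] mult_mat_vec_carrier[OF Pmats(4) y] .
 have s: "(GU *\<^sub>v b) \<bullet>c y = (GV *\<^sub>v y) \<bullet>c y + (mat_adjoint Gam *\<^sub>v a) \<bullet>c y"
  unfolding b(2) by (rule cscalar_prod_add_left[OF Gc y])
 have P: "Re ((Pick *\<^sub>v (a @\<^sub>v (- 1) \<cdot>\<^sub>v y)) \<bullet>c (a @\<^sub>v (- 1) \<cdot>\<^sub>v y)) =
  Re ((GX *\<^sub>v a) \<bullet>c a) - Re ((GY *\<^sub>v a) \<bullet>c a) - 2 * Re ((mat_adjoint Gam *\<^sub>v a) \<bullet>c y) + Re ((GU *\<^sub>v y) \<bullet>c y) - Re ((GV *\<^sub>v y) \<bullet>c y)"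
  unfolding Pick_form[OF a ym] neg[OF Pmats(4)] neg[OF Pmats(5)]
   cscalar_prod_smult_right[OF mult_mat_vec_carrier[OF adj_dims(4) a] y] by simp
 have bc: "b - y \<in> carrier_vec nw" by (rule minus_carrier_vec[OF b(1) y])
 \<comment> \<open>The Pick form at (a, -y) is the J-form of the test element divided by 2\<pi> plus
   this square; the equation for \<open>b\<close> eliminates the mixed terms.\<close>
 have "0 \<le> Re ((GU *\<^sub>v (b - y)) \<bullet>c (b - y))"
  using vinner_self_nonneg(1)[OF f_L2(4)[OF bc]] unfolding grams(4)[OF bc bc] by (simp add: zero_le_mult_iff linorder_not_le[THEN iffD2, OF pi_gt_zero])
 also have "(GU *\<^sub>v (b - y)) \<bullet>c (b - y) = (GU *\<^sub>v b) \<bullet>c b - (GU *\<^sub>v b) \<bullet>c y - ((GU *\<^sub>v y) \<bullet>c b - (GU *\<^sub>v y) \<bullet>c y)"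
  unfolding mult_minus_distrib_mat_vec[OF Pmats(4) b(1) y] cscalar_prod_minus_left[OF Gb bc]
   cscalar_prod_minus_right[OF Gb(1) b(1) y] cscalar_prod_minus_right[OF Gb(2) b(1) y] ..
 also have "(GU *\<^sub>v y) \<bullet>c b = cnj ((GU *\<^sub>v b) \<bullet>c y)" by (rule hermitian_form_commute[OF Pmats(4) gram_hermitian(4) b(1) y])
 finally show ?thesis using Q arg_cong[OF s, of Re] unfolding P by simp
qed

end

section \<open>Completeness of the orthogonal complement\<close>

context btoa
begin

text \<open>Rewrites the right side of the last condition of \<open>perp_rep\<close> through the
  second block row of the Pick matrix, so that it can be controlled by Pick coordinates.\<close>

lemma Pick_second:
 assumes a: "a \<in> carrier_vec nz" and b: "b \<in> carrier_vec nw" and x: "x \<in> carrier_vec nw"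
 shows "(Pick *\<^sub>v (a @\<^sub>v (- 1) \<cdot>\<^sub>v b)) \<bullet>c (0\<^sub>v nz @\<^sub>v x) =
  (GV *\<^sub>v b) \<bullet>c x - (GU *\<^sub>v b - mat_adjoint Gam *\<^sub>v a) \<bullet>c x"
proof -
 have bm: "(- 1) \<cdot>\<^sub>v b \<in> carrier_vec nw" using b by simp
 have c: "Gamma_L D *\<^sub>v a \<in> carrier_vec nz" "Gam *\<^sub>v ((- 1) \<cdot>\<^sub>v b) \<in> carrier_vec nz" "mat_adjoint Gam *\<^sub>v a \<in> carrier_vec nw" "Gamma_R D *\<^sub>v ((- 1) \<cdot>\<^sub>v b) \<in> carrier_vec nw"
  using mult_mat_vec_carrier[OF Gamma_dims(1) a] mult_mat_vec_carrier[OF dims(7) bm] mult_mat_vec_carrier[OF adj_dims(4) a] mult_mat_vec_carrier[OF Gamma_dims(2) bm] .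
 have g: "GU *\<^sub>v b \<in> carrier_vec nw" "GV *\<^sub>v b \<in> carrier_vec nw"
  using mult_mat_vec_carrier[OF Pmats(4) b] mult_mat_vec_carrier[OF Pmats(5) b] .
 have 1: "(Gamma_R D *\<^sub>v ((- 1) \<cdot>\<^sub>v b)) \<bullet>c x = - ((GU *\<^sub>v b) \<bullet>c x - (GV *\<^sub>v b) \<bullet>c x)"
  unfolding mult_mat_vec[OF Gamma_dims(2) b] cscalar_prod_smult_left[OF mult_mat_vec_carrier[OF Gamma_dims(2) b] x]
  unfolding Gamma_R_eq minus_mult_distrib_mat_vec[OF Pmats(4,5) b] cscalar_prod_minus_left[OF g x] by simp
 have 2: "(Gamma_L D *\<^sub>v a + Gam *\<^sub>v ((- 1) \<cdot>\<^sub>v b)) \<bullet>c 0\<^sub>v nz = 0"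
  unfolding cscalar_prod_sum[OF zero_carrier_vec] by simp
 show ?thesis
  unfolding Pick_mult[OF a bm] cscalar_prod_append[OF add_carrier_vec[OF c(1,2)] add_carrier_vec[OF c(3,4)] zero_carrier_vec x]
   cscalar_prod_add_left[OF c(3,4) x] cscalar_prod_minus_left[OF g(1) c(3) x] 1 2 by simp
qed

text \<open>For the remainder the conditions become orthogonality to the Hardy space and prescribed
  pairings with \<open>gV x\<close>; both survive limits of the remainder and of the Pick
  coordinates.\<close>

lemma perp_rep_resid:
 assumes r: "perp_rep F1 F2 a b"
 shows "(%y. F1 y - fX a y - gV b y) \<in> L2_imag p"
  "hardy_vec p h H ==> vinner p (%y. F1 y - fX a y - gV b y) H = 0"
  "x \<in> carrier_vec nw ==> vinner p (%y. F1 y - fX a y - gV b y) (gV x) =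
   - (2 * pi) * ((Pick *\<^sub>v (a @\<^sub>v (- 1) \<cdot>\<^sub>v b)) \<bullet>c (0\<^sub>v nz @\<^sub>v x))"
proof -
 note f = perp_repD[OF r]
 note L = L2_imag_diff[OF f(1) f_L2(1)[OF f(3)]] f_L2(5)[OF f(4)]
 show "(%y. F1 y - fX a y - gV b y) \<in> L2_imag p" by (rule L2_imag_diff[OF L])
 show "vinner p (%y. F1 y - fX a y - gV b y) H = 0" if h: "hardy_vec p h H"
  using vinner_cnj[of p "gV b" H] unfolding vinner_diff_left[OF L hardy_vec_L2[OF h]] f(6)[OF h] g_orth(2)[OF h f(4)] by simp
 show "vinner p (%y. F1 y - fX a y - gV b y) (gV x) =
   - (2 * pi) * ((Pick *\<^sub>v (a @\<^sub>v (- 1) \<cdot>\<^sub>v b)) \<bullet>c (0\<^sub>v nz @\<^sub>v x))" if x: "x \<in> carrier_vec nw"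
  unfolding vinner_diff_left[OF L f_L2(5)[OF x]] f(7)[OF x] grams(5)[OF f(4) x] Pick_second[OF f(3,4) x]
  by (simp add: algebra_simps)
qed

text \<open>Serves to rebuild an element from its coordinates and its remainder, in particular a
  limit from the limits of its parts.\<close>

lemma perp_rep_of_resid:
 assumes a: "a \<in> carrier_vec nz" and b: "b \<in> carrier_vec nw" and r: "r \<in> L2_imag p"
  and o1: "!!h H. hardy_vec p h H ==> vinner p r H = 0"
  and o2: "!!x. x \<in> carrier_vec nw ==> vinner p r (gV x) = - (2 * pi) * ((Pick *\<^sub>v (a @\<^sub>v (- 1) \<cdot>\<^sub>v b)) \<bullet>c (0\<^sub>v nz @\<^sub>v x))"
 shows "perp_rep (%y. r y + gV b y + fX a y) (%y. gU b y + fY a y) a b"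
 unfolding perp_rep_def
proof (intro conjI allI impI ballI a b)
 note L = f_L2(1)[OF a] f_L2(2)[OF a] f_L2(4)[OF b] f_L2(5)[OF b]
 show "(%y. r y + gV b y + fX a y) \<in> L2_imag p" by (rule L2_imag_add[OF L2_imag_add[OF r L(4)] L(1)])
 show "(%y. gU b y + fY a y) \<in> L2_imag m" by (rule L2_imag_add[OF L(3,2)])
 show "AE y in lborel. gU b y + fY a y = gU b y + fY a y" by simp
 have e: "r y + gV b y + fX a y - fX a y = r y + gV b y" for y
  using carrier_vecD[OF L2_imag_carrier[OF L(1)], of y] carrier_vecD[OF L2_imag_carrier[OF L(4)], of y] carrier_vecD[OF L2_imag_carrier[OF r], of y]
  by (intro eq_vecI) auto
 show "vinner p (%y. r y + gV b y + fX a y - fX a y) H = 0" if h: "hardy_vec p h H" for h H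
  using vinner_cnj[of p "gV b" H] unfolding e vinner_add_left[OF r L(4) hardy_vec_L2[OF h]] o1[OF h] g_orth(2)[OF h b] by simp
 fix x :: "complex vec" assume x: "x \<in> carrier_vec nw"
 show "vinner p (%y. r y + gV b y + fX a y - fX a y) (gV x) = 2 * pi * ((GU *\<^sub>v b - mat_adjoint Gam *\<^sub>v a) \<bullet>c x)"
  unfolding e vinner_add_left[OF r L(4) f_L2(5)[OF x]] o2[OF x] grams(5)[OF b x] Pick_second[OF a b x] by (simp add: algebra_simps)
qed

text \<open>With all signs 1 the squared J-distance is 2\<pi> times the squared distance of the Pick
  coordinates plus the squared L2 distance of the remainders. So both parts are Cauchy: the
  coordinates converge in finite dimension, the remainders in L2, and the limits still satisfy the
  relations that link them.\<close>

lemma M_perp_complete: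
 assumes o: "form_orthonormal (nz + nw) Pick (carrier_vec (nz + nw)) k v e"
  and rep: "!!x. x \<in> carrier_vec (nz + nw) ==> x = lin_comb (nz + nw) k v (%i. of_real (e i) * ((Pick *\<^sub>v x) \<bullet>c v i))"
  and e: "!!i. i < k ==> e i = 1"
  and s: "!!n. s n \<in> M_perp D"
  and cauchy: "!!\<epsilon>. \<epsilon> > 0 ==> \<exists>M. \<forall>j\<ge>M. \<forall>k\<ge>M. Re (J_inner D (%t. s j t - s k t) (%t. s j t - s k t)) < \<epsilon>"
 obtains f where "f \<in> M_perp D" "(%n. Re (J_inner D (%t. s n t - f t) (%t. s n t - f t))) \<longlonglongrightarrow> 0"
proof -
 let ?N = "nz + nw"
 have expand: "(Pick *\<^sub>v x) \<bullet>c y = (\<Sum>i<k. of_real (e i) * ((Pick *\<^sub>v x) \<bullet>c v i) * cnj ((Pick *\<^sub>v y) \<bullet>c v i))"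
  if "x \<in> carrier_vec ?N" "y \<in> carrier_vec ?N" for x y
  by (rule form_orthonormal_expand[OF Pick_carrier Pick_hermitian subset_refl o rep that])
 have vc: "v i \<in> carrier_vec ?N" if "i < k" for i using o that unfolding form_orthonormal_def by blast
 define w where "w = (%a b. a @\<^sub>v (- 1) \<cdot>\<^sub>v b :: complex vec)"
 have wc: "w a b \<in> carrier_vec ?N" if "a \<in> carrier_vec nz" "b \<in> carrier_vec nw" for a b
  unfolding w_def using that by simp
 have form: "Re ((Pick *\<^sub>v x) \<bullet>c x) = (\<Sum>i<k. (cmod ((Pick *\<^sub>v x) \<bullet>c v i))\<^sup>2)" if x: "x \<in> carrier_vec ?N" for x
 proof -
  have "(Pick *\<^sub>v x) \<bullet>c x = (\<Sum>i<k. of_real (e i) * ((Pick *\<^sub>v x) \<bullet>c v i) * cnj ((Pick *\<^sub>v x) \<bullet>c v i))"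
   by (rule expand[OF x x])
  also have "\<dots> = (\<Sum>i<k. of_real ((cmod ((Pick *\<^sub>v x) \<bullet>c v i))\<^sup>2))"
   by (intro sum.cong refl) (use e in \<open>simp add: complex_norm_square del: of_real_power\<close>)
  finally have f0: "(Pick *\<^sub>v x) \<bullet>c x = (\<Sum>i<k. of_real ((cmod ((Pick *\<^sub>v x) \<bullet>c v i))\<^sup>2))" .
  show ?thesis unfolding f0 by simp
 qed
 have "\<exists>F1 F2 a b. s n = (%y. F1 y @\<^sub>v F2 y) \<and> perp_rep F1 F2 a b" for n using M_perp_rep[OF s[of n]] by metis
 then obtain F1 F2 a b where sF: "!!n. s n = (%y. F1 n y @\<^sub>v F2 n y)" and pr: "!!n. perp_rep (F1 n) (F2 n) (a n) (b n)" by metis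
 note ac = perp_repD(3)[OF pr] and bc = perp_repD(4)[OF pr]
 define r where "r = (%n y. F1 n y - fX (a n) y - gV (b n) y)"
 \<comment> \<open>Pick coordinates of the n-th element with respect to the signed basis.\<close>
 define u where "u = (%n i. (Pick *\<^sub>v w (a n) (b n)) \<bullet>c v i)"
 have rL: "r n \<in> L2_imag p" for n unfolding r_def by (rule perp_rep_resid(1)[OF pr])
 \<comment> \<open>Stated for an arbitrary represented element, since it is used once for pairs of
   members of the sequence and once for the limit.\<close>
 have Jdiff: "Re (J_inner D (%t. s n t - (G1 t @\<^sub>v G2 t)) (%t. s n t - (G1 t @\<^sub>v G2 t))) =
   2 * pi * (\<Sum>i<k. (cmod (u n i - (Pick *\<^sub>v w a' b') \<bullet>c v i))\<^sup>2) +
   Re (vinner p (%y. r n y - (G1 y - fX a' y - gV b' y)) (%y. r n y - (G1 y - fX a' y - gV b' y)))"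
  if G: "perp_rep G1 G2 a' b'" for n G1 G2 a' b'
 proof -
  note g = perp_repD[OF G] and f = perp_repD[OF pr[of n]]
  have sd: "(%t. s n t - (G1 t @\<^sub>v G2 t)) = (%t. (F1 n t - G1 t) @\<^sub>v (F2 n t - G2 t))"
   unfolding sF using append_vec_minus[OF L2_imag_carrier[OF f(1)] L2_imag_carrier[OF f(2)] L2_imag_carrier[OF g(1)] L2_imag_carrier[OF g(2)]] by blast
  have wd: "(a n - a') @\<^sub>v (- 1) \<cdot>\<^sub>v (b n - b') = w (a n) (b n) - w a' b'"
   unfolding w_def using carrier_vecD[OF f(3)] carrier_vecD[OF f(4)] carrier_vecD[OF g(3)] carrier_vecD[OF g(4)] by (intro eq_vecI) auto
  have wn: "w (a n) (b n) \<in> carrier_vec ?N" and w': "w a' b' \<in> carrier_vec ?N"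
   by (rule wc[OF f(3,4)], rule wc[OF g(3,4)])
  have ud: "(Pick *\<^sub>v (w (a n) (b n) - w a' b')) \<bullet>c v i = u n i - (Pick *\<^sub>v w a' b') \<bullet>c v i" if "i < k" for i
   unfolding u_def mult_minus_distrib_mat_vec[OF Pick_carrier wn w']
   by (rule cscalar_prod_minus_left[OF mult_mat_vec_carrier[OF Pick_carrier wn] mult_mat_vec_carrier[OF Pick_carrier w'] vc[OF that]])
  have rX: "fX (a n - a') y = fX (a n) y - fX a' y" for y by (rule rfun_linear(2)[OF uminus_Zs(1) adj_dims(2) axis_notin(2) f(3) g(3)])
  have rV: "gV (b n - b') y = gV (b n) y - gV b' y" for y by (rule rfun_linear(2)[OF dims(6,5) axis_notin(1) f(4) g(4)])
  have fXc: "fX b y \<in> carrier_vec p" for b y by (rule rfun_carrier[OF adj_dims(2)])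
  have gVc: "gV b y \<in> carrier_vec p" for b y by (rule rfun_carrier[OF dims(5)])
  have rd: "F1 n y - G1 y - fX (a n - a') y - gV (b n - b') y = r n y - (G1 y - fX a' y - gV b' y)" for y
   unfolding r_def rX rV
   using carrier_vecD[OF L2_imag_carrier[OF f(1)], of y] carrier_vecD[OF L2_imag_carrier[OF g(1)], of y]
    carrier_vecD[OF fXc, of "a n" y] carrier_vecD[OF fXc, of a' y] carrier_vecD[OF gVc, of "b n" y] carrier_vecD[OF gVc, of b' y]
   by (intro eq_vecI) auto
  have "Re ((Pick *\<^sub>v (w (a n) (b n) - w a' b')) \<bullet>c (w (a n) (b n) - w a' b')) = (\<Sum>i<k. (cmod (u n i - (Pick *\<^sub>v w a' b') \<bullet>c v i))\<^sup>2)"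
   unfolding form[OF minus_carrier_vec[OF wn w']] by (intro sum.cong refl) (simp add: ud)
  then show ?thesis unfolding sd perp_rep_form[OF perp_rep_diff[OF pr G]] wd rd by simp
 qed
 have Jjk: "Re (J_inner D (%t. s j t - s l t) (%t. s j t - s l t)) =
   2 * pi * (\<Sum>i<k. (cmod (u j i - u l i))\<^sup>2) + Re (vinner p (%y. r j y - r l y) (%y. r j y - r l y))" for j l
  using Jdiff[OF pr[of l], of j] unfolding sF[of l] u_def r_def .
 have nn: "0 \<le> Re (vinner p (%y. r j y - r l y) (%y. r j y - r l y))" for j l
  by (rule vinner_self_nonneg(1)[OF L2_imag_diff[OF rL rL]])
 have sn: "0 \<le> (\<Sum>i<k. (cmod (u j i - u l i))\<^sup>2)" for j l by (rule sum_nonneg) simp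
 have rC: "\<exists>M. \<forall>j\<ge>M. \<forall>l\<ge>M. Re (vinner p (%y. r j y - r l y) (%y. r j y - r l y)) < \<epsilon>" if \<epsilon>: "\<epsilon> > 0" for \<epsilon>
 proof -
  have le: "Re (vinner p (%y. r j y - r l y) (%y. r j y - r l y)) \<le> Re (J_inner D (%t. s j t - s l t) (%t. s j t - s l t))" for j l
   unfolding Jjk using sn[of j l] by simp
  show ?thesis using cauchy[OF \<epsilon>] le by (meson le_less_trans)
 qed
 obtain R where R: "R \<in> L2_imag p" "(%n. Re (vinner p (%y. r n y - R y) (%y. r n y - R y))) \<longlonglongrightarrow> 0"
  using L2_imag_complete[where s = r, OF rL rC] by blast
 have "convergent (%n. u n i)" if i: "i < k" for i
 proof (intro Cauchy_convergent CauchyI)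
  fix \<epsilon> :: real assume \<epsilon>: "0 < \<epsilon>"
  have "0 < 2 * pi * \<epsilon>\<^sup>2" using \<epsilon> by simp
  from cauchy[OF this] obtain M where M: "!!j l. j \<ge> M ==> l \<ge> M ==> Re (J_inner D (%t. s j t - s l t) (%t. s j t - s l t)) < 2 * pi * \<epsilon>\<^sup>2" by blast
  have "norm (u j i - u l i) < \<epsilon>" if "j \<ge> M" "l \<ge> M" for j l
  proof -
   have "(cmod (u j i - u l i))\<^sup>2 \<le> (\<Sum>i<k. (cmod (u j i - u l i))\<^sup>2)"
    by (rule member_le_sum) (use i in auto)
   then have "2 * pi * (cmod (u j i - u l i))\<^sup>2 \<le> 2 * pi * (\<Sum>i<k. (cmod (u j i - u l i))\<^sup>2)" by simp
   also have "\<dots> < 2 * pi * \<epsilon>\<^sup>2" using M[OF that] nn[of j l] unfolding Jjk by linarith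
   finally have "(cmod (u j i - u l i))\<^sup>2 < \<epsilon>\<^sup>2" by simp
   then show ?thesis by (rule power2_less_imp_less) (use \<epsilon> in simp)
  qed
  then show "\<exists>M. \<forall>j\<ge>M. \<forall>l\<ge>M. norm (u j i - u l i) < \<epsilon>" by blast
 qed
 then have "\<exists>c. i < k \<longrightarrow> (%n. u n i) \<longlonglongrightarrow> c" for i unfolding convergent_def by blast
 then obtain c where c: "!!i. i < k ==> (%n. u n i) \<longlonglongrightarrow> c i" by metis
 \<comment> \<open>The vector with the limit coordinates; as all signs are 1, the coefficients are
   the coordinates themselves.\<close>
 define x where "x = lin_comb ?N k v c"
 have xc: "x \<in> carrier_vec ?N" unfolding x_def by simp
 have xu: "(Pick *\<^sub>v x) \<bullet>c v i = c i" if "i < k" for i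
  unfolding x_def using form_orthonormal_coordinate[OF Pick_carrier subset_refl o that, of c] e[OF that] by simp
 define a0 where "a0 = vec_first x nz"
 \<comment> \<open>Undoes the sign with which the second block enters the Pick form.\<close>
 define b0 where "b0 = (- 1) \<cdot>\<^sub>v vec_last x nw"
 have a0: "a0 \<in> carrier_vec nz" and b0: "b0 \<in> carrier_vec nw" unfolding a0_def b0_def by simp_all
 have xw: "w a0 b0 = x" unfolding w_def a0_def b0_def smult_smult_assoc using append_vec_split[OF xc] by simp
 have lim_form: "(%n. (Pick *\<^sub>v w (a n) (b n)) \<bullet>c y) \<longlonglongrightarrow> (Pick *\<^sub>v x) \<bullet>c y" if y: "y \<in> carrier_vec ?N" for y
 proof -
  have 1: "(Pick *\<^sub>v w (a n) (b n)) \<bullet>c y = (\<Sum>i<k. of_real (e i) * u n i * cnj ((Pick *\<^sub>v y) \<bullet>c v i))" for n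
   unfolding u_def by (rule expand[OF wc[OF ac bc] y])
  have 2: "(Pick *\<^sub>v x) \<bullet>c y = (\<Sum>i<k. of_real (e i) * c i * cnj ((Pick *\<^sub>v y) \<bullet>c v i))"
   using expand[OF xc y] by (simp add: xu)
  show ?thesis unfolding 1 2 by (intro tendsto_sum tendsto_mult tendsto_const c) auto
 qed
 \<comment> \<open>Norm convergence of the remainders implies convergence of their pairings, by
   Cauchy-Schwarz.\<close>
 have lim_inner: "(%n. vinner p (r n) H) \<longlonglongrightarrow> vinner p R H" if H: "H \<in> L2_imag p" for H
 proof -
  let ?q = "%n. Re (vinner p (%y. r n y - R y) (%y. r n y - R y)) * Re (vinner p H H)"
  have b: "norm (vinner p (r n) H - vinner p R H) \<le> sqrt (?q n)" for n
  proof -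
   have "(cmod (vinner p (%y. r n y - R y) H))\<^sup>2 \<le> ?q n" by (rule vinner_Cauchy_Schwarz[OF L2_imag_diff[OF rL R(1)] H])
   then show ?thesis unfolding vinner_diff_left[OF rL R(1) H] by (rule real_le_rsqrt)
  qed
  have "(%n. sqrt (?q n)) \<longlonglongrightarrow> sqrt (0 * Re (vinner p H H))"
   by (intro tendsto_intros R(2))
  then have "(%n. sqrt (?q n)) \<longlonglongrightarrow> 0" by simp
  then have "(%n. vinner p (r n) H - vinner p R H) \<longlonglongrightarrow> 0"
   by (rule Lim_null_comparison[rotated]) (simp add: b)
  then show ?thesis by (rule LIM_zero_cancel)
 qed
 have rep0: "perp_rep (%y. R y + gV b0 y + fX a0 y) (%y. gU b0 y + fY a0 y) a0 b0"
 proof (rule perp_rep_of_resid[OF a0 b0 R(1)])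
  show "vinner p R H = 0" if h: "hardy_vec p h H" for h H
  proof -
   have z: "vinner p (r n) H = 0" for n unfolding r_def by (rule perp_rep_resid(2)[OF pr h])
   show ?thesis using lim_inner[OF hardy_vec_L2[OF h]] unfolding z by (simp add: LIMSEQ_const_iff)
  qed
  fix x' :: "complex vec" assume x': "x' \<in> carrier_vec nw"
  have "(%n. vinner p (r n) (gV x')) \<longlonglongrightarrow> - (2 * pi) * ((Pick *\<^sub>v x) \<bullet>c (0\<^sub>v nz @\<^sub>v x'))"
   unfolding r_def perp_rep_resid(3)[OF pr x']
   by (intro tendsto_mult tendsto_const lim_form[unfolded w_def]) (use x' in simp)
  then show "vinner p R (gV x') = - (2 * pi) * ((Pick *\<^sub>v (a0 @\<^sub>v (- 1) \<cdot>\<^sub>v b0)) \<bullet>c (0\<^sub>v nz @\<^sub>v x'))"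
   using LIMSEQ_unique[OF lim_inner[OF f_L2(5)[OF x']]] unfolding xw[symmetric] w_def by blast
 qed
 let ?f = "%y. (R y + gV b0 y + fX a0 y) @\<^sub>v (gU b0 y + fY a0 y)"
 have re: "R y + gV b0 y + fX a0 y - fX a0 y - gV b0 y = R y" for y
  using carrier_vecD[OF L2_imag_carrier[OF R(1)], of y] carrier_vecD[OF L2_imag_carrier[OF f_L2(1)[OF a0]], of y]
   carrier_vecD[OF L2_imag_carrier[OF f_L2(5)[OF b0]], of y]
  by (intro eq_vecI) auto
 have "(%n. 2 * pi * (\<Sum>i<k. (cmod (u n i - c i))\<^sup>2) + Re (vinner p (%y. r n y - R y) (%y. r n y - R y))) \<longlonglongrightarrow>
   2 * pi * (\<Sum>i<k. (cmod (c i - c i))\<^sup>2) + 0"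
  by (intro tendsto_add tendsto_mult tendsto_const tendsto_sum tendsto_power tendsto_norm tendsto_diff c R(2)) auto
 moreover have "Re (J_inner D (%t. s n t - ?f t) (%t. s n t - ?f t)) =
   2 * pi * (\<Sum>i<k. (cmod (u n i - c i))\<^sup>2) + Re (vinner p (%y. r n y - R y) (%y. r n y - R y))" for n
  unfolding Jdiff[OF rep0] re xw using xu by simp
 ultimately have "(%n. Re (J_inner D (%t. s n t - ?f t) (%t. s n t - ?f t))) \<longlonglongrightarrow> 0" by simp
 moreover have "?f \<in> M_perp D" by (rule M_perpI[OF rep0 refl])
 ultimately show ?thesis using that by blast
qed

end

section \<open>Pontryagin spaces modelled on a Hermitian matrix\<close>

lemma append_zero_vec: "0\<^sub>v n @\<^sub>v 0\<^sub>v k = (0\<^sub>v (n + k) :: complex vec)"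
 by (intro eq_vecI) auto

lemma hermitian_form_basis:
 assumes G: "G \<in> carrier_mat n n" and h: "mat_adjoint G = G" and d: "det G \<noteq> 0"
 obtains k v e where "form_orthonormal n G (carrier_vec n) k v e"
  "!!x. x \<in> carrier_vec n ==> x = lin_comb n k v (%i. of_real (e i) * ((G *\<^sub>v x) \<bullet>c v i))"
proof (rule form_orthonormal_basis[OF G h subset_refl zero_carrier_vec])
 show "x + y \<in> carrier_vec n" if "x \<in> carrier_vec n" "y \<in> carrier_vec n" for x y :: "complex vec" using that by simp
 show "c \<cdot>\<^sub>v x \<in> carrier_vec n" if "x \<in> carrier_vec n" for x and c :: complex using that by simp
 fix x assume x: "x \<in> carrier_vec n" and *: "!!y. y \<in> carrier_vec n ==> (G *\<^sub>v x) \<bullet>c y = 0"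
 have "G *\<^sub>v x = 0\<^sub>v n"
 proof (rule vec_eqI_cscalar[OF mult_mat_vec_carrier[OF G x] zero_carrier_vec])
  fix y :: "complex vec" assume y: "y \<in> carrier_vec n"
  show "(G *\<^sub>v x) \<bullet>c y = 0\<^sub>v n \<bullet>c y" using *[OF y] cscalar_prod_sum[OF y, of "0\<^sub>v n"] by simp
 qed
 then show "x = 0\<^sub>v n" using det_0_iff_vec_prod_zero_field[OF G] d x by blast
qed (rule that)

text \<open>Project x onto \<open>T\<close> with an orthonormal basis for the standard inner
  product. The defect x - q is orthogonal to \<open>T\<close>, and as \<open>G\<close> is invertible
  it has the form G v with v annihilating \<open>T\<close>; so v = 0 and x lies in
  \<open>T\<close>.\<close>

lemma subspace_eq_carrier:
 fixes T :: "complex vec set"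
 assumes G: "G \<in> carrier_mat n n" and det: "det G \<noteq> 0" and T: "T \<subseteq> carrier_vec n" "0\<^sub>v n \<in> T"
  and add: "!!x y. x \<in> T ==> y \<in> T ==> x + y \<in> T" and sm: "!!c x. x \<in> T ==> c \<cdot>\<^sub>v x \<in> T"
  and ann: "!!v. v \<in> carrier_vec n ==> (!!t. t \<in> T ==> (G *\<^sub>v v) \<bullet>c t = 0) ==> v = 0\<^sub>v n"
 shows "T = carrier_vec n"
proof
 show "T \<subseteq> carrier_vec n" by (rule T(1))
 show "carrier_vec n \<subseteq> T"
 proof
  fix x :: "complex vec" assume x: "x \<in> carrier_vec n"
  have I: "1\<^sub>m n \<in> carrier_mat n n" "mat_adjoint (1\<^sub>m n :: complex mat) = 1\<^sub>m n" by simp_all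
  have one: "1\<^sub>m n *\<^sub>v u = u" if "u \<in> carrier_vec n" for u :: "complex vec" using that by simp
  have nd: "x = 0\<^sub>v n" if x: "x \<in> T" and *: "!!y. y \<in> T ==> (1\<^sub>m n *\<^sub>v x) \<bullet>c y = 0" for x
  proof -
   have xc: "x \<in> carrier_vec n" using x T by blast
   have "x \<bullet>c x = 0" using *[OF x] unfolding one[OF xc] .
   then show "x = 0\<^sub>v n" using conjugate_square_eq_0_vec[OF xc] by blast
  qed
  obtain k v e where o: "form_orthonormal n (1\<^sub>m n) T k v e"
   and rep: "!!x. x \<in> T ==> x = lin_comb n k v (%i. of_real (e i) * ((1\<^sub>m n *\<^sub>v x) \<bullet>c v i))"
   by (rule form_orthonormal_basis[OF I T]) (rule that add sm nd; assumption)+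
  have vT: "v i \<in> T" if "i < k" for i using o that unfolding form_orthonormal_def by blast
  have vc: "v i \<in> carrier_vec n" if "i < k" for i using vT[OF that] T by blast
  have ee: "complex_of_real (e i) * of_real (e i) = 1" if "i < k" for i
   using o that unfolding form_orthonormal_def by (auto simp flip: of_real_mult)
  define q where "q = lin_comb n k v (%i. of_real (e i) * (x \<bullet>c v i))"
  have qT: "q \<in> T" unfolding q_def by (rule lin_comb_in[OF vT T add sm])
  have qc: "q \<in> carrier_vec n" using qT T by blast
  have d: "(x - q) \<in> carrier_vec n" by (rule minus_carrier_vec[OF x qc])
  have ov: "(x - q) \<bullet>c v i = 0" if i: "i < k" for i
  proof -
   have "q \<bullet>c v i = of_real (e i) * (x \<bullet>c v i) * of_real (e i)"
    using form_orthonormal_coordinate[OF I(1) T(1) o i, of "%i. of_real (e i) * (x \<bullet>c v i)"] unfolding one[OF lin_comb_carrier] q_def .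
   also have "\<dots> = x \<bullet>c v i" using ee[OF i] by (simp add: mult.commute mult.left_commute)
   finally show ?thesis unfolding cscalar_prod_minus_left[OF x qc vc[OF i]] by simp
  qed
  define S where "S = {t \<in> carrier_vec n. (x - q) \<bullet>c t = 0}"
  have S: "v i \<in> S" if "i < k" for i using ov[OF that] vc[OF that] unfolding S_def by simp
  have tS: "t \<in> S" if t: "t \<in> T" for t
  proof -
   have "lin_comb n k v (%i. of_real (e i) * ((1\<^sub>m n *\<^sub>v t) \<bullet>c v i)) \<in> S"
   proof (rule lin_comb_in[OF S])
    show "0\<^sub>v n \<in> S" unfolding S_def using d by simp
    show "y + z \<in> S" if "y \<in> S" "z \<in> S" for y z
     using that cscalar_prod_add_right[OF d, of y z] unfolding S_def by simp
    show "c \<cdot>\<^sub>v y \<in> S" if "y \<in> S" for c y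
     using that cscalar_prod_smult_right[OF d, of y c] unfolding S_def by simp
   qed (auto simp: S_def)
   then show ?thesis unfolding rep[OF t, symmetric] .
  qed
  note Gi = minv_props[OF G det]
  have vv: "minv G *\<^sub>v (x - q) \<in> carrier_vec n" using Gi(1) d by (rule mult_mat_vec_carrier)
  have Gv: "G *\<^sub>v (minv G *\<^sub>v (x - q)) = x - q"
   unfolding assoc_mult_mat_vec[OF G Gi(1) d, symmetric] Gi(2) by (rule one[OF d])
  have "minv G *\<^sub>v (x - q) = 0\<^sub>v n"
   by (rule ann[OF vv]) (use tS in \<open>unfold Gv S_def, blast\<close>)
  moreover have "G *\<^sub>v 0\<^sub>v n = 0\<^sub>v n" using G by (intro eq_vecI) (auto simp: scalar_prod_def)
  ultimately have xq: "x - q = 0\<^sub>v n" using Gv by simp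
  have "x = q"
  proof (rule eq_vecI)
   show "dim_vec x = dim_vec q" using carrier_vecD[OF x] carrier_vecD[OF qc] by simp
   fix i assume "i < dim_vec q"
   then have i: "i < n" using carrier_vecD[OF qc] by simp
   have "x $ i - q $ i = (x - q) $ i" using i carrier_vecD[OF qc] by simp
   then show "x $ i = q $ i" unfolding xq using i by simp
  qed
  then show "x \<in> T" using qT by simp
 qed
qed

text \<open>The space C^n with the form of \<open>G\<close>, realized as functions through an
  injective linear map. The signed basis is a parameter, which gives the positive and negative parts
  explicit coordinates.\<close>

locale gram_model =
 fixes n d :: nat and G :: "complex mat" and \<Phi> :: "complex vec => 'a => complex vec"
  and k :: nat and v :: "nat => complex vec" and e :: "nat => real"
 assumes G: "G \<in> carrier_mat n n" and herm: "mat_adjoint G = G"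
  and o: "form_orthonormal n G (carrier_vec n) k v e"
  and rep: "!!x. x \<in> carrier_vec n ==> x = lin_comb n k v (%i. of_real (e i) * ((G *\<^sub>v x) \<bullet>c v i))"
  and \<Phi>_carrier: "!!x t. x \<in> carrier_vec n ==> \<Phi> x t \<in> carrier_vec d"
  and \<Phi>_add: "!!x y t. x \<in> carrier_vec n ==> y \<in> carrier_vec n ==> \<Phi> (x + y) t = \<Phi> x t + \<Phi> y t"
  and \<Phi>_smult: "!!c x t. x \<in> carrier_vec n ==> \<Phi> (c \<cdot>\<^sub>v x) t = c \<cdot>\<^sub>v \<Phi> x t"
  and \<Phi>_inj: "!!x. x \<in> carrier_vec n ==> (!!t. \<Phi> x t = 0\<^sub>v d) ==> x = 0\<^sub>v n"
begin

definition "model = \<Phi> ` carrier_vec n"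

definition "coord f = (SOME x. x \<in> carrier_vec n \<and> f = \<Phi> x)"

text \<open>The value 0 off the space follows the convention under which
  \<open>is_rk_pontryagin_space\<close> determines the inner product as a total function.\<close>

definition "ip f g = (if f \<in> model \<and> g \<in> model then (G *\<^sub>v coord f) \<bullet>c coord g else 0)"

lemma v: "i < k ==> v i \<in> carrier_vec n" and e: "i < k ==> e i = 1 \<or> e i = - 1"
 using o unfolding form_orthonormal_def by blast+

lemma ee: "i < k ==> complex_of_real (e i) * of_real (e i) = 1"
 using e[of i] by (auto simp flip: of_real_mult)

lemma \<Phi>_minus:
 assumes "x \<in> carrier_vec n" "y \<in> carrier_vec n" shows "\<Phi> (x - y) t = \<Phi> x t - \<Phi> y t"
proof -
 have "x - y = x + (- 1) \<cdot>\<^sub>v y" using carrier_vecD[OF assms(1)] carrier_vecD[OF assms(2)] by (intro eq_vecI) auto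
 then have "\<Phi> (x - y) t = \<Phi> x t + (- 1) \<cdot>\<^sub>v \<Phi> y t"
  using \<Phi>_add[OF assms(1), of "(- 1) \<cdot>\<^sub>v y"] \<Phi>_smult[OF assms(2)] assms(2) by simp
 also have "\<dots> = \<Phi> x t - \<Phi> y t"
  using carrier_vecD[OF \<Phi>_carrier[OF assms(1)], of t] carrier_vecD[OF \<Phi>_carrier[OF assms(2)], of t] by (intro eq_vecI) auto
 finally show ?thesis .
qed

lemma \<Phi>_zero: "\<Phi> (0\<^sub>v n) t = 0\<^sub>v d"
proof -
 have z: "0\<^sub>v n \<in> carrier_vec n" by simp
 have "0 \<cdot>\<^sub>v 0\<^sub>v n = (0\<^sub>v n :: complex vec)" by (intro eq_vecI) auto
 then have "\<Phi> (0\<^sub>v n) t = \<Phi> (0 \<cdot>\<^sub>v 0\<^sub>v n) t" by simp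
 also have "\<dots> = 0 \<cdot>\<^sub>v \<Phi> (0\<^sub>v n) t" by (rule \<Phi>_smult[OF z])
 also have "\<dots> = 0\<^sub>v d" using carrier_vecD[OF \<Phi>_carrier[OF z], of t] by (intro eq_vecI) auto
 finally show ?thesis .
qed

lemma vec_minus_zeroD:
 assumes "x \<in> carrier_vec n" "y \<in> carrier_vec n" "x - y = (0\<^sub>v n :: complex vec)" shows "x = y"
proof (rule eq_vecI)
 fix i assume "i < dim_vec y"
 then have i: "i < n" using carrier_vecD[OF assms(2)] by simp
 have "x $ i - y $ i = (x - y) $ i" using i carrier_vecD[OF assms(2)] by simp
 then show "x $ i = y $ i" unfolding assms(3) using i by simp
qed (use carrier_vecD[OF assms(1)] carrier_vecD[OF assms(2)] in simp)

lemma \<Phi>_inject: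
 assumes x: "x \<in> carrier_vec n" and y: "y \<in> carrier_vec n" and eq: "\<Phi> x = \<Phi> y" shows "x = y"
proof (rule vec_minus_zeroD[OF x y], rule \<Phi>_inj[OF minus_carrier_vec[OF x y]])
 fix t show "\<Phi> (x - y) t = 0\<^sub>v d" unfolding \<Phi>_minus[OF x y] eq
  using carrier_vecD[OF \<Phi>_carrier[OF y], of t] by (intro eq_vecI) auto
qed

lemma coord: "x \<in> carrier_vec n ==> coord (\<Phi> x) = x"
 unfolding coord_def by (rule some_equality) (auto dest: \<Phi>_inject)

lemma ip:
 assumes x: "x \<in> carrier_vec n" and y: "y \<in> carrier_vec n"
 shows "ip (\<Phi> x) (\<Phi> y) = (G *\<^sub>v x) \<bullet>c y"
proof -
 have "\<Phi> x \<in> model" "\<Phi> y \<in> model" unfolding model_def using assms by blast+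
 then show ?thesis unfolding ip_def coord[OF x] coord[OF y] by simp
qed

lemma space_subspace:
 assumes T: "T \<subseteq> carrier_vec n" "0\<^sub>v n \<in> T"
  and add: "!!x y. x \<in> T ==> y \<in> T ==> x + y \<in> T" and sm: "!!c x. x \<in> T ==> c \<cdot>\<^sub>v x \<in> T"
 shows "VectorSpace.subspace class_ring (\<Phi> ` T) (fun_space d)"
proof (rule fun_space_subspaceI)
 show "f t \<in> carrier_vec d" if "f \<in> \<Phi> ` T" for f t using that T(1) \<Phi>_carrier by blast
 show "(%t. 0\<^sub>v d) \<in> \<Phi> ` T" by (rule image_eqI[of _ _ "0\<^sub>v n"]) (use \<Phi>_zero T(2) in auto)
 show "(%t. f t + g t) \<in> \<Phi> ` T" if "f \<in> \<Phi> ` T" "g \<in> \<Phi> ` T" for f g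
 proof -
  obtain x y where xy: "x \<in> T" "y \<in> T" "f = \<Phi> x" "g = \<Phi> y" using \<open>f \<in> \<Phi> ` T\<close> \<open>g \<in> \<Phi> ` T\<close> by blast
  have c: "x \<in> carrier_vec n" "y \<in> carrier_vec n" using xy T(1) by auto
  show ?thesis unfolding xy(3,4) by (rule image_eqI[of _ _ "x + y"]) (auto simp: \<Phi>_add[OF c] add[OF xy(1,2)])
 qed
 show "(%t. c \<cdot>\<^sub>v f t) \<in> \<Phi> ` T" if "f \<in> \<Phi> ` T" for c f
 proof -
  obtain x where x: "x \<in> T" "f = \<Phi> x" using \<open>f \<in> \<Phi> ` T\<close> by blast
  have c: "x \<in> carrier_vec n" using x T(1) by auto
  show ?thesis unfolding x(2) by (rule image_eqI[of _ _ "c \<cdot>\<^sub>v x"]) (auto simp: \<Phi>_smult[OF c] sm[OF x(1)])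
 qed
qed

lemma hermitian:
 assumes T: "T \<subseteq> carrier_vec n" shows "hermitian_form_on (\<Phi> ` T) ip"
 unfolding hermitian_form_on_def
proof (intro conjI ballI allI)
 fix f g assume "f \<in> \<Phi> ` T" "g \<in> \<Phi> ` T"
 then obtain x y where xy: "x \<in> carrier_vec n" "y \<in> carrier_vec n" "f = \<Phi> x" "g = \<Phi> y" using T by blast
 show "ip g f = cnj (ip f g)"
  unfolding xy(3,4) ip[OF xy(1,2)] ip[OF xy(2,1)] by (rule hermitian_form_commute[OF G herm xy(1,2)])
 show "ip (%t. c \<cdot>\<^sub>v f t) g = c * ip f g" for c
 proof -
  have 1: "(%t. c \<cdot>\<^sub>v f t) = \<Phi> (c \<cdot>\<^sub>v x)" unfolding xy(3) using \<Phi>_smult[OF xy(1)] by auto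
  have 2: "c \<cdot>\<^sub>v x \<in> carrier_vec n" using xy(1) by simp
  show ?thesis unfolding 1 unfolding xy(3,4) ip[OF 2 xy(2)] ip[OF xy(1,2)] mult_mat_vec[OF G xy(1)]
   by (rule cscalar_prod_smult_left[OF mult_mat_vec_carrier[OF G xy(1)] xy(2)])
 qed
 fix h assume "h \<in> \<Phi> ` T"
 then obtain z where z: "z \<in> carrier_vec n" "h = \<Phi> z" using T by blast
 have 1: "(%t. f t + g t) = \<Phi> (x + y)" unfolding xy(3,4) using \<Phi>_add[OF xy(1,2)] by auto
 have 2: "x + y \<in> carrier_vec n" using xy(1,2) by simp
 show "ip (%t. f t + g t) h = ip f h + ip g h"
  unfolding 1 unfolding xy(3,4) z(2) ip[OF 2 z(1)] ip[OF xy(1) z(1)] ip[OF xy(2) z(1)] mult_add_distrib_mat_vec[OF G xy(1,2)]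
  by (rule cscalar_prod_add_left[OF mult_mat_vec_carrier[OF G xy(1)] mult_mat_vec_carrier[OF G xy(2)] z(1)])
qed

text \<open>The span of the basis vectors of sign \<open>s\<close>, described by the vanishing of
  the other coordinates; in this form closure under sums and limits is immediate.\<close>

definition "signed s = {x \<in> carrier_vec n. \<forall>i<k. e i \<noteq> s \<longrightarrow> (G *\<^sub>v x) \<bullet>c v i = 0}"

lemma signed_closed:
 "signed s \<subseteq> carrier_vec n" "0\<^sub>v n \<in> signed s"
 "x \<in> signed s ==> y \<in> signed s ==> x + y \<in> signed s" "x \<in> signed s ==> c \<cdot>\<^sub>v x \<in> signed s"
proof -
 show "signed s \<subseteq> carrier_vec n" unfolding signed_def by blast
 have "G *\<^sub>v 0\<^sub>v n = 0\<^sub>v n" using G by (intro eq_vecI) (auto simp: scalar_prod_def)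
 then show "0\<^sub>v n \<in> signed s" unfolding signed_def using v by (auto simp: cscalar_prod_sum)
 show "x + y \<in> signed s" if "x \<in> signed s" "y \<in> signed s"
 proof -
  have c: "x \<in> carrier_vec n" "y \<in> carrier_vec n" using that unfolding signed_def by auto
  have "(G *\<^sub>v (x + y)) \<bullet>c v i = (G *\<^sub>v x) \<bullet>c v i + (G *\<^sub>v y) \<bullet>c v i" if "i < k" for i
   unfolding mult_add_distrib_mat_vec[OF G c]
   by (rule cscalar_prod_add_left[OF mult_mat_vec_carrier[OF G c(1)] mult_mat_vec_carrier[OF G c(2)] v[OF that]])
  then show ?thesis using that c unfolding signed_def by simp
 qed
 show "c \<cdot>\<^sub>v x \<in> signed s" if "x \<in> signed s"
 proof -
  have xc: "x \<in> carrier_vec n" using that unfolding signed_def by auto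
  have "(G *\<^sub>v (c \<cdot>\<^sub>v x)) \<bullet>c v i = c * ((G *\<^sub>v x) \<bullet>c v i)" if "i < k" for i
   unfolding mult_mat_vec[OF G xc] by (rule cscalar_prod_smult_left[OF mult_mat_vec_carrier[OF G xc] v[OF that]])
  then show ?thesis using that xc unfolding signed_def by simp
 qed
qed

lemma expand:
 assumes "x \<in> carrier_vec n" "y \<in> carrier_vec n"
 shows "(G *\<^sub>v x) \<bullet>c y = (\<Sum>i<k. of_real (e i) * ((G *\<^sub>v x) \<bullet>c v i) * cnj ((G *\<^sub>v y) \<bullet>c v i))"
 by (rule form_orthonormal_expand[OF G herm subset_refl o rep assms])

lemma coordinate: "i < k ==> (G *\<^sub>v lin_comb n k v c) \<bullet>c v i = c i * of_real (e i)"
 by (rule form_orthonormal_coordinate[OF G subset_refl o])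

lemma coords_zero:
 assumes x: "x \<in> carrier_vec n" and 0: "!!i. i < k ==> (G *\<^sub>v x) \<bullet>c v i = 0" shows "x = 0\<^sub>v n"
proof -
 have "lin_comb n k v (%i. of_real (e i) * ((G *\<^sub>v x) \<bullet>c v i)) = 0\<^sub>v n"
  using 0 by (intro eq_vecI) (auto simp: lin_comb_def intro!: sum.neutral)
 then show ?thesis using rep[OF x] by simp
qed

lemma signed_form:
 assumes x: "x \<in> signed s"
 shows "Re ((G *\<^sub>v x) \<bullet>c x) = s * (\<Sum>i<k. (cmod ((G *\<^sub>v x) \<bullet>c v i))\<^sup>2)"
proof -
 have xc: "x \<in> carrier_vec n" using x unfolding signed_def by simp
 have "(G *\<^sub>v x) \<bullet>c x = (\<Sum>i<k. of_real (e i) * ((G *\<^sub>v x) \<bullet>c v i) * cnj ((G *\<^sub>v x) \<bullet>c v i))"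
  by (rule expand[OF xc xc])
 also have "\<dots> = (\<Sum>i<k. of_real (s * (cmod ((G *\<^sub>v x) \<bullet>c v i))\<^sup>2))"
 proof (intro sum.cong refl)
  fix i assume "i \<in> {..<k}"
  then have i: "i < k" by simp
  show "of_real (e i) * ((G *\<^sub>v x) \<bullet>c v i) * cnj ((G *\<^sub>v x) \<bullet>c v i) = of_real (s * (cmod ((G *\<^sub>v x) \<bullet>c v i))\<^sup>2)"
  proof (cases "e i = s")
   case True
   then show ?thesis unfolding of_real_mult complex_norm_square by (simp add: mult.assoc)
  next
   case False
   then have "(G *\<^sub>v x) \<bullet>c v i = 0" using x i unfolding signed_def by blast
   then show ?thesis by simp
  qed
 qed
 finally have f: "(G *\<^sub>v x) \<bullet>c x = (\<Sum>i<k. of_real (s * (cmod ((G *\<^sub>v x) \<bullet>c v i))\<^sup>2))" .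
 show ?thesis unfolding f by (simp add: sum_distrib_left)
qed

lemma signed_form_pos:
 assumes x: "x \<in> signed s" and nz: "\<Phi> x \<noteq> (%t. 0\<^sub>v d)"
 shows "0 < (\<Sum>i<k. (cmod ((G *\<^sub>v x) \<bullet>c v i))\<^sup>2)"
proof -
 have xc: "x \<in> carrier_vec n" using x unfolding signed_def by simp
 have "x \<noteq> 0\<^sub>v n" using nz \<Phi>_zero by auto
 then obtain i where i: "i < k" "(G *\<^sub>v x) \<bullet>c v i \<noteq> 0" using coords_zero[OF xc] by blast
 show ?thesis by (rule sum_pos2[of _ i]) (use i in auto)
qed

text \<open>On this part the form is the sum of squared coordinates, so a Cauchy sequence converges
  coordinatewise, and the coordinates of the other sign stay zero in the limit.\<close>

lemma positive_part_hilbert: "hilbert_space d {%t. 0\<^sub>v d} (\<Phi> ` signed 1) ip"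
 unfolding hilbert_space_def
proof (intro conjI ballI allI impI)
 show "VectorSpace.subspace class_ring (\<Phi> ` signed 1) (fun_space d)" by (rule space_subspace[OF signed_closed])
 show "hermitian_form_on (\<Phi> ` signed 1) ip" by (rule hermitian[OF signed_closed(1)])
 show "0 < Re (ip f f)" if f: "f \<in> \<Phi> ` signed 1" and nf: "f \<notin> {%t. 0\<^sub>v d}" for f
 proof -
  obtain x where x: "x \<in> signed 1" "f = \<Phi> x" using f by blast
  have xc: "x \<in> carrier_vec n" using x(1) unfolding signed_def by simp
  show ?thesis unfolding x(2) ip[OF xc xc] signed_form[OF x(1)] using signed_form_pos[OF x(1)] nf x(2) by simp
 qed
 fix s :: "nat => 'a => complex vec" assume *: "(\<forall>j. s j \<in> \<Phi> ` signed 1) \<and> (\<forall>\<epsilon>>0. \<exists>M. \<forall>j\<ge>M. \<forall>l\<ge>M. Re (ip (%t. s j t - s l t) (%t. s j t - s l t)) < \<epsilon>)"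
 then have "\<exists>x. x \<in> signed 1 \<and> s j = \<Phi> x" for j by blast
 then obtain x where x: "!!j. x j \<in> signed 1" and sx: "!!j. s j = \<Phi> (x j)" by metis
 have xc: "x j \<in> carrier_vec n" for j using x[of j] unfolding signed_def by simp
 define u where "u = (%j i. (G *\<^sub>v x j) \<bullet>c v i)"
 have d: "Re (ip (%t. s j t - \<Phi> y t) (%t. s j t - \<Phi> y t)) = (\<Sum>i<k. (cmod (u j i - (G *\<^sub>v y) \<bullet>c v i))\<^sup>2)" if y: "y \<in> signed 1" for j y
 proof -
  have yc: "y \<in> carrier_vec n" using y unfolding signed_def by simp
  have "x j - y = x j + (- 1) \<cdot>\<^sub>v y" using carrier_vecD[OF xc] carrier_vecD[OF yc] by (intro eq_vecI) auto
  then have dS: "x j - y \<in> signed 1" using signed_closed(3)[OF x signed_closed(4)[OF y]] by simp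
  have dc: "x j - y \<in> carrier_vec n" by (rule minus_carrier_vec[OF xc yc])
  have "(%t. s j t - \<Phi> y t) = \<Phi> (x j - y)" unfolding sx using \<Phi>_minus[OF xc yc] by auto
  moreover have "(G *\<^sub>v (x j - y)) \<bullet>c v i = u j i - (G *\<^sub>v y) \<bullet>c v i" if "i < k" for i
   unfolding u_def mult_minus_distrib_mat_vec[OF G xc yc]
   by (rule cscalar_prod_minus_left[OF mult_mat_vec_carrier[OF G xc] mult_mat_vec_carrier[OF G yc] v[OF that]])
  ultimately show ?thesis using signed_form[OF dS] by (simp add: ip[OF dc dc])
 qed
 have "convergent (%j. u j i)" if i: "i < k" for i
 proof (intro Cauchy_convergent CauchyI)
  fix \<epsilon> :: real assume \<epsilon>: "0 < \<epsilon>"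
  then have "0 < \<epsilon>\<^sup>2" by simp
  then obtain M where M: "!!j l. j \<ge> M ==> l \<ge> M ==> Re (ip (%t. s j t - s l t) (%t. s j t - s l t)) < \<epsilon>\<^sup>2" using * by blast
  have "norm (u j i - u l i) < \<epsilon>" if "j \<ge> M" "l \<ge> M" for j l
  proof -
   have "(cmod (u j i - u l i))\<^sup>2 \<le> (\<Sum>i<k. (cmod (u j i - u l i))\<^sup>2)"
    by (rule member_le_sum) (use i in auto)
   also have "\<dots> = Re (ip (%t. s j t - s l t) (%t. s j t - s l t))" using d[OF x[of l], of j] unfolding sx[of l] u_def by simp
   also have "\<dots> < \<epsilon>\<^sup>2" by (rule M[OF that])
   finally show ?thesis by (rule power2_less_imp_less) (use \<epsilon> in simp)
  qed
  then show "\<exists>M. \<forall>j\<ge>M. \<forall>l\<ge>M. norm (u j i - u l i) < \<epsilon>" by blast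
 qed
 then have "\<exists>c. i < k \<longrightarrow> (%j. u j i) \<longlonglongrightarrow> c" for i unfolding convergent_def by blast
 then obtain c where c: "!!i. i < k ==> (%j. u j i) \<longlonglongrightarrow> c i" by metis
 \<comment> \<open>Reading off a coordinate of a linear combination multiplies the coefficient by e
   i, so e i is inserted to get c i back.\<close>
 define y where "y = lin_comb n k v (%i. of_real (e i) * c i)"
 have yu: "(G *\<^sub>v y) \<bullet>c v i = c i" if "i < k" for i
  unfolding y_def coordinate[OF that] using ee[OF that] by (simp add: mult.commute mult.left_commute)
 have yS: "y \<in> signed 1"
  unfolding signed_def
 proof (intro CollectI conjI allI impI)
  show "y \<in> carrier_vec n" by (simp add: y_def)
  fix i assume i: "i < k" "e i \<noteq> 1"
  have "u j i = 0" for j using x[of j] i unfolding signed_def u_def by blast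
  then show "(G *\<^sub>v y) \<bullet>c v i = 0" using c[OF i(1)] yu[OF i(1)] by (simp add: LIMSEQ_const_iff)
 qed
 have "(%j. \<Sum>i<k. (cmod (u j i - c i))\<^sup>2) \<longlonglongrightarrow> (\<Sum>i<k. (cmod (c i - c i))\<^sup>2)"
  by (intro tendsto_sum tendsto_power tendsto_norm tendsto_diff tendsto_const c) auto
 moreover have "Re (ip (%t. s j t - \<Phi> y t) (%t. s j t - \<Phi> y t)) = (\<Sum>i<k. (cmod (u j i - c i))\<^sup>2)" for j
  unfolding d[OF yS] using yu by simp
 ultimately have "(%j. Re (ip (%t. s j t - \<Phi> y t) (%t. s j t - \<Phi> y t))) \<longlonglongrightarrow> 0" by simp
 then show "\<exists>f\<in>\<Phi> ` signed 1. (%j. Re (ip (%t. s j t - f t) (%t. s j t - f t))) \<longlonglongrightarrow> 0" using yS by blast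
qed

text \<open>A basis vector of sign -1 would give a nonzero element of negative square; with all
  signs 1 the positive part is everything.\<close>

lemma hilbert_iff: "hilbert_space d {%t. 0\<^sub>v d} model ip \<longleftrightarrow> positive_definite_mat G"
proof -
 have signs: "positive_definite_mat G \<longleftrightarrow> (\<forall>i<k. e i = 1)" by (rule positive_definite_iff_signs[OF G herm o rep])
 show ?thesis
 proof
  assume h: "hilbert_space d {%t. 0\<^sub>v d} model ip"
  have "e i = 1" if i: "i < k" for i
  proof -
   have vi: "(G *\<^sub>v v i) \<bullet>c v i = of_real (e i)" using o i unfolding form_orthonormal_def by auto
   have "\<Phi> (v i) \<noteq> (%t. 0\<^sub>v d)"
   proof
    assume "\<Phi> (v i) = (%t. 0\<^sub>v d)"
    then have "v i = 0\<^sub>v n" by (intro \<Phi>_inj[OF v[OF i]]) simp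
    then have "(G *\<^sub>v v i) \<bullet>c v i = 0" unfolding cscalar_prod_sum[OF v[OF i]] by simp
    then show False using vi e[OF i] by auto
   qed
   then have "0 < Re (ip (\<Phi> (v i)) (\<Phi> (v i)))" using h v[OF i] unfolding hilbert_space_def model_def by blast
   then show ?thesis unfolding ip[OF v[OF i] v[OF i]] vi using e[OF i] by auto
  qed
  then show "positive_definite_mat G" using signs by blast
 next
  assume "positive_definite_mat G"
  then have "signed 1 = carrier_vec n" unfolding signs signed_def by auto
  then show "hilbert_space d {%t. 0\<^sub>v d} model ip" using positive_part_hilbert unfolding model_def by simp
 qed
qed

lemma negative_part_fin_dim:
 "VectorSpace.vectorspace.fin_dim class_ring ((fun_space d)\<lparr>carrier := \<Phi> ` signed (- 1)\<rparr>)"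
proof -
 let ?Q = "\<Phi> ` signed (- 1)"
 let ?V = "(fun_space d)\<lparr>carrier := ?Q\<rparr>"
 have sub: "VectorSpace.subspace class_ring ?Q (fun_space d)" by (rule space_subspace[OF signed_closed])
 interpret V: vectorspace class_ring ?V
  by (rule vectorspace.subspace_is_vs[OF subspace.vs[OF sub] sub])
 \<comment> \<open>Vectors of the wrong sign are replaced by zero, so that linear combinations keep
   their index range.\<close>
 define v' where "v' = (%i. if e i = - 1 then v i else 0\<^sub>v n)"
 let ?B = "(%i. \<Phi> (v' i)) ` {..<k}"
 have v'S: "v' i \<in> signed (- 1)" if i: "i < k" for i
 proof (cases "e i = - 1")
  case True
  have "(G *\<^sub>v v i) \<bullet>c v j = 0" if "j < k" "e j \<noteq> - 1" for j
   using o i that True unfolding form_orthonormal_def by auto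
  then show ?thesis using True v[OF i] unfolding v'_def signed_def by simp
 next
  case False
  then show ?thesis using signed_closed(2)[of "- 1"] unfolding v'_def by simp
 qed
 have B: "?B \<subseteq> carrier ?V" using v'S by auto
 have sm: "submodule class_ring (V.span ?B) ?V" by (rule V.span_is_submodule[OF B])
 have in_span: "?B \<subseteq> V.span ?B" by (rule V.in_own_span[OF B])
 \<comment> \<open>The preimage of the span under \<open>\<Phi>\<close>; being closed under linear
   combinations, it receives every vector of the negative part.\<close>
 define T where "T = {x \<in> carrier_vec n. \<Phi> x \<in> V.span ?B}"
 have "\<Phi> x \<in> V.span ?B" if x: "x \<in> signed (- 1)" for x
 proof -
  have xc: "x \<in> carrier_vec n" using x unfolding signed_def by simp
  let ?c = "%i. of_real (e i) * ((G *\<^sub>v x) \<bullet>c v i)"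
  have "lin_comb n k v ?c = lin_comb n k v' ?c"
   unfolding lin_comb_def
  proof (intro eq_vecI, unfold dim_vec)
   fix l assume l: "l < n"
   have t: "?c i * v i $ l = ?c i * v' i $ l" if "i < k" for i
    using x that unfolding signed_def v'_def by (cases "e i = - 1") auto
   have "(\<Sum>i<k. ?c i * v i $ l) = (\<Sum>i<k. ?c i * v' i $ l)" by (rule sum.cong[OF refl], rule t, simp)
   then show "vec n (%l. \<Sum>i<k. ?c i * v i $ l) $ l = vec n (%l. \<Sum>i<k. ?c i * v' i $ l) $ l" using l by simp
  qed simp
  moreover have "lin_comb n k v' ?c \<in> T"
  proof (rule lin_comb_in)
   show "v' i \<in> T" if "i < k" for i using v'S[OF that] in_span that signed_closed(1)[of "- 1"] unfolding T_def by blast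
   show "T \<subseteq> carrier_vec n" unfolding T_def by blast
   have "(%t. 0\<^sub>v d) = \<Phi> (0\<^sub>v n)" using \<Phi>_zero by auto
   then show "0\<^sub>v n \<in> T" using submodule.zero_closed[OF sm] unfolding T_def by (simp add: fun_space_def)
   show "a + b \<in> T" if "a \<in> T" "b \<in> T" for a b
   proof -
    have c: "a \<in> carrier_vec n" "b \<in> carrier_vec n" and s: "\<Phi> a \<in> V.span ?B" "\<Phi> b \<in> V.span ?B" using that unfolding T_def by auto
    have "\<Phi> (a + b) = (%t. \<Phi> a t + \<Phi> b t)" using \<Phi>_add[OF c] by auto
    then show ?thesis using submodule.m_closed[OF sm s] c unfolding T_def by (simp add: fun_space_def)
   qed
   show "z \<cdot>\<^sub>v a \<in> T" if "a \<in> T" for z a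
   proof -
    have c: "a \<in> carrier_vec n" and s: "\<Phi> a \<in> V.span ?B" using that unfolding T_def by auto
    have "\<Phi> (z \<cdot>\<^sub>v a) = (%t. z \<cdot>\<^sub>v \<Phi> a t)" using \<Phi>_smult[OF c] by auto
    then show ?thesis using submodule.smult_closed[OF sm _ s, of z] c unfolding T_def by (simp add: fun_space_def class_ring_simps)
   qed
  qed
  ultimately have "lin_comb n k v ?c \<in> T" by simp
  then have "x \<in> T" using arg_cong[OF rep[OF xc], of "%y. y \<in> T"] by blast
  then show ?thesis unfolding T_def by simp
 qed
 then have "?Q \<subseteq> V.span ?B" by blast
 moreover have "V.span ?B \<subseteq> ?Q" using submodule.subset[OF sm] by simp
 ultimately have "V.span ?B = carrier ?V" by simp
 then show ?thesis unfolding V.fin_dim_def using B by (intro exI[of _ ?B]) auto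
qed

lemma pontryagin: "pontryagin_space d model ip"
 unfolding pontryagin_space_def
proof (intro conjI exI)
 have cl: "x + y \<in> carrier_vec n" "c \<cdot>\<^sub>v x \<in> carrier_vec n" if "x \<in> carrier_vec n" "y \<in> carrier_vec n" for x y :: "complex vec" and c
  using that by auto
 show "VectorSpace.subspace class_ring model (fun_space d)" unfolding model_def
  by (rule space_subspace) auto
 show "hermitian_form_on model ip" unfolding model_def by (rule hermitian) simp
 show "hilbert_space d {%t. 0\<^sub>v d} (\<Phi> ` signed 1) ip" by (rule positive_part_hilbert)
 show "VectorSpace.subspace class_ring (\<Phi> ` signed (- 1)) (fun_space d)" by (rule space_subspace[OF signed_closed])
 show "VectorSpace.vectorspace.fin_dim class_ring ((fun_space d)\<lparr>carrier := \<Phi> ` signed (- 1)\<rparr>)" by (rule negative_part_fin_dim)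
 show "\<forall>g\<in>\<Phi> ` signed (- 1). g \<noteq> (%t. 0\<^sub>v d) \<longrightarrow> Re (ip g g) < 0"
 proof (intro ballI impI)
  fix g assume "g \<in> \<Phi> ` signed (- 1)" and nz: "g \<noteq> (%t. 0\<^sub>v d)"
  then obtain x where x: "x \<in> signed (- 1)" "g = \<Phi> x" by blast
  have xc: "x \<in> carrier_vec n" using x(1) unfolding signed_def by simp
  show "Re (ip g g) < 0" unfolding x(2) ip[OF xc xc] signed_form[OF x(1)] using signed_form_pos[OF x(1)] nz x(2) by simp
 qed
 show "\<forall>f\<in>\<Phi> ` signed 1. \<forall>g\<in>\<Phi> ` signed (- 1). ip f g = 0"
 proof (intro ballI)
  fix f g assume "f \<in> \<Phi> ` signed 1" "g \<in> \<Phi> ` signed (- 1)"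
  then obtain x y where x: "x \<in> signed 1" "f = \<Phi> x" and y: "y \<in> signed (- 1)" "g = \<Phi> y" by blast
  have c: "x \<in> carrier_vec n" "y \<in> carrier_vec n" using x y unfolding signed_def by auto
  have t: "of_real (e i) * ((G *\<^sub>v x) \<bullet>c v i) * cnj ((G *\<^sub>v y) \<bullet>c v i) = 0" if "i < k" for i
   using x(1) y(1) that unfolding signed_def by (cases "e i = 1") auto
  then show "ip f g = 0" unfolding x(2) y(2) ip[OF c] expand[OF c] by (intro sum.neutral ballI t) simp
 qed
 show "model = {%t. f t + g t | f g. f \<in> \<Phi> ` signed 1 \<and> g \<in> \<Phi> ` signed (- 1)}"
 proof (rule subset_antisym; rule subsetI)
  fix h assume "h \<in> model"
  then obtain x where x: "x \<in> carrier_vec n" "h = \<Phi> x" unfolding model_def by blast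
  \<comment> \<open>The expansion in the basis is split by the sign of e i.\<close>
  let ?c = "%s i. if e i = s then of_real (e i) * ((G *\<^sub>v x) \<bullet>c v i) else 0"
  let ?x = "%s. lin_comb n k v (?c s)"
  have S: "?x s \<in> signed s" for s unfolding signed_def using coordinate by simp
  have "lin_comb n k v (%i. of_real (e i) * ((G *\<^sub>v x) \<bullet>c v i)) = ?x 1 + ?x (- 1)"
  proof (rule eq_vecI)
   fix l assume "l < dim_vec (?x 1 + ?x (- 1))"
   then have l: "l < n" by (simp add: lin_comb_def)
   have "of_real (e i) * ((G *\<^sub>v x) \<bullet>c v i) * v i $ l = ?c 1 i * v i $ l + ?c (- 1) i * v i $ l" if "i < k" for i
    using e[OF that] by auto
   then show "lin_comb n k v (%i. of_real (e i) * ((G *\<^sub>v x) \<bullet>c v i)) $ l = (?x 1 + ?x (- 1)) $ l"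
    using l by (simp add: lin_comb_def sum.distrib)
  qed (simp add: lin_comb_def)
  then have "x = ?x 1 + ?x (- 1)" using rep[OF x(1)] by simp
  then have "h = (%t. \<Phi> (?x 1) t + \<Phi> (?x (- 1)) t)" unfolding x(2) using \<Phi>_add[of "?x 1" "?x (- 1)"] by auto
  then show "h \<in> {%t. f t + g t | f g. f \<in> \<Phi> ` signed 1 \<and> g \<in> \<Phi> ` signed (- 1)}" using S by blast
 next
  fix h assume "h \<in> {%t. f t + g t | f g. f \<in> \<Phi> ` signed 1 \<and> g \<in> \<Phi> ` signed (- 1)}"
  then obtain x y where xy: "x \<in> signed 1" "y \<in> signed (- 1)" and h: "h = (%t. \<Phi> x t + \<Phi> y t)" by blast
  have c: "x \<in> carrier_vec n" "y \<in> carrier_vec n" using xy unfolding signed_def by auto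
  have "h = \<Phi> (x + y)" unfolding h using \<Phi>_add[OF c] by auto
  then show "h \<in> model" unfolding model_def using c by simp
 qed
qed

end

section \<open>Positivity of the Pick matrix and of the orthogonal complement\<close>

context btoa
begin

text \<open>Forwards, the J-form is 2\<pi> times the Pick form at (a, -b) plus the square norm of
  the remainder, and it vanishes only if both do. Backwards, nonnegativity of the Pick form is
  enough, because at a basis vector its value is 1 or -1.\<close>

theorem positive_definite_iff_M_perp_hilbert:
 assumes det: "det Pick \<noteq> 0"
 shows "positive_definite_mat Pick \<longleftrightarrow>
  hilbert_space (p + m) {F. AE y in lborel. F y = 0\<^sub>v (p + m)} (M_perp D) (J_inner D)"
proof -
 let ?N = "nz + nw" and ?null = "{F. AE y in lborel. F y = 0\<^sub>v (p + m)}"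
 obtain k v e where o: "form_orthonormal ?N Pick (carrier_vec ?N) k v e"
  and rep: "!!x. x \<in> carrier_vec ?N ==> x = lin_comb ?N k v (%i. of_real (e i) * ((Pick *\<^sub>v x) \<bullet>c v i))"
  using hermitian_form_basis[OF Pick_carrier Pick_hermitian det] by metis
 have signs: "positive_definite_mat Pick \<longleftrightarrow> (\<forall>i<k. e i = 1)"
  by (rule positive_definite_iff_signs[OF Pick_carrier Pick_hermitian o rep])
 have dP: "dim_row Pick = ?N" using Pick_carrier by (rule carrier_matD)
 show ?thesis
 proof
  assume pd: "positive_definite_mat Pick"
  have e: "e i = 1" if "i < k" for i using signs pd that by blast
  have pos: "0 < Re ((Pick *\<^sub>v x) \<bullet>c x)" if "x \<in> carrier_vec ?N" "x \<noteq> 0\<^sub>v ?N" for x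
   using pd that unfolding positive_definite_mat_def dP by blast
  show "hilbert_space (p + m) ?null (M_perp D) (J_inner D)"
   unfolding hilbert_space_def hermitian_form_on_def
  proof (intro conjI ballI allI impI)
   \<comment> \<open>The zero function arises from zero coordinates and zero remainder.\<close>
   have z: "(%y. 0\<^sub>v (p + m)) \<in> M_perp D"
   proof -
    have u0: "gU (0\<^sub>v nw) y = 0\<^sub>v m" "gV (0\<^sub>v nw) y = 0\<^sub>v p" "fX (0\<^sub>v nz) y = 0\<^sub>v p" "fY (0\<^sub>v nz) y = 0\<^sub>v m" for y
     using rfun_zero_vec[OF dims(4,6) axis_notin(1)] rfun_zero_vec[OF dims(5,6) axis_notin(1)]
      rfun_zero_vec[OF adj_dims(2) uminus_Zs(1) axis_notin(2)] rfun_zero_vec[OF adj_dims(3) uminus_Zs(1) axis_notin(2)] .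
    have P0: "(Pick *\<^sub>v (0\<^sub>v nz @\<^sub>v (- 1) \<cdot>\<^sub>v 0\<^sub>v nw)) \<bullet>c y = 0" if "y \<in> carrier_vec ?N" for y
    proof -
     have "0\<^sub>v nz @\<^sub>v (- 1) \<cdot>\<^sub>v 0\<^sub>v nw = (0\<^sub>v ?N :: complex vec)" by (intro eq_vecI) auto
     moreover have "Pick *\<^sub>v 0\<^sub>v ?N = 0\<^sub>v ?N" using dP carrier_matD(2)[OF Pick_carrier] by (intro eq_vecI) (auto simp: scalar_prod_def)
     ultimately show ?thesis unfolding cscalar_prod_sum[OF that] by simp
    qed
    have v0: "vinner p (%y. 0\<^sub>v p) E = 0" for E unfolding vinner_def inner2_def by simp
    have "perp_rep (%y. 0\<^sub>v p + gV (0\<^sub>v nw) y + fX (0\<^sub>v nz) y) (%y. gU (0\<^sub>v nw) y + fY (0\<^sub>v nz) y) (0\<^sub>v nz) (0\<^sub>v nw)"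
    proof (rule perp_rep_of_resid[OF zero_carrier_vec zero_carrier_vec L2_imag_zero])
     show "vinner p (%y. 0\<^sub>v p) H = 0" for H by (rule v0)
     show "vinner p (%y. 0\<^sub>v p) (gV x) = - (2 * pi) * ((Pick *\<^sub>v (0\<^sub>v nz @\<^sub>v (- 1) \<cdot>\<^sub>v 0\<^sub>v nw)) \<bullet>c (0\<^sub>v nz @\<^sub>v x))"
      if "x \<in> carrier_vec nw" for x
      using P0[of "0\<^sub>v nz @\<^sub>v x"] that unfolding v0 by simp
    qed
    from M_perpI[OF this refl] show ?thesis
     unfolding u0 by (simp add: append_zero_vec)
   qed
   show "VectorSpace.subspace class_ring (M_perp D) (fun_space (p + m))"
   proof (rule fun_space_subspaceI)
    show "f t \<in> carrier_vec (p + m)" if "f \<in> M_perp D" for f t using L2_imag_carrier[OF M_perp_L2[OF that]] .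
   qed (rule z M_perp_closed; assumption?)+
   show "J_inner D (%t. f t + g t) h = J_inner D f h + J_inner D g h" if "f \<in> M_perp D" "g \<in> M_perp D" "h \<in> M_perp D" for f g h
    by (rule J_inner_linear(1)[OF that[THEN M_perp_L2]])
   show "J_inner D (%t. c \<cdot>\<^sub>v f t) h = c * J_inner D f h" if "f \<in> M_perp D" "h \<in> M_perp D" for c f h
    by (rule J_inner_linear(2)[OF that(1)[THEN M_perp_L2] that(1)[THEN M_perp_L2] that(2)[THEN M_perp_L2]])
   show "J_inner D g f = cnj (J_inner D f g)" if "f \<in> M_perp D" "g \<in> M_perp D" for f g
    by (rule J_inner_linear(3)[OF that[THEN M_perp_L2] that(1)[THEN M_perp_L2]])
   show "0 < Re (J_inner D F F)" if F: "F \<in> M_perp D" and nF: "F \<notin> ?null" for F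
   proof -
    obtain F1 F2 a b where F': "F = (%y. F1 y @\<^sub>v F2 y)" and r: "perp_rep F1 F2 a b" using M_perp_rep[OF F] by metis
    note f = perp_repD[OF r]
    let ?w = "a @\<^sub>v (- 1) \<cdot>\<^sub>v b" and ?r = "%y. F1 y - fX a y - gV b y"
    have wc: "?w \<in> carrier_vec ?N" using f(3,4) by simp
    have J: "Re (J_inner D F F) = 2 * pi * Re ((Pick *\<^sub>v ?w) \<bullet>c ?w) + Re (vinner p ?r ?r)"
     unfolding F' perp_rep_form[OF r] by simp
    have rn: "0 \<le> Re (vinner p ?r ?r)" by (rule vinner_self_nonneg(1)[OF perp_rep_resid(1)[OF r]])
    show ?thesis
    proof (cases "?w = 0\<^sub>v ?N")
     case False
     then have "0 < 2 * pi * Re ((Pick *\<^sub>v ?w) \<bullet>c ?w)" using pos[OF wc] by simp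
     then show ?thesis unfolding J using rn by linarith
    next
     case True
     have a0: "a = 0\<^sub>v nz"
     proof (rule eq_vecI)
      fix i assume "i < dim_vec (0\<^sub>v nz :: complex vec)"
      then have i: "i < nz" by simp
      have "a $ i = ?w $ i" using append_vec_nth(1)[OF f(3) smult_carrier_vec[THEN iffD2, OF f(4)] i] by simp
      then show "a $ i = 0\<^sub>v nz $ i" unfolding True using i by simp
     qed (use carrier_vecD[OF f(3)] in simp)
     have b0: "b = 0\<^sub>v nw"
     proof (rule eq_vecI)
      fix i assume "i < dim_vec (0\<^sub>v nw :: complex vec)"
      then have i: "i < nw" by simp
      have "((- 1) \<cdot>\<^sub>v b) $ i = ?w $ (nz + i)" using append_vec_nth(2)[OF f(3) smult_carrier_vec[THEN iffD2, OF f(4)] i] by simp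
      then show "b $ i = 0\<^sub>v nw $ i" unfolding True using i carrier_vecD[OF f(4)] by simp
     qed (use carrier_vecD[OF f(4)] in simp)
     have u0: "gU (0\<^sub>v nw) y = 0\<^sub>v m" "gV (0\<^sub>v nw) y = 0\<^sub>v p" "fX (0\<^sub>v nz) y = 0\<^sub>v p" "fY (0\<^sub>v nz) y = 0\<^sub>v m" for y
      using rfun_zero_vec[OF dims(4,6) axis_notin(1)] rfun_zero_vec[OF dims(5,6) axis_notin(1)]
       rfun_zero_vec[OF adj_dims(2) uminus_Zs(1) axis_notin(2)] rfun_zero_vec[OF adj_dims(3) uminus_Zs(1) axis_notin(2)] .
     have r1: "?r = F1"
     proof
      fix y show "?r y = F1 y" unfolding a0 b0 u0 using carrier_vecD[OF L2_imag_carrier[OF f(1)], of y] by (intro eq_vecI) auto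
     qed
     \<comment> \<open>With a = 0 and b = 0 the second component vanishes almost everywhere, so the
       first cannot; it equals the remainder.\<close>
     have "Re (vinner p F1 F1) \<noteq> 0"
     proof
      assume "Re (vinner p F1 F1) = 0"
      then have "AE y in lborel. F1 y = 0\<^sub>v p" by (rule vinner_self_eq_0[OF f(1)])
      then have "AE y in lborel. F y = 0\<^sub>v (p + m)" using f(5)
      proof eventually_elim
       case (elim y)
       show ?case unfolding F' elim a0 b0 u0 by (intro eq_vecI) auto
      qed
      then show False using nF by simp
     qed
     moreover have "(Pick *\<^sub>v ?w) \<bullet>c ?w = 0" unfolding True cscalar_prod_sum[OF zero_carrier_vec] by simp
     ultimately show ?thesis using rn unfolding J r1 by simp
    qed
   qed
   show "\<exists>f\<in>M_perp D. (%n. Re (J_inner D (%t. s n t - f t) (%t. s n t - f t))) \<longlonglongrightarrow> 0"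
    if H: "(\<forall>n. s n \<in> M_perp D) \<and> (\<forall>e>0. \<exists>M. \<forall>j\<ge>M. \<forall>k\<ge>M. Re (J_inner D (%t. s j t - s k t) (%t. s j t - s k t)) < e)" for s
   proof (rule M_perp_complete[OF o, where s = s])
    show "x = lin_comb ?N k v (%i. of_real (e i) * ((Pick *\<^sub>v x) \<bullet>c v i))" if "x \<in> carrier_vec ?N" for x by (rule rep[OF that])
    show "e i = 1" if "i < k" for i by (rule e[OF that])
    show "s n \<in> M_perp D" for n by (rule conjunct1[OF H, THEN spec])
    show "\<exists>M. \<forall>j\<ge>M. \<forall>k\<ge>M. Re (J_inner D (%t. s j t - s k t) (%t. s j t - s k t)) < \<epsilon>" if "\<epsilon> > 0" for \<epsilon>
     by (rule conjunct2[OF H, THEN spec, THEN mp, OF that])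
    fix f assume fM: "f \<in> M_perp D" and lim: "(%n. Re (J_inner D (%t. s n t - f t) (%t. s n t - f t))) \<longlonglongrightarrow> 0"
    show "\<exists>f\<in>M_perp D. (%n. Re (J_inner D (%t. s n t - f t) (%t. s n t - f t))) \<longlonglongrightarrow> 0"
     by (rule bexI[of _ f]) (rule lim, rule fM)
   qed
  qed
 next
  assume hs: "hilbert_space (p + m) ?null (M_perp D) (J_inner D)"
  have P: "\<forall>f\<in>M_perp D. f \<notin> ?null \<longrightarrow> 0 < Re (J_inner D f f)"
   using hs unfolding hilbert_space_def by (elim conjE)
  \<comment> \<open>Strict positivity says nothing about null functions; on these the form is
    0.\<close>
  have nn: "0 \<le> Re (J_inner D F F)" if F: "F \<in> M_perp D" for F
  proof (cases "F \<in> ?null")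
   case True
   then show ?thesis using M_perp_null[of F] by simp
  next
   case False
   show ?thesis by (rule less_imp_le[OF mp[OF bspec[OF P F] False]])
  qed
  have "e i = 1" if i: "i < k" for i
  proof -
   have vi: "v i \<in> carrier_vec ?N" "e i = 1 \<or> e i = - 1" "(Pick *\<^sub>v v i) \<bullet>c v i = of_real (e i)"
    using o i unfolding form_orthonormal_def by auto
   define y where "y = (- 1) \<cdot>\<^sub>v vec_last (v i) nw"
   have y: "y \<in> carrier_vec nw" unfolding y_def by simp
   have eq: "vec_first (v i) nz @\<^sub>v (- 1) \<cdot>\<^sub>v y = v i"
    unfolding y_def smult_smult_assoc using append_vec_split[OF vi(1)] by simp
   have "0 \<le> Re ((Pick *\<^sub>v (vec_first (v i) nz @\<^sub>v (- 1) \<cdot>\<^sub>v y)) \<bullet>c (vec_first (v i) nz @\<^sub>v (- 1) \<cdot>\<^sub>v y))"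
    by (rule Pick_nonneg[OF _ vec_first_carrier y]) (rule nn)
   then have "0 \<le> Re ((Pick *\<^sub>v v i) \<bullet>c v i)" unfolding eq .
   then show ?thesis using vi(2) unfolding vi(3) by auto
  qed
  then show "positive_definite_mat Pick" unfolding signs by blast
 qed
qed

end

section \<open>Uniqueness of the reproducing kernel space\<close>

text \<open>The assumption on the kernel says that evaluation at w in direction y is represented,
  with respect to \<open>G\<close>, by the vector whose image is the kernel function.\<close>

locale gram_rk = gram_model n d G \<Phi> k v e
 for n d :: nat and G :: "complex mat" and \<Phi> :: "complex vec => complex => complex vec"
  and k :: nat and v :: "nat => complex vec" and e :: "nat => real" +
 fixes \<Omega> :: "complex set" and K :: "complex => complex => complex mat"
 assumes det: "det G \<noteq> 0"
  and off: "!!x z. x \<in> carrier_vec n ==> z \<notin> \<Omega> ==> \<Phi> x z = 0\<^sub>v d"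
  and kernel: "!!w y. w \<in> \<Omega> ==> y \<in> carrier_vec d ==>
   \<exists>x\<in>carrier_vec n. (%z. if z \<in> \<Omega> then K z w *\<^sub>v y else 0\<^sub>v d) = \<Phi> x \<and>
    (\<forall>x'\<in>carrier_vec n. (G *\<^sub>v x') \<bullet>c x = \<Phi> x' w \<bullet>c y)"
begin

lemma zero_of_products:
 assumes f: "f \<in> carrier_vec d" and 0: "!!y. y \<in> carrier_vec d ==> f \<bullet>c y = 0"
 shows "f = (0\<^sub>v d :: complex vec)"
 using 0[OF f] conjugate_square_eq_0_vec[OF f] by blast

lemma is_rk: "is_rk_pontryagin_space d \<Omega> K (model, ip)"
 unfolding is_rk_pontryagin_space_def prod.case Let_def
proof (intro conjI ballI allI impI)
 show "pontryagin_space d model ip" by (rule pontryagin)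
 show "f z = 0\<^sub>v d" if "f \<in> model" "z \<notin> \<Omega>" for f z using that off unfolding model_def by blast
 show "ip f g = 0" if "f \<notin> model \<or> g \<notin> model" for f g using that unfolding ip_def by auto
 fix w and y :: "complex vec" assume wy: "w \<in> \<Omega>" "y \<in> carrier_vec d"
 obtain x where x: "x \<in> carrier_vec n" "(%z. if z \<in> \<Omega> then K z w *\<^sub>v y else 0\<^sub>v d) = \<Phi> x"
  "!!x'. x' \<in> carrier_vec n ==> (G *\<^sub>v x') \<bullet>c x = \<Phi> x' w \<bullet>c y" using kernel[OF wy] by blast
 show "(%z. if z \<in> \<Omega> then K z w *\<^sub>v y else 0\<^sub>v d) \<in> model" unfolding x(2) model_def using x(1) by blast
 show "ip f (%z. if z \<in> \<Omega> then K z w *\<^sub>v y else 0\<^sub>v d) = f w \<bullet>c y" if f: "f \<in> model" for f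
 proof -
  obtain x' where x': "x' \<in> carrier_vec n" "f = \<Phi> x'" using f unfolding model_def by blast
  show ?thesis unfolding x(2) x'(2) ip[OF x'(1) x(1)] by (rule x(3)[OF x'(1)])
 qed
qed

text \<open>The coordinate vectors of the kernel functions have a trivial annihilator, so any space with this
 kernel contains the whole model; an element of such a space differs from its projection to the model
 by a function orthogonal to all kernel functions, that is, by zero.\<close>

lemma rk_unique:
 assumes rk: "is_rk_pontryagin_space d \<Omega> K (S', ip')"
 shows "S' = model \<and> ip' = ip"
proof -
 note R = rk[unfolded is_rk_pontryagin_space_def prod.case Let_def pontryagin_space_def]
 have sub: "VectorSpace.subspace class_ring S' (fun_space d)" and hf: "hermitian_form_on S' ip'" using R by blast+
 note R2 = R[THEN conjunct2, THEN conjunct1] and R3 = R[THEN conjunct2, THEN conjunct2, THEN conjunct1]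
  and R4 = R[THEN conjunct2, THEN conjunct2, THEN conjunct2]
 have off': "f z = 0\<^sub>v d" if "f \<in> S'" "z \<notin> \<Omega>" for f z by (rule bspec[OF R2 that(1), rule_format, OF that(2)])
 have out': "ip' f g = 0" if "f \<notin> S' \<or> g \<notin> S'" for f g by (rule R3[rule_format, OF that])
 have ker': "(%z. if z \<in> \<Omega> then K z w *\<^sub>v y else 0\<^sub>v d) \<in> S'"
  "f \<in> S' ==> ip' f (%z. if z \<in> \<Omega> then K z w *\<^sub>v y else 0\<^sub>v d) = f w \<bullet>c y" if "w \<in> \<Omega>" "y \<in> carrier_vec d" for w y f
  by (rule conjunct1[OF bspec[OF bspec[OF R4 that(1)] that(2)]], rule bspec[OF conjunct2[OF bspec[OF bspec[OF R4 that(1)] that(2)]]])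
 note sm = subspace.submod[OF sub]
 have Sc: "f t \<in> carrier_vec d" if "f \<in> S'" for f t using submodule.subset[OF sm] that unfolding fun_space_def by auto
 have Sz: "(%t. 0\<^sub>v d) \<in> S'" using submodule.zero_closed[OF sm] by (simp add: fun_space_def)
 have Sa: "(%t. f t + g t) \<in> S'" if "f \<in> S'" "g \<in> S'" for f g using submodule.m_closed[OF sm that] by (simp add: fun_space_def)
 have Ss: "(%t. c \<cdot>\<^sub>v f t) \<in> S'" if "f \<in> S'" for c f using submodule.smult_closed[OF sm _ that, of c] by (simp add: fun_space_def class_ring_simps)
 have la: "ip' (%t. f t + g t) h = ip' f h + ip' g h" if "f \<in> S'" "g \<in> S'" "h \<in> S'" for f g h using hf that unfolding hermitian_form_on_def by blast
 have ls: "ip' (%t. c \<cdot>\<^sub>v f t) h = c * ip' f h" if "f \<in> S'" "h \<in> S'" for c f h using hf that unfolding hermitian_form_on_def by blast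
 have hc: "ip' g f = cnj (ip' f g)" if "f \<in> S'" "g \<in> S'" for f g using hf that unfolding hermitian_form_on_def by blast
 have ra: "ip' h (%t. f t + g t) = ip' h f + ip' h g" if "f \<in> S'" "g \<in> S'" "h \<in> S'" for f g h
  unfolding hc[OF Sa[OF that(1,2)] that(3)] la[OF that] hc[OF that(3) that(1)] hc[OF that(3) that(2)] by simp
 have rs: "ip' h (%t. c \<cdot>\<^sub>v f t) = cnj c * ip' h f" if "f \<in> S'" "h \<in> S'" for c f h
  unfolding hc[OF Ss[OF that(1)] that(2)] ls[OF that] hc[OF that(2) that(1)] by simp
 have rz: "ip' h (%t. 0\<^sub>v d) = 0" if h: "h \<in> S'" for h
 proof -
  have "(%t::complex. 0\<^sub>v d) = (%t. 0 \<cdot>\<^sub>v (0\<^sub>v d :: complex vec))" by (intro ext eq_vecI) auto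
  then show ?thesis using rs[OF Sz h, of 0] by simp
 qed
 have \<Phi>a: "\<Phi> (x + y) = (%t. \<Phi> x t + \<Phi> y t)" if "x \<in> carrier_vec n" "y \<in> carrier_vec n" for x y using \<Phi>_add[OF that] by auto
 have \<Phi>s: "\<Phi> (c \<cdot>\<^sub>v x) = (%t. c \<cdot>\<^sub>v \<Phi> x t)" if "x \<in> carrier_vec n" for c x using \<Phi>_smult[OF that] by auto
 have \<Phi>z: "\<Phi> (0\<^sub>v n) = (%t. 0\<^sub>v d)" using \<Phi>_zero by auto
 \<comment> \<open>The vectors whose images lie in S' and on which both forms agree against all
   images already in S'. The reproducing property in both spaces puts the kernel vectors into
   \<open>T\<close>.\<close>
 define T where "T = {x \<in> carrier_vec n. \<Phi> x \<in> S' \<and> (\<forall>x'\<in>carrier_vec n. \<Phi> x' \<in> S' \<longrightarrow> ip' (\<Phi> x') (\<Phi> x) = (G *\<^sub>v x') \<bullet>c x)}"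
 have "T = carrier_vec n"
 proof (rule subspace_eq_carrier[OF G det])
  show "T \<subseteq> carrier_vec n" unfolding T_def by blast
  show "0\<^sub>v n \<in> T" unfolding T_def mem_Collect_eq
  proof (intro conjI ballI impI)
   show "\<Phi> (0\<^sub>v n) \<in> S'" unfolding \<Phi>z by (rule Sz)
   fix x' assume "\<Phi> x' \<in> S'"
   from rz[OF this] show "ip' (\<Phi> x') (\<Phi> (0\<^sub>v n)) = (G *\<^sub>v x') \<bullet>c 0\<^sub>v n"
    unfolding \<Phi>z cscalar_prod_sum[OF zero_carrier_vec] by simp
  qed (rule zero_carrier_vec)
  show "x + y \<in> T" if "x \<in> T" "y \<in> T" for x y
  proof -
   have c: "x \<in> carrier_vec n" "y \<in> carrier_vec n" and s: "\<Phi> x \<in> S'" "\<Phi> y \<in> S'" using that unfolding T_def by auto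
   have "ip' (\<Phi> x') (%t. \<Phi> x t + \<Phi> y t) = (G *\<^sub>v x') \<bullet>c (x + y)" if "x' \<in> carrier_vec n" "\<Phi> x' \<in> S'" for x'
    unfolding ra[OF s that(2)] cscalar_prod_add_right[OF mult_mat_vec_carrier[OF G that(1)] c]
    using \<open>x \<in> T\<close> \<open>y \<in> T\<close> that unfolding T_def by simp
   then show ?thesis unfolding T_def mem_Collect_eq \<Phi>a[OF c] using Sa[OF s] add_carrier_vec[OF c] by blast
  qed
  show "a \<cdot>\<^sub>v x \<in> T" if "x \<in> T" for a x
  proof -
   have c: "x \<in> carrier_vec n" and s: "\<Phi> x \<in> S'" using that unfolding T_def by auto
   have "ip' (\<Phi> x') (%t. a \<cdot>\<^sub>v \<Phi> x t) = (G *\<^sub>v x') \<bullet>c (a \<cdot>\<^sub>v x)" if "x' \<in> carrier_vec n" "\<Phi> x' \<in> S'" for x'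
    unfolding rs[OF s that(2)] cscalar_prod_smult_right[OF mult_mat_vec_carrier[OF G that(1)] c]
    using \<open>x \<in> T\<close> that unfolding T_def by simp
   then show ?thesis unfolding T_def mem_Collect_eq \<Phi>s[OF c] using Ss[OF s] smult_carrier_vec[THEN iffD2, OF c] by blast
  qed
  fix u assume u: "u \<in> carrier_vec n" and ann: "!!t. t \<in> T ==> (G *\<^sub>v u) \<bullet>c t = 0"
  \<comment> \<open>A vector annihilating \<open>T\<close> annihilates all kernel vectors, so its
    image vanishes at every point.\<close>
  have "\<Phi> u w = 0\<^sub>v d" for w
  proof (cases "w \<in> \<Omega>")
   case False
   then show ?thesis by (rule off[OF u])
  next
   case True
   show ?thesis
   proof (rule zero_of_products[OF \<Phi>_carrier[OF u]])
    fix y :: "complex vec" assume y: "y \<in> carrier_vec d"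
    obtain x where x: "x \<in> carrier_vec n" "(%z. if z \<in> \<Omega> then K z w *\<^sub>v y else 0\<^sub>v d) = \<Phi> x"
     "!!x'. x' \<in> carrier_vec n ==> (G *\<^sub>v x') \<bullet>c x = \<Phi> x' w \<bullet>c y" using kernel[OF True y] by blast
    have "x \<in> T" using ker'[OF True y] x(1,3) unfolding T_def x(2) by simp
    then show "\<Phi> u w \<bullet>c y = 0" using ann x(3)[OF u] by simp
   qed
  qed
  then show "u = 0\<^sub>v n" by (rule \<Phi>_inj[OF u])
 qed
 then have inS: "\<Phi> x \<in> S'" and form: "x' \<in> carrier_vec n ==> ip' (\<Phi> x') (\<Phi> x) = (G *\<^sub>v x') \<bullet>c x" if "x \<in> carrier_vec n" for x x'
  using that unfolding T_def by blast+
 have "S' \<subseteq> model"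
 proof
  fix f assume f: "f \<in> S'"
  \<comment> \<open>The projection of \<open>f\<close> to the model, with coordinates computed by
    the form of S'.\<close>
  define x where "x = lin_comb n k v (%i. of_real (e i) * ip' f (\<Phi> (v i)))"
  have x: "x \<in> carrier_vec n" unfolding x_def by simp
  define g where "g = (%t. f t + (- 1) \<cdot>\<^sub>v \<Phi> x t)"
  have gS: "g \<in> S'" unfolding g_def by (rule Sa[OF f Ss[OF inS[OF x]]])
  have gv: "ip' g (\<Phi> (v i)) = 0" if i: "i < k" for i
  proof -
   have "(G *\<^sub>v x) \<bullet>c v i = ip' f (\<Phi> (v i))"
    unfolding x_def coordinate[OF i] using ee[OF i] by (simp add: mult.commute mult.left_commute)
   then show ?thesis unfolding g_def la[OF f Ss[OF inS[OF x]] inS[OF v[OF i]]] ls[OF inS[OF x] inS[OF v[OF i]]] form[OF v[OF i] x] by simp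
  qed
  define T0 where "T0 = {t \<in> carrier_vec n. ip' g (\<Phi> t) = 0}"
  \<comment> \<open>Orthogonality to the images of the basis vectors extends to all images by
    linearity, in particular to the kernel functions.\<close>
  have T0: "t \<in> T0" if t: "t \<in> carrier_vec n" for t
  proof -
   have "lin_comb n k v (%i. of_real (e i) * ((G *\<^sub>v t) \<bullet>c v i)) \<in> T0"
   proof (rule lin_comb_in)
    show "v i \<in> T0" if "i < k" for i using gv[OF that] v[OF that] unfolding T0_def by simp
    show "T0 \<subseteq> carrier_vec n" unfolding T0_def by blast
    show "0\<^sub>v n \<in> T0" unfolding T0_def \<Phi>z mem_Collect_eq using rz[OF gS] by (simp add: \<Phi>z)
    show "a + b \<in> T0" if "a \<in> T0" "b \<in> T0" for a b
    proof -
     have c: "a \<in> carrier_vec n" "b \<in> carrier_vec n" using that unfolding T0_def by auto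
     show ?thesis using that add_carrier_vec[OF c] ra[OF inS[OF c(1)] inS[OF c(2)] gS] unfolding T0_def by (simp add: \<Phi>a[OF c])
    qed
    show "z \<cdot>\<^sub>v a \<in> T0" if "a \<in> T0" for z a
    proof -
     have c: "a \<in> carrier_vec n" using that unfolding T0_def by auto
     show ?thesis using that smult_carrier_vec[THEN iffD2, OF c] rs[OF inS[OF c] gS] unfolding T0_def by (simp add: \<Phi>s[OF c])
    qed
   qed
   then show ?thesis using arg_cong[OF rep[OF t], of "%y. y \<in> T0"] by blast
  qed
  have g0: "g w = 0\<^sub>v d" for w
  proof (cases "w \<in> \<Omega>")
   case False
   then show ?thesis by (rule off'[OF gS])
  next
   case True
   show ?thesis
   proof (rule zero_of_products[OF Sc[OF gS]])
    fix y :: "complex vec" assume y: "y \<in> carrier_vec d"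
    obtain t where t: "t \<in> carrier_vec n" "(%z. if z \<in> \<Omega> then K z w *\<^sub>v y else 0\<^sub>v d) = \<Phi> t" using kernel[OF True y] by blast
    show "g w \<bullet>c y = 0" using ker'(2)[OF True y gS] T0[OF t(1)] unfolding t(2) T0_def by simp
   qed
  qed
  have "f = \<Phi> x"
  proof
   fix w
   have c: "f w \<in> carrier_vec d" "\<Phi> x w \<in> carrier_vec d" by (rule Sc[OF f], rule \<Phi>_carrier[OF x])
   show "f w = \<Phi> x w"
   proof (rule eq_vecI)
    fix i assume "i < dim_vec (\<Phi> x w)"
    then have i: "i < d" using carrier_vecD[OF c(2)] by simp
    have "f w $ i + (- 1) * \<Phi> x w $ i = g w $ i" unfolding g_def using i carrier_vecD[OF c(2)] by simp
    then show "f w $ i = \<Phi> x w $ i" unfolding g0 using i by simp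
   qed (use carrier_vecD[OF c(1)] carrier_vecD[OF c(2)] in simp)
  qed
  then show "f \<in> model" unfolding model_def using x by blast
 qed
 moreover have "model \<subseteq> S'" unfolding model_def using inS by blast
 ultimately have S: "S' = model" by blast
 have "ip' = ip"
 proof (intro ext)
  fix f g
  show "ip' f g = ip f g"
  proof (cases "f \<in> model \<and> g \<in> model")
   case True
   then obtain x y where "x \<in> carrier_vec n" "y \<in> carrier_vec n" "f = \<Phi> x" "g = \<Phi> y" unfolding model_def by blast
   then show ?thesis by (simp add: form ip)
  next
   case False
   then show ?thesis using out'[of f g] unfolding S ip_def by auto
  qed
 qed
 with S show ?thesis by blast
qed

lemma rk_space_eq: "rk_pontryagin_space d \<Omega> K = (model, ip)"
 unfolding rk_pontryagin_space_def
proof (rule the_equality[where P = "is_rk_pontryagin_space d \<Omega> K", OF is_rk])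
 fix H assume "is_rk_pontryagin_space d \<Omega> K H"
 then show "H = (model, ip)" using rk_unique[of "fst H" "snd H"] by (simp add: prod_eq_iff)
qed

end

section \<open>Factorization of the kernel\<close>

lemma smult_mat_mult_vec:
 assumes A: "A \<in> carrier_mat n k" and x: "x \<in> carrier_vec k"
 shows "(c \<cdot>\<^sub>m A) *\<^sub>v x = c \<cdot>\<^sub>v (A *\<^sub>v (x :: complex vec))"
proof (rule eq_vecI)
 fix i assume "i < dim_vec (c \<cdot>\<^sub>v (A *\<^sub>v x))"
 then have i: "i < n" using carrier_matD[OF A] by simp
 have cA: "c \<cdot>\<^sub>m A \<in> carrier_mat n k" using A by simp
 have "((c \<cdot>\<^sub>m A) *\<^sub>v x) $ i = (\<Sum>j<k. c * A $$ (i, j) * x $ j)"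
  unfolding mult_mat_vec_index_sum[OF cA x i] using i carrier_matD[OF A] by (intro sum.cong refl) simp
 also have "\<dots> = c * (A *\<^sub>v x) $ i" unfolding mult_mat_vec_index_sum[OF A x i] by (simp add: sum_distrib_left mult.assoc)
 finally show "((c \<cdot>\<^sub>m A) *\<^sub>v x) $ i = (c \<cdot>\<^sub>v (A *\<^sub>v x)) $ i" using i carrier_matD[OF A] by (simp del: index_mult_mat_vec)
qed (use carrier_matD[OF A] in simp)

lemma four_block_diag_resolvent:
 assumes A: "A \<in> carrier_mat n n" and B: "B \<in> carrier_mat k k" and zA: "z \<notin> spectrum A" and zB: "z \<notin> spectrum B"
 defines "M \<equiv> four_block_mat A (0\<^sub>m n k) (0\<^sub>m k n) B"
 shows "resolvent M z = four_block_mat (resolvent A z) (0\<^sub>m n k) (0\<^sub>m k n) (resolvent B z)" "z \<notin> spectrum M"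
proof -
 note RA = resolvent_props[OF A zA] and RB = resolvent_props[OF B zB]
 have M: "M \<in> carrier_mat (n + k) (n + k)" unfolding M_def by (rule four_block_carrier_mat[OF A B])
 let ?R = "four_block_mat (resolvent A z) (0\<^sub>m n k) (0\<^sub>m k n) (resolvent B z)"
 have R: "?R \<in> carrier_mat (n + k) (n + k)" by (rule four_block_carrier_mat[OF RA(1) RB(1)])
 have e: "z \<cdot>\<^sub>m 1\<^sub>m (n + k) - M = four_block_mat (z \<cdot>\<^sub>m 1\<^sub>m n - A) (0\<^sub>m n k) (0\<^sub>m k n) (z \<cdot>\<^sub>m 1\<^sub>m k - B)"
  unfolding M_def by (rule eq_matI) (use A B in auto)
 have cA: "z \<cdot>\<^sub>m 1\<^sub>m n - A \<in> carrier_mat n n" and cB: "z \<cdot>\<^sub>m 1\<^sub>m k - B \<in> carrier_mat k k" using A B by auto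
 have "(z \<cdot>\<^sub>m 1\<^sub>m (n + k) - M) * ?R = 1\<^sub>m (n + k)"
  unfolding e mult_four_block_mat[OF cA zero_carrier_mat zero_carrier_mat cB RA(1) zero_carrier_mat zero_carrier_mat RB(1)] RA(2) RB(2)
  using RA(1) RB(1) by (simp add: right_mult_zero_mat[OF cA] right_mult_zero_mat[OF cB])
 from resolvent_unique[OF M R this] show "resolvent M z = ?R" "z \<notin> spectrum M" .
qed

lemma smult_zero_vec_eq: "c \<cdot>\<^sub>v 0\<^sub>v n = (0\<^sub>v n :: complex vec)"
 by (intro eq_vecI) auto

lemma one_mult_mat_vec: "x \<in> carrier_vec n ==> 1\<^sub>m n *\<^sub>v x = (x :: complex vec)"
 by simp

lemma smult_one_mult_vec:
 assumes x: "x \<in> carrier_vec n" shows "(c \<cdot>\<^sub>m 1\<^sub>m n) *\<^sub>v x = c \<cdot>\<^sub>v (x :: complex vec)"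
proof -
 have "(c \<cdot>\<^sub>m 1\<^sub>m n) *\<^sub>v x = c \<cdot>\<^sub>v (1\<^sub>m n *\<^sub>v x)" by (rule smult_mat_mult_vec[OF one_carrier_mat x])
 then show ?thesis using x by simp
qed

lemma minus_as_smult: "x \<in> carrier_vec n ==> y \<in> carrier_vec n ==> x - y = x + (- 1) \<cdot>\<^sub>v (y :: complex vec)"
 by (intro eq_vecI) (auto dest: carrier_vecD)

lemma minus_plus_cancel:
 "x \<in> carrier_vec n ==> y \<in> carrier_vec n ==> z \<in> carrier_vec n ==> (x - y) + (z + y) = x + (z :: complex vec)"
 by (intro eq_vecI) (auto dest: carrier_vecD)

lemma minus_plus_cancel':
 "x \<in> carrier_vec n ==> y \<in> carrier_vec n ==> z \<in> carrier_vec n ==> (x - y) + (y + z) = x + (z :: complex vec)"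
 by (intro eq_vecI) (auto dest: carrier_vecD)

lemma minus_minus_cancel:
 "x \<in> carrier_vec n ==> y \<in> carrier_vec n ==> z \<in> carrier_vec n ==> x - ((x - y) - z) = y + (z :: complex vec)"
 by (intro eq_vecI) (auto dest: carrier_vecD)

text \<open>Collects the three matrix equations of the data into the block identity Pick A + A^*
  Pick = -C^* J C. The last factor is J C written out, and the lower left block is the adjoint of
  the equation for \<open>Gam\<close>.\<close>

lemma pick_lyapunov:
 fixes Z X Y U V W Gam L R :: "complex mat"
 assumes Z: "Z \<in> carrier_mat n n" and X: "X \<in> carrier_mat n p" and Y: "Y \<in> carrier_mat n m" and U: "U \<in> carrier_mat m k"
  and V: "V \<in> carrier_mat p k" and W: "W \<in> carrier_mat k k" and Gam: "Gam \<in> carrier_mat n k"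
  and L: "L \<in> carrier_mat n n" and R: "R \<in> carrier_mat k k"
  and eL: "L * mat_adjoint Z + Z * L = X * mat_adjoint X - Y * mat_adjoint Y"
  and eR: "R * W + mat_adjoint W * R = mat_adjoint U * U - mat_adjoint V * V"
  and eG: "Gam * W - Z * Gam = X * V - Y * U"
 shows "four_block_mat L Gam (mat_adjoint Gam) R * four_block_mat (- mat_adjoint Z) (0\<^sub>m n k) (0\<^sub>m k n) W +
   four_block_mat (- Z) (0\<^sub>m n k) (0\<^sub>m k n) (mat_adjoint W) * four_block_mat L Gam (mat_adjoint Gam) R =
  - (four_block_mat (- X) (- Y) (mat_adjoint V) (mat_adjoint U) * four_block_mat (- mat_adjoint X) V (mat_adjoint Y) (- U))"
proof -
 let ?Zs = "mat_adjoint Z" and ?Xs = "mat_adjoint X" and ?Ys = "mat_adjoint Y" and ?Us = "mat_adjoint U"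
  and ?Vs = "mat_adjoint V" and ?Ws = "mat_adjoint W" and ?Gs = "mat_adjoint Gam"
 note s = mat_adjoint_carrier[OF Z] mat_adjoint_carrier[OF X] mat_adjoint_carrier[OF Y] mat_adjoint_carrier[OF U]
  mat_adjoint_carrier[OF V] mat_adjoint_carrier[OF W] mat_adjoint_carrier[OF Gam]
 note d = carrier_matD[OF Z] carrier_matD[OF X] carrier_matD[OF Y] carrier_matD[OF U] carrier_matD[OF V] carrier_matD[OF W]
  carrier_matD[OF Gam] carrier_matD[OF L] carrier_matD[OF R]
 note um = uminus_mult_left_mat uminus_mult_right_mat
 note z = right_mult_zero_mat[OF L] right_mult_zero_mat[OF Gam] right_mult_zero_mat[OF R] right_mult_zero_mat[OF s(7)]
  left_mult_zero_mat[OF L] left_mult_zero_mat[OF Gam] left_mult_zero_mat[OF R] left_mult_zero_mat[OF s(7)]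
 have eG': "?Ws * ?Gs - ?Gs * ?Zs = ?Vs * ?Xs - ?Us * ?Ys"
  using arg_cong[OF eG, of mat_adjoint]
  unfolding mat_adjoint_minus[OF mult_carrier_mat[OF Gam W] mult_carrier_mat[OF Z Gam]] mat_adjoint_minus[OF mult_carrier_mat[OF X V] mult_carrier_mat[OF Y U]]
   mat_adjoint_mult[OF Gam W] mat_adjoint_mult[OF Z Gam] mat_adjoint_mult[OF X V] mat_adjoint_mult[OF Y U] .
 have 11: "(L * - ?Zs + Gam * 0\<^sub>m k n) + (- Z * L + 0\<^sub>m n k * ?Gs) = - (- X * - ?Xs + - Y * ?Ys)" (is "?l = ?r")
 proof (rule eq_matI)
  fix i j assume "i < dim_row ?r" "j < dim_col ?r"
  then have ij: "i < n" "j < n" using d by simp_all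
  have "?l $$ (i, j) = - ((L * ?Zs) $$ (i, j) + (Z * L) $$ (i, j))" using ij by (simp add: d z um del: index_mult_mat(1))
  moreover have "?r $$ (i, j) = - ((X * ?Xs) $$ (i, j) - (Y * ?Ys) $$ (i, j))" using ij by (simp add: d um del: index_mult_mat(1))
  moreover have "(L * ?Zs) $$ (i, j) + (Z * L) $$ (i, j) = (X * ?Xs) $$ (i, j) - (Y * ?Ys) $$ (i, j)"
   using arg_cong[OF eL, of "%M. M $$ (i, j)"] ij by (simp add: d del: index_mult_mat(1))
  ultimately show "?l $$ (i, j) = ?r $$ (i, j)" by (simp only:)
 qed (simp_all add: d)
 have 12: "(L * 0\<^sub>m n k + Gam * W) + (- Z * Gam + 0\<^sub>m n k * R) = - (- X * V + - Y * - U)" (is "?l = ?r")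
 proof (rule eq_matI)
  fix i j assume "i < dim_row ?r" "j < dim_col ?r"
  then have ij: "i < n" "j < k" using d by simp_all
  have "?l $$ (i, j) = (Gam * W) $$ (i, j) - (Z * Gam) $$ (i, j)" using ij by (simp add: d z um del: index_mult_mat(1))
  moreover have "?r $$ (i, j) = (X * V) $$ (i, j) - (Y * U) $$ (i, j)" using ij by (simp add: d um del: index_mult_mat(1))
  moreover have "(Gam * W) $$ (i, j) - (Z * Gam) $$ (i, j) = (X * V) $$ (i, j) - (Y * U) $$ (i, j)"
   using arg_cong[OF eG, of "%M. M $$ (i, j)"] ij by (simp add: d del: index_mult_mat(1))
  ultimately show "?l $$ (i, j) = ?r $$ (i, j)" by (simp only:)
 qed (simp_all add: d)
 have 21: "(?Gs * - ?Zs + R * 0\<^sub>m k n) + (0\<^sub>m k n * L + ?Ws * ?Gs) = - (?Vs * - ?Xs + ?Us * ?Ys)" (is "?l = ?r")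
 proof (rule eq_matI)
  fix i j assume "i < dim_row ?r" "j < dim_col ?r"
  then have ij: "i < k" "j < n" using d by simp_all
  have "?l $$ (i, j) = (?Ws * ?Gs) $$ (i, j) - (?Gs * ?Zs) $$ (i, j)" using ij by (simp add: d z um del: index_mult_mat(1))
  moreover have "?r $$ (i, j) = (?Vs * ?Xs) $$ (i, j) - (?Us * ?Ys) $$ (i, j)" using ij by (simp add: d um del: index_mult_mat(1))
  moreover have "(?Ws * ?Gs) $$ (i, j) - (?Gs * ?Zs) $$ (i, j) = (?Vs * ?Xs) $$ (i, j) - (?Us * ?Ys) $$ (i, j)"
   using arg_cong[OF eG', of "%M. M $$ (i, j)"] ij by (simp add: d del: index_mult_mat(1))
  ultimately show "?l $$ (i, j) = ?r $$ (i, j)" by (simp only:)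
 qed (simp_all add: d)
 have 22: "(?Gs * 0\<^sub>m n k + R * W) + (0\<^sub>m k n * Gam + ?Ws * R) = - (?Vs * V + ?Us * - U)" (is "?l = ?r")
 proof (rule eq_matI)
  fix i j assume "i < dim_row ?r" "j < dim_col ?r"
  then have ij: "i < k" "j < k" using d by simp_all
  have "?l $$ (i, j) = (R * W) $$ (i, j) + (?Ws * R) $$ (i, j)" using ij by (simp add: d z um del: index_mult_mat(1))
  moreover have "?r $$ (i, j) = (?Us * U) $$ (i, j) - (?Vs * V) $$ (i, j)" using ij by (simp add: d um del: index_mult_mat(1))
  moreover have "(R * W) $$ (i, j) + (?Ws * R) $$ (i, j) = (?Us * U) $$ (i, j) - (?Vs * V) $$ (i, j)"
   using arg_cong[OF eR, of "%M. M $$ (i, j)"] ij by (simp add: d del: index_mult_mat(1))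
  ultimately show "?l $$ (i, j) = ?r $$ (i, j)" by (simp only:)
 qed (simp_all add: d)
 have u: "- X \<in> carrier_mat n p" "- Y \<in> carrier_mat n m" "- U \<in> carrier_mat m k" "- Z \<in> carrier_mat n n" "- ?Zs \<in> carrier_mat n n" "- ?Xs \<in> carrier_mat p n"
  using X Y U Z s by auto
 have neg: "- four_block_mat A B C E = four_block_mat (- A) (- B) (- C) (- E)"
  if "A \<in> carrier_mat n n" "B \<in> carrier_mat n k" "C \<in> carrier_mat k n" "E \<in> carrier_mat k k" for A B C E :: "complex mat"
  by (rule eq_matI) (use that in auto)
 note c = mult_carrier_mat
 have m1: "four_block_mat L Gam ?Gs R * four_block_mat (- ?Zs) (0\<^sub>m n k) (0\<^sub>m k n) W =
   four_block_mat (L * - ?Zs + Gam * 0\<^sub>m k n) (L * 0\<^sub>m n k + Gam * W) (?Gs * - ?Zs + R * 0\<^sub>m k n) (?Gs * 0\<^sub>m n k + R * W)"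
  by (rule mult_four_block_mat[OF L Gam s(7) R u(5) zero_carrier_mat zero_carrier_mat W])
 have m2: "four_block_mat (- Z) (0\<^sub>m n k) (0\<^sub>m k n) ?Ws * four_block_mat L Gam ?Gs R =
   four_block_mat (- Z * L + 0\<^sub>m n k * ?Gs) (- Z * Gam + 0\<^sub>m n k * R) (0\<^sub>m k n * L + ?Ws * ?Gs) (0\<^sub>m k n * Gam + ?Ws * R)"
  by (rule mult_four_block_mat[OF u(4) zero_carrier_mat zero_carrier_mat s(6) L Gam s(7) R])
 have m3: "four_block_mat (- X) (- Y) ?Vs ?Us * four_block_mat (- ?Xs) V ?Ys (- U) =
   four_block_mat (- X * - ?Xs + - Y * ?Ys) (- X * V + - Y * - U) (?Vs * - ?Xs + ?Us * ?Ys) (?Vs * V + ?Us * - U)"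
  by (rule mult_four_block_mat[OF u(1,2) s(5,4) u(6) V s(3) u(3)])
 have cz: "0\<^sub>m a b \<in> carrier_mat a b" for a b :: nat by simp
 have m4: "four_block_mat (L * - ?Zs + Gam * 0\<^sub>m k n) (L * 0\<^sub>m n k + Gam * W) (?Gs * - ?Zs + R * 0\<^sub>m k n) (?Gs * 0\<^sub>m n k + R * W) +
   four_block_mat (- Z * L + 0\<^sub>m n k * ?Gs) (- Z * Gam + 0\<^sub>m n k * R) (0\<^sub>m k n * L + ?Ws * ?Gs) (0\<^sub>m k n * Gam + ?Ws * R) =
   four_block_mat ((L * - ?Zs + Gam * 0\<^sub>m k n) + (- Z * L + 0\<^sub>m n k * ?Gs)) ((L * 0\<^sub>m n k + Gam * W) + (- Z * Gam + 0\<^sub>m n k * R))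
    ((?Gs * - ?Zs + R * 0\<^sub>m k n) + (0\<^sub>m k n * L + ?Ws * ?Gs)) ((?Gs * 0\<^sub>m n k + R * W) + (0\<^sub>m k n * Gam + ?Ws * R))"
  by (rule add_four_block_mat[OF
   add_carrier_mat[OF c[OF Gam cz]] add_carrier_mat[OF c[OF Gam W]] add_carrier_mat[OF c[OF R cz]] add_carrier_mat[OF c[OF R W]]
   add_carrier_mat[OF c[OF cz s(7)]] add_carrier_mat[OF c[OF cz R]] add_carrier_mat[OF c[OF s(6) s(7)]] add_carrier_mat[OF c[OF s(6) R]]])
 show ?thesis
  unfolding m1 m2 m3 m4 11 12 21 22
  by (rule neg[symmetric, OF add_carrier_mat[OF c[OF u(2) s(3)]] add_carrier_mat[OF c[OF u(2) u(3)]]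
    add_carrier_mat[OF c[OF s(4) s(3)]] add_carrier_mat[OF c[OF s(4) u(3)]]])
qed

context btoa
begin

abbreviation "Am \<equiv> Amat D"
abbreviation "Cm \<equiv> Cmat D"
abbreviation "Jm \<equiv> Jmat D"

lemma ACJ: "Am \<in> carrier_mat (nz + nw) (nz + nw)" "Cm \<in> carrier_mat (p + m) (nz + nw)" "Jm \<in> carrier_mat (p + m) (p + m)"
 unfolding Amat_def Cmat_def Jmat_def
 by (rule four_block_carrier_mat[OF uminus_Zs(1) dims(6)],
   rule four_block_carrier_mat[OF uminus_carrier_mat[OF adj_dims(2)] dims(4)],
   rule four_block_carrier_mat[OF one_carrier_mat uminus_carrier_mat[OF one_carrier_mat]])

text \<open>The resolvent of a block diagonal matrix is block diagonal. This ties the elements of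
  the reproducing kernel space to the functions of the L2 side; the signs come from the first block
  column of \<open>Cmat\<close>.\<close>

lemma Am_resolvent:
 assumes "z \<notin> spectrum (- Zs)" "z \<notin> spectrum W"
 shows "z \<notin> spectrum Am"
  "a \<in> carrier_vec nz ==> b \<in> carrier_vec nw ==> rfun Cm Am (a @\<^sub>v b) z =
   ((- 1) \<cdot>\<^sub>v rfun Xs (- Zs) a z + rfun V W b z) @\<^sub>v ((- 1) \<cdot>\<^sub>v rfun Ys (- Zs) a z + rfun U W b z)"
proof -
 note R = four_block_diag_resolvent[OF uminus_Zs(1) dims(6) assms, folded Amat_def]
 show zA: "z \<notin> spectrum Am" by (rule R(2))
 assume a: "a \<in> carrier_vec nz" and b: "b \<in> carrier_vec nw"
 note R1 = resolvent_props(1)[OF uminus_Zs(1) assms(1)] and R2 = resolvent_props(1)[OF dims(6) assms(2)]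
 have ab: "a @\<^sub>v b \<in> carrier_vec (nz + nw)" using a b by simp
 let ?a = "resolvent (- Zs) z *\<^sub>v a" and ?b = "resolvent W z *\<^sub>v b"
 have a': "?a \<in> carrier_vec nz" and b': "?b \<in> carrier_vec nw" by (rule mult_mat_vec_carrier[OF R1 a], rule mult_mat_vec_carrier[OF R2 b])
 have "resolvent Am z *\<^sub>v (a @\<^sub>v b) = (?a + 0\<^sub>m nz nw *\<^sub>v b) @\<^sub>v (0\<^sub>m nw nz *\<^sub>v a + ?b)"
  unfolding R(1) by (rule four_block_mat_mult_vec[OF R1 zero_carrier_mat zero_carrier_mat R2 a b])
 also have "\<dots> = ?a @\<^sub>v ?b" unfolding zero_mult_vec[OF a] zero_mult_vec[OF b] using a' b' by simp
 finally have e: "resolvent Am z *\<^sub>v (a @\<^sub>v b) = ?a @\<^sub>v ?b" .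
 have "rfun Cm Am (a @\<^sub>v b) z = Cm *\<^sub>v (?a @\<^sub>v ?b)"
  unfolding rfun_def assoc_mult_mat_vec[OF ACJ(2) resolvent_props(1)[OF ACJ(1) zA] ab] e ..
 also have "\<dots> = ((- Xs) *\<^sub>v ?a + V *\<^sub>v ?b) @\<^sub>v ((- Ys) *\<^sub>v ?a + U *\<^sub>v ?b)"
  unfolding Cmat_def by (rule four_block_mat_mult_vec[OF uminus_carrier_mat[OF adj_dims(2)] dims(5) uminus_Zs(2) dims(4) a' b'])
 finally show "rfun Cm Am (a @\<^sub>v b) z =
   ((- 1) \<cdot>\<^sub>v rfun Xs (- Zs) a z + rfun V W b z) @\<^sub>v ((- 1) \<cdot>\<^sub>v rfun Ys (- Zs) a z + rfun U W b z)"
  unfolding rfun_def assoc_mult_mat_vec[OF adj_dims(2) R1 a] assoc_mult_mat_vec[OF adj_dims(3) R1 a]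
   assoc_mult_mat_vec[OF dims(5) R2 b] assoc_mult_mat_vec[OF dims(4) R2 b] uminus_mult_vec[OF adj_dims(2) a'] uminus_mult_vec[OF adj_dims(3) a'] .
qed

lemma Omega: "z \<in> \<Pi>\<^sub>+ - spectrum W ==> z \<notin> spectrum (- Zs)" "z \<in> \<Pi>\<^sub>+ - spectrum W ==> z \<notin> spectrum W"
 "z \<in> \<Pi>\<^sub>+ - spectrum W ==> z \<notin> spectrum Am"
 using spmZs[of z] Am_resolvent(1)[of z] by (auto simp: right_half_plane_def)

text \<open>A function of the model space that vanishes extends to the imaginary axis, where its two parts lie in the
 Hardy space and in its orthogonal complement.\<close>

lemma rfun_Theta_inj:
 assumes v: "v \<in> carrier_vec (nz + nw)" and 0: "!!z. z \<in> \<Pi>\<^sub>+ - spectrum W ==> rfun Cm Am v z = 0\<^sub>v (p + m)"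
 shows "v = 0\<^sub>v (nz + nw)"
proof -
 have ax: "rfun Cm Am v (Complex 0 y) = 0\<^sub>v (p + m)" for y
 proof (rule eq_vecI)
  fix i assume "i < dim_vec (0\<^sub>v (p + m) :: complex vec)"
  then have i: "i < p + m" by simp
  have nA: "Complex 0 y \<in> - spectrum Am" using Am_resolvent(1)[OF axis_notin(2,1)] by simp
  have oA: "open (- spectrum Am)" and oW: "open (- spectrum W)"
   using finite_imp_closed[OF finite_spectrum[OF ACJ(1)]] finite_imp_closed[OF finite_spectrum[OF dims(6)]] by (simp_all add: open_Compl)
  have c: "isCont (%z. vec_index (rfun Cm Am v z) i) (Complex 0 y)"
   using holomorphic_on_imp_continuous_on[OF rfun_holomorphic(1)[OF ACJ(1,2) v i]] continuous_on_eq_continuous_at[OF oA] nA by blast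
  have l: "((%x. Complex x y) \<longlongrightarrow> Complex 0 y) (at_right 0)" by (intro tendsto_intros)
  \<comment> \<open>The axis point is approached from inside the half-plane; being off the spectrum
    of \<open>W\<close>, it is reached through points of the domain.\<close>
  have "\<forall>\<^sub>F x in at_right 0. Complex x y \<in> - spectrum W"
   by (rule topological_tendstoD[OF l oW]) (use axis_notin(1) in simp)
  moreover have "\<forall>\<^sub>F x in at_right (0::real). 0 < x" by (rule eventually_at_right_less)
  ultimately have "\<forall>\<^sub>F x in at_right 0. vec_index (rfun Cm Am v (Complex x y)) i = 0"
  proof eventually_elim
   case (elim x)
   then have "Complex x y \<in> \<Pi>\<^sub>+ - spectrum W" by (simp add: right_half_plane_def)
   then show ?case using 0 i by simp
  qed
  then have "((%x. vec_index (rfun Cm Am v (Complex x y)) i) \<longlongrightarrow> 0) (at_right 0)" by (rule tendsto_eventually)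
  from tendsto_unique[OF _ isCont_tendsto_compose[OF c l] this]
  show "vec_index (rfun Cm Am v (Complex 0 y)) i = vec_index (0\<^sub>v (p + m)) i" using i by simp
 qed (use carrier_vecD[OF rfun_carrier[OF ACJ(2)]] in simp)
 define a where "a = vec_first v nz"
 define b where "b = vec_last v nw"
 have a: "a \<in> carrier_vec nz" and b: "b \<in> carrier_vec nw" unfolding a_def b_def by simp_all
 have vab: "v = a @\<^sub>v b" unfolding a_def b_def by (rule append_vec_split[OF v])
 note L = f_L2(1)[OF a] f_L2(2)[OF a] f_L2(4)[OF b] f_L2(5)[OF b]
 have eq: "gV b y = fX a y" "gU b y = fY a y" for y
 proof -
  note c = L2_imag_carrier[OF L(1), of y] L2_imag_carrier[OF L(2), of y] L2_imag_carrier[OF L(3), of y] L2_imag_carrier[OF L(4), of y]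
  have e: "((- 1) \<cdot>\<^sub>v fX a y + gV b y) @\<^sub>v ((- 1) \<cdot>\<^sub>v fY a y + gU b y) = 0\<^sub>v (p + m)"
   using ax[of y] unfolding vab Am_resolvent(2)[OF axis_notin(2,1) a b] .
  have ec: "(- 1) \<cdot>\<^sub>v fX a y + gV b y \<in> carrier_vec p" "(- 1) \<cdot>\<^sub>v fY a y + gU b y \<in> carrier_vec m" using c by auto
  show "gV b y = fX a y"
  proof (rule eq_vecI)
   fix i assume "i < dim_vec (fX a y)"
   then have i: "i < p" using carrier_vecD[OF c(1)] by simp
   have "(- 1) * vec_index (fX a y) i + vec_index (gV b y) i = vec_index ((- 1) \<cdot>\<^sub>v fX a y + gV b y) i"
    using i carrier_vecD[OF c(1)] carrier_vecD[OF c(4)] by simp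
   also have "\<dots> = 0" unfolding append_vec_nth(1)[OF ec i, symmetric] e using i by simp
   finally show "vec_index (gV b y) i = vec_index (fX a y) i" by simp
  qed (use carrier_vecD[OF c(1)] carrier_vecD[OF c(4)] in simp)
  show "gU b y = fY a y"
  proof (rule eq_vecI)
   fix i assume "i < dim_vec (fY a y)"
   then have i: "i < m" using carrier_vecD[OF c(2)] by simp
   have "(- 1) * vec_index (fY a y) i + vec_index (gU b y) i = vec_index ((- 1) \<cdot>\<^sub>v fY a y + gU b y) i"
    using i carrier_vecD[OF c(2)] carrier_vecD[OF c(3)] by simp
   also have "\<dots> = 0" unfolding append_vec_nth(2)[OF ec i, symmetric] e using i by simp
   finally show "vec_index (gU b y) i = vec_index (fY a y) i" by simp
  qed (use carrier_vecD[OF c(2)] carrier_vecD[OF c(3)] in simp)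
 qed
 have "vinner m (gU b) (gU b) = 0" using g_orth(1)[OF f_hardy(2)[OF a] b] unfolding eq(2)[symmetric] .
 then have "(GU *\<^sub>v b) \<bullet>c b = 0" unfolding grams(4)[OF b b] by simp
 then have b0: "b = 0\<^sub>v nw" using GU_pos[OF b] by force
 have "vinner p (fX a) (fX a) = 0" using g_orth(2)[OF f_hardy(1)[OF a] b] unfolding eq(1) .
 then have "(GX *\<^sub>v a) \<bullet>c a = 0" unfolding grams(1)[OF a a] by simp
 then have a0: "a = 0\<^sub>v nz" using GX_pos[OF a] by force
 show ?thesis unfolding vab a0 b0 by (rule append_zero_vec)
qed

lemma Jm_Jm: "u \<in> carrier_vec (p + m) ==> Jm *\<^sub>v (Jm *\<^sub>v u) = u"
proof -
 assume "u \<in> carrier_vec (p + m)"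
 from append_vec_split[OF this] obtain x y where u: "u = x @\<^sub>v y" "x \<in> carrier_vec p" "y \<in> carrier_vec m" by auto
 have ym: "(- 1) \<cdot>\<^sub>v y \<in> carrier_vec m" using u(3) by simp
 show ?thesis unfolding u(1) Jmat_append[OF u(2,3)] Jmat_append[OF u(2) ym] by (simp add: smult_smult_assoc)
qed

lemma Jm_adjoint: "mat_adjoint Jm = Jm"
 unfolding Jmat_def mat_adjoint_four_block[OF one_carrier_mat zero_carrier_mat zero_carrier_mat uminus_carrier_mat[OF one_carrier_mat]]
 by (simp add: mat_adjoint_uminus)

lemma Gamma_lyapunov:
 "Gamma_L D * Zs + Z * Gamma_L D = X * Xs - Y * Ys"
 "Gamma_R D * W + mat_adjoint W * Gamma_R D = mat_adjoint U * U - mat_adjoint V * V"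
proof -
 have c: "X * Xs \<in> carrier_mat nz nz" "Y * Ys \<in> carrier_mat nz nz"
  "mat_adjoint U * U \<in> carrier_mat nw nw" "mat_adjoint V * V \<in> carrier_mat nw nw"
  using mult_carrier_mat[OF dims(2) adj_dims(2)] mult_carrier_mat[OF dims(3) adj_dims(3)]
   mult_carrier_mat[OF mat_adjoint_carrier[OF dims(4)] dims(4)] mult_carrier_mat[OF mat_adjoint_carrier[OF dims(5)] dims(5)] .
 have "Gamma_L D = axis_gram nz Zs (X * Xs - Y * Ys)"
  unfolding Gamma_L_eq axis_gram_minus[OF adj_dims(1) spZs c(1,2)] by simp
 then show "Gamma_L D * Zs + Z * Gamma_L D = X * Xs - Y * Ys"
  using lyapunov_exists[OF adj_dims(1) spZs minus_carrier_mat[OF c(2)]] by simp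
 have "Gamma_R D = axis_gram nw W (mat_adjoint U * U - mat_adjoint V * V)"
  unfolding Gamma_R_eq axis_gram_minus[OF dims(6) spW c(3,4)] by simp
 then show "Gamma_R D * W + mat_adjoint W * Gamma_R D = mat_adjoint U * U - mat_adjoint V * V"
  using lyapunov_exists[OF dims(6) spW minus_carrier_mat[OF c(4)]] by simp
qed

lemma Pick_lyapunov_vec:
 assumes q: "q \<in> carrier_vec (nz + nw)"
 shows "Pick *\<^sub>v (Am *\<^sub>v q) + mat_adjoint Am *\<^sub>v (Pick *\<^sub>v q) = (- 1) \<cdot>\<^sub>v (mat_adjoint Cm *\<^sub>v (Jm *\<^sub>v (Cm *\<^sub>v q)))"
proof -
 let ?JC = "four_block_mat (- Xs) V Ys (- U)"
 note uX = uminus_carrier_mat[OF adj_dims(2)] and uU = uminus_carrier_mat[OF dims(4)]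
 note a1 = mat_adjoint_carrier[OF dims(4)] mat_adjoint_carrier[OF dims(5)] mat_adjoint_carrier[OF dims(6)]
 have JC: "?JC \<in> carrier_mat (p + m) (nz + nw)" by (rule four_block_carrier_mat[OF uX uU])
 have eL: "Gamma_L D * Zs + Z * Gamma_L D = X * Xs - Y * Ys"
  and eR: "Gamma_R D * W + mat_adjoint W * Gamma_R D = mat_adjoint U * U - mat_adjoint V * V"
  by (rule Gamma_lyapunov)+
 have eG: "Gam * W - Z * Gam = X * V - Y * U" using adm unfolding btoa_admissible_def by blast
 have As: "mat_adjoint Am = four_block_mat (- Z) (0\<^sub>m nz nw) (0\<^sub>m nw nz) (mat_adjoint W)"
  unfolding Amat_def mat_adjoint_four_block[OF uminus_Zs(1) zero_carrier_mat zero_carrier_mat dims(6)] by (simp add: mat_adjoint_uminus)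
 have Cs: "mat_adjoint Cm = four_block_mat (- X) (- Y) (mat_adjoint V) (mat_adjoint U)"
  unfolding Cmat_def mat_adjoint_four_block[OF uX dims(5) uminus_Zs(2) dims(4)] by (simp add: mat_adjoint_uminus)
 have M: "Pick * Am + mat_adjoint Am * Pick = - (mat_adjoint Cm * ?JC)"
  unfolding As Cs btoa_pick_def unfolding Amat_def
  by (rule pick_lyapunov[OF dims Gamma_dims eL eR eG])
 have JCv: "Jm *\<^sub>v (Cm *\<^sub>v q) = ?JC *\<^sub>v q"
 proof -
  define a where "a = vec_first q nz"
  define b where "b = vec_last q nw"
  have a: "a \<in> carrier_vec nz" and b: "b \<in> carrier_vec nw" unfolding a_def b_def by simp_all
  have qab: "q = a @\<^sub>v b" unfolding a_def b_def by (rule append_vec_split[OF q])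
  note cc = mult_mat_vec_carrier[OF adj_dims(2) a] mult_mat_vec_carrier[OF adj_dims(3) a] mult_mat_vec_carrier[OF dims(4) b] mult_mat_vec_carrier[OF dims(5) b]
  have e1: "Cm *\<^sub>v q = ((- Xs) *\<^sub>v a + V *\<^sub>v b) @\<^sub>v ((- Ys) *\<^sub>v a + U *\<^sub>v b)"
   unfolding Cmat_def qab by (rule four_block_mat_mult_vec[OF uX dims(5) uminus_Zs(2) dims(4) a b])
  have e2: "?JC *\<^sub>v q = ((- Xs) *\<^sub>v a + V *\<^sub>v b) @\<^sub>v (Ys *\<^sub>v a + (- U) *\<^sub>v b)"
   unfolding qab by (rule four_block_mat_mult_vec[OF uX dims(5) adj_dims(3) uU a b])
  have c1: "(- Xs) *\<^sub>v a + V *\<^sub>v b \<in> carrier_vec p" "(- 1) \<cdot>\<^sub>v (Ys *\<^sub>v a) + U *\<^sub>v b \<in> carrier_vec m"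
   using add_carrier_vec[OF mult_mat_vec_carrier[OF uX a] cc(4)] add_carrier_vec[OF smult_carrier_vec[THEN iffD2, OF cc(2)] cc(3)] .
  have e3: "(- 1) \<cdot>\<^sub>v ((- 1) \<cdot>\<^sub>v (Ys *\<^sub>v a) + U *\<^sub>v b) = Ys *\<^sub>v a + (- 1) \<cdot>\<^sub>v (U *\<^sub>v b)"
   using carrier_vecD[OF cc(2)] carrier_vecD[OF cc(3)] by (intro eq_vecI) (auto simp del: dim_mult_mat_vec index_mult_mat_vec)
  show ?thesis unfolding e1 e2 uminus_mult_vec[OF adj_dims(3) a] uminus_mult_vec[OF dims(4) b] Jmat_append[OF c1] e3 ..
 qed
 note Asc = mat_adjoint_carrier[OF ACJ(1)] and Csc = mat_adjoint_carrier[OF ACJ(2)]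
 have "Pick *\<^sub>v (Am *\<^sub>v q) + mat_adjoint Am *\<^sub>v (Pick *\<^sub>v q) = (Pick * Am + mat_adjoint Am * Pick) *\<^sub>v q"
  unfolding add_mult_distrib_mat_vec[OF mult_carrier_mat[OF Pick_carrier ACJ(1)] mult_carrier_mat[OF Asc Pick_carrier] q]
   assoc_mult_mat_vec[OF Pick_carrier ACJ(1) q] assoc_mult_mat_vec[OF Asc Pick_carrier q] ..
 also have "\<dots> = (- 1) \<cdot>\<^sub>v ((mat_adjoint Cm * ?JC) *\<^sub>v q)" unfolding M by (rule uminus_mult_vec[OF mult_carrier_mat[OF Csc JC] q])
 also have "(mat_adjoint Cm * ?JC) *\<^sub>v q = mat_adjoint Cm *\<^sub>v (Jm *\<^sub>v (Cm *\<^sub>v q))" unfolding JCv by (rule assoc_mult_mat_vec[OF Csc JC q])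
 finally show ?thesis .
qed

text \<open>All computations act on the fixed vector y. With T = I - Theta the adjoint of T at w
  sends y to J C q, and the Lyapunov identity turns what remains into z + cnj w times C R(z) q,
  cancelling the denominator of the kernel.\<close>

lemma K_Theta_vec:
 assumes det: "det Pick \<noteq> 0" and z: "z \<notin> spectrum Am" and w: "w \<notin> spectrum Am" and zw: "z + cnj w \<noteq> 0" and y: "y \<in> carrier_vec (p + m)"
 defines "q \<equiv> minv Pick *\<^sub>v (mat_adjoint (resolvent Am w) *\<^sub>v (mat_adjoint Cm *\<^sub>v y))"
 shows "q \<in> carrier_vec (nz + nw)" "K_Theta D z w *\<^sub>v y = rfun Cm Am q z"
  "x \<in> carrier_vec (nz + nw) ==> (Pick *\<^sub>v x) \<bullet>c q = rfun Cm Am x w \<bullet>c y"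
proof -
 let ?N = "nz + nw" and ?d = "p + m"
 note A = ACJ(1) and C = ACJ(2) and J = ACJ(3)
 note P = Pick_carrier
 note Rz = resolvent_props[OF A z] and Rw = resolvent_props[OF A w]
 note Q = minv_props[OF P det]
 note Cs = mat_adjoint_carrier[OF C] and S = mat_adjoint_carrier[OF Rw(1)] and As = mat_adjoint_carrier[OF A]
 have Qs: "mat_adjoint (minv Pick) = minv Pick"
 proof (rule minv_unique[OF P mat_adjoint_carrier[OF Q(1)], symmetric])
  have "mat_adjoint (minv Pick * Pick) = mat_adjoint Pick * mat_adjoint (minv Pick)" by (rule mat_adjoint_mult[OF Q(1) P])
  then show "Pick * mat_adjoint (minv Pick) = 1\<^sub>m ?N" unfolding Q(3) Pick_hermitian by simp
 qed
 define c where "c = mat_adjoint Cm *\<^sub>v y"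
 define s where "s = mat_adjoint (resolvent Am w) *\<^sub>v c"
 have c: "c \<in> carrier_vec ?N" unfolding c_def by (rule mult_mat_vec_carrier[OF Cs y])
 have s: "s \<in> carrier_vec ?N" unfolding s_def by (rule mult_mat_vec_carrier[OF S c])
 have qs: "q = minv Pick *\<^sub>v s" unfolding q_def s_def c_def ..
 show q: "q \<in> carrier_vec ?N" unfolding qs by (rule mult_mat_vec_carrier[OF Q(1) s])
 have Pq: "Pick *\<^sub>v q = s" unfolding qs assoc_mult_mat_vec[OF P Q(1) s, symmetric] Q(2) using s by simp
 show "(Pick *\<^sub>v x) \<bullet>c q = rfun Cm Am x w \<bullet>c y" if x: "x \<in> carrier_vec ?N"
 proof -
  have "(Pick *\<^sub>v x) \<bullet>c q = x \<bullet>c s" using mat_adjoint_cscalar[OF P x q] unfolding Pick_hermitian Pq .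
  also have "\<dots> = (resolvent Am w *\<^sub>v x) \<bullet>c c" unfolding s_def by (rule mat_adjoint_cscalar[OF Rw(1) x c, symmetric])
  also have "\<dots> = (Cm *\<^sub>v (resolvent Am w *\<^sub>v x)) \<bullet>c y"
   unfolding c_def by (rule mat_adjoint_cscalar[OF C mult_mat_vec_carrier[OF Rw(1) x] y, symmetric])
  also have "Cm *\<^sub>v (resolvent Am w *\<^sub>v x) = rfun Cm Am x w" unfolding rfun_def by (rule assoc_mult_mat_vec[OF C Rw(1) x, symmetric])
  finally show ?thesis .
 qed
 define T where "T = (%z. Cm * resolvent Am z * minv Pick * mat_adjoint Cm * Jm)"
 have Tc: "T u \<in> carrier_mat ?d ?d" if "u \<notin> spectrum Am" for u
  unfolding T_def by (rule mult_carrier_mat[OF mult_carrier_mat[OF mult_carrier_mat[OF mult_carrier_mat[OF C resolvent_props(1)[OF A that]] Q(1)] Cs] J])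
 have Th: "Theta D u = 1\<^sub>m ?d - T u" for u unfolding Theta_def T_def ..
 have Thc: "Theta D u \<in> carrier_mat ?d ?d" if "u \<notin> spectrum Am" for u unfolding Th by (rule minus_carrier_mat[OF Tc[OF that]])
 have Tv: "T z *\<^sub>v u = Cm *\<^sub>v (resolvent Am z *\<^sub>v (minv Pick *\<^sub>v (mat_adjoint Cm *\<^sub>v (Jm *\<^sub>v u))))" if u: "u \<in> carrier_vec ?d" for u
 proof -
  note 1 = mult_mat_vec_carrier[OF J u]
  note 2 = mult_mat_vec_carrier[OF Cs 1]
  note 3 = mult_mat_vec_carrier[OF Q(1) 2]
  note CR = mult_carrier_mat[OF C Rz(1)]
  note CRQ = mult_carrier_mat[OF CR Q(1)]
  show ?thesis unfolding T_def
   by (simp only: assoc_mult_mat_vec[OF mult_carrier_mat[OF CRQ Cs] J u] assoc_mult_mat_vec[OF CRQ Cs 1] assoc_mult_mat_vec[OF CR Q(1) 2] assoc_mult_mat_vec[OF C Rz(1) 3])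
 qed
 have Tsv: "mat_adjoint (T w) *\<^sub>v y = Jm *\<^sub>v (Cm *\<^sub>v q)"
 proof -
  note CR = mult_carrier_mat[OF C Rw(1)]
  note CRQ = mult_carrier_mat[OF CR Q(1)]
  note CRQC = mult_carrier_mat[OF CRQ Cs]
  have e: "mat_adjoint (T w) = Jm * (Cm * (minv Pick * (mat_adjoint (resolvent Am w) * mat_adjoint Cm)))"
   unfolding T_def mat_adjoint_mult[OF CRQC J] mat_adjoint_mult[OF CRQ Cs] mat_adjoint_mult[OF CR Q(1)] mat_adjoint_mult[OF C Rw(1)]
    Jm_adjoint Qs mat_adjoint_adjoint ..
  note 1 = mult_carrier_mat[OF S Cs]
  note 2 = mult_carrier_mat[OF Q(1) 1]
  note 3 = mult_carrier_mat[OF C 2]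
  show ?thesis
   unfolding e qs s_def c_def
   by (simp only: assoc_mult_mat_vec[OF J 3 y] assoc_mult_mat_vec[OF C 2 y] assoc_mult_mat_vec[OF Q(1) 1 y] assoc_mult_mat_vec[OF S Cs y])
 qed
 define Cq where "Cq = Cm *\<^sub>v q"
 have Cq: "Cq \<in> carrier_vec ?d" unfolding Cq_def by (rule mult_mat_vec_carrier[OF C q])
 have JCq: "Jm *\<^sub>v Cq \<in> carrier_vec ?d" and Jy: "Jm *\<^sub>v y \<in> carrier_vec ?d" by (rule mult_mat_vec_carrier[OF J Cq], rule mult_mat_vec_carrier[OF J y])
 have Ths: "mat_adjoint (Theta D w) *\<^sub>v y = y - Jm *\<^sub>v Cq"
  unfolding Th mat_adjoint_minus[OF one_carrier_mat Tc[OF w]] mat_adjoint_one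
   minus_mult_distrib_mat_vec[OF one_carrier_mat mat_adjoint_carrier[OF Tc[OF w]] y] Tsv Cq_def using y by simp
 have yJ: "y - Jm *\<^sub>v Cq \<in> carrier_vec ?d" by (rule minus_carrier_vec[OF y JCq])
 \<comment> \<open>This is J Theta(w)^* y, so the numerator of the kernel applied to y is J y -
   Theta(z) u.\<close>
 define u where "u = Jm *\<^sub>v (y - Jm *\<^sub>v Cq)"
 have u: "u \<in> carrier_vec ?d" unfolding u_def by (rule mult_mat_vec_carrier[OF J yJ])
 have u1: "u = Jm *\<^sub>v y - Cq" unfolding u_def mult_minus_distrib_mat_vec[OF J y JCq] Jm_Jm[OF Cq] ..
 have Ju: "Jm *\<^sub>v u = y - Jm *\<^sub>v Cq" unfolding u_def by (rule Jm_Jm[OF yJ])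
 define x where "x = minv Pick *\<^sub>v (mat_adjoint Cm *\<^sub>v (y - Jm *\<^sub>v Cq))"
 have Aq: "Am *\<^sub>v q \<in> carrier_vec ?N" by (rule mult_mat_vec_carrier[OF A q])
 have cq: "cnj w \<cdot>\<^sub>v q \<in> carrier_vec ?N" "z \<cdot>\<^sub>v q \<in> carrier_vec ?N" using q by simp_all
 \<comment> \<open>By the Lyapunov identity the terms with the adjoint of A cancel: the adjoint of C
   maps y - J C q to Pick applied to cnj w q + A q.\<close>
 have xe: "x = cnj w \<cdot>\<^sub>v q + Am *\<^sub>v q"
 proof -
  have cs: "c = cnj w \<cdot>\<^sub>v s - mat_adjoint Am *\<^sub>v s"
  proof -
   have wA: "w \<cdot>\<^sub>m 1\<^sub>m ?N - Am \<in> carrier_mat ?N ?N" by (rule minus_carrier_mat[OF A])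
   have wAs: "mat_adjoint (w \<cdot>\<^sub>m 1\<^sub>m ?N - Am) = cnj w \<cdot>\<^sub>m 1\<^sub>m ?N - mat_adjoint Am"
    unfolding mat_adjoint_minus[OF smult_carrier_mat[OF one_carrier_mat] A] mat_adjoint_smult mat_adjoint_one ..
   have "mat_adjoint (resolvent Am w * (w \<cdot>\<^sub>m 1\<^sub>m ?N - Am)) = (cnj w \<cdot>\<^sub>m 1\<^sub>m ?N - mat_adjoint Am) * mat_adjoint (resolvent Am w)"
    unfolding mat_adjoint_mult[OF Rw(1) wA] wAs ..
   then have 1: "(cnj w \<cdot>\<^sub>m 1\<^sub>m ?N - mat_adjoint Am) * mat_adjoint (resolvent Am w) = 1\<^sub>m ?N" unfolding Rw(3) by simp
   have "c = ((cnj w \<cdot>\<^sub>m 1\<^sub>m ?N - mat_adjoint Am) * mat_adjoint (resolvent Am w)) *\<^sub>v c" unfolding 1 using c by simp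
   also have "\<dots> = (cnj w \<cdot>\<^sub>m 1\<^sub>m ?N - mat_adjoint Am) *\<^sub>v s"
    unfolding s_def by (rule assoc_mult_mat_vec[OF minus_carrier_mat[OF As] S c])
   also have "\<dots> = (cnj w \<cdot>\<^sub>m 1\<^sub>m ?N) *\<^sub>v s - mat_adjoint Am *\<^sub>v s"
    by (rule minus_mult_distrib_mat_vec[OF smult_carrier_mat[OF one_carrier_mat] As s])
   also have "(cnj w \<cdot>\<^sub>m 1\<^sub>m ?N) *\<^sub>v s = cnj w \<cdot>\<^sub>v s"
    using smult_one_mult_vec[OF s] .
   finally show ?thesis .
  qed
  have As_s: "mat_adjoint Am *\<^sub>v s \<in> carrier_vec ?N" by (rule mult_mat_vec_carrier[OF As s])
  have PAq: "Pick *\<^sub>v (Am *\<^sub>v q) \<in> carrier_vec ?N" by (rule mult_mat_vec_carrier[OF P Aq])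
  have CJC: "mat_adjoint Cm *\<^sub>v (Jm *\<^sub>v Cq) \<in> carrier_vec ?N" by (rule mult_mat_vec_carrier[OF Cs JCq])
  have ly: "Pick *\<^sub>v (Am *\<^sub>v q) + mat_adjoint Am *\<^sub>v s = (- 1) \<cdot>\<^sub>v (mat_adjoint Cm *\<^sub>v (Jm *\<^sub>v Cq))"
   using Pick_lyapunov_vec[OF q] unfolding Pq Cq_def .
  have "mat_adjoint Cm *\<^sub>v (y - Jm *\<^sub>v Cq) = c - mat_adjoint Cm *\<^sub>v (Jm *\<^sub>v Cq)"
   unfolding mult_minus_distrib_mat_vec[OF Cs y JCq] c_def ..
  also have "\<dots> = c + (- 1) \<cdot>\<^sub>v (mat_adjoint Cm *\<^sub>v (Jm *\<^sub>v Cq))"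
   by (rule minus_as_smult[OF c CJC])
  also have "\<dots> = (cnj w \<cdot>\<^sub>v s - mat_adjoint Am *\<^sub>v s) + (Pick *\<^sub>v (Am *\<^sub>v q) + mat_adjoint Am *\<^sub>v s)"
   unfolding ly[symmetric] cs[symmetric] ..
  also have "\<dots> = cnj w \<cdot>\<^sub>v s + Pick *\<^sub>v (Am *\<^sub>v q)"
   by (rule minus_plus_cancel[OF smult_carrier_vec[THEN iffD2, OF s] As_s PAq])
  also have "\<dots> = Pick *\<^sub>v (cnj w \<cdot>\<^sub>v q + Am *\<^sub>v q)"
   unfolding mult_add_distrib_mat_vec[OF P cq(1) Aq] mult_mat_vec[OF P q] Pq ..
  finally have e: "mat_adjoint Cm *\<^sub>v (y - Jm *\<^sub>v Cq) = Pick *\<^sub>v (cnj w \<cdot>\<^sub>v q + Am *\<^sub>v q)" .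
  have cA: "cnj w \<cdot>\<^sub>v q + Am *\<^sub>v q \<in> carrier_vec ?N" by (rule add_carrier_vec[OF cq(1) Aq])
  show ?thesis unfolding x_def e assoc_mult_mat_vec[OF Q(1) P cA, symmetric] Q(3) by (rule one_mult_mat_vec[OF cA])
 qed
 have xc: "x \<in> carrier_vec ?N" unfolding xe by (rule add_carrier_vec[OF cq(1) Aq])
 have Rx: "resolvent Am z *\<^sub>v x \<in> carrier_vec ?N" and Rq: "resolvent Am z *\<^sub>v q \<in> carrier_vec ?N"
  by (rule mult_mat_vec_carrier[OF Rz(1) xc], rule mult_mat_vec_carrier[OF Rz(1) q])
 have CRx: "Cm *\<^sub>v (resolvent Am z *\<^sub>v x) \<in> carrier_vec ?d" by (rule mult_mat_vec_carrier[OF C Rx])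
 have qz: "q = resolvent Am z *\<^sub>v (z \<cdot>\<^sub>v q - Am *\<^sub>v q)"
 proof -
  have "q = (resolvent Am z * (z \<cdot>\<^sub>m 1\<^sub>m ?N - Am)) *\<^sub>v q" unfolding Rz(3) using q by simp
  also have "\<dots> = resolvent Am z *\<^sub>v ((z \<cdot>\<^sub>m 1\<^sub>m ?N - Am) *\<^sub>v q)" by (rule assoc_mult_mat_vec[OF Rz(1) minus_carrier_mat[OF A] q])
  also have "(z \<cdot>\<^sub>m 1\<^sub>m ?N - Am) *\<^sub>v q = z \<cdot>\<^sub>v q - Am *\<^sub>v q"
   unfolding minus_mult_distrib_mat_vec[OF smult_carrier_mat[OF one_carrier_mat] A q] smult_one_mult_vec[OF q] ..
  finally show ?thesis .
 qed
 \<comment> \<open>Adding q = R(z) (zq - Aq) to R(z) (cnj w q + Aq) removes A and leaves the factor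
   z + cnj w.\<close>
 have qx: "q + resolvent Am z *\<^sub>v x = (z + cnj w) \<cdot>\<^sub>v (resolvent Am z *\<^sub>v q)"
 proof -
  have zq: "z \<cdot>\<^sub>v q - Am *\<^sub>v q \<in> carrier_vec ?N" by (rule minus_carrier_vec[OF cq(2) Aq])
  have "q + resolvent Am z *\<^sub>v x = resolvent Am z *\<^sub>v (z \<cdot>\<^sub>v q - Am *\<^sub>v q) + resolvent Am z *\<^sub>v x"
   using arg_cong[OF qz, of "%t. t + resolvent Am z *\<^sub>v x"] .
  also have "\<dots> = resolvent Am z *\<^sub>v ((z \<cdot>\<^sub>v q - Am *\<^sub>v q) + x)" by (rule mult_add_distrib_mat_vec[OF Rz(1) zq xc, symmetric])
  also have "(z \<cdot>\<^sub>v q - Am *\<^sub>v q) + x = (z \<cdot>\<^sub>v q - Am *\<^sub>v q) + (Am *\<^sub>v q + cnj w \<cdot>\<^sub>v q)"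
   unfolding xe comm_add_vec[OF cq(1) Aq] ..
  also have "\<dots> = (z + cnj w) \<cdot>\<^sub>v q"
   unfolding add_smult_distrib_vec minus_plus_cancel'[OF cq(2) Aq cq(1)] ..
  also have "resolvent Am z *\<^sub>v ((z + cnj w) \<cdot>\<^sub>v q) = (z + cnj w) \<cdot>\<^sub>v (resolvent Am z *\<^sub>v q)" by (rule mult_mat_vec[OF Rz(1) q])
  finally show ?thesis .
 qed
 have "(Jm - Theta D z * Jm * mat_adjoint (Theta D w)) *\<^sub>v y = Jm *\<^sub>v y - Theta D z *\<^sub>v u"
  unfolding minus_mult_distrib_mat_vec[OF J mult_carrier_mat[OF mult_carrier_mat[OF Thc[OF z] J] mat_adjoint_carrier[OF Thc[OF w]]] y]
   assoc_mult_mat_vec[OF mult_carrier_mat[OF Thc[OF z] J] mat_adjoint_carrier[OF Thc[OF w]] y] Ths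
   assoc_mult_mat_vec[OF Thc[OF z] J yJ] u_def ..
 also have "Theta D z *\<^sub>v u = u - Cm *\<^sub>v (resolvent Am z *\<^sub>v x)"
  unfolding Th minus_mult_distrib_mat_vec[OF one_carrier_mat Tc[OF z] u] one_mult_mat_vec[OF u] Tv[OF u] Ju x_def ..
 also have "Jm *\<^sub>v y - (u - Cm *\<^sub>v (resolvent Am z *\<^sub>v x)) = Cq + Cm *\<^sub>v (resolvent Am z *\<^sub>v x)"
  unfolding u1 by (rule minus_minus_cancel[OF Jy Cq CRx])
 also have "\<dots> = Cm *\<^sub>v (q + resolvent Am z *\<^sub>v x)"
  unfolding Cq_def by (rule mult_add_distrib_mat_vec[OF C q Rx, symmetric])
 also have "\<dots> = (z + cnj w) \<cdot>\<^sub>v (Cm *\<^sub>v (resolvent Am z *\<^sub>v q))"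
  unfolding qx by (rule mult_mat_vec[OF C Rq])
 also have "Cm *\<^sub>v (resolvent Am z *\<^sub>v q) = rfun Cm Am q z" unfolding rfun_def by (rule assoc_mult_mat_vec[OF C Rz(1) q, symmetric])
 finally have e: "(Jm - Theta D z * Jm * mat_adjoint (Theta D w)) *\<^sub>v y = (z + cnj w) \<cdot>\<^sub>v rfun Cm Am q z" .
 have Mc: "Jm - Theta D z * Jm * mat_adjoint (Theta D w) \<in> carrier_mat ?d ?d"
  by (rule minus_carrier_mat[OF mult_carrier_mat[OF mult_carrier_mat[OF Thc[OF z] J] mat_adjoint_carrier[OF Thc[OF w]]]])
 show "K_Theta D z w *\<^sub>v y = rfun Cm Am q z"
  unfolding K_Theta_def smult_mat_mult_vec[OF Mc y] e smult_smult_assoc using zw by simp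
qed

section \<open>Positivity of the Pick matrix and of the reproducing kernel space\<close>

theorem positive_definite_iff_H_Theta_hilbert:
 assumes det: "det Pick \<noteq> 0"
 shows "positive_definite_mat Pick \<longleftrightarrow>
  hilbert_space (p + m) {%z. 0\<^sub>v (p + m)} (fst (H_Theta D)) (snd (H_Theta D))"
proof -
 let ?N = "nz + nw" and ?\<Omega> = "\<Pi>\<^sub>+ - spectrum W" and ?d = "p + m"
 obtain k v e where o: "form_orthonormal ?N Pick (carrier_vec ?N) k v e"
  and rep: "!!x. x \<in> carrier_vec ?N ==> x = lin_comb ?N k v (%i. of_real (e i) * ((Pick *\<^sub>v x) \<bullet>c v i))"
  using hermitian_form_basis[OF Pick_carrier Pick_hermitian det] by metis
 \<comment> \<open>Extension by zero off the domain follows the convention for reproducing kernel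
   spaces.\<close>
 define \<Phi> where "\<Phi> = (%x z. if z \<in> ?\<Omega> then rfun Cm Am x z else 0\<^sub>v ?d)"
 have lin: "rfun Cm Am (x + y) z = rfun Cm Am x z + rfun Cm Am y z" "rfun Cm Am (c \<cdot>\<^sub>v x) z = c \<cdot>\<^sub>v rfun Cm Am x z"
  if "z \<in> ?\<Omega>" "x \<in> carrier_vec ?N" "y \<in> carrier_vec ?N" for x y z c
  using rfun_linear(1,3)[OF ACJ(1,2) Omega(3)[OF that(1)] that(2,3)] by blast+
 interpret gram_rk ?N ?d Pick \<Phi> k v e ?\<Omega> "K_Theta D"
 proof
  show "Pick \<in> carrier_mat ?N ?N" by (rule Pick_carrier)
  show "mat_adjoint Pick = Pick" by (rule Pick_hermitian)
  show "form_orthonormal ?N Pick (carrier_vec ?N) k v e" by (rule o)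
  show "x = lin_comb ?N k v (%i. of_real (e i) * ((Pick *\<^sub>v x) \<bullet>c v i))" if "x \<in> carrier_vec ?N" for x by (rule rep[OF that])
  show "\<Phi> x t \<in> carrier_vec ?d" if "x \<in> carrier_vec ?N" for x t unfolding \<Phi>_def using rfun_carrier[OF ACJ(2)] by simp
  show "\<Phi> (x + y) t = \<Phi> x t + \<Phi> y t" if "x \<in> carrier_vec ?N" "y \<in> carrier_vec ?N" for x y t
   unfolding \<Phi>_def using lin(1)[OF _ that] by simp
  show "\<Phi> (c \<cdot>\<^sub>v x) t = c \<cdot>\<^sub>v \<Phi> x t" if "x \<in> carrier_vec ?N" for c x t
   unfolding \<Phi>_def using lin(2)[OF _ that that] by (simp add: smult_zero_vec_eq)
  show "x = 0\<^sub>v ?N" if x: "x \<in> carrier_vec ?N" and 0: "!!t. \<Phi> x t = 0\<^sub>v ?d" for x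
  proof (rule rfun_Theta_inj[OF x])
   fix z assume z: "z \<in> ?\<Omega>"
   have "\<Phi> x z = rfun Cm Am x z" unfolding \<Phi>_def by (rule if_P[OF z])
   then show "rfun Cm Am x z = 0\<^sub>v ?d" using 0[of z] by simp
  qed
  show "det Pick \<noteq> 0" by (rule det)
  show "\<Phi> x z = 0\<^sub>v ?d" if "z \<notin> ?\<Omega>" for x z unfolding \<Phi>_def by (rule if_not_P[OF that])
  fix w and y :: "complex vec" assume w: "w \<in> ?\<Omega>" and y: "y \<in> carrier_vec ?d"
  let ?q = "minv Pick *\<^sub>v (mat_adjoint (resolvent Am w) *\<^sub>v (mat_adjoint Cm *\<^sub>v y))"
  \<comment> \<open>Both points lie in the right half-plane, so the denominator of the kernel has
    positive real part.\<close>
  have nz: "z + cnj w \<noteq> 0" if "z \<in> ?\<Omega>" for z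
  proof -
   have "0 < Re (z + cnj w)" using w that by (simp add: right_half_plane_def)
   then show ?thesis by (auto simp del: plus_complex.sel)
  qed
  note Kw = K_Theta_vec[OF det Omega(3)[OF w] Omega(3)[OF w] nz[OF w] y]
  show "\<exists>x\<in>carrier_vec ?N. (%z. if z \<in> ?\<Omega> then K_Theta D z w *\<^sub>v y else 0\<^sub>v ?d) = \<Phi> x \<and>
    (\<forall>x'\<in>carrier_vec ?N. (Pick *\<^sub>v x') \<bullet>c x = \<Phi> x' w \<bullet>c y)"
  proof (intro bexI conjI ballI)
   show "?q \<in> carrier_vec ?N" by (rule Kw(1))
   show "(%z. if z \<in> ?\<Omega> then K_Theta D z w *\<^sub>v y else 0\<^sub>v ?d) = \<Phi> ?q"
   proof
    fix z
    show "(if z \<in> ?\<Omega> then K_Theta D z w *\<^sub>v y else 0\<^sub>v ?d) = \<Phi> ?q z"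
    proof (cases "z \<in> ?\<Omega>")
     case True
     show ?thesis unfolding \<Phi>_def if_P[OF True]
      by (rule K_Theta_vec(2)[OF det Omega(3)[OF True] Omega(3)[OF w] nz[OF True] y])
    next
     case False
     show ?thesis unfolding \<Phi>_def if_not_P[OF False] ..
    qed
   qed
   show "(Pick *\<^sub>v x') \<bullet>c ?q = \<Phi> x' w \<bullet>c y" if "x' \<in> carrier_vec ?N" for x'
    unfolding \<Phi>_def if_P[OF w] by (rule Kw(3)[OF that])
  qed
 qed
 have H: "H_Theta D = (model, ip)" unfolding H_Theta_def by (rule rk_space_eq)
 show ?thesis unfolding H fst_conv snd_conv by (rule hilbert_iff[symmetric])
qed

end

theorem corollary4p1:
  fixes D :: btoa_data
  assumes "btoa_admissible D"
    and "invertible_mat (btoa_pick D)"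
  shows "(positive_definite_mat (btoa_pick D) \<longleftrightarrow>
          hilbert_space (dp D + dm D) {F. AE y in lborel. F y = 0\<^sub>v (dp D + dm D)}
            (M_perp D) (J_inner D)) \<and>
         (hilbert_space (dp D + dm D) {F. AE y in lborel. F y = 0\<^sub>v (dp D + dm D)}
            (M_perp D) (J_inner D) \<longleftrightarrow>
          hilbert_space (dp D + dm D) {\<lambda>z. 0\<^sub>v (dp D + dm D)}
            (fst (H_Theta D)) (snd (H_Theta D)))"
proof -
  interpret btoa D by (rule btoa.intro[OF assms(1)])
  have det: "det (btoa_pick D) \<noteq> 0" by (rule invertible_mat_det[OF assms(2) Pick_carrier])
  show ?thesis
    using positive_definite_iff_M_perp_hilbert[OF det] positive_definite_iff_H_Theta_hilbert[OF det] by blast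
qed

end
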